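(* Let $\{\phi_j\}_{j=0}^{\infty}$ be the complete orthonormal system of Legendre polynomials in $L_2([t,T])$, i.e. $$\phi_j(s)=\sqrt{\frac{2j+1}{T-t}}\,P_j\!\left(\left(s-\frac{T+t}{2}\right)\frac{2}{T-t}\right),\quad j\ge 0,$$ where $P_j$ is the $j$-th Legendre polynomial. For $i\in\{1,\dots,m\}$ and $j\ge0$ let $\zeta_j^{(i)}=\int_t^T\phi_j(s)\,d\mathbf f^{(i)}_s$. For nonnegative integers $l_1,l_2,l_3$ and $i_1,i_2,i_3\in\{1,\dots,m\}$ define $$I^{*(i_1i_2i_3)}_{l_1l_2l_3\,T,t}=\int_t^{*T}(t-t_3)^{l_3}\int_t^{*t_3}(t-t_2)^{l_2}\int_t^{*t_2}(t-t_1)^{l_1}\,d\mathbf f^{(i_1)}_{t_1}\,d\mathbf f^{(i_2)}_{t_2}\,d\mathbf f^{(i_3)}_{t_3}$$ and $$C_{j_3j_2j_1}=\int_t^T(t-s)^{l_3}\phi_{j_3}(s)\int_t^s(t-s_1)^{l_2}\phi_{j_2}(s_1)\int_t^{s_1}(t-s_2)^{l_1}\phi_{j_1}(s_2)\,ds_2\,ds_1\,ds.$$ Then $$I^{*(i_1i_2i_3)}_{l_1l_2l_3\,T,t}=\operatorname*{l.i.m.}_{p_1,p_2,p_3\to\infty}\sum_{j_1=0}^{p_1}\sum_{j_2=0}^{p_2}\sum_{j_3=0}^{p_3}C_{j_3j_2j_1}\,\zeta_{j_1}^{(i_1)}\zeta_{j_2}^{(i_2)}\zeta_{j_3}^{(i_3)}$$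 (mean-square limit, $p_1,p_2,p_3$ tending to infinity independently) holds in each of the following cases: 1. $i_1\ne i_2$, $i_2\ne i_3$, $i_1\ne i_3$, and $l_1,l_2,l_3\in\{0,1,2,\dots\}$ arbitrary; 2. $i_1=i_2\ne i_3$ and $l_1=l_2\ne l_3$, with $l_1,l_2,l_3\in\{0,1,2,\dots\}$; 3. $i_1\ne i_2=i_3$ and $l_1\ne l_2=l_3$, with $l_1,l_2,l_3\in\{0,1,2,\dots\}$; 4. $i_1,i_2,i_3\in\{1,\dots,m\}$ arbitrary and $l_1=l_2=l_3=l$ with $l\in\{0,1,2,\dots\}$.
   Context: $(\Omega,\mathrm F,\mathsf P)$ is a complete probability space with a nondecreasing right-continuous filtration $\{\mathrm F_s\}_{s\in[0,T]}$, and $\mathbf f_s=(\mathbf f^{(1)}_s,\dots,\mathbf f^{(m)}_s)$ is a standard $m$-dimensional Wiener process adapted to it, with independent components; $0\le t<T$. $\int^{*}$ denotes the Stratonovich stochastic integral, and $I^{*}$ is an iterated Stratonovich integral (the innermost integral defines a process in $t_2$, which is multiplied by $(t-t_2)^{l_2}$ and Stratonovich-integrated against $d\mathbf f^{(i_2)}_{t_2}$ up to $t_3$, and the result is multiplied by $(t-t_3)^{l_3}$ and Stratonovich-integrated against $d\mathbf f^{(i_3)}_{t_3}$ over $[t,T]$). $\operatorname{l.i.m.}$ denotes the limit in mean square (in $L_2(\Omega)$). *)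

theory Defs
  imports "HOL-Probability.Probability"
begin

definition legendreP :: "nat \<Rightarrow> real \<Rightarrow> real" where
  "legendreP n x = (\<Sum>k\<le>n. real ((n choose k)^2) * (x - 1)^(n - k) * (x + 1)^k) / 2^n"

definition legendre_phi :: "real \<Rightarrow> real \<Rightarrow> nat \<Rightarrow> real \<Rightarrow> real" where
  "legendre_phi t T j s =
     sqrt ((2 * real j + 1) / (T - t)) * legendreP j ((s - (T + t) / 2) * (2 / (T - t)))"

definition ms_tendsto :: "'a measure \<Rightarrow> ('i \<Rightarrow> 'a \<Rightarrow> real) \<Rightarrow> ('a \<Rightarrow> real) \<Rightarrow> 'i filter \<Rightarrow> bool" where
  "ms_tendsto M X Y F \<longleftrightarrow>
     Y \<in> borel_measurable M \<and> integrable M (\<lambda>\<omega>. (Y \<omega>)\<^sup>2) \<and>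
     (\<forall>\<^sub>F n in F. X n \<in> borel_measurable M \<and> integrable M (\<lambda>\<omega>. (X n \<omega>)\<^sup>2)) \<and>
     ((\<lambda>n. integral\<^sup>L M (\<lambda>\<omega>. (X n \<omega> - Y \<omega>)\<^sup>2)) \<longlongrightarrow> 0) F"

definition is_partition :: "real \<Rightarrow> real \<Rightarrow> nat \<Rightarrow> (nat \<Rightarrow> real) \<Rightarrow> bool" where
  "is_partition a b N \<tau> \<longleftrightarrow> \<tau> 0 = a \<and> \<tau> N = b \<and> (\<forall>q<N. \<tau> q < \<tau> (Suc q))"

definition mesh :: "nat \<Rightarrow> (nat \<Rightarrow> real) \<Rightarrow> real" where
  "mesh N \<tau> = Max (insert 0 ((\<lambda>q. \<tau> (Suc q) - \<tau> q) ` {..<N}))"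

definition ito_int_rel :: "'a measure \<Rightarrow> (real \<Rightarrow> 'a \<Rightarrow> real) \<Rightarrow> (real \<Rightarrow> 'a \<Rightarrow> real)
     \<Rightarrow> real \<Rightarrow> real \<Rightarrow> ('a \<Rightarrow> real) \<Rightarrow> bool" where
  "ito_int_rel M W X a b Y \<longleftrightarrow>
     (\<forall>(N :: nat \<Rightarrow> nat) (\<tau> :: nat \<Rightarrow> nat \<Rightarrow> real).
        (\<forall>k. is_partition a b (N k) (\<tau> k)) \<and> (\<lambda>k. mesh (N k) (\<tau> k)) \<longlonglongrightarrow> 0 \<longrightarrow>
        ms_tendsto M (\<lambda>k \<omega>. \<Sum>q<N k. X (\<tau> k q) \<omega> * (W (\<tau> k (Suc q)) \<omega> - W (\<tau> k q) \<omega>))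
           Y sequentially)"

definition strat_int_rel :: "'a measure \<Rightarrow> (real \<Rightarrow> 'a \<Rightarrow> real) \<Rightarrow> (real \<Rightarrow> 'a \<Rightarrow> real)
     \<Rightarrow> real \<Rightarrow> real \<Rightarrow> ('a \<Rightarrow> real) \<Rightarrow> bool" where
  "strat_int_rel M W X a b Y \<longleftrightarrow>
     (\<forall>(N :: nat \<Rightarrow> nat) (\<tau> :: nat \<Rightarrow> nat \<Rightarrow> real).
        (\<forall>k. is_partition a b (N k) (\<tau> k)) \<and> (\<lambda>k. mesh (N k) (\<tau> k)) \<longlonglongrightarrow> 0 \<longrightarrow>
        ms_tendsto M (\<lambda>k \<omega>. \<Sum>q<N k. (X (\<tau> k q) \<omega> + X (\<tau> k (Suc q)) \<omega>) / 2
                                     * (W (\<tau> k (Suc q)) \<omega> - W (\<tau> k q) \<omega>))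
           Y sequentially)"

definition ito_int where
  "ito_int M W X a b = (SOME Y. ito_int_rel M W X a b Y)"

definition strat_int where
  "strat_int M W X a b = (SOME Y. strat_int_rel M W X a b Y)"

definition rc_filtration :: "'a measure \<Rightarrow> (real \<Rightarrow> 'a measure) \<Rightarrow> real \<Rightarrow> bool" where
  "rc_filtration M F T \<longleftrightarrow>
     (\<forall>s\<in>{0..T}. space (F s) = space M \<and> sets (F s) \<subseteq> sets M) \<and>
     (\<forall>s\<in>{0..T}. \<forall>u\<in>{0..T}. s \<le> u \<longrightarrow> sets (F s) \<subseteq> sets (F u)) \<and>
     (\<forall>s\<in>{0..<T}. sets (F s) = (\<Inter>u\<in>{s<..T}. sets (F u)))"

text \<open>W 1, ..., W m form a standard m-dimensional Wiener process on [0,T], adapted to F,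
  with independent components: W i 0 = 0, continuous paths, W i s is F s-measurable, and for
  0 \<le> s < u \<le> T the increment vector (W i u - W i s)_{i=1..m} is independent of F s and has
  independent N(0, u - s) components.\<close>
definition std_wiener :: "'a measure \<Rightarrow> (real \<Rightarrow> 'a measure) \<Rightarrow> real \<Rightarrow> nat
     \<Rightarrow> (nat \<Rightarrow> real \<Rightarrow> 'a \<Rightarrow> real) \<Rightarrow> bool" where
  "std_wiener M F T m W \<longleftrightarrow>
     (\<forall>i\<in>{1..m}.
        (\<forall>\<omega>\<in>space M. W i 0 \<omega> = 0 \<and> continuous_on {0..T} (\<lambda>s. W i s \<omega>)) \<and>
        (\<forall>s\<in>{0..T}. W i s \<in> borel_measurable (F s))) \<and>
     (\<forall>s u A (B :: nat \<Rightarrow> real set). 0 \<le> s \<and> s < u \<and> u \<le> T \<and> A \<in> sets (F s) \<and>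
        (\<forall>i\<in>{1..m}. B i \<in> sets borel) \<longrightarrow>
        measure M (A \<inter> (\<Inter>i\<in>{1..m}. {\<omega>\<in>space M. W i u \<omega> - W i s \<omega> \<in> B i})) =
        measure M A * (\<Prod>i\<in>{1..m}. measure (density lborel (normal_density 0 (sqrt (u - s)))) (B i)))"

end

theory Submission
  imports Defs "HOL-Computational_Algebra.Polynomial"
begin

text \<open>
  Write psi_k(s) = (t - s)^l_k. By the Ito product rule, a product of three Wiener integrals of
  phi_j1, phi_j2, phi_j3 is the sum, over the six orderings, of iterated Ito integrals, plus one
  trace term <phi_j, phi_j'> times a single Wiener integral for each pair of coinciding components.
  The iterated Stratonovich integral is likewise the iterated Ito integral with kernel
  K = psi_1(s_1) psi_2(s_2) psi_3(s_3) on the simplex, plus half-traces of K. By the Ito isometry the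
  six orderings together contribute exactly ||K||^2 - sum C_j^2 to the mean-square error, because the
  six simplices fill the cube and the phi_j are orthonormal; this tends to 0 by Parseval's identity
  applied in one variable at a time. In the traces, equal weights psi turn the two coupled integrals
  into the half-squares (1/2) (int psi phi_j)^2 over [t,s] or [s,T], so Parseval on these intervals
  yields the half-traces, while the trace over the first and third variable vanishes since
  psi 1_[t,s] and psi 1_[s,T] are orthogonal.

  The stochastic integrals are constructed for adapted integrands with bounded fourth moments and
  E (X_s - X_u)^4 <= C (s - u)^2. This class is stable under integration, and fourth moments suffice
  for the mean-square convergence of products of two integrals.
\<close>

section \<open>Legendre polynomials\<close>

text \<open>The four cases enter through one implication: coinciding components carry equal weights.
  The obstacle is that p1, p2, p3 grow independently: a trace is cut off at the minimum of two
  truncations while the third index stays free. Every trace error is therefore bounded by a(min) +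
  b(free) with null sequences a and b, Bessel's inequality making the first term uniform in the free
  index. The six orderings are never compared with each other. The error of one and the second
  moments of the other five are nonnegative and add up to the defect ||K||^2 - sum C_j^2, so each is
  at most this defect even when components coincide. The integrals of the statement are chosen by
  \<open>SOME\<close>. Each level must be shown to exist along every sequence of partitions, and is
  then known only almost surely at each fixed time, so identities are proved at fixed times. Time is
  a zeroth integrator, so one product rule covers the correction terms too.\<close>

lemma sum_choose_Suc_split:
  fixes f :: "nat \<Rightarrow> nat \<Rightarrow> 'a::comm_ring_1"
  shows "(\<Sum>k\<le>Suc n. of_nat (Suc n choose k) * f k (Suc n - k)) =
    (\<Sum>k\<le>n. of_nat (n choose k) * (f (Suc k) (n - k) + f k (Suc n - k)))"
proof -
  have "(\<Sum>k\<le>n. of_nat (n choose k) * f k (Suc n - k))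
      = (\<Sum>k\<le>Suc n. of_nat (n choose k) * f k (Suc n - k))"
    by (simp add: binomial_eq_0)
  also have "\<dots> = f 0 (Suc n) + (\<Sum>k\<le>n. of_nat (n choose Suc k) * f (Suc k) (n - k))"
    by (subst sum.atMost_Suc_shift) simp
  finally have *: "(\<Sum>k\<le>n. of_nat (n choose k) * f k (Suc n - k))
      = f 0 (Suc n) + (\<Sum>k\<le>n. of_nat (n choose Suc k) * f (Suc k) (n - k))" .
  have "(\<Sum>k\<le>Suc n. of_nat (Suc n choose k) * f k (Suc n - k))
      = f 0 (Suc n) + (\<Sum>k\<le>n. of_nat (Suc n choose Suc k) * f (Suc k) (n - k))"
    by (subst sum.atMost_Suc_shift) simp
  also have "\<dots> = f 0 (Suc n) + (\<Sum>k\<le>n. of_nat (n choose Suc k) * f (Suc k) (n - k))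
      + (\<Sum>k\<le>n. of_nat (n choose k) * f (Suc k) (n - k))"
    by (simp add: sum.distrib algebra_simps)
  finally show ?thesis
    unfolding * [symmetric] by (simp add: sum.distrib algebra_simps)
qed

lemma higher_pderiv_mult:
  fixes p q :: "'a::{comm_ring_1,semiring_no_zero_divisors} poly"
  shows "(pderiv ^^ n) (p * q) =
    (\<Sum>k\<le>n. of_nat (n choose k) * ((pderiv ^^ k) p * (pderiv ^^ (n - k)) q))"
proof (induction n)
  case (Suc n)
  have "(pderiv ^^ Suc n) (p * q) =
     pderiv (\<Sum>k\<le>n. of_nat (n choose k) * ((pderiv ^^ k) p * (pderiv ^^ (n - k)) q))"
    by (simp add: Suc.IH)
  also have "\<dots> = (\<Sum>k\<le>n. of_nat (n choose k) * ((pderiv ^^ Suc k) p * (pderiv ^^ (n - k)) q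
       + (pderiv ^^ k) p * (pderiv ^^ (Suc n - k)) q))"
    unfolding higher_pderiv_sum[of 1, simplified]
    by (intro sum.cong refl) (simp add: pderiv_mult Suc_diff_le algebra_simps)
  also have "\<dots> = (\<Sum>k\<le>Suc n. of_nat (Suc n choose k) * ((pderiv ^^ k) p * (pderiv ^^ (Suc n - k)) q))"
    by (rule sum_choose_Suc_split[symmetric])
  finally show ?case .
qed simp

lemma higher_pderiv_linear_power:
  fixes a :: real
  shows "k \<le> n \<Longrightarrow> (pderiv ^^ k) ([:a, 1:] ^ n) = smult (fact n / fact (n - k)) ([:a, 1:] ^ (n - k))"
proof (induction k)
  case (Suc k)
  then obtain r where r: "n - k = Suc r" "n - Suc k = r"
    by (metis Suc_diff_Suc Suc_le_eq)
  have "fact n / fact (Suc r) * real (Suc r) = fact n / fact r"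
    by (simp add: fact_Suc del: of_nat_Suc)
  thus ?case
    using Suc by (simp add: r pderiv_smult pderiv_power_Suc pderiv_pCons del: power_Suc fact_Suc of_nat_Suc)
qed simp

text \<open>A polynomial object rather than a function, so that derivatives, degrees and leading
  coefficients are available.\<close>

definition legendre_poly :: "nat \<Rightarrow> real poly" where
  "legendre_poly n = smult (1 / 2^n)
     (\<Sum>k\<le>n. smult (real ((n choose k)^2)) ([:-1, 1:] ^ (n - k) * [:1, 1:] ^ k))"

lemma poly_legendre_poly: "poly (legendre_poly n) x = legendreP n x"
  by (simp add: legendre_poly_def legendreP_def poly_sum poly_mult add.commute field_simps)

text \<open>In Leibniz's rule the k-th term carries n!/(n-k)! from one factor and n!/k! from the
  other; together with the binomial coefficient this is n! times its square. So the explicit sum is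
  Rodrigues' formula, from which orthogonality follows by integration by parts.\<close>

lemma legendre_poly_Rodrigues:
  "(pderiv ^^ n) ([:-1, 1:] ^ n * [:1, 1:] ^ n) = smult (fact n * 2 ^ n) (legendre_poly n)"
proof -
  have "(pderiv ^^ n) ([:-1, 1:] ^ n * [:1, 1:] ^ n :: real poly) =
     (\<Sum>k\<le>n. smult (fact n) (smult (real ((n choose k)^2)) ([:-1, 1:] ^ (n - k) * [:1, 1:] ^ k)))"
    unfolding higher_pderiv_mult
  proof (intro sum.cong refl)
    fix k assume "k \<in> {..n}"
    hence k: "k \<le> n" by simp
    have "real (n choose k) * (fact n / fact (n - k) * (fact n / fact k)) = fact n * real ((n choose k)^2)"
      using binomial_fact[OF k, where ?'a = real] by (simp add: power2_eq_square field_simps)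
    thus "of_nat (n choose k) * ((pderiv ^^ k) ([:-1, 1:] ^ n) * (pderiv ^^ (n - k)) ([:1, 1:] ^ n)) =
       smult (fact n) (smult (real ((n choose k)^2)) ([:-1, 1:] ^ (n - k) * [:1, 1:] ^ k :: real poly))"
      using k by (simp add: higher_pderiv_linear_power of_nat_poly mult_ac)
  qed
  also have "\<dots> = smult (fact n * 2 ^ n) (legendre_poly n)"
    using sum_distrib_left[of "[:fact n:]"
        "\<lambda>k. smult (real ((n choose k)^2)) ([:-1, 1:] ^ (n - k) * [:1, 1:] ^ k)" "{..n}"]
    unfolding legendre_poly_def by (simp add: mult.commute)
  finally show ?thesis .
qed

lemma degree_legendre_poly: "degree (legendre_poly n) \<le> n"
  unfolding legendre_poly_def
proof (rule order.trans[OF degree_smult_le], rule degree_sum_le)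
  fix k assume "k \<in> {..n}"
  have "degree ([:-1, 1:] ^ (n - k) * [:1, 1:] ^ k :: real poly) \<le> (n - k) + k"
    by (intro order.trans[OF degree_mult_le] add_mono order.trans[OF degree_power_le]) auto
  with \<open>k \<in> {..n}\<close> show "degree (smult (real ((n choose k)^2)) ([:-1, 1:] ^ (n - k) * [:1, 1:] ^ k)) \<le> n"
    by (intro order.trans[OF degree_smult_le]) auto
qed simp

lemma legendre_poly_at_1: "poly (legendre_poly n) 1 = 1"
proof -
  have "(\<Sum>k\<le>n. (real (n choose k))\<^sup>2 * (0::real) ^ (n - k) * 2 ^ k) = (\<Sum>k\<in>{n}. 2 ^ k)"
    by (rule sum.mono_neutral_cong_right) (auto simp: power_0_left)
  thus ?thesis by (simp add: poly_legendre_poly legendreP_def)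
qed

lemma legendre_poly_at_minus_1: "(poly (legendre_poly n) (-1))\<^sup>2 = 1"
proof -
  have "(\<Sum>k\<le>n. (real (n choose k))\<^sup>2 * (-2) ^ (n - k) * 0 ^ k) = (\<Sum>k\<in>{0::nat}. (-2::real) ^ n)"
    by (rule sum.mono_neutral_cong_right) (auto simp: power_0_left)
  hence "poly (legendre_poly n) (-1) = (-2) ^ n / 2 ^ n"
    by (simp add: poly_legendre_poly legendreP_def)
  also have "\<dots> = (-1) ^ n" by (simp flip: power_divide)
  finally show ?thesis by (simp flip: power_mult)
qed

section \<open>Orthogonality and norm on [-1, 1]\<close>

lemma has_integral_poly_pderiv:
  fixes p :: "real poly"
  assumes "a \<le> b"
  shows "(poly (pderiv p) has_integral (poly p b - poly p a)) {a..b}"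
  using assms by (intro fundamental_theorem_of_calculus)
    (auto simp: has_real_derivative_iff_has_vector_derivative[symmetric] intro: poly_DERIV DERIV_subset)

lemma poly_integrable [simp]: "(poly p) integrable_on {a..b}" for p :: "real poly"
  by (intro integrable_continuous_real continuous_intros)

lemma poly_integral_by_parts:
  fixes p q :: "real poly"
  assumes "a \<le> b"
  shows "integral {a..b} (poly (p * pderiv q)) =
    poly p b * poly q b - poly p a * poly q a - integral {a..b} (poly (pderiv p * q))"
proof -
  have "integral {a..b} (poly (pderiv (p * q))) = poly p b * poly q b - poly p a * poly q a"
    using integral_unique[OF has_integral_poly_pderiv[OF assms, of "p * q"]] by simp
  moreover have "poly (pderiv (p * q)) = (\<lambda>x. poly (p * pderiv q) x + poly (pderiv p * q) x)"
    by (simp add: fun_eq_iff pderiv_mult algebra_simps)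
  ultimately show ?thesis
    by (simp add: integral_add del: poly_mult)
qed

text \<open>A zero of order n loses at most one order per derivative. This makes the boundary terms
  vanish in the repeated integration by parts.\<close>

lemma dvd_higher_pderiv_power:
  fixes q :: "real poly"
  shows "k \<le> n \<Longrightarrow> q ^ (n - k) dvd (pderiv ^^ k) (q ^ n)"
proof (induction k)
  case (Suc k)
  then obtain r where r: "(pderiv ^^ k) (q ^ n) = q ^ (n - k) * r" by (auto elim: dvdE)
  obtain l where l: "n - k = Suc l" "n - Suc k = l"
    using Suc.prems by (metis Suc_diff_Suc Suc_le_eq)
  have "(pderiv ^^ Suc k) (q ^ n) = q ^ l * (smult (real (Suc l)) (pderiv q * r) + q * pderiv r)"
    by (simp add: r l pderiv_mult pderiv_power_Suc algebra_simps del: power_Suc) (simp add: algebra_simps)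
  thus ?case unfolding l by simp
qed simp

text \<open>Repeated integration by parts against the Rodrigues form: all boundary terms vanish,
  because derivatives of order below n of (x^2 - 1)^n are still divisible by x^2 - 1.\<close>

lemma legendre_poly_orth_lower:
  assumes "degree p < n"
  shows "integral {-1..1} (poly (p * legendre_poly n)) = 0"
proof -
  define R :: "real poly" where "R = ([:-1, 1:] * [:1, 1:]) ^ n"
  have zero: "poly ((pderiv ^^ k) R) 1 = 0 \<and> poly ((pderiv ^^ k) R) (-1) = 0" if "k < n" for k
  proof -
    have "[:-1, 1:] * [:1, 1:] dvd ([:-1, 1:] * [:1, 1:] :: real poly) ^ (n - k)"
      using that by (intro dvd_power) auto
    also have "\<dots> dvd (pderiv ^^ k) R"
      unfolding R_def using that by (intro dvd_higher_pderiv_power) auto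
    finally obtain r where "(pderiv ^^ k) R = [:-1, 1:] * [:1, 1:] * r" by (auto elim: dvdE)
    thus ?thesis by simp
  qed
  \<comment> \<open>Each integration by parts lowers both the order k and the degree of q;
    \<open>degree q < k\<close> guarantees that q becomes constant, and then its derivative 0,
    before the derivatives of \<open>R\<close> are used up.\<close>
  have main: "integral {-1..1} (poly (q * (pderiv ^^ k) R)) = 0" if "k \<le> n" "degree q < k" for k q
    using that
  proof (induction k arbitrary: q)
    case (Suc k)
    have "integral {-1..1} (poly (q * (pderiv ^^ Suc k) R)) = - integral {-1..1} (poly (pderiv q * (pderiv ^^ k) R))"
      using poly_integral_by_parts[of "-1" 1 q "(pderiv ^^ k) R"] zero[of k] Suc.prems by simp
    also have "\<dots> = 0"
    proof (cases "degree q = 0")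
      case True
      hence "pderiv q = 0" by (simp add: pderiv_eq_0_iff)
      thus ?thesis by (simp add: poly_0[abs_def])
    next
      case False
      hence "integral {-1..1} (poly (pderiv q * (pderiv ^^ k) R)) = 0"
        using Suc.prems by (intro Suc.IH) (auto simp: degree_pderiv)
      thus ?thesis by simp
    qed
    finally show ?case .
  qed simp
  have "integral {-1..1} (poly (p * smult (fact n * 2 ^ n) (legendre_poly n))) = 0"
    using main[of n p] assms unfolding legendre_poly_Rodrigues[symmetric] R_def power_mult_distrib
    by simp
  moreover have "poly (p * smult (fact n * 2 ^ n) (legendre_poly n)) = (\<lambda>x. fact n * 2 ^ n * poly (p * legendre_poly n) x)"
    by (simp add: fun_eq_iff)
  ultimately show ?thesis by (simp del: poly_mult)
qed

text \<open>Integrating x P P' by parts determines the norm without any beta integral, because x P' - n P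
  has degree less than n.\<close>
lemma legendre_poly_norm:
  "integral {-1..1} (poly (legendre_poly n * legendre_poly n)) = 2 / (2 * real n + 1)"
proof -
  let ?P = "legendre_poly n"
  define N where "N = integral {-1..1} (poly (?P * ?P))"
  \<comment> \<open>The boundary term x P(x)^2 is 1 at 1 and -1 at -1, which gives the 2.\<close>
  have "integral {-1..1} (poly ([:0,1:] * pderiv (?P * ?P))) = 2 - N"
    using legendre_poly_at_1[of n] legendre_poly_at_minus_1[of n]
    by (subst poly_integral_by_parts) (auto simp: N_def pderiv_pCons power2_eq_square)
  moreover define Q where "Q = [:0,1:] * pderiv ?P - smult (real n) ?P"
  have "integral {-1..1} (poly (Q * ?P)) = 0"
  proof (cases "n = 0")
    case True
    hence "pderiv ?P = 0" using degree_legendre_poly[of n] by (simp add: pderiv_eq_0_iff)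
    thus ?thesis by (simp add: Q_def True poly_0[abs_def])
  next
    case False
    have "coeff Q i = 0" if "i > n - 1" for i
    proof (cases "i = n")
      case True
      then obtain k where "n = Suc k" using False by (cases n) auto
      thus ?thesis using True by (simp add: Q_def coeff_pCons coeff_pderiv)
    next
      case False
      hence "i > n" using that by auto
      hence "coeff ?P i = 0" using degree_legendre_poly[of n] by (intro coeff_eq_0) auto
      thus ?thesis using \<open>i > n\<close> by (cases i) (auto simp: Q_def coeff_pCons coeff_pderiv)
    qed
    hence "degree Q \<le> n - 1" by (intro degree_le) auto
    thus ?thesis using False by (intro legendre_poly_orth_lower) auto
  qed
  moreover have "poly ([:0,1:] * pderiv (?P * ?P)) = (\<lambda>x. 2 * poly (Q * ?P) x + 2 * real n * poly (?P * ?P) x)"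
    by (simp add: fun_eq_iff Q_def pderiv_mult algebra_simps)
  hence "integral {-1..1} (poly ([:0,1:] * pderiv (?P * ?P))) = 2 * integral {-1..1} (poly (Q * ?P)) + 2 * real n * N"
    unfolding N_def
    by (simp only:, subst integral_add)
      (auto intro!: integrable_continuous_real continuous_intros simp del: poly_mult)
  ultimately have "2 - N = 2 * real n * N" by simp
  thus ?thesis unfolding N_def[symmetric] by (simp add: field_simps)
qed

lemma legendre_poly_orthogonal:
  assumes "i \<noteq> j"
  shows "integral {-1..1} (poly (legendre_poly i * legendre_poly j)) = 0"
proof (cases "i < j")
  case True
  thus ?thesis using degree_legendre_poly[of i] by (intro legendre_poly_orth_lower) auto
next
  case False
  thus ?thesis using degree_legendre_poly[of j] assms
    by (subst mult.commute, intro legendre_poly_orth_lower) auto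
qed

text \<open>A drop in degree would make the polynomial orthogonal to itself, against its nonzero
  norm.\<close>

lemma degree_legendre_poly_eq: "degree (legendre_poly n) = n"
proof (rule ccontr)
  assume "degree (legendre_poly n) \<noteq> n"
  hence "degree (legendre_poly n) < n" using degree_legendre_poly[of n] by auto
  from legendre_poly_orth_lower[OF this] show False
    by (simp add: legendre_poly_norm del: poly_mult)
qed

text \<open>Because the degree of the n-th polynomial is exactly n, its multiple can remove the
  leading coefficient of p.\<close>

lemma legendre_poly_span:
  "degree p \<le> n \<Longrightarrow> \<exists>c. p = (\<Sum>j\<le>n. smult (c j) (legendre_poly j))"
proof (induction n arbitrary: p)
  case 0
  have c: "coeff (legendre_poly 0) 0 = 1" by (simp add: legendre_poly_def)
  obtain a where "p = [:a:]" using 0 by (metis degree_eq_zeroE le_zero_eq)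
  moreover obtain b where b: "legendre_poly 0 = [:b:]" using degree_legendre_poly_eq[of 0] by (metis degree_eq_zeroE)
  ultimately show ?case using c by (intro exI[of _ "\<lambda>_. a"]) simp
next
  case (Suc n)
  define c where "c = coeff p (Suc n) / lead_coeff (legendre_poly (Suc n))"
  have lc: "coeff (legendre_poly (Suc n)) (Suc n) \<noteq> 0"
    by (metis degree_legendre_poly_eq degree_0 leading_coeff_0_iff nat.distinct(1))
  define r where "r = p - smult c (legendre_poly (Suc n))"
  have "coeff r i = 0" if "i > n" for i
  proof (cases "i = Suc n")
    case True
    thus ?thesis using lc by (simp add: r_def c_def degree_legendre_poly_eq)
  next
    case False
    hence "i > Suc n" using that by auto
    thus ?thesis using Suc.prems by (simp add: r_def coeff_eq_0 degree_legendre_poly_eq)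
  qed
  hence "degree r \<le> n" by (intro degree_le) auto
  from Suc.IH[OF this] obtain d where d: "r = (\<Sum>j\<le>n. smult (d j) (legendre_poly j))" by auto
  have "p = (\<Sum>j\<le>Suc n. smult ((d(Suc n := c)) j) (legendre_poly j))"
    using d by (simp add: r_def algebra_simps)
  thus ?case by blast
qed

section \<open>The basis on [t, T] and polynomial approximation\<close>

definition phi_poly :: "real \<Rightarrow> real \<Rightarrow> nat \<Rightarrow> real poly" where
  "phi_poly t T j = smult (sqrt ((2 * real j + 1) / (T - t)))
     (pcompose (legendre_poly j) [:- ((T + t) / (T - t)), 2 / (T - t):])"

lemma poly_phi_poly:
  assumes "t < T"
  shows "poly (phi_poly t T j) = legendre_phi t T j"
proof
  fix s
  have "- ((T + t) / (T - t)) + s * (2 / (T - t)) = (s - (T + t) / 2) * (2 / (T - t))"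
    using assms by (simp add: divide_simps) (simp add: algebra_simps)
  thus "poly (phi_poly t T j) s = legendre_phi t T j s"
    by (simp add: phi_poly_def legendre_phi_def poly_pcompose poly_legendre_poly)
qed

lemma continuous_on_legendre_phi [continuous_intros]:
  "t < T \<Longrightarrow> continuous_on A (legendre_phi t T j)"
  by (simp add: poly_phi_poly[symmetric] continuous_intros)

text \<open>The substitution m s + c maps [t, T] onto [-1, 1]. Its Jacobian (T - t)/2, the norm
  2/(2j+1) and the squared normalisation (2j+1)/(T - t) multiply to 1.\<close>

lemma legendre_phi_has_integral:
  assumes "t < T"
  shows "((\<lambda>s. legendre_phi t T i s * legendre_phi t T j s) has_integral (if i = j then 1 else 0)) {t..T}"
proof -
  define m c where "m = 2 / (T - t)" and "c = - ((T + t) / (T - t))"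
  have m: "m > 0" using assms by (simp add: m_def)
  let ?I = "integral {-1..1} (poly (legendre_poly i * legendre_poly j))"
  have "(poly (legendre_poly i * legendre_poly j) has_integral ?I) (cbox (-1) 1)"
    by (auto intro!: integrable_integral simp del: poly_mult)
  from has_integral_affinity[OF this, of m c] m
  have "((\<lambda>x. poly (legendre_poly i * legendre_poly j) (m * x + c)) has_integral (1 / m) * ?I)
     ((\<lambda>x. (1 / m) * x + - ((1 / m) * c)) ` {-1..1})"
    by simp
  moreover have "(\<lambda>x. (1 / m) * x + - ((1 / m) * c)) ` {-1..1} = {t..T}"
    using m assms by (subst image_affinity_atLeastAtMost) (auto simp: m_def c_def field_simps)
  ultimately have "((\<lambda>x. poly (legendre_poly i * legendre_poly j) (m * x + c)) has_integral (1 / m) * ?I) {t..T}"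
    by simp
  hence "((\<lambda>x. sqrt ((2 * real i + 1) / (T - t)) * sqrt ((2 * real j + 1) / (T - t))
       * poly (legendre_poly i * legendre_poly j) (m * x + c)) has_integral
       sqrt ((2 * real i + 1) / (T - t)) * sqrt ((2 * real j + 1) / (T - t)) * ((1 / m) * ?I)) {t..T}"
    by (intro has_integral_mult_right)
  moreover have "sqrt ((2 * real i + 1) / (T - t)) * sqrt ((2 * real j + 1) / (T - t)) * ((1 / m) * ?I)
      = (if i = j then 1 else 0)"
  proof (cases "i = j")
    case True
    have "sqrt ((2 * real j + 1) / (T - t)) * sqrt ((2 * real j + 1) / (T - t)) = (2 * real j + 1) / (T - t)"
      using assms by simp
    thus ?thesis unfolding True legendre_poly_norm using assms by (simp add: m_def divide_simps) (simp add: algebra_simps)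
  qed (simp add: legendre_poly_orthogonal del: poly_mult)
  moreover have "(\<lambda>x. sqrt ((2 * real i + 1) / (T - t)) * sqrt ((2 * real j + 1) / (T - t))
       * poly (legendre_poly i * legendre_poly j) (m * x + c))
     = (\<lambda>s. legendre_phi t T i s * legendre_phi t T j s)"
    using assms by (auto simp: fun_eq_iff poly_phi_poly[symmetric] phi_poly_def poly_pcompose m_def c_def algebra_simps)
  ultimately show ?thesis by simp
qed

lemma legendre_phi_span:
  assumes "t < T" "degree p \<le> n"
  shows "\<exists>c. \<forall>s. poly p s = (\<Sum>j\<le>n. c j * legendre_phi t T j s)"
proof -
  define q where "q = pcompose p [:(T + t) / 2, (T - t) / 2:]"
  have "degree q \<le> n"
    using assms(2) by (auto simp: q_def degree_pcompose)
  then obtain c where c: "q = (\<Sum>j\<le>n. smult (c j) (legendre_poly j))"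
    using legendre_poly_span by blast
  define d where "d j = c j / sqrt ((2 * real j + 1) / (T - t))" for j
  have "poly p s = (\<Sum>j\<le>n. d j * legendre_phi t T j s)" for s
  proof -
    have "poly p s = poly q ((s - (T + t) / 2) * (2 / (T - t)))"
    proof -
      have "s = (T + t) / 2 + (s - (T + t) / 2) * (2 / (T - t)) * ((T - t) / 2)"
        using assms(1) by (simp add: field_simps)
      thus ?thesis by (simp add: q_def poly_pcompose)
    qed
    also have "\<dots> = (\<Sum>j\<le>n. d j * legendre_phi t T j s)"
      unfolding c poly_sum using assms(1)
      by (intro sum.cong) (auto simp: d_def legendre_phi_def poly_legendre_poly)
    finally show ?thesis .
  qed
  thus ?thesis by blast
qed

lemma weierstrass_poly:
  fixes g :: "real \<Rightarrow> real"
  assumes "continuous_on {a..b} g" "e > 0"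
  shows "\<exists>p. \<forall>x\<in>{a..b}. \<bar>g x - poly p x\<bar> < e"
proof -
  obtain r where r: "real_polynomial_function r" "\<And>x. x \<in> {a..b} \<Longrightarrow> \<bar>g x - r x\<bar> < e"
    using Stone_Weierstrass_real_polynomial_function[OF compact_Icc assms] by blast
  then obtain c n where "r = (\<lambda>x. \<Sum>i\<le>n. c i * x ^ i)"
    using real_polynomial_function_iff_sum by blast
  hence "r = poly (\<Sum>i\<le>n. monom (c i) i)"
    by (simp add: fun_eq_iff poly_sum poly_monom)
  thus ?thesis using r by blast
qed

section \<open>Bessel and Parseval on subintervals\<close>

locale legendre_interval =
  fixes t T :: real
  assumes tT: "t < T"
begin

abbreviation \<phi> where "\<phi> \<equiv> legendre_phi t T"

lemma phi_cont [continuous_intros]: "continuous_on A (\<phi> j)"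
  using tT by (rule continuous_on_legendre_phi)

text \<open>Completing the square around the Fourier coefficients c. The choice r = c gives Bessel's
  inequality, and any other r bounds the Parseval defect from above. The hypotheses are integrals
  and not continuity, since f is going to be a continuous function cut off at the ends of a
  subinterval.\<close>

lemma has_integral_sub_square:
  assumes f2: "((\<lambda>x. f x ^ 2) has_integral N) {t..T}"
    and fphi: "\<And>j. ((\<lambda>x. f x * \<phi> j x) has_integral c j) {t..T}"
  shows "((\<lambda>x. (f x - (\<Sum>j\<le>n. r j * \<phi> j x)) ^ 2) has_integral
     (N - (\<Sum>j\<le>n. c j ^ 2) + (\<Sum>j\<le>n. (c j - r j) ^ 2))) {t..T}"
proof -
  have "((\<lambda>x. f x ^ 2 - 2 * (\<Sum>j\<le>n. r j * (f x * \<phi> j x)) + (\<Sum>i\<le>n. \<Sum>j\<le>n. r i * r j * (\<phi> i x * \<phi> j x)))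
     has_integral (N - 2 * (\<Sum>j\<le>n. r j * c j) + (\<Sum>i\<le>n. \<Sum>j\<le>n. r i * r j * (if i = j then 1 else 0)))) {t..T}"
    by (intro has_integral_add has_integral_diff has_integral_mult_right has_integral_sum f2 fphi
        legendre_phi_has_integral tT finite_atMost)
  moreover have "(\<lambda>x. f x ^ 2 - 2 * (\<Sum>j\<le>n. r j * (f x * \<phi> j x)) + (\<Sum>i\<le>n. \<Sum>j\<le>n. r i * r j * (\<phi> i x * \<phi> j x)))
     = (\<lambda>x. (f x - (\<Sum>j\<le>n. r j * \<phi> j x)) ^ 2)"
  proof
    fix x
    show "f x ^ 2 - 2 * (\<Sum>j\<le>n. r j * (f x * \<phi> j x)) + (\<Sum>i\<le>n. \<Sum>j\<le>n. r i * r j * (\<phi> i x * \<phi> j x))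
      = (f x - (\<Sum>j\<le>n. r j * \<phi> j x)) ^ 2"
      unfolding power2_diff power2_eq_square[of "\<Sum>j\<le>n. r j * \<phi> j x"] sum_product
      by (simp add: sum_distrib_left mult_ac)
  qed
  moreover have "(\<Sum>i\<le>n. \<Sum>j\<le>n. r i * r j * (if i = j then 1 else 0)) = (\<Sum>i\<le>n. (r i)^2)"
    by (intro sum.cong refl) (simp add: if_distrib power2_eq_square cong: if_cong)
  moreover have "N - 2 * (\<Sum>j\<le>n. r j * c j) + (\<Sum>i\<le>n. (r i)^2) = N - (\<Sum>j\<le>n. c j ^ 2) + (\<Sum>j\<le>n. (c j - r j) ^ 2)"
    by (simp add: power2_diff sum.distrib sum_subtractf sum_distrib_left mult_ac)
  ultimately show ?thesis by metis
qed

context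
  fixes a b :: real and q :: "real \<Rightarrow> real"
  assumes ab: "t \<le> a" "a \<le> b" "b \<le> T" and q: "continuous_on {t..T} q"
begin

lemma restricted_has_integral:
  fixes g :: "real \<Rightarrow> real"
  assumes "continuous_on {a..b} g"
  shows "((\<lambda>x. if x \<in> {a<..<b} then g x else 0) has_integral integral {a..b} g) {t..T}"
proof -
  have "(g has_integral integral {a..b} g) (cbox a b)"
    using integrable_integral[OF integrable_continuous_real[OF assms]] by simp
  from has_integral_restrict_open_subinterval[OF this, of t T] show ?thesis using ab by simp
qed

text \<open>The function that is expanded over [t, T] is q times the indicator of (a, b), which may
  jump at a and b and then has no uniform polynomial approximation. It is first replaced by q times
  a continuous cutoff (small error by dominated convergence), and only then approximated by
  Weierstrass' theorem.\<close>

lemma bessel_parseval_interval: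
  shows "(\<Sum>j\<le>n. (integral {a..b} (\<lambda>x. q x * \<phi> j x))\<^sup>2) \<le> integral {a..b} (\<lambda>x. (q x)\<^sup>2)" (is ?bessel)
    and "(\<lambda>n. \<Sum>j\<le>n. (integral {a..b} (\<lambda>x. q x * \<phi> j x))\<^sup>2) \<longlonglongrightarrow> integral {a..b} (\<lambda>x. (q x)\<^sup>2)" (is ?parseval)
proof -
  define f where "f x = (if x \<in> {a<..<b} then q x else 0)" for x
  define N where "N = integral {a..b} (\<lambda>x. (q x)\<^sup>2)"
  define c where "c j = integral {a..b} (\<lambda>x. q x * \<phi> j x)" for j
  have qab: "continuous_on {a..b} q" using q ab by (auto intro: continuous_on_subset)
  have f2: "((\<lambda>x. f x ^ 2) has_integral N) {t..T}"
  proof -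
    have "(\<lambda>x. f x ^ 2) = (\<lambda>x. if x \<in> {a<..<b} then (q x)\<^sup>2 else 0)" by (auto simp: f_def)
    thus ?thesis unfolding N_def using restricted_has_integral[of "\<lambda>x. (q x)\<^sup>2"] qab
      by (simp add: continuous_intros)
  qed
  have fphi: "((\<lambda>x. f x * \<phi> j x) has_integral c j) {t..T}" for j
  proof -
    have "(\<lambda>x. f x * \<phi> j x) = (\<lambda>x. if x \<in> {a<..<b} then q x * \<phi> j x else 0)" by (auto simp: f_def)
    thus ?thesis unfolding c_def using restricted_has_integral[of "\<lambda>x. q x * \<phi> j x"] qab
      by (simp add: continuous_intros)
  qed
  note sq = has_integral_sub_square[OF f2 fphi]
  have bessel: "(\<Sum>j\<le>n. (c j)\<^sup>2) \<le> N" for n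
    using has_integral_nonneg[OF sq[where r = c and n = n]] by simp
  thus ?bessel by (simp add: N_def c_def)
  have approx: "\<exists>p. \<exists>I<e. ((\<lambda>x. (f x - poly p x)\<^sup>2) has_integral I) {t..T}" if "e > 0" for e
  proof -
    \<comment> \<open>A trapezoid of slope k: it vanishes off the open interval and equals 1 as soon
      as k times the distance to the nearer endpoint exceeds 1. Hence q times \<open>h k\<close>
      converges to f at every point, the endpoints included.\<close>
    define h where "h k x = max 0 (min 1 (real k * min (x - a) (b - x)))" for k x
    have h01: "0 \<le> h k x" "h k x \<le> 1" for k x by (auto simp: h_def)
    have h0: "h k x = 0" if "x \<notin> {a<..<b}" for k x
    proof -
      have "min (x - a) (b - x) \<le> 0" using that by auto
      hence "real k * min (x - a) (b - x) \<le> 0" by (intro mult_nonneg_nonpos) auto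
      thus ?thesis by (simp add: h_def)
    qed
    have cont: "continuous_on S (h k)" for S k unfolding h_def by (intro continuous_intros)
    obtain B where B: "\<forall>x\<in>{t..T}. \<bar>q x\<bar> \<le> B"
      using compact_imp_bounded[OF compact_continuous_image[OF q compact_Icc]]
      by (auto simp: bounded_iff)
    have eq: "(f x - q x * h k x)\<^sup>2 = (if x \<in> {a<..<b} then (q x - q x * h k x)\<^sup>2 else 0)" for x k
      by (auto simp: f_def h0)
    have int: "(\<lambda>x. (f x - q x * h k x)\<^sup>2) integrable_on {t..T}" for k
    proof -
      have "continuous_on {a..b} (\<lambda>x. (q x - q x * h k x)\<^sup>2)"
        by (intro continuous_intros qab cont)
      from restricted_has_integral[OF this] show ?thesis unfolding eq by blast
    qed
    have "(\<lambda>k. integral {t..T} (\<lambda>x. (f x - q x * h k x)\<^sup>2)) \<longlonglongrightarrow> integral {t..T} (\<lambda>x. 0)"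
    proof (rule dominated_convergence[where h = "\<lambda>_. B\<^sup>2"])
      fix k x assume x: "x \<in> {t..T}"
      have "\<bar>f x - q x * h k x\<bar> \<le> \<bar>q x\<bar>"
      proof (cases "x \<in> {a<..<b}")
        case True
        hence "f x - q x * h k x = q x * (1 - h k x)" by (simp add: f_def algebra_simps)
        also have "\<bar>\<dots>\<bar> \<le> \<bar>q x\<bar> * 1" unfolding abs_mult using h01[of k x] by (intro mult_left_mono) auto
        finally show ?thesis by simp
      qed (auto simp: h0 f_def)
      also have "\<dots> \<le> B" using B x by auto
      finally show "norm ((f x - q x * h k x)\<^sup>2) \<le> B\<^sup>2"
        using abs_le_square_iff[of "f x - q x * h k x" B] by auto
    next
      fix x
      show "(\<lambda>k. (f x - q x * h k x)\<^sup>2) \<longlonglongrightarrow> 0"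
      proof (cases "x \<in> {a<..<b}")
        case True
        define d where "d = min (x - a) (b - x)"
        have d: "d > 0" using True by (auto simp: d_def)
        obtain K where K: "real K * d > 1" using reals_Archimedean3[OF d] by blast
        have "h k x = 1" if "k \<ge> K" for k
        proof -
          have "real k * d \<ge> real K * d" using that d by (intro mult_right_mono) auto
          thus ?thesis using K by (simp add: h_def d_def[symmetric])
        qed
        hence "\<forall>\<^sub>F k in sequentially. (f x - q x * h k x)\<^sup>2 = 0"
          using True by (intro eventually_sequentiallyI[of K]) (auto simp: f_def)
        thus ?thesis by (rule tendsto_eventually)
      qed (auto simp: h0 f_def)
    qed (use int in auto)
    hence "(\<lambda>k. integral {t..T} (\<lambda>x. (f x - q x * h k x)\<^sup>2)) \<longlonglongrightarrow> 0" by simp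
    from order_tendstoD(2)[OF this, of "e/4"] \<open>e > 0\<close>
    obtain k where k: "integral {t..T} (\<lambda>x. (f x - q x * h k x)\<^sup>2) < e / 4"
      by (auto simp: eventually_sequentially)
    \<comment> \<open>Squaring a sum costs a factor 2: the cutoff contributes less than 2 e/4 and
      the uniform error 2 d^2 (T - t) = e/4, in total 3e/4.\<close>
    define d where "d = sqrt (e / (8 * (T - t)))"
    have d: "d > 0" "d\<^sup>2 = e / (8 * (T - t))" using \<open>e > 0\<close> tT by (auto simp: d_def)
    have "continuous_on {t..T} (\<lambda>x. q x * h k x)" by (intro continuous_intros q cont)
    from weierstrass_poly[OF this d(1)]
    obtain p where p: "\<And>x. x \<in> {t..T} \<Longrightarrow> \<bar>q x * h k x - poly p x\<bar> < d" by blast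
    obtain r where r: "\<And>x. poly p x = (\<Sum>j\<le>degree p. r j * \<phi> j x)"
      using legendre_phi_span[OF tT order.refl] by blast
    define I where "I = N - (\<Sum>j\<le>degree p. c j ^ 2) + (\<Sum>j\<le>degree p. (c j - r j) ^ 2)"
    have I: "((\<lambda>x. (f x - poly p x)\<^sup>2) has_integral I) {t..T}"
      unfolding r I_def by (rule sq)
    have J: "((\<lambda>x. 2 * (f x - q x * h k x)\<^sup>2 + 2 * d\<^sup>2) has_integral
        (2 * integral {t..T} (\<lambda>x. (f x - q x * h k x)\<^sup>2) + (T - t) * (2 * d\<^sup>2))) {t..T}"
      using tT has_integral_const_real[of "2 * d\<^sup>2" t T]
      by (intro has_integral_add has_integral_mult_right integrable_integral int) auto
    have "I \<le> 2 * integral {t..T} (\<lambda>x. (f x - q x * h k x)\<^sup>2) + (T - t) * (2 * d\<^sup>2)"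
    proof (rule has_integral_le[OF I J])
      fix x assume "x \<in> {t..T}"
      hence "(q x * h k x - poly p x)\<^sup>2 \<le> d\<^sup>2"
        using p[of x] d abs_le_square_iff[of "q x * h k x - poly p x" d] by auto
      moreover have "(f x - poly p x)\<^sup>2 \<le> 2 * (f x - q x * h k x)\<^sup>2 + 2 * (q x * h k x - poly p x)\<^sup>2"
        using zero_le_square[of "f x - 2 * (q x * h k x) + poly p x"]
        by (simp add: power2_eq_square algebra_simps)
      ultimately show "(f x - poly p x)\<^sup>2 \<le> 2 * (f x - q x * h k x)\<^sup>2 + 2 * d\<^sup>2" by simp
    qed
    also have "\<dots> < e" using k d tT \<open>e > 0\<close> by (simp add: field_simps)
    finally show ?thesis using I by blast
  qed
  have "(\<lambda>n. \<Sum>j\<le>n. (c j)\<^sup>2) \<longlonglongrightarrow> N"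
  proof (rule LIMSEQ_I)
    fix e :: real assume "e > 0"
    from approx[OF this] obtain p I where p: "I < e" "((\<lambda>x. (f x - poly p x)\<^sup>2) has_integral I) {t..T}"
      by blast
    \<comment> \<open>For n at least the degree, p is a combination of the first n + 1 basis
      functions, so the Parseval defect at n is at most the squared distance I from f to p.\<close>
    have "norm ((\<Sum>j\<le>n. (c j)\<^sup>2) - N) < e" if n: "n \<ge> degree p" for n
    proof -
      obtain r where r: "\<And>x. poly p x = (\<Sum>j\<le>n. r j * \<phi> j x)"
        using legendre_phi_span[OF tT n] by blast
      have "I = N - (\<Sum>j\<le>n. c j ^ 2) + (\<Sum>j\<le>n. (c j - r j) ^ 2)"
        using p(2) unfolding r by (rule has_integral_unique) (rule sq)
      moreover have "(\<Sum>j\<le>n. (c j - r j) ^ 2) \<ge> 0" by (intro sum_nonneg) auto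
      ultimately show ?thesis using p(1) bessel[of n] by (simp add: abs_real_def)
    qed
    thus "\<exists>no. \<forall>n\<ge>no. norm ((\<Sum>j\<le>n. (c j)\<^sup>2) - N) < e" by blast
  qed
  thus ?parseval by (simp add: N_def c_def)
qed

end

end

context legendre_interval
begin

subsection \<open>Iterated deterministic integrals and traces of the coefficients\<close>

definition D1 :: "(real \<Rightarrow> real) \<Rightarrow> real \<Rightarrow> real" where "D1 f s = integral {t..s} f"

definition D2 :: "(real \<Rightarrow> real) \<Rightarrow> (real \<Rightarrow> real) \<Rightarrow> real \<Rightarrow> real" where
  "D2 f g = D1 (\<lambda>u. g u * D1 f u)"

text \<open>Innermost weight first: this is the integral of f(s1) g(s2) h(s3) over the simplex t <
  s1 < s2 < s3 < s.\<close>

definition D3 :: "(real \<Rightarrow> real) \<Rightarrow> (real \<Rightarrow> real) \<Rightarrow> (real \<Rightarrow> real) \<Rightarrow> real \<Rightarrow> real" where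
  "D3 f g h = D1 (\<lambda>u. h u * D2 f g u)"

abbreviation cont :: "(real \<Rightarrow> real) \<Rightarrow> bool" where "cont f \<equiv> continuous_on {t..T} f"

lemma cont_integrable: "cont f \<Longrightarrow> t \<le> a \<Longrightarrow> b \<le> T \<Longrightarrow> f integrable_on {a..b}"
  by (rule integrable_continuous_real) (auto intro: continuous_on_subset)

lemma D1_start [simp]: "D1 f t = 0"
  by (simp add: D1_def)

lemma D1_deriv:
  assumes "cont f" "s \<in> {t..T}"
  shows "(D1 f has_real_derivative f s) (at s within {t..T})"
  unfolding D1_def using integral_has_real_derivative[OF assms] .

lemma cont_D1 [continuous_intros]: "cont f \<Longrightarrow> cont (D1 f)"
  by (rule DERIV_continuous_on) (rule D1_deriv)

lemma cont_D2 [continuous_intros]: "cont f \<Longrightarrow> cont g \<Longrightarrow> cont (D2 f g)"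
  unfolding D2_def by (intro cont_D1 continuous_on_mult)

lemma D1_cong: "s \<le> T \<Longrightarrow> (\<And>u. u \<in> {t..T} \<Longrightarrow> f u = g u) \<Longrightarrow> D1 f s = D1 g s"
  unfolding D1_def by (rule Henstock_Kurzweil_Integration.integral_cong) auto

lemma D1_add: "cont f \<Longrightarrow> cont g \<Longrightarrow> s \<le> T \<Longrightarrow> D1 (\<lambda>u. f u + g u) s = D1 f s + D1 g s"
  unfolding D1_def by (intro Henstock_Kurzweil_Integration.integral_add cont_integrable) auto

lemma D1_diff: "cont f \<Longrightarrow> cont g \<Longrightarrow> s \<le> T \<Longrightarrow> D1 (\<lambda>u. f u - g u) s = D1 f s - D1 g s"
  unfolding D1_def by (intro Henstock_Kurzweil_Integration.integral_diff cont_integrable) auto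

lemma D1_cmult: "D1 (\<lambda>u. c * f u) s = c * D1 f s"
  by (simp add: D1_def)

lemma D1_sum:
  assumes "\<And>k. k \<in> A \<Longrightarrow> cont (f k)" "s \<le> T"
  shows "D1 (\<lambda>u. \<Sum>k\<in>A. f k u) s = (\<Sum>k\<in>A. D1 (f k) s)"
proof (cases "finite A")
  case True
  thus ?thesis unfolding D1_def using assms
    by (intro Henstock_Kurzweil_Integration.integral_sum cont_integrable) auto
qed (simp add: D1_def)

lemma D1_nonneg:
  assumes "cont f" "s \<le> T" "\<And>u. u \<in> {t..T} \<Longrightarrow> 0 \<le> f u"
  shows "0 \<le> D1 f s"
  unfolding D1_def using assms by (intro Henstock_Kurzweil_Integration.integral_nonneg cont_integrable) auto

lemma D1_FTC:
  assumes "\<And>u. u \<in> {t..T} \<Longrightarrow> (G has_real_derivative f u) (at u within {t..T})" "s \<in> {t..T}"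
  shows "D1 f s = G s - G t"
proof -
  have "(G has_real_derivative f x) (at x within {t..s})" if "x \<in> {t..s}" for x
    using DERIV_subset[OF assms(1)[of x], of "{t..s}"] that assms(2) by auto
  hence "(f has_integral (G s - G t)) {t..s}"
    using assms(2) by (intro fundamental_theorem_of_calculus)
      (auto simp: has_real_derivative_iff_has_vector_derivative[symmetric])
  thus ?thesis unfolding D1_def by (rule integral_unique)
qed

lemma D1_by_parts:
  assumes "cont f" "cont g" "s \<in> {t..T}"
  shows "D1 f s * D1 g s = D1 (\<lambda>u. g u * D1 f u) s + D1 (\<lambda>u. f u * D1 g u) s"
proof -
  have "D1 (\<lambda>u. g u * D1 f u + f u * D1 g u) s = D1 f s * D1 g s - D1 f t * D1 g t"
    by (rule D1_FTC[OF _ assms(3)]) (auto intro!: derivative_eq_intros D1_deriv assms(1,2))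
  thus ?thesis using assms by (simp add: D1_add continuous_intros)
qed

text \<open>Shuffle product: h is inserted at each of the three positions relative to the ordered
  pair f, g.\<close>

lemma D1_mult_D2:
  assumes "cont f" "cont g" "cont h" "s \<in> {t..T}"
  shows "D2 f g s * D1 h s = D3 f g h s + D3 f h g s + D3 h f g s"
proof -
  have "D2 f g s * D1 h s = D3 f g h s + D1 (\<lambda>u. g u * D1 f u * D1 h u) s"
    unfolding D2_def D3_def using assms by (intro D1_by_parts) (auto intro!: continuous_intros)
  also have "D1 (\<lambda>u. g u * D1 f u * D1 h u) s = D1 (\<lambda>u. g u * D2 f h u + g u * D2 h f u) s"
  proof (rule D1_cong)
    fix u assume "u \<in> {t..T}"
    from D1_by_parts[OF assms(1,3) this] show "g u * D1 f u * D1 h u = g u * D2 f h u + g u * D2 h f u"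
      by (simp add: D2_def algebra_simps)
  qed (use assms in auto)
  also have "\<dots> = D3 f h g s + D3 h f g s"
    unfolding D3_def using assms by (intro D1_add) (auto intro!: continuous_intros)
  finally show ?thesis by simp
qed

text \<open>Two shuffles, starting from \<open>D2 f g\<close> and from \<open>D2 g f\<close>. For
  products of two basis functions the right-hand side becomes a product of Kronecker symbols, which
  is how orthonormality reaches the simplex integrals.\<close>

lemma sum_permutations_D3:
  assumes "cont f" "cont g" "cont h" "s \<in> {t..T}"
  shows "D3 f g h s + D3 f h g s + D3 g f h s + D3 g h f s + D3 h f g s + D3 h g f s = D1 f s * D1 g s * D1 h s"
proof -
  have "D1 f s * D1 g s = D2 f g s + D2 g f s"
    unfolding D2_def by (rule D1_by_parts[OF assms(1,2,4)])
  thus ?thesis using D1_mult_D2[OF assms] D1_mult_D2[OF assms(2,1,3,4)] by (simp add: distrib_right)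
qed

lemma D1_tendsto:
  assumes "\<And>n. cont (h n)" "\<And>n x. x \<in> {t..T} \<Longrightarrow> \<bar>h n x\<bar> \<le> B"
    "\<And>x. x \<in> {t..T} \<Longrightarrow> (\<lambda>n. h n x) \<longlonglongrightarrow> k x" "s \<in> {t..T}"
  shows "(\<lambda>n. D1 (h n) s) \<longlonglongrightarrow> D1 k s"
  unfolding D1_def using assms
  by (intro dominated_convergence(2)[where h = "\<lambda>_. B"] cont_integrable) auto

lemma cont_bounded: "cont f \<Longrightarrow> \<exists>B\<ge>0. \<forall>x\<in>{t..T}. \<bar>f x\<bar> \<le> B"
proof -
  assume f: "cont f"
  obtain B where B: "\<forall>x\<in>{t..T}. \<bar>f x\<bar> \<le> B"
    using compact_imp_bounded[OF compact_continuous_image[OF f compact_Icc]] by (auto simp: bounded_iff)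
  moreover have "B \<ge> 0" using B tT by (auto intro: order.trans[of _ "\<bar>f t\<bar>"])
  ultimately show ?thesis by blast
qed

lemma bessel:
  assumes "cont q" "s \<in> {t..T}"
  shows "(\<Sum>j\<le>n. (D1 (\<lambda>x. q x * \<phi> j x) s)\<^sup>2) \<le> D1 (\<lambda>x. (q x)\<^sup>2) s"
  unfolding D1_def using assms by (intro bessel_parseval_interval) auto

lemma parseval:
  assumes "cont q" "s \<in> {t..T}"
  shows "(\<lambda>n. \<Sum>j\<le>n. (D1 (\<lambda>x. q x * \<phi> j x) s)\<^sup>2) \<longlonglongrightarrow> D1 (\<lambda>x. (q x)\<^sup>2) s"
  unfolding D1_def using assms by (intro bessel_parseval_interval) auto

lemma D1_tail:
  assumes "cont f" "s \<in> {t..T}"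
  shows "integral {s..T} f = D1 f T - D1 f s"
proof -
  have "integral {t..s} f + integral {s..T} f = integral {t..T} f"
    using assms tT by (intro Henstock_Kurzweil_Integration.integral_combine cont_integrable) auto
  thus ?thesis by (simp add: D1_def)
qed

lemma bessel_tail:
  assumes "cont q" "s \<in> {t..T}"
  shows "(\<Sum>j\<le>n. (D1 (\<lambda>x. q x * \<phi> j x) T - D1 (\<lambda>x. q x * \<phi> j x) s)\<^sup>2) \<le> D1 (\<lambda>x. (q x)\<^sup>2) T - D1 (\<lambda>x. (q x)\<^sup>2) s"
  using bessel_parseval_interval(1)[of s T q n] assms by (simp add: D1_tail continuous_intros phi_cont)

lemma parseval_tail:
  assumes "cont q" "s \<in> {t..T}"
  shows "(\<lambda>n. \<Sum>j\<le>n. (D1 (\<lambda>x. q x * \<phi> j x) T - D1 (\<lambda>x. q x * \<phi> j x) s)\<^sup>2) \<longlonglongrightarrow> D1 (\<lambda>x. (q x)\<^sup>2) T - D1 (\<lambda>x. (q x)\<^sup>2) s"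
  using bessel_parseval_interval(2)[of s T q] assms by (simp add: D1_tail continuous_intros phi_cont)

lemma D1_phi: "D1 (\<lambda>x. \<phi> i x * \<phi> j x) T = (if i = j then 1 else 0)"
  unfolding D1_def by (rule integral_unique[OF legendre_phi_has_integral[OF tT]])

text \<open>Parseval's identity under an outer time integral. Bessel's inequality dominates the
  partial sums, so dominated convergence applies.\<close>

lemma parseval_weighted:
  assumes w: "cont w" and q: "cont q" and s: "s \<in> {t..T}"
  shows "(\<lambda>n. \<Sum>j\<le>n. D1 (\<lambda>u. (w u * D1 (\<lambda>x. q x * \<phi> j x) u)\<^sup>2) s) \<longlonglongrightarrow> D1 (\<lambda>u. (w u)\<^sup>2 * D1 (\<lambda>x. (q x)\<^sup>2) u) s"
proof -
  define h where "h n u = (w u)\<^sup>2 * (\<Sum>j\<le>n. (D1 (\<lambda>x. q x * \<phi> j x) u)\<^sup>2)" for n u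
  have c: "cont (\<lambda>u. (w u)\<^sup>2 * D1 (\<lambda>x. (q x)\<^sup>2) u)" using w q by (intro continuous_intros)
  obtain B where B: "\<forall>x\<in>{t..T}. \<bar>(w x)\<^sup>2 * D1 (\<lambda>x. (q x)\<^sup>2) x\<bar> \<le> B" using cont_bounded[OF c] by blast
  have hc: "cont (h n)" for n unfolding h_def using w q by (intro continuous_intros)
  have "(\<lambda>n. D1 (h n) s) \<longlonglongrightarrow> D1 (\<lambda>u. (w u)\<^sup>2 * D1 (\<lambda>x. (q x)\<^sup>2) u) s"
  proof (rule D1_tendsto[OF hc _ _ s])
    fix n x assume x: "x \<in> {t..T}"
    have "\<bar>h n x\<bar> = (w x)\<^sup>2 * (\<Sum>j\<le>n. (D1 (\<lambda>x. q x * \<phi> j x) x)\<^sup>2)"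
      unfolding h_def by (intro abs_of_nonneg mult_nonneg_nonneg sum_nonneg) auto
    also have "\<dots> \<le> (w x)\<^sup>2 * D1 (\<lambda>x. (q x)\<^sup>2) x" by (intro mult_left_mono bessel q x) auto
    also have "\<dots> \<le> B" using B x by fastforce
    finally show "\<bar>h n x\<bar> \<le> B" .
  next
    fix x assume x: "x \<in> {t..T}"
    show "(\<lambda>n. h n x) \<longlonglongrightarrow> (w x)\<^sup>2 * D1 (\<lambda>x. (q x)\<^sup>2) x"
      unfolding h_def by (intro tendsto_mult_left parseval q x)
  qed
  moreover have "D1 (h n) s = (\<Sum>j\<le>n. D1 (\<lambda>u. (w u * D1 (\<lambda>x. q x * \<phi> j x) u)\<^sup>2) s)" for n
    unfolding h_def sum_distrib_left power_mult_distrib using s w q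
    by (intro D1_sum) (auto intro!: continuous_intros)
  ultimately show ?thesis by simp
qed

text \<open>The indices are listed from the innermost to the outermost integral: the paper writes C_{j3 j2 j1}.\<close>
definition C3 :: "(real \<Rightarrow> real) \<Rightarrow> (real \<Rightarrow> real) \<Rightarrow> (real \<Rightarrow> real) \<Rightarrow> nat \<Rightarrow> nat \<Rightarrow> nat \<Rightarrow> real" where
  "C3 f g h j1 j2 j3 = D3 (\<lambda>s. f s * \<phi> j1 s) (\<lambda>s. g s * \<phi> j2 s) (\<lambda>s. h s * \<phi> j3 s) T"

text \<open>With the inner indices fixed, the coefficient is an ordinary Fourier coefficient in the
  outermost index, so j3 is summed first, then j2, then j1. The truncations are chosen in the
  opposite order, each depending on the previous ones. One good triple is enough: sums of squares
  grow with the index set.\<close>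

lemma parseval_C3:
  assumes c: "cont f" "cont g" "cont h" and e: "e > 0"
  shows "\<exists>p1 p2 p3. (\<Sum>j1\<le>p1. \<Sum>j2\<le>p2. \<Sum>j3\<le>p3. (C3 f g h j1 j2 j3)\<^sup>2) >
     D3 (\<lambda>s. (f s)\<^sup>2) (\<lambda>s. (g s)\<^sup>2) (\<lambda>s. (h s)\<^sup>2) T - e"
proof -
  define G1 where "G1 j1 = D1 (\<lambda>s. f s * \<phi> j1 s)" for j1
  define G2 where "G2 j1 j2 = D1 (\<lambda>u. g u * G1 j1 u * \<phi> j2 u)" for j1 j2
  have cG: "cont (G1 j)" "cont (G2 j j')" for j j'
    unfolding G1_def G2_def using c by (auto intro!: continuous_intros)
  have T: "T \<in> {t..T}" using tT by simp
  define L where "L = D3 (\<lambda>s. (f s)\<^sup>2) (\<lambda>s. (g s)\<^sup>2) (\<lambda>s. (h s)\<^sup>2) T"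
  \<comment> \<open>\<open>B2\<close> will be the full sum over j3 for fixed j1, j2, and
    \<open>B1\<close> the full sum over j2 and j3 for fixed j1.\<close>
  define B1 where "B1 j1 = D1 (\<lambda>u. (h u)\<^sup>2 * D1 (\<lambda>x. (g x * G1 j1 x)\<^sup>2) u) T" for j1
  define B2 where "B2 j1 j2 = D1 (\<lambda>u. (h u * G2 j1 j2 u)\<^sup>2) T" for j1 j2
  have lim3: "(\<lambda>n. \<Sum>j3\<le>n. (C3 f g h j1 j2 j3)\<^sup>2) \<longlonglongrightarrow> B2 j1 j2" for j1 j2
  proof -
    have "C3 f g h j1 j2 j3 = D1 (\<lambda>x. h x * G2 j1 j2 x * \<phi> j3 x) T" for j3
      unfolding C3_def D3_def D2_def G2_def G1_def by (simp add: mult_ac)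
    thus ?thesis unfolding B2_def using parseval[OF _ T, of "\<lambda>x. h x * G2 j1 j2 x"] c cG
      by (simp add: continuous_on_mult)
  qed
  have lim2: "(\<lambda>n. \<Sum>j2\<le>n. B2 j1 j2) \<longlonglongrightarrow> B1 j1" for j1
    unfolding B2_def B1_def G2_def using c cG by (intro parseval_weighted T continuous_on_mult) auto
  have lim1: "(\<lambda>n. \<Sum>j1\<le>n. B1 j1) \<longlonglongrightarrow> L"
  proof -
    define k where "k n u = (h u)\<^sup>2 * (\<Sum>j1\<le>n. D1 (\<lambda>x. (g x * G1 j1 x)\<^sup>2) u)" for n u
    have kc: "cont (k n)" for n unfolding k_def using c cG by (intro continuous_intros)
    have pw: "(\<lambda>n. \<Sum>j1\<le>n. D1 (\<lambda>x. (g x * G1 j1 x)\<^sup>2) u) \<longlonglongrightarrow> D2 (\<lambda>s. (f s)\<^sup>2) (\<lambda>s. (g s)\<^sup>2) u" if "u \<in> {t..T}" for u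
      unfolding D2_def G1_def using c that by (intro parseval_weighted)
    have nn: "0 \<le> D1 (\<lambda>x. (g x * G1 j1 x)\<^sup>2) u" if "u \<in> {t..T}" for u j1
      using that c cG by (intro D1_nonneg continuous_intros) auto
    have le: "(\<Sum>j1\<le>n. D1 (\<lambda>x. (g x * G1 j1 x)\<^sup>2) u) \<le> D2 (\<lambda>s. (f s)\<^sup>2) (\<lambda>s. (g s)\<^sup>2) u" if u: "u \<in> {t..T}" for n u
    proof (rule incseq_le[OF _ pw[OF u]])
      show "incseq (\<lambda>n. \<Sum>j1\<le>n. D1 (\<lambda>x. (g x * G1 j1 x)\<^sup>2) u)"
        by (rule incseq_SucI) (simp add: nn[OF u])
    qed
    have cc: "cont (\<lambda>u. (h u)\<^sup>2 * D2 (\<lambda>s. (f s)\<^sup>2) (\<lambda>s. (g s)\<^sup>2) u)" using c by (intro continuous_intros)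
    obtain B where B: "\<forall>x\<in>{t..T}. \<bar>(h x)\<^sup>2 * D2 (\<lambda>s. (f s)\<^sup>2) (\<lambda>s. (g s)\<^sup>2) x\<bar> \<le> B" using cont_bounded[OF cc] by blast
    have "(\<lambda>n. D1 (k n) T) \<longlonglongrightarrow> D1 (\<lambda>u. (h u)\<^sup>2 * D2 (\<lambda>s. (f s)\<^sup>2) (\<lambda>s. (g s)\<^sup>2) u) T"
    proof (rule D1_tendsto[OF kc _ _ T])
      fix n x assume x: "x \<in> {t..T}"
      have "\<bar>k n x\<bar> = (h x)\<^sup>2 * (\<Sum>j1\<le>n. D1 (\<lambda>y. (g y * G1 j1 y)\<^sup>2) x)"
        unfolding k_def by (intro abs_of_nonneg mult_nonneg_nonneg sum_nonneg nn x) auto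
      also have "\<dots> \<le> (h x)\<^sup>2 * D2 (\<lambda>s. (f s)\<^sup>2) (\<lambda>s. (g s)\<^sup>2) x" by (intro mult_left_mono le x) auto
      also have "\<dots> \<le> B" using B x by fastforce
      finally show "\<bar>k n x\<bar> \<le> B" .
    next
      fix x assume x: "x \<in> {t..T}"
      show "(\<lambda>n. k n x) \<longlonglongrightarrow> (h x)\<^sup>2 * D2 (\<lambda>s. (f s)\<^sup>2) (\<lambda>s. (g s)\<^sup>2) x"
        unfolding k_def by (intro tendsto_mult_left pw x)
    qed
    moreover have "D1 (k n) T = (\<Sum>j1\<le>n. B1 j1)" for n
      unfolding k_def B1_def sum_distrib_left using T c cG by (intro D1_sum) (auto intro!: continuous_intros)
    ultimately show ?thesis by (simp add: L_def D3_def)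
  qed
  from order_tendstoD(1)[OF lim1, of "L - e"] e obtain p1 where p1: "L - e < (\<Sum>j1\<le>p1. B1 j1)"
    by (auto simp: eventually_sequentially)
  have "(\<lambda>n. \<Sum>j1\<le>p1. \<Sum>j2\<le>n. B2 j1 j2) \<longlonglongrightarrow> (\<Sum>j1\<le>p1. B1 j1)" by (intro tendsto_sum lim2)
  from order_tendstoD(1)[OF this p1] obtain p2 where p2: "L - e < (\<Sum>j1\<le>p1. \<Sum>j2\<le>p2. B2 j1 j2)"
    by (auto simp: eventually_sequentially)
  have "(\<lambda>n. \<Sum>j1\<le>p1. \<Sum>j2\<le>p2. \<Sum>j3\<le>n. (C3 f g h j1 j2 j3)\<^sup>2) \<longlonglongrightarrow> (\<Sum>j1\<le>p1. \<Sum>j2\<le>p2. B2 j1 j2)"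
    by (intro tendsto_sum lim3)
  from order_tendstoD(1)[OF this p2] obtain p3 where "L - e < (\<Sum>j1\<le>p1. \<Sum>j2\<le>p2. \<Sum>j3\<le>p3. (C3 f g h j1 j2 j3)\<^sup>2)"
    by (auto simp: eventually_sequentially)
  thus ?thesis unfolding L_def by blast
qed

text \<open>The expression is the mean-square error of replacing the Wiener integral of G by a
  truncated expansion whose coefficients are those of \<open>F q\<close>. It equals the sum of
  squared coefficient differences plus the Parseval defect of G at n. Bessel bounds the former by
  ||F q - G||^2 for all n at once, so the dependence on q and on n separates.\<close>

lemma D1_phi_approx:
  assumes F: "\<And>q. cont (F q)" "\<And>q x. x \<in> {t..T} \<Longrightarrow> \<bar>F q x\<bar> \<le> B" and G: "cont G"
    and lim: "\<And>x. x \<in> {t..T} \<Longrightarrow> (\<lambda>q. F q x) \<longlonglongrightarrow> G x"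
  shows "\<exists>a b. a \<longlonglongrightarrow> 0 \<and> b \<longlonglongrightarrow> 0 \<and> (\<forall>q n.
    (\<Sum>j\<le>n. (D1 (\<lambda>x. F q x * \<phi> j x) T)\<^sup>2) - 2 * (\<Sum>j\<le>n. D1 (\<lambda>x. F q x * \<phi> j x) T * D1 (\<lambda>x. G x * \<phi> j x) T)
      + D1 (\<lambda>x. (G x)\<^sup>2) T \<le> a q + b n)"
proof -
  have T: "T \<in> {t..T}" using tT by simp
  define \<alpha> where "\<alpha> q j = D1 (\<lambda>x. F q x * \<phi> j x) T" for q j
  define \<beta> where "\<beta> j = D1 (\<lambda>x. G x * \<phi> j x) T" for j
  define a where "a q = D1 (\<lambda>x. (F q x - G x)\<^sup>2) T" for q
  define b where "b n = D1 (\<lambda>x. (G x)\<^sup>2) T - (\<Sum>j\<le>n. (\<beta> j)\<^sup>2)" for n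
  obtain K where K: "\<forall>x\<in>{t..T}. \<bar>G x\<bar> \<le> K" using cont_bounded[OF G] by blast
  have "a \<longlonglongrightarrow> D1 (\<lambda>x. 0) T"
    unfolding a_def
  proof (rule D1_tendsto[OF _ _ _ T])
    show "cont (\<lambda>x. (F q x - G x)\<^sup>2)" for q using F G by (intro continuous_intros)
    fix x assume x: "x \<in> {t..T}"
    show "\<bar>(F q x - G x)\<^sup>2\<bar> \<le> (B + K)\<^sup>2" for q
    proof -
      have "\<bar>F q x - G x\<bar> \<le> B + K" using F(2)[OF x, of q] K x by fastforce
      thus ?thesis using power_mono[of "\<bar>F q x - G x\<bar>" "B + K" 2] by simp
    qed
    have "(\<lambda>q. (F q x - G x)\<^sup>2) \<longlonglongrightarrow> (G x - G x)\<^sup>2" by (intro tendsto_intros lim x)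
    thus "(\<lambda>q. (F q x - G x)\<^sup>2) \<longlonglongrightarrow> 0" by simp
  qed
  hence "a \<longlonglongrightarrow> 0" by (simp add: D1_def)
  moreover have "b \<longlonglongrightarrow> 0"
    unfolding b_def \<beta>_def using tendsto_diff[OF tendsto_const parseval[OF G T], of "D1 (\<lambda>x. (G x)\<^sup>2) T"] by simp
  moreover have "(\<Sum>j\<le>n. (\<alpha> q j)\<^sup>2) - 2 * (\<Sum>j\<le>n. \<alpha> q j * \<beta> j) + D1 (\<lambda>x. (G x)\<^sup>2) T \<le> a q + b n" for q n
  proof -
    have "\<alpha> q j - \<beta> j = D1 (\<lambda>x. (F q x - G x) * \<phi> j x) T" for j
      unfolding \<alpha>_def \<beta>_def left_diff_distrib using F G
      by (subst D1_diff) (auto intro!: continuous_intros)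
    hence "(\<Sum>j\<le>n. (\<alpha> q j - \<beta> j)\<^sup>2) \<le> a q"
      unfolding a_def using bessel[OF _ T, of "\<lambda>x. F q x - G x" n] F G by (simp add: continuous_on_diff)
    thus ?thesis unfolding b_def by (simp add: power2_diff sum.distrib sum_subtractf sum_distrib_left mult.assoc)
  qed
  ultimately show ?thesis unfolding \<alpha>_def \<beta>_def by blast
qed

lemma D2_same: "cont k \<Longrightarrow> s \<in> {t..T} \<Longrightarrow> D2 k k s = (D1 k s)\<^sup>2 / 2"
  using D1_by_parts[of k k s] by (simp add: D2_def power2_eq_square)

text \<open>Fubini with the variable of p made outermost. If both k lie later than p, the remaining
  simplex over [s, T] is half a square; if p lies between them, the remaining domain is the product
  of [t, s] and [s, T].\<close>

lemma D3_outer_same: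
  assumes "cont p" "cont k"
  shows "D3 p k k T = D1 (\<lambda>s. p s * ((D1 k T - D1 k s)\<^sup>2 / 2)) T"
    and "D3 k p k T = D1 (\<lambda>s. p s * (D1 k s * (D1 k T - D1 k s))) T"
proof -
  have T: "T \<in> {t..T}" using tT by simp
  have *: "D3 q r k T = D1 (\<lambda>s. (D1 k T - D1 k s) * (r s * D1 q s)) T" if q: "cont q" "cont r" for q r
  proof -
    have "D1 k T * D2 q r T = D1 (\<lambda>u. r u * D1 q u * D1 k u) T + D3 q r k T"
      unfolding D2_def D3_def using assms q by (intro D1_by_parts[OF _ _ T]) (auto intro!: continuous_intros)
    hence "D3 q r k T = D1 (\<lambda>u. D1 k T * (r u * D1 q u)) T - D1 (\<lambda>u. r u * D1 q u * D1 k u) T"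
      by (simp add: D2_def D1_cmult)
    also have "\<dots> = D1 (\<lambda>u. D1 k T * (r u * D1 q u) - r u * D1 q u * D1 k u) T"
      using assms q by (intro D1_diff[symmetric]) (auto intro!: continuous_intros)
    finally show ?thesis by (simp add: algebra_simps)
  qed
  show "D3 k p k T = D1 (\<lambda>s. p s * (D1 k s * (D1 k T - D1 k s))) T"
    unfolding *[OF assms(2,1)] by (simp add: mult_ac)
  \<comment> \<open>The antiderivative is minus half the squared tail of k times
    \<open>D1 p\<close>. It vanishes at T because of the tail and at t because of
    \<open>D1 p\<close>.\<close>
  have "D1 (\<lambda>s. (D1 k T - D1 k s) * (k s * D1 p s) - p s * ((D1 k T - D1 k s)\<^sup>2 / 2)) T =
      - ((D1 k T - D1 k T)\<^sup>2 / 2 * D1 p T) - - ((D1 k T - D1 k t)\<^sup>2 / 2 * D1 p t)"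
    by (rule D1_FTC[OF _ T])
       (auto intro!: derivative_eq_intros D1_deriv assms simp: field_simps power2_eq_square)
  also have "D1 (\<lambda>s. (D1 k T - D1 k s) * (k s * D1 p s) - p s * ((D1 k T - D1 k s)\<^sup>2 / 2)) T =
     D1 (\<lambda>s. (D1 k T - D1 k s) * (k s * D1 p s)) T - D1 (\<lambda>s. p s * ((D1 k T - D1 k s)\<^sup>2 / 2)) T"
    using assms by (intro D1_diff) (auto intro!: continuous_intros)
  finally show "D3 p k k T = D1 (\<lambda>s. p s * ((D1 k T - D1 k s)\<^sup>2 / 2)) T"
    unfolding *[OF assms] by simp
qed

text \<open>The inner double integral with twice the same function is half a square. The partial
  trace is therefore the j-th coefficient of h times half a Bessel sum over [t, x], which converges
  boundedly to half the integral of f^2.\<close>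

lemma trace12:
  assumes f: "cont f" "cont h"
  shows "\<exists>a b. a \<longlonglongrightarrow> 0 \<and> b \<longlonglongrightarrow> 0 \<and> (\<forall>q n.
    (\<Sum>j\<le>n. (\<Sum>i\<le>q. C3 f f h i i j)\<^sup>2) - 2 * (\<Sum>j\<le>n. (\<Sum>i\<le>q. C3 f f h i i j) * D1 (\<lambda>x. h x * (D1 (\<lambda>y. f y * f y) x / 2) * \<phi> j x) T)
      + D1 (\<lambda>x. (h x * (D1 (\<lambda>y. f y * f y) x / 2))\<^sup>2) T \<le> a q + b n)"
proof -
  define F where "F q x = h x * (\<Sum>i\<le>q. (D1 (\<lambda>s. f s * \<phi> i s) x)\<^sup>2) / 2" for q x
  have Fc: "cont (F q)" for q unfolding F_def using f by (intro continuous_intros) auto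
  have eq: "(\<Sum>i\<le>q. C3 f f h i i j) = D1 (\<lambda>x. F q x * \<phi> j x) T" for q j
  proof -
    have "(\<Sum>i\<le>q. C3 f f h i i j) = (\<Sum>i\<le>q. D1 (\<lambda>x. h x * (D1 (\<lambda>s. f s * \<phi> i s) x)\<^sup>2 / 2 * \<phi> j x) T)"
      unfolding C3_def D3_def using f by (intro sum.cong refl D1_cong) (auto simp: D2_same continuous_intros)
    also have "\<dots> = D1 (\<lambda>x. \<Sum>i\<le>q. h x * (D1 (\<lambda>s. f s * \<phi> i s) x)\<^sup>2 / 2 * \<phi> j x) T"
      using f by (intro D1_sum[symmetric]) (auto intro!: continuous_intros)
    finally show ?thesis by (simp add: F_def sum_distrib_left sum_distrib_right sum_divide_distrib)
  qed
  have c2: "cont (\<lambda>x. h x * (D1 (\<lambda>y. f y * f y) x / 2))" using f by (intro continuous_intros) auto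
  obtain B where B: "\<forall>x\<in>{t..T}. \<bar>h x * (D1 (\<lambda>y. f y * f y) x / 2)\<bar> \<le> B" using cont_bounded[OF c2] by blast
  show ?thesis unfolding eq
  proof (rule D1_phi_approx[OF Fc _ c2])
    fix x assume x: "x \<in> {t..T}"
    show "\<bar>F q x\<bar> \<le> B" for q
    proof -
      have "\<bar>F q x\<bar> = \<bar>h x\<bar> * ((\<Sum>i\<le>q. (D1 (\<lambda>s. f s * \<phi> i s) x)\<^sup>2) / 2)"
        by (simp add: F_def abs_mult sum_nonneg)
      also have "\<dots> \<le> \<bar>h x\<bar> * (D1 (\<lambda>y. f y * f y) x / 2)"
        using bessel[OF f(1) x, of q] by (intro mult_left_mono divide_right_mono) (auto simp: power2_eq_square)
      also have "\<dots> \<le> \<bar>h x * (D1 (\<lambda>y. f y * f y) x / 2)\<bar>" unfolding abs_mult by (intro mult_left_mono abs_ge_self) auto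
      also have "\<dots> \<le> B" using B x by blast
      finally show ?thesis .
    qed
    have "(\<lambda>q. h x * (\<Sum>i\<le>q. (D1 (\<lambda>s. f s * \<phi> i s) x)\<^sup>2) / 2) \<longlonglongrightarrow> h x * D1 (\<lambda>y. (f y)\<^sup>2) x / 2"
      by (intro tendsto_intros parseval f x) auto
    thus "(\<lambda>q. F q x) \<longlonglongrightarrow> h x * (D1 (\<lambda>y. f y * f y) x / 2)" by (simp add: F_def power2_eq_square)
  qed
qed

text \<open>Mirror image of \<open>trace12\<close>: the two outer variables are integrated over the
  tail [x, T], so Bessel and Parseval are used on that interval.\<close>

lemma trace23:
  assumes f: "cont f" "cont g"
  shows "\<exists>a b. a \<longlonglongrightarrow> 0 \<and> b \<longlonglongrightarrow> 0 \<and> (\<forall>q n.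
    (\<Sum>j\<le>n. (\<Sum>i\<le>q. C3 f g g j i i)\<^sup>2)
     - 2 * (\<Sum>j\<le>n. (\<Sum>i\<le>q. C3 f g g j i i) * D1 (\<lambda>x. f x * ((D1 (\<lambda>y. g y * g y) T - D1 (\<lambda>y. g y * g y) x) / 2) * \<phi> j x) T)
      + D1 (\<lambda>x. (f x * ((D1 (\<lambda>y. g y * g y) T - D1 (\<lambda>y. g y * g y) x) / 2))\<^sup>2) T \<le> a q + b n)"
proof -
  let ?k = "\<lambda>i x. D1 (\<lambda>s. g s * \<phi> i s) T - D1 (\<lambda>s. g s * \<phi> i s) x"
  let ?N = "\<lambda>x. D1 (\<lambda>y. g y * g y) T - D1 (\<lambda>y. g y * g y) x"
  define F where "F q x = f x * (\<Sum>i\<le>q. (?k i x)\<^sup>2) / 2" for q x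
  have Fc: "cont (F q)" for q unfolding F_def using f by (intro continuous_intros) auto
  have eq: "(\<Sum>i\<le>q. C3 f g g j i i) = D1 (\<lambda>x. F q x * \<phi> j x) T" for q j
  proof -
    have "(\<Sum>i\<le>q. C3 f g g j i i) = (\<Sum>i\<le>q. D1 (\<lambda>x. f x * \<phi> j x * ((?k i x)\<^sup>2 / 2)) T)"
      unfolding C3_def using f by (intro sum.cong refl D3_outer_same(1)) (auto intro!: continuous_intros)
    also have "\<dots> = D1 (\<lambda>x. \<Sum>i\<le>q. f x * \<phi> j x * ((?k i x)\<^sup>2 / 2)) T"
      using f by (intro D1_sum[symmetric]) (auto intro!: continuous_intros)
    finally show ?thesis by (simp add: F_def sum_distrib_left sum_distrib_right sum_divide_distrib mult_ac)
  qed
  have c2: "cont (\<lambda>x. f x * (?N x / 2))" using f by (intro continuous_intros) auto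
  obtain B where B: "\<forall>x\<in>{t..T}. \<bar>f x * (?N x / 2)\<bar> \<le> B" using cont_bounded[OF c2] by blast
  show ?thesis unfolding eq
  proof (rule D1_phi_approx[OF Fc _ c2])
    fix x assume x: "x \<in> {t..T}"
    show "\<bar>F q x\<bar> \<le> B" for q
    proof -
      have "\<bar>F q x\<bar> = \<bar>f x\<bar> * ((\<Sum>i\<le>q. (?k i x)\<^sup>2) / 2)"
        by (simp add: F_def abs_mult sum_nonneg)
      also have "\<dots> \<le> \<bar>f x\<bar> * (?N x / 2)"
        using bessel_tail[OF f(2) x, of q] by (intro mult_left_mono divide_right_mono) (auto simp: power2_eq_square)
      also have "\<dots> \<le> \<bar>f x * (?N x / 2)\<bar>" unfolding abs_mult by (intro mult_left_mono abs_ge_self) auto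
      also have "\<dots> \<le> B" using B x by blast
      finally show ?thesis .
    qed
    have "(\<lambda>q. f x * (\<Sum>i\<le>q. (?k i x)\<^sup>2) / 2) \<longlonglongrightarrow> f x * (D1 (\<lambda>y. (g y)\<^sup>2) T - D1 (\<lambda>y. (g y)\<^sup>2) x) / 2"
      by (intro tendsto_intros parseval_tail f x) auto
    thus "(\<lambda>q. F q x) \<longlonglongrightarrow> f x * (?N x / 2)" by (simp add: F_def power2_eq_square)
  qed
qed

text \<open>Here the limit function is 0, so in \<open>D1_phi_approx\<close> only the squares
  remain. The summands are products of a left and a tail coefficient, hence not of one sign, and
  have to be rewritten through squares before Bessel can dominate them.\<close>

lemma trace13:
  assumes f: "cont f" "cont g"
  shows "\<exists>a b. a \<longlonglongrightarrow> 0 \<and> b \<longlonglongrightarrow> 0 \<and> (\<forall>q n. (\<Sum>j\<le>n. (\<Sum>i\<le>q. C3 f g f i j i)\<^sup>2) \<le> a q + b n)"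
proof -
  have T: "T \<in> {t..T}" using tT by simp
  let ?k = "\<lambda>i. D1 (\<lambda>s. f s * \<phi> i s)"
  define F where "F q x = g x * (\<Sum>i\<le>q. ?k i x * (?k i T - ?k i x))" for q x
  have Fc: "cont (F q)" for q unfolding F_def using f by (intro continuous_intros)
  have eq: "(\<Sum>i\<le>q. C3 f g f i j i) = D1 (\<lambda>x. F q x * \<phi> j x) T" for q j
  proof -
    have "(\<Sum>i\<le>q. C3 f g f i j i) = (\<Sum>i\<le>q. D1 (\<lambda>x. g x * \<phi> j x * (?k i x * (?k i T - ?k i x))) T)"
      unfolding C3_def using f by (intro sum.cong refl D3_outer_same(2)) (auto intro!: continuous_intros)
    also have "\<dots> = D1 (\<lambda>x. \<Sum>i\<le>q. g x * \<phi> j x * (?k i x * (?k i T - ?k i x))) T"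
      using f by (intro D1_sum[symmetric]) (auto intro!: continuous_intros)
    finally show ?thesis by (simp add: F_def sum_distrib_left sum_distrib_right mult_ac)
  qed
  let ?N = "D1 (\<lambda>y. (f y)\<^sup>2)"
  \<comment> \<open>Polarisation u v = ((u + v)^2 - u^2 - v^2)/2 with u the part over [t, x] and v
    the tail. By Parseval the three sums tend to integrals over [t, T], [t, x] and [x, T], which
    cancel.\<close>
  have pol: "(\<Sum>i\<le>q. ?k i x * (?k i T - ?k i x)) = ((\<Sum>i\<le>q. (?k i T)\<^sup>2) - (\<Sum>i\<le>q. (?k i x)\<^sup>2) - (\<Sum>i\<le>q. (?k i T - ?k i x)\<^sup>2)) / 2" for q x
    unfolding sum_subtractf[symmetric] sum_divide_distrib
    by (intro sum.cong refl) (simp add: power2_eq_square algebra_simps)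
  obtain K where K: "\<forall>x\<in>{t..T}. \<bar>g x\<bar> \<le> K" "K \<ge> 0" using cont_bounded[OF f(2)] by blast
  have "\<exists>a b. a \<longlonglongrightarrow> 0 \<and> b \<longlonglongrightarrow> 0 \<and> (\<forall>q n.
    (\<Sum>j\<le>n. (D1 (\<lambda>x. F q x * \<phi> j x) T)\<^sup>2) - 2 * (\<Sum>j\<le>n. D1 (\<lambda>x. F q x * \<phi> j x) T * D1 (\<lambda>x. 0 * \<phi> j x) T)
      + D1 (\<lambda>x. (0::real)\<^sup>2) T \<le> a q + b n)"
  proof (rule D1_phi_approx[OF Fc])
    fix x assume x: "x \<in> {t..T}"
    have N0: "0 \<le> ?N x" "?N x \<le> ?N T"
    proof -
      show "0 \<le> ?N x" using x f by (intro D1_nonneg continuous_intros) auto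
      have "0 \<le> (\<Sum>j\<le>0. (?k j T - ?k j x)\<^sup>2)" by (intro sum_nonneg) auto
      thus "?N x \<le> ?N T" using bessel_tail[OF f(1) x, of 0] by linarith
    qed
    show "\<bar>F q x\<bar> \<le> K * ?N T" for q
    proof -
      have "0 \<le> (\<Sum>i\<le>q. (?k i T)\<^sup>2)" "0 \<le> (\<Sum>i\<le>q. (?k i x)\<^sup>2)" "0 \<le> (\<Sum>i\<le>q. (?k i T - ?k i x)\<^sup>2)"
        by (intro sum_nonneg; simp)+
      hence "\<bar>\<Sum>i\<le>q. ?k i x * (?k i T - ?k i x)\<bar> \<le> ?N T"
        unfolding pol using bessel[OF f(1) x, of q] bessel[OF f(1) T, of q] bessel_tail[OF f(1) x, of q] N0
        by (simp add: abs_le_iff)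
      thus ?thesis unfolding F_def abs_mult using K x by (intro mult_mono) auto
    qed
    have "(\<lambda>q. g x * (((\<Sum>i\<le>q. (?k i T)\<^sup>2) - (\<Sum>i\<le>q. (?k i x)\<^sup>2) - (\<Sum>i\<le>q. (?k i T - ?k i x)\<^sup>2)) / 2))
        \<longlonglongrightarrow> g x * ((?N T - ?N x - (?N T - ?N x)) / 2)"
      by (intro tendsto_intros parseval parseval_tail f x T) auto
    thus "(\<lambda>q. F q x) \<longlonglongrightarrow> 0" unfolding F_def pol by simp
  qed simp
  thus ?thesis unfolding eq by (simp add: D1_def)
qed

end

section \<open>Moment bounds\<close>

lemma power4_add_le: "(x + y) ^ 4 \<le> 8 * (x ^ 4 + y ^ 4)" for x y :: real
proof -
  have a: "(u + v)\<^sup>2 \<le> 2 * (u\<^sup>2 + v\<^sup>2)" for u v :: real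
    using zero_le_square[of "u - v"] by (simp add: power2_eq_square algebra_simps)
  have "(x + y) ^ 4 = ((x + y)\<^sup>2)\<^sup>2" by simp
  also have "\<dots> \<le> (2 * (x\<^sup>2 + y\<^sup>2))\<^sup>2" by (intro power_mono a) auto
  also have "\<dots> = 4 * (x\<^sup>2 + y\<^sup>2)\<^sup>2" by (simp only: power_mult_distrib) simp
  also have "\<dots> \<le> 4 * (2 * ((x\<^sup>2)\<^sup>2 + (y\<^sup>2)\<^sup>2))" by (intro mult_left_mono a) auto
  also have "\<dots> = 8 * (x ^ 4 + y ^ 4)" by simp
  finally show ?thesis .
qed

lemma power2_add_le: "(x + y)\<^sup>2 \<le> 2 * (x\<^sup>2 + y\<^sup>2)" for x y :: real
  using zero_le_square[of "x - y"] by (simp add: power2_eq_square algebra_simps)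

lemma abs_mult_le_weighted: "l > 0 \<Longrightarrow> \<bar>x * y\<bar> \<le> (l * x\<^sup>2 + y\<^sup>2 / l) / 2" for x y l :: real
proof -
  assume l: "l > 0"
  have "0 \<le> (l * \<bar>x\<bar> - \<bar>y\<bar>)\<^sup>2 / l" using l by simp
  also have "\<dots> = l * x\<^sup>2 - 2 * \<bar>x * y\<bar> + y\<^sup>2 / l"
    using l by (simp add: power2_diff power_mult_distrib abs_mult field_simps power2_eq_square)
  finally show ?thesis by simp
qed

lemma weighted_Cauchy_Schwarz_sum:
  fixes d x :: "'i \<Rightarrow> real"
  assumes "\<And>k. k \<in> A \<Longrightarrow> d k \<ge> 0"
  shows "(\<Sum>k\<in>A. d k * x k)\<^sup>2 \<le> (\<Sum>k\<in>A. d k) * (\<Sum>k\<in>A. d k * (x k)\<^sup>2)"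
proof -
  have "(\<Sum>k\<in>A. d k * x k) = (\<Sum>k\<in>A. sqrt (d k) * (sqrt (d k) * x k))"
    using assms by (intro sum.cong) (auto simp flip: mult.assoc)
  also have "(\<dots>)\<^sup>2 \<le> (\<Sum>k\<in>A. (sqrt (d k))\<^sup>2) * (\<Sum>k\<in>A. (sqrt (d k) * x k)\<^sup>2)"
    by (rule Cauchy_Schwarz_ineq_sum)
  also have "\<dots> = (\<Sum>k\<in>A. d k) * (\<Sum>k\<in>A. d k * (x k)\<^sup>2)"
    using assms by (simp add: power_mult_distrib)
  finally show ?thesis .
qed

context prob_space
begin

text \<open>Integrability is bundled with the bound, so that a moment is never the junk value 0.\<close>
definition mom :: "nat \<Rightarrow> ('a \<Rightarrow> real) \<Rightarrow> real \<Rightarrow> bool" where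
  "mom p X c \<longleftrightarrow> X \<in> borel_measurable M \<and> integrable M (\<lambda>\<omega>. X \<omega> ^ p) \<and> expectation (\<lambda>\<omega>. X \<omega> ^ p) \<le> c"

lemma momD [dest]:
  assumes "mom p X c"
  shows "X \<in> borel_measurable M" "integrable M (\<lambda>\<omega>. X \<omega> ^ p)" "expectation (\<lambda>\<omega>. X \<omega> ^ p) \<le> c"
  using assms by (auto simp: mom_def)

lemma mom_mono: "mom p X c \<Longrightarrow> c \<le> d \<Longrightarrow> mom p X d"
  by (auto simp: mom_def)

lemma mom_nonneg: "mom p X c \<Longrightarrow> even p \<Longrightarrow> c \<ge> 0"
  using momD(3)[of p X c] Bochner_Integration.integral_nonneg[of M "\<lambda>\<omega>. X \<omega> ^ p"] zero_le_even_power[of p]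
  by (metis (no_types, lifting) order.trans)

lemma mom_AE_cong:
  assumes "mom p X c" "AE \<omega> in M. X \<omega> = Y \<omega>" "Y \<in> borel_measurable M"
  shows "mom p Y c"
proof -
  have [measurable]: "X \<in> borel_measurable M" "Y \<in> borel_measurable M" using assms by auto
  have ae: "AE \<omega> in M. X \<omega> ^ p = Y \<omega> ^ p" using assms(2) by auto
  have "integrable M (\<lambda>\<omega>. Y \<omega> ^ p)"
    by (rule integrable_cong_AE_imp[OF momD(2)[OF assms(1)]]) (use ae in \<open>auto simp: eq_commute\<close>)
  moreover have "expectation (\<lambda>\<omega>. X \<omega> ^ p) = expectation (\<lambda>\<omega>. Y \<omega> ^ p)"
    by (rule integral_cong_AE) (use ae in simp_all)
  ultimately show ?thesis using assms by (auto simp: mom_def)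
qed

lemma mom_dominated:
  assumes "integrable M g" "X \<in> borel_measurable M" "\<And>\<omega>. \<omega> \<in> space M \<Longrightarrow> X \<omega> ^ p \<le> g \<omega>"
    "expectation g \<le> c" "even p"
  shows "mom p X c"
proof -
  have [measurable]: "X \<in> borel_measurable M" by fact
  have nn: "X \<omega> ^ p \<ge> 0" for \<omega> using assms(5) by (simp add: zero_le_even_power)
  have i: "integrable M (\<lambda>\<omega>. X \<omega> ^ p)"
    by (rule Bochner_Integration.integrable_bound[OF assms(1)])
       (use assms(3) nn in \<open>auto intro!: AE_I2 order.trans[OF _ abs_ge_self] simp: abs_of_nonneg\<close>)
  have "expectation (\<lambda>\<omega>. X \<omega> ^ p) \<le> expectation g"
    by (intro integral_mono i assms) auto
  thus ?thesis using assms i by (auto simp: mom_def)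
qed

lemma mom_0: "p > 0 \<Longrightarrow> mom p (\<lambda>_. 0) 0"
  by (simp add: mom_def power_0_left)

lemma mom_const: "mom p (\<lambda>_. a) (a ^ p)"
  by (simp add: mom_def prob_space)

lemma mom_cmult: "mom p X c \<Longrightarrow> even p \<Longrightarrow> mom p (\<lambda>\<omega>. a * X \<omega>) (a ^ p * c)"
  by (auto simp: mom_def power_mult_distrib intro!: mult_left_mono)

lemma mom_minus: "mom p (\<lambda>\<omega>. X \<omega> - Y \<omega>) c \<Longrightarrow> even p \<Longrightarrow> mom p (\<lambda>\<omega>. Y \<omega> - X \<omega>) c"
  using mom_cmult[of p "\<lambda>\<omega>. X \<omega> - Y \<omega>" c "-1"] by simp

lemma mom4_add:
  assumes "mom 4 X a" "mom 4 Y b"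
  shows "mom 4 (\<lambda>\<omega>. X \<omega> + Y \<omega>) (8 * (a + b))"
proof (rule mom_dominated)
  show "integrable M (\<lambda>\<omega>. 8 * (X \<omega> ^ 4 + Y \<omega> ^ 4))"
    using momD(2)[OF assms(1)] momD(2)[OF assms(2)] by (intro integrable_mult_right Bochner_Integration.integrable_add)
  show "(\<lambda>\<omega>. X \<omega> + Y \<omega>) \<in> borel_measurable M" using momD(1)[OF assms(1)] momD(1)[OF assms(2)] by measurable
  show "expectation (\<lambda>\<omega>. 8 * (X \<omega> ^ 4 + Y \<omega> ^ 4)) \<le> 8 * (a + b)"
    using momD[OF assms(1)] momD[OF assms(2)] by simp
qed (use power4_add_le in simp_all)

lemma mom2_add:
  assumes "mom 2 X a" "mom 2 Y b"
  shows "mom 2 (\<lambda>\<omega>. X \<omega> + Y \<omega>) (2 * (a + b))"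
proof (rule mom_dominated)
  show "integrable M (\<lambda>\<omega>. 2 * ((X \<omega>)\<^sup>2 + (Y \<omega>)\<^sup>2))"
    using momD(2)[OF assms(1)] momD(2)[OF assms(2)] by (intro integrable_mult_right Bochner_Integration.integrable_add)
  show "(\<lambda>\<omega>. X \<omega> + Y \<omega>) \<in> borel_measurable M" using momD(1)[OF assms(1)] momD(1)[OF assms(2)] by measurable
  show "expectation (\<lambda>\<omega>. 2 * ((X \<omega>)\<^sup>2 + (Y \<omega>)\<^sup>2)) \<le> 2 * (a + b)"
    using momD[OF assms(1)] momD[OF assms(2)] by simp
qed (use power2_add_le in simp_all)

lemma mom4_diff: "mom 4 X a \<Longrightarrow> mom 4 Y b \<Longrightarrow> mom 4 (\<lambda>\<omega>. X \<omega> - Y \<omega>) (8 * (a + b))"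
  using mom4_add[of X a "\<lambda>\<omega>. (-1) * Y \<omega>" b] mom_cmult[of 4 Y b "-1"] by simp

lemma mom2_diff: "mom 2 X a \<Longrightarrow> mom 2 Y b \<Longrightarrow> mom 2 (\<lambda>\<omega>. X \<omega> - Y \<omega>) (2 * (a + b))"
  using mom2_add[of X a "\<lambda>\<omega>. (-1) * Y \<omega>" b] mom_cmult[of 2 Y b "-1"] by simp

lemma mom_limit_bound:
  assumes "\<And>n. mom p X (c n)" "c \<longlonglongrightarrow> d"
  shows "mom p X d"
proof -
  have "expectation (\<lambda>\<omega>. X \<omega> ^ p) \<le> d"
    by (rule LIMSEQ_le_const[OF assms(2)]) (use momD(3)[OF assms(1)] in blast)
  thus ?thesis using assms(1)[of 0] by (simp add: mom_def)
qed

text \<open>Cauchy-Schwarz for the squares, from Young's inequality with the optimal weight l = b/a.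
  Adding 1/(n+1) to a and b keeps the weight defined and positive when one of them is 0; the limit
  removes it.\<close>

lemma mom4_mult:
  assumes "mom 4 X (a\<^sup>2)" "mom 4 Y (b\<^sup>2)" "a \<ge> 0" "b \<ge> 0"
  shows "mom 2 (\<lambda>\<omega>. X \<omega> * Y \<omega>) (a * b)"
proof (rule mom_limit_bound)
  fix n :: nat
  define e where "e = 1 / real (Suc n)"
  define l where "l = (b + e) / (a + e)"
  have e: "e > 0" by (simp add: e_def)
  have l: "l > 0" using assms e by (auto simp: l_def intro!: divide_pos_pos add_nonneg_pos)
  show "mom 2 (\<lambda>\<omega>. X \<omega> * Y \<omega>) ((a + 1 / real (Suc n)) * (b + 1 / real (Suc n)))"
    unfolding e_def[symmetric]
  proof (rule mom_dominated)
    show "integrable M (\<lambda>\<omega>. (l * X \<omega> ^ 4 + Y \<omega> ^ 4 / l) / 2)"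
      using momD(2)[OF assms(1)] momD(2)[OF assms(2)] by simp
    show "(\<lambda>\<omega>. X \<omega> * Y \<omega>) \<in> borel_measurable M" using momD(1)[OF assms(1)] momD(1)[OF assms(2)] by measurable
    fix \<omega>
    have "(X \<omega> * Y \<omega>)\<^sup>2 = \<bar>(X \<omega>)\<^sup>2 * (Y \<omega>)\<^sup>2\<bar>" by (simp add: power_mult_distrib)
    also have "\<dots> \<le> (l * ((X \<omega>)\<^sup>2)\<^sup>2 + ((Y \<omega>)\<^sup>2)\<^sup>2 / l) / 2" by (rule abs_mult_le_weighted[OF l])
    finally show "(X \<omega> * Y \<omega>)\<^sup>2 \<le> (l * X \<omega> ^ 4 + Y \<omega> ^ 4 / l) / 2" by simp
  next
    have "expectation (\<lambda>\<omega>. X \<omega> ^ 4) \<le> (a + e)\<^sup>2" "expectation (\<lambda>\<omega>. Y \<omega> ^ 4) \<le> (b + e)\<^sup>2"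
      using assms(3,4) e
      by (auto intro!: order.trans[OF momD(3)[OF assms(1)]] order.trans[OF momD(3)[OF assms(2)]] power_mono)
    hence "(l * expectation (\<lambda>\<omega>. X \<omega> ^ 4) + expectation (\<lambda>\<omega>. Y \<omega> ^ 4) / l) / 2 \<le> (l * (a + e)\<^sup>2 + (b + e)\<^sup>2 / l) / 2"
      using l by (intro divide_right_mono add_mono mult_left_mono) auto
    also have "\<dots> = (a + e) * (b + e)"
    proof -
      have "a + e > 0" "b + e > 0" using e assms by auto
      moreover have "(v / u * u\<^sup>2 + v\<^sup>2 / (v / u)) / 2 = u * v" if "u > 0" "v > 0" for u v :: real
        using that by (simp add: power2_eq_square)
      ultimately show ?thesis unfolding l_def by blast
    qed
    finally show "expectation (\<lambda>\<omega>. (l * X \<omega> ^ 4 + Y \<omega> ^ 4 / l) / 2) \<le> (a + e) * (b + e)"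
      using momD(2)[OF assms(1)] momD(2)[OF assms(2)] by (simp add: add_divide_distrib)
  qed auto
next
  have "(\<lambda>n. (a + 1 / real (Suc n)) * (b + 1 / real (Suc n))) \<longlonglongrightarrow> (a + 0) * (b + 0)"
    by (intro tendsto_intros LIMSEQ_Suc[OF lim_1_over_n])
  thus "(\<lambda>n. (a + 1 / real (Suc n)) * (b + 1 / real (Suc n))) \<longlonglongrightarrow> a * b" by simp
qed

lemma mom4_imp_mom2: "mom 4 X (a\<^sup>2) \<Longrightarrow> a \<ge> 0 \<Longrightarrow> mom 2 X a"
  using mom4_mult[of X a "\<lambda>_. 1" 1] mom_const[of 4 1] by simp

lemma mom4_imp_mom2_sqrt: "mom 4 X c \<Longrightarrow> mom 2 X (sqrt c)"
  using mom4_imp_mom2[of X "sqrt c"] mom_nonneg[of 4 X c] by simp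

lemma mom2_integrable_mult:
  assumes "mom 2 X a" "mom 2 Y b"
  shows "integrable M (\<lambda>\<omega>. X \<omega> * Y \<omega>)"
proof (rule Bochner_Integration.integrable_bound)
  show "integrable M (\<lambda>\<omega>. ((X \<omega>)\<^sup>2 + (Y \<omega>)\<^sup>2) / 2)"
    using momD(2)[OF assms(1)] momD(2)[OF assms(2)] by simp
  show "(\<lambda>\<omega>. X \<omega> * Y \<omega>) \<in> borel_measurable M" using momD(1)[OF assms(1)] momD(1)[OF assms(2)] by measurable
  show "AE \<omega> in M. norm (X \<omega> * Y \<omega>) \<le> norm (((X \<omega>)\<^sup>2 + (Y \<omega>)\<^sup>2) / 2)"
    using abs_mult_le_weighted[of 1] by (intro AE_I2) auto
qed

lemma mom2_integrable: "mom 2 X a \<Longrightarrow> integrable M X"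
  using mom2_integrable_mult[of X a "\<lambda>_. 1" 1] mom_const[of 2 1] by simp

lemma mom2_expectation_abs_le:
  assumes "mom 2 X a" "mom 2 Y b" "l > 0"
  shows "\<bar>expectation (\<lambda>\<omega>. X \<omega> * Y \<omega>)\<bar> \<le> (l * a + b / l) / 2"
proof -
  note i = mom2_integrable_mult[OF assms(1,2)]
  have "\<bar>expectation (\<lambda>\<omega>. X \<omega> * Y \<omega>)\<bar> \<le> expectation (\<lambda>\<omega>. \<bar>X \<omega> * Y \<omega>\<bar>)"
    by (rule integral_abs_bound)
  also have "\<dots> \<le> expectation (\<lambda>\<omega>. (l * (X \<omega>)\<^sup>2 + (Y \<omega>)\<^sup>2 / l) / 2)"
    using momD(2)[OF assms(1)] momD(2)[OF assms(2)] abs_mult_le_weighted[OF assms(3)]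
    by (intro integral_mono integrable_abs i) simp_all
  also have "\<dots> = (l * expectation (\<lambda>\<omega>. (X \<omega>)\<^sup>2) + expectation (\<lambda>\<omega>. (Y \<omega>)\<^sup>2) / l) / 2"
    using momD(2)[OF assms(1)] momD(2)[OF assms(2)] by (simp add: add_divide_distrib)
  also have "\<dots> \<le> (l * a + b / l) / 2"
    using momD(3)[OF assms(1)] momD(3)[OF assms(2)] assms(3)
    by (intro divide_right_mono add_mono mult_left_mono) auto
  finally show ?thesis .
qed

lemma mom_zero_imp_AE:
  assumes "mom p X 0" "even p"
  shows "AE \<omega> in M. X \<omega> = 0"
proof -
  have "expectation (\<lambda>\<omega>. X \<omega> ^ p) = 0"
    using momD(3)[OF assms(1)] assms(2)
    by (intro antisym integral_nonneg) (simp_all add: zero_le_even_power)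
  moreover have "(expectation (\<lambda>\<omega>. X \<omega> ^ p) = 0) = (AE \<omega> in M. X \<omega> ^ p = 0)"
    using momD(2)[OF assms(1)] assms(2)
    by (intro integral_nonneg_eq_0_iff_AE) (auto simp: zero_le_even_power)
  ultimately have "AE \<omega> in M. X \<omega> ^ p = 0" by simp
  thus ?thesis by eventually_elim auto
qed

text \<open>Fatou's lemma, which yields integrability of the limit as well as the bound.\<close>

lemma mom_AE_limit:
  assumes "\<And>n. mom p (X n) (c n)" "AE \<omega> in M. (\<lambda>n. X n \<omega>) \<longlonglongrightarrow> Y \<omega>"
    "Y \<in> borel_measurable M" "c \<longlonglongrightarrow> d" "even p"
  shows "mom p Y d"
proof -
  have [measurable]: "\<And>n. X n \<in> borel_measurable M" "Y \<in> borel_measurable M" using assms by auto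
  have c0: "c n \<ge> 0" for n using mom_nonneg[OF assms(1)] assms by auto
  have d0: "d \<ge> 0" using LIMSEQ_le_const[OF assms(4)] c0 by auto
  have "(\<integral>\<^sup>+ \<omega>. ennreal (Y \<omega> ^ p) \<partial>M) = (\<integral>\<^sup>+ \<omega>. liminf (\<lambda>n. ennreal (X n \<omega> ^ p)) \<partial>M)"
  proof (rule nn_integral_cong_AE)
    show "AE \<omega> in M. ennreal (Y \<omega> ^ p) = liminf (\<lambda>n. ennreal (X n \<omega> ^ p))"
      using assms(2)
    proof eventually_elim
      case (elim \<omega>)
      hence "(\<lambda>n. ennreal (X n \<omega> ^ p)) \<longlonglongrightarrow> ennreal (Y \<omega> ^ p)"
        by (intro tendsto_ennrealI tendsto_power)
      from lim_imp_Liminf[OF _ this] show ?case by simp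
    qed
  qed
  also have "\<dots> \<le> liminf (\<lambda>n. \<integral>\<^sup>+ \<omega>. ennreal (X n \<omega> ^ p) \<partial>M)"
    by (rule nn_integral_liminf) measurable
  also have "\<dots> \<le> liminf (\<lambda>n. ennreal (c n))"
  proof (intro Liminf_mono always_eventually allI)
    fix n
    have "(\<integral>\<^sup>+ \<omega>. ennreal (X n \<omega> ^ p) \<partial>M) = ennreal (expectation (\<lambda>\<omega>. X n \<omega> ^ p))"
      using momD(2)[OF assms(1)] assms(5) by (intro nn_integral_eq_integral) (auto simp: zero_le_even_power)
    also have "\<dots> \<le> ennreal (c n)" using momD(3)[OF assms(1)] by (intro ennreal_leI)
    finally show "(\<integral>\<^sup>+ \<omega>. ennreal (X n \<omega> ^ p) \<partial>M) \<le> ennreal (c n)" .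
  qed
  also have "\<dots> = ennreal d"
    by (intro lim_imp_Liminf tendsto_ennrealI assms) simp
  finally have le: "(\<integral>\<^sup>+ \<omega>. ennreal (Y \<omega> ^ p) \<partial>M) \<le> ennreal d" .
  have i: "integrable M (\<lambda>\<omega>. Y \<omega> ^ p)"
  proof (rule integrableI_bounded)
    have "(\<integral>\<^sup>+ \<omega>. ennreal (norm (Y \<omega> ^ p)) \<partial>M) = (\<integral>\<^sup>+ \<omega>. ennreal (Y \<omega> ^ p) \<partial>M)"
      using assms(5) by (intro nn_integral_cong) (simp add: abs_of_nonneg zero_le_even_power)
    thus "(\<integral>\<^sup>+ \<omega>. ennreal (norm (Y \<omega> ^ p)) \<partial>M) < \<infinity>" using le by (auto simp: le_less_trans)
  qed measurable
  have "ennreal (expectation (\<lambda>\<omega>. Y \<omega> ^ p)) = (\<integral>\<^sup>+ \<omega>. ennreal (Y \<omega> ^ p) \<partial>M)"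
    using i assms(5) by (intro nn_integral_eq_integral[symmetric]) (auto simp: zero_le_even_power)
  with le have "ennreal (expectation (\<lambda>\<omega>. Y \<omega> ^ p)) \<le> ennreal d" by simp
  hence "expectation (\<lambda>\<omega>. Y \<omega> ^ p) \<le> d" using d0 by (subst (asm) ennreal_le_iff)
  thus ?thesis using i by (simp add: mom_def)
qed

text \<open>Fourth-mean Cauchy implies Cauchy in L1, which supplies an almost everywhere convergent
  subsequence. The limit is the pointwise \<open>lim\<close> of G-measurable functions and so is
  G-measurable itself; this is what makes the stochastic integral adapted.\<close>

lemma mom4_complete:
  assumes mom: "\<And>n k. n \<le> k \<Longrightarrow> mom 4 (\<lambda>\<omega>. X n \<omega> - X k \<omega>) (c n)"
    and c: "c \<longlonglongrightarrow> 0" and X: "\<And>n. mom 4 (X n) (b n)"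
    and G: "\<And>n. X n \<in> borel_measurable G" "space G = space M" "sets G \<subseteq> sets M"
  shows "\<exists>Y \<in> borel_measurable G. \<exists>r. strict_mono r \<and> (AE \<omega> in M. (\<lambda>n. X (r n) \<omega>) \<longlonglongrightarrow> Y \<omega>)"
proof -
  have [measurable]: "X n \<in> borel_measurable M" for n using X by auto
  have c0: "c n \<ge> 0" for n using mom_nonneg[OF mom[of n n]] by auto
  \<comment> \<open>From |x| \<le> e/2 + x^2/(2e). Both indices are compared with n, and 8 (c n + c
    n) = 16 c n bounds the fourth moment of their difference.\<close>
  have L1: "expectation (\<lambda>\<omega>. norm (X i \<omega> - X j \<omega>)) \<le> e / 2 + sqrt (16 * c n) / (2 * e)"
    if "n \<le> i" "n \<le> j" "e > 0" for i j n e
  proof -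
    have "mom 4 (\<lambda>\<omega>. X i \<omega> - X j \<omega>) (8 * (c n + c n))"
      using mom4_diff[OF mom[OF that(2)] mom[OF that(1)]] by simp
    hence m2: "mom 2 (\<lambda>\<omega>. X i \<omega> - X j \<omega>) (sqrt (16 * c n))"
      using mom4_imp_mom2_sqrt by fastforce
    have "expectation (\<lambda>\<omega>. norm (X i \<omega> - X j \<omega>)) \<le> expectation (\<lambda>\<omega>. e / 2 + (X i \<omega> - X j \<omega>)\<^sup>2 / (2 * e))"
    proof (intro integral_mono integrable_norm)
      show "integrable M (\<lambda>\<omega>. X i \<omega> - X j \<omega>)" using m2 by (rule mom2_integrable)
      show "integrable M (\<lambda>\<omega>. e / 2 + (X i \<omega> - X j \<omega>)\<^sup>2 / (2 * e))" using momD(2)[OF m2] by simp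
      fix \<omega> show "norm (X i \<omega> - X j \<omega>) \<le> e / 2 + (X i \<omega> - X j \<omega>)\<^sup>2 / (2 * e)"
        using abs_mult_le_weighted[OF that(3), of 1 "X i \<omega> - X j \<omega>"] by (simp add: field_simps)
    qed
    also have "\<dots> = e / 2 + expectation (\<lambda>\<omega>. (X i \<omega> - X j \<omega>)\<^sup>2) / (2 * e)"
      using momD(2)[OF m2] by (simp add: prob_space)
    also have "\<dots> \<le> e / 2 + sqrt (16 * c n) / (2 * e)"
      using momD(3)[OF m2] that(3) by (intro add_left_mono divide_right_mono) auto
    finally show ?thesis .
  qed
  have "\<exists>N. \<forall>i\<ge>N. \<forall>j\<ge>N. expectation (\<lambda>\<omega>. norm (X i \<omega> - X j \<omega>)) < e" if e: "e > 0" for e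
  proof -
    have "(\<lambda>n. sqrt (16 * c n)) \<longlonglongrightarrow> sqrt (16 * 0)" by (intro tendsto_intros c)
    hence "(\<lambda>n. sqrt (16 * c n)) \<longlonglongrightarrow> 0" by simp
    from order_tendstoD(2)[OF this, of "e\<^sup>2"] e
    obtain N where "sqrt (16 * c N) < e\<^sup>2" by (auto simp: eventually_sequentially)
    hence "e / 2 + sqrt (16 * c N) / (2 * e) < e" using e by (simp add: field_simps power2_eq_square)
    thus ?thesis using L1[OF _ _ e] by (intro exI[of _ N]) (auto intro: le_less_trans)
  qed
  then obtain r where r: "strict_mono r" "AE \<omega> in M. Cauchy (\<lambda>i. X (r i) \<omega>)"
    using cauchy_L1_AE_cauchy_subseq[of M X] mom2_integrable[OF mom4_imp_mom2_sqrt[OF X]] by blast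
  have "(\<lambda>\<omega>. lim (\<lambda>k. X (r k) \<omega>)) \<in> borel_measurable G"
    using G(1) by measurable
  moreover have "AE \<omega> in M. (\<lambda>n. X (r n) \<omega>) \<longlonglongrightarrow> lim (\<lambda>k. X (r k) \<omega>)"
    using r(2) by eventually_elim (auto simp: Cauchy_convergent_iff convergent_LIMSEQ_iff)
  ultimately show ?thesis using r(1) by (intro bexI exI conjI)
qed

end

section \<open>Increments of the Wiener process\<close>

locale wiener = prob_space M for M :: "'a measure" +
  fixes F :: "real \<Rightarrow> 'a measure" and T :: real and m :: nat and W :: "nat \<Rightarrow> real \<Rightarrow> 'a \<Rightarrow> real"
  assumes filtration: "rc_filtration M F T" and wiener: "std_wiener M F T m W"
begin

lemma subalgebra_F: "0 \<le> s \<Longrightarrow> s \<le> T \<Longrightarrow> subalgebra M (F s)"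
  using filtration by (auto simp: rc_filtration_def subalgebra_def)

lemma measurable_F: "X \<in> borel_measurable (F s) \<Longrightarrow> 0 \<le> s \<Longrightarrow> s \<le> T \<Longrightarrow> X \<in> borel_measurable M"
  using measurable_from_subalg subalgebra_F by blast

lemma measurable_F_mono:
  assumes "X \<in> borel_measurable (F s)" "0 \<le> s" "s \<le> u" "u \<le> T"
  shows "X \<in> borel_measurable (F u)"
proof -
  have "subalgebra (F u) (F s)"
    using filtration assms by (auto simp: rc_filtration_def subalgebra_def)
  thus ?thesis using assms(1) by (rule measurable_from_subalg)
qed

text \<open>Time is treated as an additional integrator, with index 0.\<close>
definition V :: "nat \<Rightarrow> real \<Rightarrow> 'a \<Rightarrow> real" where
  "V i s \<omega> = (if i = 0 then s else W i s \<omega>)"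

definition inc :: "nat \<Rightarrow> real \<Rightarrow> real \<Rightarrow> 'a \<Rightarrow> real" where
  "inc i s u \<omega> = V i u \<omega> - V i s \<omega>"

lemma inc_0 [simp]: "inc 0 s u \<omega> = u - s"
  by (simp add: inc_def V_def)

lemma inc_refl [simp]: "inc i s s \<omega> = 0"
  by (simp add: inc_def)

lemma measurable_V: "i \<le> m \<Longrightarrow> 0 \<le> s \<Longrightarrow> s \<le> T \<Longrightarrow> V i s \<in> borel_measurable (F s)"
  using wiener by (cases "i = 0") (auto simp: std_wiener_def V_def[abs_def])

lemma measurable_inc:
  assumes "i \<le> m" "0 \<le> s" "s \<le> u" "u \<le> T"
  shows "inc i s u \<in> borel_measurable (F u)" "inc i s u \<in> borel_measurable M"
proof -
  have [measurable]: "V i s \<in> borel_measurable (F u)" "V i u \<in> borel_measurable (F u)"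
    using assms by (auto intro!: measurable_V measurable_F_mono[OF measurable_V])
  show "inc i s u \<in> borel_measurable (F u)" unfolding inc_def[abs_def] by measurable
  thus "inc i s u \<in> borel_measurable M" using measurable_F[of _ u] assms by auto
qed

abbreviation normal_measure :: "real \<Rightarrow> real measure" where
  "normal_measure v \<equiv> density lborel (normal_density 0 (sqrt v))"

context
  fixes s u :: real
  assumes su: "0 \<le> s" "s < u" "u \<le> T"
begin

lemma prob_space_normal_measure: "prob_space (normal_measure (u - s))"
  using su by (intro prob_space_normal_density) simp

lemma increments_joint:
  assumes "A \<in> sets (F s)" "\<And>i. i \<in> {1..m} \<Longrightarrow> B i \<in> sets borel"
  shows "prob (A \<inter> (\<Inter>i\<in>{1..m}. {\<omega>\<in>space M. inc i s u \<omega> \<in> B i})) =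
     prob A * (\<Prod>i\<in>{1..m}. measure (normal_measure (u - s)) (B i))"
proof -
  have "(\<Inter>i\<in>{1..m}. {\<omega>\<in>space M. inc i s u \<omega> \<in> B i}) = (\<Inter>i\<in>{1..m}. {\<omega>\<in>space M. W i u \<omega> - W i s \<omega> \<in> B i})"
    by (intro INF_cong refl) (auto simp: inc_def V_def)
  thus ?thesis using wiener assms su unfolding std_wiener_def by auto
qed

text \<open>The marginal law is read off the joint formula with A the whole space and all other
  Borel sets equal to the line.\<close>

lemma increment_prob:
  assumes "i \<in> {1..m}" "B \<in> sets borel"
  shows "prob (inc i s u -` B \<inter> space M) = measure (normal_measure (u - s)) B"
proof -
  interpret N: prob_space "normal_measure (u - s)" by (rule prob_space_normal_measure)
  have N1: "measure (normal_measure (u - s)) UNIV = 1" using N.prob_space by simp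
  define C where "C k = (if k = i then B else UNIV)" for k
  have sp: "space M \<in> sets (F s)"
    using subalgebra_F[of s] su sets.top[of "F s"] by (simp add: subalgebra_def)
  have "prob (inc i s u -` B \<inter> space M) = prob (space M \<inter> (\<Inter>k\<in>{1..m}. {\<omega>\<in>space M. inc k s u \<omega> \<in> C k}))"
    using assms by (intro arg_cong[where f = prob]) (auto simp: C_def split: if_splits)
  also have "\<dots> = prob (space M) * (\<Prod>k\<in>{1..m}. measure (normal_measure (u - s)) (C k))"
    using assms by (intro increments_joint sp) (auto simp: C_def)
  also have "(\<Prod>k\<in>{1..m}. measure (normal_measure (u - s)) (C k)) =
      (\<Prod>k\<in>{1..m}. if k = i then measure (normal_measure (u - s)) B else 1)"
    by (intro prod.cong refl) (simp add: C_def N1)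
  also have "\<dots> = measure (normal_measure (u - s)) B"
    using assms by (subst prod.delta) auto
  finally show ?thesis by (simp add: prob_space)
qed

lemma distr_increment:
  assumes "i \<in> {1..m}"
  shows "distr M borel (inc i s u) = normal_measure (u - s)"
proof (rule measure_eqI)
  interpret N: prob_space "normal_measure (u - s)" by (rule prob_space_normal_measure)
  have [measurable]: "inc i s u \<in> borel_measurable M" using measurable_inc(2)[of i s u] su assms by auto
  fix B assume "B \<in> sets (distr M borel (inc i s u))"
  hence B: "B \<in> sets borel" by simp
  thus "emeasure (distr M borel (inc i s u)) B = emeasure (normal_measure (u - s)) B"
    by (simp add: emeasure_distr emeasure_eq_measure N.emeasure_eq_measure increment_prob[OF assms])
qed simp

lemma increment_moment:
  assumes "i \<in> {1..m}"
  shows "integrable M (\<lambda>\<omega>. inc i s u \<omega> ^ k)"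
    and "expectation (\<lambda>\<omega>. inc i s u \<omega>) = 0"
    and "expectation (\<lambda>\<omega>. (inc i s u \<omega>)\<^sup>2) = u - s"
    and "expectation (\<lambda>\<omega>. inc i s u \<omega> ^ 3) = 0"
    and "expectation (\<lambda>\<omega>. inc i s u \<omega> ^ 4) = 3 * (u - s)\<^sup>2"
proof -
  let ?n = "normal_density 0 (sqrt (u - s))"
  have pos: "0 < sqrt (u - s)" using su by simp
  have [measurable]: "inc i s u \<in> borel_measurable M" using measurable_inc(2)[of i s u] su assms by auto
  have ex: "expectation (\<lambda>\<omega>. inc i s u \<omega> ^ k) = (\<integral>x. ?n x * x ^ k \<partial>lborel)" for k
  proof -
    have "expectation (\<lambda>\<omega>. inc i s u \<omega> ^ k) = (\<integral>x. x ^ k \<partial>distr M borel (inc i s u))"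
      by (subst integral_distr) auto
    also have "\<dots> = (\<integral>x. ?n x * x ^ k \<partial>lborel)"
      unfolding distr_increment[OF assms] by (subst integral_density) auto
    finally show ?thesis .
  qed
  show "integrable M (\<lambda>\<omega>. inc i s u \<omega> ^ k)"
  proof -
    have "integrable (distr M borel (inc i s u)) (\<lambda>x. x ^ k)"
      unfolding distr_increment[OF assms]
      using integrable_normal_moment[OF pos, of 0 k] by (subst integrable_density) auto
    thus ?thesis by (subst (asm) integrable_distr_eq) auto
  qed
  note even = integral_normal_moment_even[OF pos, of 0] and odd = integral_normal_moment_odd[OF pos, of 0]
  show "expectation (\<lambda>\<omega>. inc i s u \<omega>) = 0"
    using ex[of 1] odd[of 0] by simp
  show "expectation (\<lambda>\<omega>. inc i s u \<omega> ^ 3) = 0"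
    using ex[of 3] odd[of 1] by (simp add: numeral_3_eq_3)
  show "expectation (\<lambda>\<omega>. (inc i s u \<omega>)\<^sup>2) = u - s"
    using ex[of 2] even[of 1] su by simp
  show "expectation (\<lambda>\<omega>. inc i s u \<omega> ^ 4) = 3 * (u - s)\<^sup>2"
    using ex[of 4] even[of 2] su by (simp add: fact_numeral power_divide)
qed

text \<open>The index 0 carries an arbitrary random variable of the past, next to the m Wiener
  increments, so that independence of the past and of the components is a single statement.\<close>

lemma indep_increments:
  assumes Z: "Z \<in> borel_measurable (F s)"
  shows "indep_vars (\<lambda>_. borel) (\<lambda>k. if k = 0 then Z else inc k s u) {0..m}"
proof -
  let ?X = "\<lambda>k. if k = 0 then Z else inc k s u"
  have rv: "?X k \<in> borel_measurable M" if "k \<in> {0..m}" for k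
    using that measurable_inc(2)[of k s u] measurable_F[OF Z] su by auto
  have "indep_vars (\<lambda>_. borel) ?X {0..m} \<longleftrightarrow>
     (\<forall>A\<in>(\<Pi> i\<in>{0..m}. sets borel). prob (\<Inter>j\<in>{0..m}. ?X j -` A j \<inter> space M) =
        (\<Prod>j\<in>{0..m}. prob (?X j -` A j \<inter> space M)))"
    using rv by (intro indep_vars_finite) (auto simp: Int_stable_def sets.sigma_sets_eq[of borel, simplified])
  moreover have "prob (\<Inter>j\<in>{0..m}. ?X j -` A j \<inter> space M) = (\<Prod>j\<in>{0..m}. prob (?X j -` A j \<inter> space M))"
    if A: "A \<in> (\<Pi> i\<in>{0..m}. sets borel)" for A
  proof -
    have "A 0 \<in> sets borel" using A by (simp add: Pi_iff)
    hence ZA: "Z -` A 0 \<inter> space M \<in> sets (F s)"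
      using measurable_sets[OF Z, of "A 0"] subalgebra_F[of s] su by (simp add: subalgebra_def)
    have split: "{0..m} = insert 0 {1..m}" by auto
    have "(\<Inter>j\<in>{0..m}. ?X j -` A j \<inter> space M) =
       (Z -` A 0 \<inter> space M) \<inter> (\<Inter>i\<in>{1..m}. {\<omega>\<in>space M. inc i s u \<omega> \<in> A i})"
      by (auto simp: split)
    hence "prob (\<Inter>j\<in>{0..m}. ?X j -` A j \<inter> space M) =
        prob (Z -` A 0 \<inter> space M) * (\<Prod>i\<in>{1..m}. measure (normal_measure (u - s)) (A i))"
      using A by (simp only:) (intro increments_joint[OF ZA], auto simp: Pi_iff)
    also have "\<dots> = (\<Prod>j\<in>{0..m}. prob (?X j -` A j \<inter> space M))"
    proof -
      have "measure (normal_measure (u - s)) (A j) = prob (?X j -` A j \<inter> space M)" if "j \<in> {1..m}" for j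
        using that A increment_prob[of j "A j"] by (auto simp: Pi_iff)
      thus ?thesis unfolding split by (subst prod.insert) auto
    qed
    finally show ?thesis .
  qed
  ultimately show ?thesis by blast
qed

end

context
  fixes s u :: real and Z :: "'a \<Rightarrow> real"
  assumes su: "0 \<le> s" "s \<le> u" "u \<le> T" and Z: "Z \<in> borel_measurable (F s)" "integrable M Z"
begin

text \<open>The hypothesis on the Wiener process concerns strictly ordered times, hence s < u.
  Coinciding times are treated separately in the lemmas that follow, where the increment is
  0.\<close>

lemma increments_indep_powers:
  assumes "s < u" "J \<subseteq> {1..m}"
  shows "integrable M (\<lambda>\<omega>. Z \<omega> * (\<Prod>i\<in>J. inc i s u \<omega> ^ k i))"
    "expectation (\<lambda>\<omega>. Z \<omega> * (\<Prod>i\<in>J. inc i s u \<omega> ^ k i)) =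
      expectation Z * (\<Prod>i\<in>J. expectation (\<lambda>\<omega>. inc i s u \<omega> ^ k i))"
proof -
  let ?X = "\<lambda>j. if j = 0 then Z else inc j s u"
  define Y where "Y j \<omega> = (?X j \<omega>) ^ (if j = 0 then 1 else k j)" for j \<omega>
  have "indep_vars (\<lambda>_. borel) (\<lambda>j \<omega>. (\<lambda>x. x ^ (if j = 0 then 1 else k j)) (?X j \<omega>)) ({0} \<union> J)"
    using assms su by (intro indep_vars_compose2[OF indep_vars_subset[OF indep_increments[OF _ _ _ Z(1)]]]) auto
  hence ind: "indep_vars (\<lambda>_. borel) Y ({0} \<union> J)" by (simp add: Y_def[abs_def])
  have int: "integrable M (Y j)" if "j \<in> {0} \<union> J" for j
    using that assms su increment_moment(1)[of s u j "k j"] Z(2) by (auto simp: Y_def[abs_def])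
  have fin: "finite J" "0 \<notin> J" using assms finite_subset by auto
  have eq: "(\<Prod>i\<in>{0} \<union> J. f i) = f 0 * (\<Prod>i\<in>J. f i)" for f :: "nat \<Rightarrow> real"
    using fin by simp
  have eq2: "(\<Prod>i\<in>J. Y i \<omega>) = (\<Prod>i\<in>J. inc i s u \<omega> ^ k i)" for \<omega>
    using fin by (intro prod.cong) (auto simp: Y_def)
  have eq3: "(\<Prod>i\<in>J. expectation (Y i)) = (\<Prod>i\<in>J. expectation (\<lambda>\<omega>. inc i s u \<omega> ^ k i))"
    using fin by (intro prod.cong) (auto simp: Y_def[abs_def])
  have Y0: "Y 0 = Z" by (simp add: Y_def[abs_def])
  show "integrable M (\<lambda>\<omega>. Z \<omega> * (\<Prod>i\<in>J. inc i s u \<omega> ^ k i))"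
    using indep_vars_integrable[OF _ ind int] fin unfolding eq eq2 Y0 by simp
  show "expectation (\<lambda>\<omega>. Z \<omega> * (\<Prod>i\<in>J. inc i s u \<omega> ^ k i)) =
      expectation Z * (\<Prod>i\<in>J. expectation (\<lambda>\<omega>. inc i s u \<omega> ^ k i))"
    using indep_vars_lebesgue_integral[OF _ ind int] fin unfolding eq eq2 eq3 Y0 by simp
qed

lemma increment_integrable:
  assumes "i \<in> {1..m}"
  shows "integrable M (\<lambda>\<omega>. Z \<omega> * inc i s u \<omega> ^ k)"
proof (cases "s < u")
  case True
  thus ?thesis using increments_indep_powers(1)[of "{i}" "\<lambda>_. k"] assms by simp
next
  case False
  thus ?thesis using su Z by simp
qed

lemma increment_expectation:
  assumes "i \<in> {1..m}"
  shows "expectation (\<lambda>\<omega>. Z \<omega> * inc i s u \<omega>) = 0"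
    and "expectation (\<lambda>\<omega>. Z \<omega> * (inc i s u \<omega>)\<^sup>2) = expectation Z * (u - s)"
    and "expectation (\<lambda>\<omega>. Z \<omega> * inc i s u \<omega> ^ 3) = 0"
    and "expectation (\<lambda>\<omega>. Z \<omega> * inc i s u \<omega> ^ 4) = expectation Z * (3 * (u - s)\<^sup>2)"
proof -
  have "expectation (\<lambda>\<omega>. Z \<omega> * inc i s u \<omega>) = 0
    \<and> expectation (\<lambda>\<omega>. Z \<omega> * (inc i s u \<omega>)\<^sup>2) = expectation Z * (u - s)
    \<and> expectation (\<lambda>\<omega>. Z \<omega> * inc i s u \<omega> ^ 3) = 0
    \<and> expectation (\<lambda>\<omega>. Z \<omega> * inc i s u \<omega> ^ 4) = expectation Z * (3 * (u - s)\<^sup>2)"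
  proof (cases "s < u")
    case True
    have e: "expectation (\<lambda>\<omega>. Z \<omega> * inc i s u \<omega> ^ k) = expectation Z * expectation (\<lambda>\<omega>. inc i s u \<omega> ^ k)" for k
      using increments_indep_powers(2)[OF True, of "{i}" "\<lambda>_. k"] assms by simp
    note mo = increment_moment[OF su(1) True su(3) assms]
    show ?thesis using e[of 1] e[of 2] e[of 3] e[of 4] mo by simp
  next
    case False
    hence "u = s" using su by simp
    thus ?thesis by simp
  qed
  thus "expectation (\<lambda>\<omega>. Z \<omega> * inc i s u \<omega>) = 0"
    and "expectation (\<lambda>\<omega>. Z \<omega> * (inc i s u \<omega>)\<^sup>2) = expectation Z * (u - s)"
    and "expectation (\<lambda>\<omega>. Z \<omega> * inc i s u \<omega> ^ 3) = 0"
    and "expectation (\<lambda>\<omega>. Z \<omega> * inc i s u \<omega> ^ 4) = expectation Z * (3 * (u - s)\<^sup>2)"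
    by auto
qed

lemma increment_expectation_cross:
  assumes "i \<in> {1..m}" "j \<in> {1..m}" "i \<noteq> j"
  shows "integrable M (\<lambda>\<omega>. Z \<omega> * (inc i s u \<omega> * inc j s u \<omega>))"
    and "expectation (\<lambda>\<omega>. Z \<omega> * (inc i s u \<omega> * inc j s u \<omega>)) = 0"
    and "integrable M (\<lambda>\<omega>. Z \<omega> * (inc i s u \<omega> * inc j s u \<omega>)\<^sup>2)"
    and "expectation (\<lambda>\<omega>. Z \<omega> * (inc i s u \<omega> * inc j s u \<omega>)\<^sup>2) = expectation Z * (u - s)\<^sup>2"
proof -
  have "integrable M (\<lambda>\<omega>. Z \<omega> * (inc i s u \<omega> * inc j s u \<omega>)) \<and>
    expectation (\<lambda>\<omega>. Z \<omega> * (inc i s u \<omega> * inc j s u \<omega>)) = 0 \<and>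
    integrable M (\<lambda>\<omega>. Z \<omega> * (inc i s u \<omega> * inc j s u \<omega>)\<^sup>2) \<and>
    expectation (\<lambda>\<omega>. Z \<omega> * (inc i s u \<omega> * inc j s u \<omega>)\<^sup>2) = expectation Z * (u - s)\<^sup>2"
  proof (cases "s < u")
    case True
    note e = increments_indep_powers[OF True, of "{i, j}"]
    note mo = increment_moment[OF su(1) True su(3)]
    show ?thesis using e[of "\<lambda>_. 1"] e[of "\<lambda>_. 2"] assms mo(2,3)
      by (simp add: power_mult_distrib power2_eq_square[of "u - s"])
  next
    case False
    hence "u = s" using su by simp
    thus ?thesis by simp
  qed
  thus "integrable M (\<lambda>\<omega>. Z \<omega> * (inc i s u \<omega> * inc j s u \<omega>))"
    and "expectation (\<lambda>\<omega>. Z \<omega> * (inc i s u \<omega> * inc j s u \<omega>)) = 0"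
    and "integrable M (\<lambda>\<omega>. Z \<omega> * (inc i s u \<omega> * inc j s u \<omega>)\<^sup>2)"
    and "expectation (\<lambda>\<omega>. Z \<omega> * (inc i s u \<omega> * inc j s u \<omega>)\<^sup>2) = expectation Z * (u - s)\<^sup>2"
    by auto
qed

end

end

section \<open>Stochastic sums\<close>

lemma abs_cube_mult_le: "\<bar>x ^ 3 * y\<bar> \<le> x ^ 4 + y ^ 4" for x y :: real
proof (cases "\<bar>x\<bar> \<le> \<bar>y\<bar>")
  case True
  have "\<bar>x ^ 3 * y\<bar> = \<bar>x\<bar> ^ 3 * \<bar>y\<bar>" by (simp add: abs_mult power_abs)
  also have "\<dots> \<le> \<bar>y\<bar> ^ 3 * \<bar>y\<bar>" using True by (intro mult_right_mono power_mono) auto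
  also have "\<dots> = y ^ 4" by (simp add: eval_nat_numeral abs_mult_self_eq flip: mult.assoc abs_mult)
  finally show ?thesis by (auto intro: order.trans)
next
  case False
  have "\<bar>x ^ 3 * y\<bar> = \<bar>x\<bar> ^ 3 * \<bar>y\<bar>" by (simp add: abs_mult power_abs)
  also have "\<dots> \<le> \<bar>x\<bar> ^ 3 * \<bar>x\<bar>" using False by (intro mult_left_mono) auto
  also have "\<dots> = x ^ 4" by (simp add: eval_nat_numeral abs_mult_self_eq flip: mult.assoc abs_mult)
  finally show ?thesis by (auto intro: order.trans)
qed

context wiener
begin

text \<open>Keeping the bound in the form 9 eta a^2, with a the elapsed time, makes the induction over the
  grid close: the cross term 6 E(X^2 H^2) d is at most 18 eta a d.\<close>
lemma mom4_wiener_step: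
  assumes i: "i \<in> {1..m}" and su: "0 \<le> s" "s \<le> u" "u \<le> T"
    and X: "X \<in> borel_measurable (F s)" "mom 4 X (9 * \<eta> * a\<^sup>2)"
    and H: "H \<in> borel_measurable (F s)" "mom 4 H \<eta>" and a: "a \<ge> 0"
  shows "mom 4 (\<lambda>\<omega>. X \<omega> + H \<omega> * inc i s u \<omega>) (9 * \<eta> * (a + (u - s))\<^sup>2)"
proof -
  define d where "d = u - s"
  have d: "d \<ge> 0" using su by (simp add: d_def)
  note [measurable] = X(1) H(1)
  have [measurable]: "X \<in> borel_measurable M" "H \<in> borel_measurable M" "inc i s u \<in> borel_measurable M"
    using X H measurable_inc(2)[of i s u] i su by auto
  have eta: "\<eta> \<ge> 0" using mom_nonneg[OF H(2)] by simp
  have m2: "mom 2 (\<lambda>\<omega>. X \<omega> * H \<omega>) (3 * sqrt \<eta> * a * sqrt \<eta>)"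
  proof (rule mom4_mult)
    show "mom 4 X ((3 * sqrt \<eta> * a)\<^sup>2)" using X(2) eta by (simp add: power_mult_distrib)
    show "mom 4 H ((sqrt \<eta>)\<^sup>2)" using H(2) eta by simp
  qed (use eta a in auto)
  have e22: "expectation (\<lambda>\<omega>. (X \<omega> * H \<omega>)\<^sup>2) \<le> 3 * \<eta> * a"
  proof -
    have "3 * sqrt \<eta> * a * sqrt \<eta> = 3 * (sqrt \<eta>)\<^sup>2 * a" by (simp add: power2_eq_square)
    also have "\<dots> = 3 * \<eta> * a" using eta by simp
    finally show ?thesis using momD(3)[OF m2] by metis
  qed
  have i4: "integrable M (\<lambda>\<omega>. X \<omega> ^ 4 + H \<omega> ^ 4)" "integrable M (\<lambda>\<omega>. X \<omega> ^ 4)" "integrable M (\<lambda>\<omega>. H \<omega> ^ 4)"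
    using momD(2)[OF X(2)] momD(2)[OF H(2)] by auto
  have i31: "integrable M (\<lambda>\<omega>. X \<omega> ^ 3 * H \<omega>)"
    by (rule Bochner_Integration.integrable_bound[OF i4(1)])
       (use abs_cube_mult_le in \<open>auto intro!: AE_I2 order.trans[OF _ abs_ge_self]\<close>)
  have i13: "integrable M (\<lambda>\<omega>. X \<omega> * H \<omega> ^ 3)"
  proof (rule Bochner_Integration.integrable_bound[OF i4(1)])
    have "\<bar>X \<omega> * H \<omega> ^ 3\<bar> \<le> X \<omega> ^ 4 + H \<omega> ^ 4" for \<omega>
      using abs_cube_mult_le[of "H \<omega>" "X \<omega>"] by (simp add: mult.commute)
    thus "AE \<omega> in M. norm (X \<omega> * H \<omega> ^ 3) \<le> norm (X \<omega> ^ 4 + H \<omega> ^ 4)"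
      by (intro AE_I2) (auto intro: order.trans[OF _ abs_ge_self])
  qed measurable
  note i22 = momD(2)[OF m2]
  have m31: "(\<lambda>\<omega>. X \<omega> ^ 3 * H \<omega>) \<in> borel_measurable (F s)" by measurable
  have m13: "(\<lambda>\<omega>. X \<omega> * H \<omega> ^ 3) \<in> borel_measurable (F s)" by measurable
  have m22: "(\<lambda>\<omega>. (X \<omega> * H \<omega>)\<^sup>2) \<in> borel_measurable (F s)" by measurable
  have m04: "(\<lambda>\<omega>. H \<omega> ^ 4) \<in> borel_measurable (F s)" by measurable
  note I = increment_integrable[OF su _ _ i] and E = increment_expectation[OF su _ _ i]
  have I': "integrable M (\<lambda>\<omega>. X \<omega> ^ 3 * H \<omega> * inc i s u \<omega>)" "integrable M (\<lambda>\<omega>. X \<omega> * H \<omega> ^ 3 * inc i s u \<omega> ^ 3)"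
    "integrable M (\<lambda>\<omega>. (X \<omega> * H \<omega>)\<^sup>2 * (inc i s u \<omega>)\<^sup>2)" "integrable M (\<lambda>\<omega>. H \<omega> ^ 4 * inc i s u \<omega> ^ 4)"
    using I[OF m31 i31, of 1] I[OF m13 i13, of 3] I[OF m22 i22, of 2] I[OF m04 i4(3), of 4] by auto
  have eq: "(X \<omega> + H \<omega> * inc i s u \<omega>) ^ 4 = X \<omega> ^ 4 + 4 * (X \<omega> ^ 3 * H \<omega> * inc i s u \<omega>)
     + 6 * ((X \<omega> * H \<omega>)\<^sup>2 * (inc i s u \<omega>)\<^sup>2) + 4 * (X \<omega> * H \<omega> ^ 3 * inc i s u \<omega> ^ 3)
     + H \<omega> ^ 4 * inc i s u \<omega> ^ 4" for \<omega>
    by (simp add: eval_nat_numeral algebra_simps)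
  have "integrable M (\<lambda>\<omega>. (X \<omega> + H \<omega> * inc i s u \<omega>) ^ 4)"
    unfolding eq by (intro Bochner_Integration.integrable_add integrable_mult_right i4 I')
  moreover have "expectation (\<lambda>\<omega>. (X \<omega> + H \<omega> * inc i s u \<omega>) ^ 4) =
     expectation (\<lambda>\<omega>. X \<omega> ^ 4) + 6 * (expectation (\<lambda>\<omega>. (X \<omega> * H \<omega>)\<^sup>2) * d) + expectation (\<lambda>\<omega>. H \<omega> ^ 4) * (3 * d\<^sup>2)"
    unfolding eq d_def using I' i4(2)
    by (simp add: E(1)[OF m31 i31] E(2)[OF m22 i22] E(3)[OF m13 i13] E(4)[OF m04 i4(3)])
  \<comment> \<open>The odd moments have dropped out. The Gaussian constant 3 in front of d^2 is
    enlarged to 9, so that the bound becomes the perfect square 9 eta (a + d)^2.\<close>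
  moreover have "\<dots> \<le> 9 * \<eta> * a\<^sup>2 + 6 * (3 * \<eta> * a * d) + \<eta> * (9 * d\<^sup>2)"
    using momD(3)[OF X(2)] momD(3)[OF H(2)] e22 d eta
    by (intro add_mono mult_left_mono mult_right_mono mult_mono) auto
  moreover have "\<dots> = 9 * \<eta> * (a + d)\<^sup>2" by (simp add: power2_eq_square algebra_simps)
  ultimately show ?thesis by (auto simp: mom_def d_def)
qed

text \<open>Points may coincide, in contrast to \<open>is_partition\<close>. This admits the
  degenerate interval [t, t].\<close>

definition grid :: "real \<Rightarrow> real \<Rightarrow> nat \<Rightarrow> (nat \<Rightarrow> real) \<Rightarrow> bool" where
  "grid a b n g \<longleftrightarrow> g 0 = a \<and> g n = b \<and> (\<forall>k<n. g k \<le> g (Suc k))"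

lemma grid_mono: "grid a b n g \<Longrightarrow> j \<le> k \<Longrightarrow> k \<le> n \<Longrightarrow> g j \<le> g k"
proof (induction k)
  case (Suc k)
  thus ?case by (cases "j = Suc k") (auto simp: grid_def le_Suc_eq intro: order.trans)
qed simp

lemma grid_bounds: "grid a b n g \<Longrightarrow> k \<le> n \<Longrightarrow> a \<le> g k \<and> g k \<le> b"
  using grid_mono[of a b n g 0 k] grid_mono[of a b n g k n] by (auto simp: grid_def)

lemma grid_restrict: "grid a b n g \<Longrightarrow> k \<le> n \<Longrightarrow> grid a (g k) k g"
  by (auto simp: grid_def)

lemma sum_grid_diff: "grid a b n g \<Longrightarrow> (\<Sum>k<n. g (Suc k) - g k) = b - a"
  by (simp add: sum_lessThan_telescope grid_def)

lemma measurable_grid_sum: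
  assumes i: "i \<le> m" and g: "grid a b n g" and ab: "0 \<le> a" "b \<le> T"
    and H: "\<And>k. k < n \<Longrightarrow> H k \<in> borel_measurable (F (g k))"
  shows "(\<lambda>\<omega>. \<Sum>k<n. H k \<omega> * inc i (g k) (g (Suc k)) \<omega>) \<in> borel_measurable (F b)"
proof (intro borel_measurable_sum borel_measurable_times)
  fix k assume k: "k \<in> {..<n}"
  have "0 \<le> g k" "g k \<le> g (Suc k)" "g (Suc k) \<le> b"
    using grid_bounds[OF g, of k] grid_bounds[OF g, of "Suc k"] grid_mono[OF g, of k "Suc k"] ab k by auto
  thus "H k \<in> borel_measurable (F b)" "inc i (g k) (g (Suc k)) \<in> borel_measurable (F b)"
    using H[of k] k i ab measurable_inc(1)[of i "g k" "g (Suc k)"]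
    by (auto intro: measurable_F_mono)
qed

text \<open>One constant for all integrators: 9 comes from the Wiener components, and T^2 covers the
  time integrator, for which (b-a)^4 \<le> T^2 (b-a)^2.\<close>

definition \<kappa> :: real where "\<kappa> = 9 + T\<^sup>2"

lemma kappa_pos: "\<kappa> > 0"
  by (auto simp: \<kappa>_def intro: add_pos_nonneg)

text \<open>For a Wiener component \<open>mom4_wiener_step\<close> is iterated along the grid. For
  the time integrator there is no cancellation; Cauchy-Schwarz is applied twice with the cell
  lengths as weights.\<close>

lemma mom4_grid:
  assumes i: "i \<le> m" and g: "grid a b n g" and ab: "0 \<le> a" "b \<le> T"
    and H: "\<And>k. k < n \<Longrightarrow> H k \<in> borel_measurable (F (g k))" "\<And>k. k < n \<Longrightarrow> mom 4 (H k) \<eta>" and eta: "\<eta> \<ge> 0"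
  shows "mom 4 (\<lambda>\<omega>. \<Sum>k<n. H k \<omega> * inc i (g k) (g (Suc k)) \<omega>) (\<kappa> * \<eta> * (b - a)\<^sup>2)"
proof (cases "i = 0")
  case False
  have "mom 4 (\<lambda>\<omega>. \<Sum>k<j. H k \<omega> * inc i (g k) (g (Suc k)) \<omega>) (9 * \<eta> * (g j - a)\<^sup>2)" if "j \<le> n" for j
    using that
  proof (induction j)
    case 0
    thus ?case using g mom_0[of 4] by (simp add: grid_def)
  next
    case (Suc j)
    have "0 \<le> g j" "g j \<le> g (Suc j)" "g (Suc j) \<le> T" "g j - a \<ge> 0"
      using grid_bounds[OF g, of j] grid_bounds[OF g, of "Suc j"] grid_mono[OF g, of j "Suc j"] ab Suc.prems by auto
    moreover have "(\<lambda>\<omega>. \<Sum>k<j. H k \<omega> * inc i (g k) (g (Suc k)) \<omega>) \<in> borel_measurable (F (g j))"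
      by (rule measurable_grid_sum[OF i grid_restrict[OF g]])
         (use Suc.prems ab H \<open>g j \<le> g (Suc j)\<close> \<open>g (Suc j) \<le> T\<close> in auto)
    ultimately have "mom 4 (\<lambda>\<omega>. (\<Sum>k<j. H k \<omega> * inc i (g k) (g (Suc k)) \<omega>) + H j \<omega> * inc i (g j) (g (Suc j)) \<omega>)
        (9 * \<eta> * ((g j - a) + (g (Suc j) - g j))\<^sup>2)"
      using False i Suc H by (intro mom4_wiener_step) auto
    thus ?case by simp
  qed
  from this[of n] have "mom 4 (\<lambda>\<omega>. \<Sum>k<n. H k \<omega> * inc i (g k) (g (Suc k)) \<omega>) (9 * \<eta> * (b - a)\<^sup>2)"
    using g by (simp add: grid_def)
  thus ?thesis by (rule mom_mono) (use eta in \<open>auto simp: \<kappa>_def intro!: mult_right_mono\<close>)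
next
  case True
  define d where "d k = g (Suc k) - g k" for k
  have d: "d k \<ge> 0" if "k < n" for k using g that by (auto simp: d_def grid_def)
  have sd: "(\<Sum>k<n. d k) = b - a" unfolding d_def by (rule sum_grid_diff[OF g])
  have ba: "b - a \<ge> 0" unfolding sd[symmetric] by (intro sum_nonneg d) auto
  have "mom 4 (\<lambda>\<omega>. \<Sum>k<n. H k \<omega> * inc i (g k) (g (Suc k)) \<omega>) ((b - a) ^ 3 * ((b - a) * \<eta>))"
  proof (rule mom_dominated)
    show "integrable M (\<lambda>\<omega>. (b - a) ^ 3 * (\<Sum>k<n. d k * H k \<omega> ^ 4))"
      by (intro integrable_mult_right Bochner_Integration.integrable_sum momD(2)[OF H(2)]) auto
    show "(\<lambda>\<omega>. \<Sum>k<n. H k \<omega> * inc i (g k) (g (Suc k)) \<omega>) \<in> borel_measurable M"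
      using measurable_grid_sum[OF i g ab H(1)] measurable_F[of _ b] ab ba by auto
    fix \<omega>
    have "(\<Sum>k<n. d k * H k \<omega>) ^ 4 = ((\<Sum>k<n. d k * H k \<omega>)\<^sup>2)\<^sup>2" by simp
    also have "\<dots> \<le> ((b - a) * (\<Sum>k<n. d k * (H k \<omega>)\<^sup>2))\<^sup>2"
      unfolding sd[symmetric] by (intro power_mono weighted_Cauchy_Schwarz_sum) (auto simp: d)
    also have "\<dots> \<le> (b - a)\<^sup>2 * ((b - a) * (\<Sum>k<n. d k * ((H k \<omega>)\<^sup>2)\<^sup>2))"
      unfolding power_mult_distrib
      unfolding sd[symmetric] by (intro mult_left_mono weighted_Cauchy_Schwarz_sum) (auto simp: d)
    also have "\<dots> = (b - a) ^ 3 * (\<Sum>k<n. d k * H k \<omega> ^ 4)" by (simp add: power2_eq_square[of "b - a"] power3_eq_cube)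
    finally show "(\<Sum>k<n. H k \<omega> * inc i (g k) (g (Suc k)) \<omega>) ^ 4 \<le> (b - a) ^ 3 * (\<Sum>k<n. d k * H k \<omega> ^ 4)"
      using True by (simp add: d_def mult.commute)
  next
    have "expectation (\<lambda>\<omega>. (b - a) ^ 3 * (\<Sum>k<n. d k * H k \<omega> ^ 4)) = (b - a) ^ 3 * (\<Sum>k<n. d k * expectation (\<lambda>\<omega>. H k \<omega> ^ 4))"
      using momD(2)[OF H(2)] by (simp add: Bochner_Integration.integral_sum)
    also have "\<dots> \<le> (b - a) ^ 3 * (\<Sum>k<n. d k * \<eta>)"
      using momD(3)[OF H(2)] d ba by (intro mult_left_mono sum_mono) auto
    also have "\<dots> = (b - a) ^ 3 * ((b - a) * \<eta>)"
      by (simp add: sd flip: sum_distrib_right)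
    finally show "expectation (\<lambda>\<omega>. (b - a) ^ 3 * (\<Sum>k<n. d k * H k \<omega> ^ 4)) \<le> (b - a) ^ 3 * ((b - a) * \<eta>)" .
  qed auto
  moreover have "(b - a) ^ 3 * ((b - a) * \<eta>) \<le> \<kappa> * \<eta> * (b - a)\<^sup>2"
  proof -
    have "(b - a) ^ 3 * ((b - a) * \<eta>) = (b - a)\<^sup>2 * \<eta> * (b - a)\<^sup>2" by (simp add: eval_nat_numeral)
    also have "\<dots> \<le> \<kappa> * \<eta> * (b - a)\<^sup>2"
    proof (intro mult_right_mono eta)
      have "(b - a)\<^sup>2 \<le> T\<^sup>2" using ab ba by (intro power_mono) auto
      thus "(b - a)\<^sup>2 \<le> \<kappa>" by (simp add: \<kappa>_def)
    qed simp
    finally show ?thesis .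
  qed
  ultimately show ?thesis by (rule mom_mono)
qed

text \<open>Overlapping intervals are reduced to a grid by passing to the common refinement.\<close>
lemma mom4_family:
  assumes i: "i \<le> m" and ab: "0 \<le> a" "a \<le> b" "b \<le> T" and R: "finite R"
    and su: "\<And>r. r \<in> R \<Longrightarrow> a \<le> s r \<and> s r \<le> u r \<and> u r \<le> b"
    and X: "\<And>r. r \<in> R \<Longrightarrow> X r \<in> borel_measurable (F (s r))"
    and mom: "\<And>x. a \<le> x \<Longrightarrow> x < b \<Longrightarrow> mom 4 (\<lambda>\<omega>. \<Sum>r\<in>{r\<in>R. s r \<le> x \<and> x < u r}. X r \<omega>) \<eta>"
    and eta: "\<eta> \<ge> 0"
  shows "mom 4 (\<lambda>\<omega>. \<Sum>r\<in>R. X r \<omega> * inc i (s r) (u r) \<omega>) (\<kappa> * \<eta> * (b - a)\<^sup>2)"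
proof -
  \<comment> \<open>All endpoints of the family. Listed in increasing order and without repetition
    they form a grid on which every interval of the family is a union of consecutive cells.\<close>
  define G where "G = insert a (insert b (s ` R \<union> u ` R))"
  define L where "L = sorted_list_of_set G"
  define n where "n = length L - 1"
  define g where "g k = L ! k" for k
  have G: "finite G" "G \<noteq> {}" "G \<subseteq> {a..b}" using R su ab by (force simp: G_def)+
  have L: "set L = G" "sorted L" "distinct L" "length L = Suc n"
    using G by (auto simp: L_def n_def card_gt_0_iff)
  have inj: "g j < g k" if "j < k" "k \<le> n" for j k
    using L that sorted_nth_mono[of L j k] nth_eq_iff_index_eq[of L j k] by (auto simp: g_def less_le)
  have mono: "g j \<le> g k" if "j \<le> k" "k \<le> n" for j k
    using inj[of j k] that by (cases "j = k") auto
  have ex: "\<exists>k\<le>n. x = g k" if "x \<in> G" for x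
    using that L unfolding g_def by (metis in_set_conv_nth less_Suc_eq_le)
  have gG: "g k \<in> G" if "k \<le> n" for k using that L by (metis g_def nth_mem less_Suc_eq_le)
  have g0: "g 0 = a"
  proof -
    obtain k where "k \<le> n" "a = g k" using ex[of a] by (auto simp: G_def)
    thus ?thesis using mono[of 0 k] gG[of 0] G by force
  qed
  have gn: "g n = b"
  proof -
    obtain k where "k \<le> n" "b = g k" using ex[of b] by (auto simp: G_def)
    thus ?thesis using mono[of k n] gG[of n] G by force
  qed
  have grid: "grid a b n g" using g0 gn mono by (auto simp: grid_def)
  \<comment> \<open>The coefficient on a refined cell is the sum over the intervals that cover it.
    Each such interval started no later than \<open>g k\<close>, so the coefficient is known at time
    \<open>g k\<close>.\<close>
  define H where "H k \<omega> = (\<Sum>r\<in>{r\<in>R. s r \<le> g k \<and> g k < u r}. X r \<omega>)" for k \<omega>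
  have tele: "inc i (s r) (u r) \<omega> = (\<Sum>k<n. if s r \<le> g k \<and> g k < u r then inc i (g k) (g (Suc k)) \<omega> else 0)"
    if r: "r \<in> R" for r \<omega>
  proof -
    obtain j where j: "j \<le> n" "s r = g j" using ex[of "s r"] r by (auto simp: G_def)
    obtain k where k: "k \<le> n" "u r = g k" using ex[of "u r"] r by (auto simp: G_def)
    have jk: "j \<le> k"
    proof (rule ccontr)
      assume "\<not> j \<le> k"
      hence "u r < s r" using inj[of k j] j k by auto
      thus False using su[OF r] by auto
    qed
    have iff: "s r \<le> g l \<and> g l < u r \<longleftrightarrow> l \<in> {j..<k}" if "l < n" for l
      using that j k inj[of j l] inj[of l j] inj[of l k] inj[of k l] mono[of j l] mono[of k l]
      by (auto simp: not_less[symmetric])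
    have "(\<Sum>l<n. if s r \<le> g l \<and> g l < u r then inc i (g l) (g (Suc l)) \<omega> else 0) = (\<Sum>l\<in>{j..<k}. inc i (g l) (g (Suc l)) \<omega>)"
      using k iff by (intro sum.mono_neutral_cong_right) auto
    also have "\<dots> = V i (g k) \<omega> - V i (g j) \<omega>"
      unfolding inc_def using jk by (rule sum_Suc_diff')
    finally show ?thesis using j k by (simp add: inc_def)
  qed
  have "(\<Sum>r\<in>R. X r \<omega> * inc i (s r) (u r) \<omega>) = (\<Sum>k<n. H k \<omega> * inc i (g k) (g (Suc k)) \<omega>)" for \<omega>
  proof -
    have "(\<Sum>r\<in>R. X r \<omega> * inc i (s r) (u r) \<omega>) =
      (\<Sum>r\<in>R. \<Sum>k<n. X r \<omega> * (if s r \<le> g k \<and> g k < u r then inc i (g k) (g (Suc k)) \<omega> else 0))"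
      by (intro sum.cong refl) (simp add: tele sum_distrib_left)
    also have "\<dots> = (\<Sum>k<n. \<Sum>r\<in>R. X r \<omega> * (if s r \<le> g k \<and> g k < u r then inc i (g k) (g (Suc k)) \<omega> else 0))"
      by (rule sum.swap)
    also have "\<dots> = (\<Sum>k<n. H k \<omega> * inc i (g k) (g (Suc k)) \<omega>)"
      unfolding H_def sum_distrib_right
      by (intro sum.cong refl sum.mono_neutral_cong_right R) auto
    finally show ?thesis .
  qed
  moreover have "mom 4 (\<lambda>\<omega>. \<Sum>k<n. H k \<omega> * inc i (g k) (g (Suc k)) \<omega>) (\<kappa> * \<eta> * (b - a)\<^sup>2)"
  proof (rule mom4_grid[OF i grid ab(1,3) _ _ eta])
    fix k assume k: "k < n"
    have gk: "a \<le> g k" "g k < b" using g0 gn mono[of 0 k] inj[of k n] k by auto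
    show "mom 4 (H k) \<eta>" unfolding H_def[abs_def] by (rule mom[OF gk])
    show "H k \<in> borel_measurable (F (g k))" unfolding H_def[abs_def]
    proof (intro borel_measurable_sum)
      fix r assume "r \<in> {r \<in> R. s r \<le> g k \<and> g k < u r}"
      thus "X r \<in> borel_measurable (F (g k))"
        using X[of r] su[of r] gk ab by (intro measurable_F_mono[of "X r" "s r" "g k"]) auto
    qed
  qed
  ultimately show ?thesis by simp
qed

end

section \<open>Orthogonal increments and the discrete isometry\<close>

context wiener
begin

text \<open>A martingale difference whose conditional second moment is at most v.\<close>
definition orth_incr :: "real \<Rightarrow> real \<Rightarrow> ('a \<Rightarrow> real) \<Rightarrow> real \<Rightarrow> bool" where
  "orth_incr s u \<xi> v \<longleftrightarrow> \<xi> \<in> borel_measurable (F u) \<and>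
     (\<forall>Z\<in>borel_measurable (F s). integrable M Z \<longrightarrow>
        integrable M (\<lambda>\<omega>. Z \<omega> * \<xi> \<omega>) \<and> expectation (\<lambda>\<omega>. Z \<omega> * \<xi> \<omega>) = 0 \<and>
        integrable M (\<lambda>\<omega>. Z \<omega> * (\<xi> \<omega>)\<^sup>2) \<and>
        ((\<forall>\<omega>. Z \<omega> \<ge> 0) \<longrightarrow> expectation (\<lambda>\<omega>. Z \<omega> * (\<xi> \<omega>)\<^sup>2) \<le> expectation Z * v))"

lemma orth_incr_measurable: "orth_incr s u \<xi> v \<Longrightarrow> \<xi> \<in> borel_measurable (F u)"
  unfolding orth_incr_def by (rule conjunct1)

text \<open>The compensated product of two increments. For i = j = 0 it is not centred, which
  explains the side condition in \<open>orth_incr_brack\<close>.\<close>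

definition brack :: "nat \<Rightarrow> nat \<Rightarrow> real \<Rightarrow> real \<Rightarrow> 'a \<Rightarrow> real" where
  "brack i j s u \<omega> = inc i s u \<omega> * inc j s u \<omega> - (if i = j then u - s else 0)"

lemma orth_incr_inc:
  assumes "i \<in> {1..m}" "0 \<le> s" "s \<le> u" "u \<le> T"
  shows "orth_incr s u (inc i s u) (u - s)"
  unfolding orth_incr_def
proof (intro conjI ballI impI)
  show "inc i s u \<in> borel_measurable (F u)" using assms by (intro measurable_inc) auto
  fix Z :: "'a \<Rightarrow> real" assume Z: "Z \<in> borel_measurable (F s)" "integrable M Z"
  show "integrable M (\<lambda>\<omega>. Z \<omega> * inc i s u \<omega>)" "integrable M (\<lambda>\<omega>. Z \<omega> * (inc i s u \<omega>)\<^sup>2)"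
    using increment_integrable[OF assms(2-4) Z assms(1), of 1] increment_integrable[OF assms(2-4) Z assms(1), of 2] by simp_all
  show "expectation (\<lambda>\<omega>. Z \<omega> * inc i s u \<omega>) = 0"
    "expectation (\<lambda>\<omega>. Z \<omega> * (inc i s u \<omega>)\<^sup>2) \<le> expectation Z * (u - s)"
    using increment_expectation[OF assms(2-4) Z assms(1)] by simp_all
qed

lemma measurable_brack:
  assumes "i \<le> m" "j \<le> m" "0 \<le> s" "s \<le> u" "u \<le> T"
  shows "brack i j s u \<in> borel_measurable (F u)"
  unfolding brack_def[abs_def] using assms
  by (intro borel_measurable_diff borel_measurable_times measurable_inc borel_measurable_const) auto

text \<open>The conditional variance is 3 d^2 - 2 d^2 + d^2 = 2 d^2 with d = u - s. The constant 2 +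
  T is chosen to serve all brackets: two different components give d^2, and a component with time
  gives d^3 \<le> T d^2.\<close>

lemma orth_incr_brack_same:
  assumes "i \<in> {1..m}" "0 \<le> s" "s \<le> u" "u \<le> T"
  shows "orth_incr s u (brack i i s u) ((2 + T) * (u - s)\<^sup>2)"
  unfolding orth_incr_def
proof (intro conjI ballI impI)
  show "brack i i s u \<in> borel_measurable (F u)" using assms by (intro measurable_brack) auto
  fix Z :: "'a \<Rightarrow> real" assume Z: "Z \<in> borel_measurable (F s)" "integrable M Z"
  define d where "d = u - s"
  note I = increment_integrable[OF assms(2-4) Z assms(1)]
  note E = increment_expectation[OF assms(2-4) Z assms(1)]
  have eq: "Z \<omega> * brack i i s u \<omega> = Z \<omega> * (inc i s u \<omega>)\<^sup>2 - Z \<omega> * d"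
    "Z \<omega> * (brack i i s u \<omega>)\<^sup>2 = Z \<omega> * inc i s u \<omega> ^ 4 - 2 * d * (Z \<omega> * (inc i s u \<omega>)\<^sup>2) + Z \<omega> * d\<^sup>2" for \<omega>
    by (simp_all add: brack_def d_def[symmetric] eval_nat_numeral algebra_simps)
  show "integrable M (\<lambda>\<omega>. Z \<omega> * brack i i s u \<omega>)" "integrable M (\<lambda>\<omega>. Z \<omega> * (brack i i s u \<omega>)\<^sup>2)"
    unfolding eq using I[of 2] I[of 4] Z by simp_all
  show "expectation (\<lambda>\<omega>. Z \<omega> * brack i i s u \<omega>) = 0"
    unfolding eq using I[of 2] Z E(2) by (simp add: d_def)
  assume "\<forall>\<omega>. 0 \<le> Z \<omega>"
  hence EZ: "expectation Z \<ge> 0" by (intro Bochner_Integration.integral_nonneg) auto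
  have "expectation (\<lambda>\<omega>. Z \<omega> * (brack i i s u \<omega>)\<^sup>2) =
      expectation Z * (3 * d\<^sup>2) - 2 * d * (expectation Z * d) + expectation Z * d\<^sup>2"
    unfolding eq using I[of 2] I[of 4] Z E(2,4) by (simp add: d_def[symmetric])
  also have "\<dots> = expectation Z * (2 * d\<^sup>2)" by (simp add: power2_eq_square algebra_simps)
  also have "\<dots> \<le> expectation Z * ((2 + T) * (u - s)\<^sup>2)"
    unfolding d_def using EZ assms by (intro mult_left_mono mult_right_mono) auto
  finally show "expectation (\<lambda>\<omega>. Z \<omega> * (brack i i s u \<omega>)\<^sup>2) \<le> expectation Z * ((2 + T) * (u - s)\<^sup>2)" .
qed

lemma orth_incr_brack_diff:
  assumes "i \<in> {1..m}" "j \<in> {1..m}" "i \<noteq> j" "0 \<le> s" "s \<le> u" "u \<le> T"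
  shows "orth_incr s u (brack i j s u) ((2 + T) * (u - s)\<^sup>2)"
  unfolding orth_incr_def
proof (intro conjI ballI impI)
  show "brack i j s u \<in> borel_measurable (F u)" using assms by (intro measurable_brack) auto
  fix Z :: "'a \<Rightarrow> real" assume Z: "Z \<in> borel_measurable (F s)" "integrable M Z"
  note E = increment_expectation_cross[OF assms(4-6) Z assms(1-3)]
  have eq: "brack i j s u = (\<lambda>\<omega>. inc i s u \<omega> * inc j s u \<omega>)" using assms by (simp add: brack_def fun_eq_iff)
  show "integrable M (\<lambda>\<omega>. Z \<omega> * brack i j s u \<omega>)" "integrable M (\<lambda>\<omega>. Z \<omega> * (brack i j s u \<omega>)\<^sup>2)"
    "expectation (\<lambda>\<omega>. Z \<omega> * brack i j s u \<omega>) = 0"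
    unfolding eq using E by simp_all
  assume "\<forall>\<omega>. 0 \<le> Z \<omega>"
  hence EZ: "expectation Z \<ge> 0" by (intro Bochner_Integration.integral_nonneg) auto
  have "1 * (u - s)\<^sup>2 \<le> (2 + T) * (u - s)\<^sup>2" using assms by (intro mult_right_mono) auto
  thus "expectation (\<lambda>\<omega>. Z \<omega> * (brack i j s u \<omega>)\<^sup>2) \<le> expectation Z * ((2 + T) * (u - s)\<^sup>2)"
    unfolding eq E(4) using EZ by (intro mult_left_mono) auto
qed

lemma orth_incr_brack_time:
  assumes "j \<in> {1..m}" "0 \<le> s" "s \<le> u" "u \<le> T"
  shows "orth_incr s u (brack 0 j s u) ((2 + T) * (u - s)\<^sup>2)"
  unfolding orth_incr_def
proof (intro conjI ballI impI)
  show "brack 0 j s u \<in> borel_measurable (F u)" using assms by (intro measurable_brack) auto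
  fix Z :: "'a \<Rightarrow> real" assume Z: "Z \<in> borel_measurable (F s)" "integrable M Z"
  note I = increment_integrable[OF assms(2-4) Z assms(1)]
  note E = increment_expectation[OF assms(2-4) Z assms(1)]
  have eq: "Z \<omega> * brack 0 j s u \<omega> = (u - s) * (Z \<omega> * inc j s u \<omega>)"
     "Z \<omega> * (brack 0 j s u \<omega>)\<^sup>2 = (u - s)\<^sup>2 * (Z \<omega> * (inc j s u \<omega>)\<^sup>2)" for \<omega>
    using assms by (simp_all add: brack_def power_mult_distrib)
  show "integrable M (\<lambda>\<omega>. Z \<omega> * brack 0 j s u \<omega>)" "integrable M (\<lambda>\<omega>. Z \<omega> * (brack 0 j s u \<omega>)\<^sup>2)"
    "expectation (\<lambda>\<omega>. Z \<omega> * brack 0 j s u \<omega>) = 0"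
    unfolding eq using E(1) I[of 1] I[of 2] by simp_all
  assume "\<forall>\<omega>. 0 \<le> Z \<omega>"
  hence EZ: "expectation Z \<ge> 0" by (intro Bochner_Integration.integral_nonneg) auto
  have "expectation (\<lambda>\<omega>. Z \<omega> * (brack 0 j s u \<omega>)\<^sup>2) = expectation Z * ((u - s) * (u - s)\<^sup>2)"
    unfolding eq using E(2) by simp
  also have "\<dots> \<le> expectation Z * ((2 + T) * (u - s)\<^sup>2)"
    using EZ assms by (intro mult_left_mono mult_right_mono) auto
  finally show "expectation (\<lambda>\<omega>. Z \<omega> * (brack 0 j s u \<omega>)\<^sup>2) \<le> expectation Z * ((2 + T) * (u - s)\<^sup>2)" .
qed

lemma brack_commute: "brack i j s u = brack j i s u"
  by (auto simp: brack_def fun_eq_iff)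

lemma orth_incr_brack:
  assumes "i \<le> m" "j \<le> m" "i \<noteq> 0 \<or> j \<noteq> 0" "0 \<le> s" "s \<le> u" "u \<le> T"
  shows "orth_incr s u (brack i j s u) ((2 + T) * (u - s)\<^sup>2)"
proof -
  consider "i = j" "i \<in> {1..m}" | "i \<noteq> j" "i \<in> {1..m}" "j \<in> {1..m}" | "i = 0" "j \<in> {1..m}" | "j = 0" "i \<in> {1..m}"
    using assms by (cases "i = 0"; cases "j = 0") auto
  thus ?thesis
    using assms by cases (simp_all add: orth_incr_brack_same orth_incr_brack_diff orth_incr_brack_time brack_commute[of i 0])
qed

lemma mom2_orth_step:
  assumes su: "0 \<le> s" "s \<le> u" "u \<le> T" and o: "orth_incr s u \<xi> v" and v: "v \<ge> 0"
    and X: "X \<in> borel_measurable (F s)" "mom 2 X a"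
    and H: "H \<in> borel_measurable (F s)" "mom 2 H c"
  shows "mom 2 (\<lambda>\<omega>. X \<omega> + H \<omega> * \<xi> \<omega>) (a + c * v)"
proof -
  have XH: "integrable M (\<lambda>\<omega>. X \<omega> * H \<omega>)" by (rule mom2_integrable_mult[OF X(2) H(2)])
  have o1: "integrable M (\<lambda>\<omega>. X \<omega> * H \<omega> * \<xi> \<omega>)" "expectation (\<lambda>\<omega>. X \<omega> * H \<omega> * \<xi> \<omega>) = 0"
    using o XH X H unfolding orth_incr_def by (auto intro!: borel_measurable_times)
  have o2: "integrable M (\<lambda>\<omega>. (H \<omega>)\<^sup>2 * (\<xi> \<omega>)\<^sup>2)"
    "expectation (\<lambda>\<omega>. (H \<omega>)\<^sup>2 * (\<xi> \<omega>)\<^sup>2) \<le> expectation (\<lambda>\<omega>. (H \<omega>)\<^sup>2) * v"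
    using o momD(2)[OF H(2)] H(1) unfolding orth_incr_def by (auto intro!: borel_measurable_power)
  have eq: "(X \<omega> + H \<omega> * \<xi> \<omega>)\<^sup>2 = (X \<omega>)\<^sup>2 + 2 * (X \<omega> * H \<omega> * \<xi> \<omega>) + (H \<omega>)\<^sup>2 * (\<xi> \<omega>)\<^sup>2" for \<omega>
    by (simp add: power2_eq_square algebra_simps)
  have i: "integrable M (\<lambda>\<omega>. (X \<omega> + H \<omega> * \<xi> \<omega>)\<^sup>2)"
    unfolding eq using momD(2)[OF X(2)] o1 o2 by simp
  have "expectation (\<lambda>\<omega>. (X \<omega> + H \<omega> * \<xi> \<omega>)\<^sup>2) = expectation (\<lambda>\<omega>. (X \<omega>)\<^sup>2) + expectation (\<lambda>\<omega>. (H \<omega>)\<^sup>2 * (\<xi> \<omega>)\<^sup>2)"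
    unfolding eq using momD(2)[OF X(2)] o1 o2 by simp
  also have "\<dots> \<le> a + c * v"
    using momD(3)[OF X(2)] momD(3)[OF H(2)] o2(2) v mult_right_mono[of "expectation (\<lambda>\<omega>. (H \<omega>)\<^sup>2)" c v] by linarith
  moreover have "\<xi> \<in> borel_measurable M" using orth_incr_measurable[OF o] su by (intro measurable_F[of \<xi> u]) simp_all
  ultimately show ?thesis using i momD(1)[OF X(2)] momD(1)[OF H(2)] by (simp add: mom_def)
qed

text \<open>Pythagoras along the grid: the partial sum times the next coefficient belongs to the
  past, so its product with the next increment has mean 0.\<close>

lemma mom2_orth_grid:
  assumes g: "grid a b n g" and ab: "0 \<le> a" "b \<le> T"
    and o: "\<And>k. k < n \<Longrightarrow> orth_incr (g k) (g (Suc k)) (\<xi> k) (v k)" "\<And>k. k < n \<Longrightarrow> v k \<ge> 0"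
    and H: "\<And>k. k < n \<Longrightarrow> H k \<in> borel_measurable (F (g k))" "\<And>k. k < n \<Longrightarrow> mom 2 (H k) (c k)"
  shows "mom 2 (\<lambda>\<omega>. \<Sum>k<n. H k \<omega> * \<xi> k \<omega>) (\<Sum>k<n. c k * v k)"
proof -
  have "(\<lambda>\<omega>. \<Sum>k<j. H k \<omega> * \<xi> k \<omega>) \<in> borel_measurable (F (g j)) \<and> mom 2 (\<lambda>\<omega>. \<Sum>k<j. H k \<omega> * \<xi> k \<omega>) (\<Sum>k<j. c k * v k)"
    if "j \<le> n" for j using that
  proof (induction j)
    case 0
    show ?case using mom_0[of 2] by simp
  next
    case (Suc j)
    have gj: "0 \<le> g j" "g j \<le> g (Suc j)" "g (Suc j) \<le> T"
      using grid_bounds[OF g, of j] grid_bounds[OF g, of "Suc j"] grid_mono[OF g, of j "Suc j"] ab Suc.prems by auto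
    have "mom 2 (\<lambda>\<omega>. (\<Sum>k<j. H k \<omega> * \<xi> k \<omega>) + H j \<omega> * \<xi> j \<omega>) ((\<Sum>k<j. c k * v k) + c j * v j)"
      using Suc gj H o by (intro mom2_orth_step[OF gj]) auto
    moreover have "(\<lambda>\<omega>. (\<Sum>k<j. H k \<omega> * \<xi> k \<omega>) + H j \<omega> * \<xi> j \<omega>) \<in> borel_measurable (F (g (Suc j)))"
    proof (intro borel_measurable_add borel_measurable_times)
      show "(\<lambda>\<omega>. \<Sum>k<j. H k \<omega> * \<xi> k \<omega>) \<in> borel_measurable (F (g (Suc j)))" "H j \<in> borel_measurable (F (g (Suc j)))"
        using Suc H(1)[of j] gj by (auto intro: measurable_F_mono[of _ "g j" "g (Suc j)"])
      show "\<xi> j \<in> borel_measurable (F (g (Suc j)))" using orth_incr_measurable[OF o(1)[of j]] Suc.prems by simp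
    qed
    ultimately show ?case by simp
  qed
  from this[of n] show ?thesis by simp
qed

text \<open>The second-moment analogue of \<open>mom4_grid\<close>, needed when a coefficient is
  itself a product of two processes with bounded fourth moments and only its second moment is
  controlled.\<close>

lemma mom2_grid:
  assumes i: "i \<le> m" and g: "grid a b n g" and ab: "0 \<le> a" "b \<le> T" "a \<le> b"
    and H: "\<And>k. k < n \<Longrightarrow> H k \<in> borel_measurable (F (g k))" "\<And>k. k < n \<Longrightarrow> mom 2 (H k) c" and c: "c \<ge> 0"
  shows "mom 2 (\<lambda>\<omega>. \<Sum>k<n. H k \<omega> * inc i (g k) (g (Suc k)) \<omega>) ((1 + T) * c * (b - a))"
proof (cases "i = 0")
  case False
  have "mom 2 (\<lambda>\<omega>. \<Sum>k<n. H k \<omega> * inc i (g k) (g (Suc k)) \<omega>) (\<Sum>k<n. c * (g (Suc k) - g k))"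
  proof (rule mom2_orth_grid[OF g ab(1,2) _ _ H])
    fix k assume "k < n"
    hence gj: "0 \<le> g k" "g k \<le> g (Suc k)" "g (Suc k) \<le> T"
      using grid_bounds[OF g, of k] grid_bounds[OF g, of "Suc k"] grid_mono[OF g, of k "Suc k"] ab by auto
    thus "orth_incr (g k) (g (Suc k)) (inc i (g k) (g (Suc k))) (g (Suc k) - g k)"
      using i False by (intro orth_incr_inc) auto
    show "g (Suc k) - g k \<ge> 0" using gj by simp
  qed
  hence "mom 2 (\<lambda>\<omega>. \<Sum>k<n. H k \<omega> * inc i (g k) (g (Suc k)) \<omega>) (1 * c * (b - a))"
    using sum_grid_diff[OF g] by (simp flip: sum_distrib_left)
  moreover have "1 * c * (b - a) \<le> (1 + T) * c * (b - a)"
    using ab c by (intro mult_right_mono) auto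
  ultimately show ?thesis by (rule mom_mono)
next
  case True
  define d where "d k = g (Suc k) - g k" for k
  have d: "d k \<ge> 0" if "k < n" for k using g that by (auto simp: d_def grid_def)
  have sd: "(\<Sum>k<n. d k) = b - a" unfolding d_def by (rule sum_grid_diff[OF g])
  have "mom 2 (\<lambda>\<omega>. \<Sum>k<n. H k \<omega> * inc i (g k) (g (Suc k)) \<omega>) ((b - a) * (c * (b - a)))"
  proof (rule mom_dominated)
    show "integrable M (\<lambda>\<omega>. (b - a) * (\<Sum>k<n. d k * (H k \<omega>)\<^sup>2))"
      by (intro integrable_mult_right Bochner_Integration.integrable_sum momD(2)[OF H(2)]) auto
    show "(\<lambda>\<omega>. \<Sum>k<n. H k \<omega> * inc i (g k) (g (Suc k)) \<omega>) \<in> borel_measurable M"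
      using measurable_grid_sum[OF i g ab(1,2) H(1)] measurable_F[of _ b] ab by auto
    fix \<omega>
    have "(\<Sum>k<n. d k * H k \<omega>)\<^sup>2 \<le> (b - a) * (\<Sum>k<n. d k * (H k \<omega>)\<^sup>2)"
      unfolding sd[symmetric] by (intro weighted_Cauchy_Schwarz_sum) (auto simp: d)
    thus "(\<Sum>k<n. H k \<omega> * inc i (g k) (g (Suc k)) \<omega>)\<^sup>2 \<le> (b - a) * (\<Sum>k<n. d k * (H k \<omega>)\<^sup>2)"
      using True by (simp add: d_def mult.commute)
  next
    have "expectation (\<lambda>\<omega>. (b - a) * (\<Sum>k<n. d k * (H k \<omega>)\<^sup>2)) = (b - a) * (\<Sum>k<n. d k * expectation (\<lambda>\<omega>. (H k \<omega>)\<^sup>2))"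
      using momD(2)[OF H(2)] by (simp add: Bochner_Integration.integral_sum)
    also have "\<dots> \<le> (b - a) * (\<Sum>k<n. d k * c)"
      using momD(3)[OF H(2)] d ab by (intro mult_left_mono sum_mono) auto
    also have "\<dots> = (b - a) * (c * (b - a))"
      by (simp add: sd flip: sum_distrib_right)
    finally show "expectation (\<lambda>\<omega>. (b - a) * (\<Sum>k<n. d k * (H k \<omega>)\<^sup>2)) \<le> (b - a) * (c * (b - a))" .
  qed auto
  moreover have "(b - a) * (c * (b - a)) \<le> (1 + T) * (c * (b - a))"
    using ab c by (intro mult_right_mono) auto
  ultimately show ?thesis unfolding mult.assoc by (rule mom_mono)
qed

text \<open>The polarised isometry as an equality. In each induction step the two terms that are
  linear in the new increment have mean 0, and the squared increment contributes its length.\<close>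

lemma wiener_grid_isometry:
  assumes i: "i \<in> {1..m}" and g: "grid a b n g" and ab: "0 \<le> a" "b \<le> T"
    and H: "\<And>k. k < n \<Longrightarrow> H k \<in> borel_measurable (F (g k))" "\<And>k. k < n \<Longrightarrow> mom 2 (H k) (c k)"
    and G: "\<And>k. k < n \<Longrightarrow> G k \<in> borel_measurable (F (g k))" "\<And>k. k < n \<Longrightarrow> mom 2 (G k) (e k)"
  shows "expectation (\<lambda>\<omega>. (\<Sum>k<n. H k \<omega> * inc i (g k) (g (Suc k)) \<omega>) * (\<Sum>k<n. G k \<omega> * inc i (g k) (g (Suc k)) \<omega>))
    = (\<Sum>k<n. expectation (\<lambda>\<omega>. H k \<omega> * G k \<omega>) * (g (Suc k) - g k))"
proof -
  let ?S = "\<lambda>H j \<omega>. \<Sum>k<j. H k \<omega> * inc i (g k) (g (Suc k)) \<omega>"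
  have gj: "0 \<le> g k" "g k \<le> g (Suc k)" "g (Suc k) \<le> T" if "k < n" for k
    using grid_bounds[OF g, of k] grid_bounds[OF g, of "Suc k"] grid_mono[OF g, of k "Suc k"] ab that by auto
  have m2: "mom 2 (?S H j) (\<Sum>k<j. c k * (g (Suc k) - g k))"
    if "j \<le> n" "\<And>k. k < n \<Longrightarrow> H k \<in> borel_measurable (F (g k))" "\<And>k. k < n \<Longrightarrow> mom 2 (H k) (c k)" for j H c
  proof (rule mom2_orth_grid[OF grid_restrict[OF g that(1)] ab(1)])
    show "g j \<le> T" using grid_bounds[OF g that(1)] ab by auto
  qed (use that gj i in \<open>auto intro!: orth_incr_inc\<close>)
  have meas: "?S H j \<in> borel_measurable (F (g j))"
    if "j \<le> n" "\<And>k. k < n \<Longrightarrow> H k \<in> borel_measurable (F (g k))" for j H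
    using that grid_bounds[OF g that(1)] ab i by (intro measurable_grid_sum[OF _ grid_restrict[OF g that(1)]]) auto
  have "expectation (\<lambda>\<omega>. ?S H j \<omega> * ?S G j \<omega>) = (\<Sum>k<j. expectation (\<lambda>\<omega>. H k \<omega> * G k \<omega>) * (g (Suc k) - g k))"
    if "j \<le> n" for j using that
  proof (induction j)
    case (Suc j)
    have j: "j < n" "j \<le> n" using Suc.prems by auto
    note mH = m2[OF j(2) H] and mG = m2[OF j(2) G]
    define Z1 Z2 Z3 where "Z1 = (\<lambda>\<omega>. ?S H j \<omega> * G j \<omega>)" and "Z2 = (\<lambda>\<omega>. ?S G j \<omega> * H j \<omega>)" and "Z3 = (\<lambda>\<omega>. H j \<omega> * G j \<omega>)"
    have int: "integrable M Z1" "integrable M Z2" "integrable M Z3" "integrable M (\<lambda>\<omega>. ?S H j \<omega> * ?S G j \<omega>)"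
      unfolding Z1_def Z2_def Z3_def using H(2)[OF j(1)] G(2)[OF j(1)] mH mG by (auto intro: mom2_integrable_mult)
    have zm: "Z1 \<in> borel_measurable (F (g j))" "Z2 \<in> borel_measurable (F (g j))" "Z3 \<in> borel_measurable (F (g j))"
      unfolding Z1_def Z2_def Z3_def using H(1)[OF j(1)] G(1)[OF j(1)] meas[OF j(2) H(1)] meas[OF j(2) G(1)]
      by (auto intro!: borel_measurable_times)
    let ?D = "\<lambda>\<omega>. inc i (g j) (g (Suc j)) \<omega>"
    note I = increment_integrable[OF gj[OF j(1)] _ _ i] and E = increment_expectation[OF gj[OF j(1)] _ _ i]
    have i': "integrable M (\<lambda>\<omega>. Z1 \<omega> * ?D \<omega>)" "integrable M (\<lambda>\<omega>. Z2 \<omega> * ?D \<omega>)" "integrable M (\<lambda>\<omega>. Z3 \<omega> * (?D \<omega>)\<^sup>2)"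
      using I[OF zm(1) int(1), of 1] I[OF zm(2) int(2), of 1] I[OF zm(3) int(3), of 2] by simp_all
    have "?S H (Suc j) \<omega> * ?S G (Suc j) \<omega> = ?S H j \<omega> * ?S G j \<omega> + Z1 \<omega> * ?D \<omega> + Z2 \<omega> * ?D \<omega> + Z3 \<omega> * (?D \<omega>)\<^sup>2" for \<omega>
      by (simp add: Z1_def Z2_def Z3_def power2_eq_square algebra_simps)
    hence "expectation (\<lambda>\<omega>. ?S H (Suc j) \<omega> * ?S G (Suc j) \<omega>) =
       expectation (\<lambda>\<omega>. ?S H j \<omega> * ?S G j \<omega> + Z1 \<omega> * ?D \<omega> + Z2 \<omega> * ?D \<omega> + Z3 \<omega> * (?D \<omega>)\<^sup>2)" by (simp only:)
    also have "\<dots> = expectation (\<lambda>\<omega>. ?S H j \<omega> * ?S G j \<omega>) + expectation Z3 * (g (Suc j) - g j)"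
      using int(4) i' E(1)[OF zm(1) int(1)] E(1)[OF zm(2) int(2)] E(2)[OF zm(3) int(3)] by simp
    finally show ?case using Suc.IH j by (simp add: Z3_def)
  qed simp
  from this[of n] show ?thesis by simp
qed

end

section \<open>The Ito integral\<close>

locale ito = wiener +
  fixes t :: real
  assumes t: "0 \<le> t" "t < T"
begin

definition RS :: "nat \<Rightarrow> (real \<Rightarrow> 'a \<Rightarrow> real) \<Rightarrow> nat \<Rightarrow> (nat \<Rightarrow> real) \<Rightarrow> 'a \<Rightarrow> real" where
  "RS i X n g \<omega> = (\<Sum>k<n. X (g k) \<omega> * inc i (g k) (g (Suc k)) \<omega>)"

definition mesh_le :: "nat \<Rightarrow> (nat \<Rightarrow> real) \<Rightarrow> real \<Rightarrow> bool" where
  "mesh_le n g \<delta> \<longleftrightarrow> (\<forall>k<n. g (Suc k) - g k \<le> \<delta>)"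

text \<open>The exponent 2 is the Brownian one: fourth moments of Wiener increments are 3
  (s-u)^2.\<close>

definition cls :: "real \<Rightarrow> (real \<Rightarrow> 'a \<Rightarrow> real) \<Rightarrow> bool" where
  "cls C X \<longleftrightarrow> C \<ge> 0 \<and> (\<forall>s\<in>{t..T}. X s \<in> borel_measurable (F s) \<and> mom 4 (X s) C) \<and>
     (\<forall>s\<in>{t..T}. \<forall>u\<in>{t..T}. mom 4 (\<lambda>\<omega>. X s \<omega> - X u \<omega>) (C * (s - u)\<^sup>2))"

lemma clsD:
  assumes "cls C X"
  shows "C \<ge> 0" "t \<le> s \<Longrightarrow> s \<le> T \<Longrightarrow> X s \<in> borel_measurable (F s)"
    "t \<le> s \<Longrightarrow> s \<le> T \<Longrightarrow> X s \<in> borel_measurable M"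
    "t \<le> s \<Longrightarrow> s \<le> T \<Longrightarrow> mom 4 (X s) C"
    "t \<le> s \<Longrightarrow> s \<le> T \<Longrightarrow> t \<le> u \<Longrightarrow> u \<le> T \<Longrightarrow> mom 4 (\<lambda>\<omega>. X s \<omega> - X u \<omega>) (C * (s - u)\<^sup>2)"
  using assms unfolding cls_def by (auto dest: momD(1))

text \<open>Half-open cells: repeated grid points produce empty cells, so that x lies in exactly
  one.\<close>

lemma grid_cell:
  assumes g: "grid a b n g" and x: "a \<le> x" "x < b"
  shows "\<exists>q<n. g q \<le> x \<and> x < g (Suc q) \<and> {k\<in>{..<n}. g k \<le> x \<and> x < g (Suc k)} = {q}"
proof -
  have ex: "\<exists>q<j. g q \<le> x \<and> x < g (Suc q)" if "x < g j" "j \<le> n" for j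
    using that
  proof (induction j)
    case 0
    thus ?case using g x by (auto simp: grid_def)
  next
    case (Suc j)
    thus ?case by (cases "x < g j") (auto simp: less_Suc_eq)
  qed
  have "x < g n" using g x by (auto simp: grid_def)
  from ex[OF this order.refl] obtain q where q: "q < n" "g q \<le> x" "x < g (Suc q)" by blast
  have "k = q" if "k < n" "g k \<le> x" "x < g (Suc k)" for k
  proof (rule ccontr)
    assume "k \<noteq> q"
    hence "Suc k \<le> q \<or> Suc q \<le> k" by auto
    thus False using grid_mono[OF g, of "Suc k" q] grid_mono[OF g, of "Suc q" k] that q by auto
  qed
  hence "{k\<in>{..<n}. g k \<le> x \<and> x < g (Suc k)} = {q}" using q by blast
  thus ?thesis using q by blast
qed

text \<open>The difference is one sum over the disjoint union of both families of cells, with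
  reversed sign on the second. At any x exactly one cell of each family is active, so the local
  coefficient is an increment of X between two left endpoints within the larger mesh of each other,
  and \<open>mom4_family\<close> applies.\<close>

lemma RS_compare:
  assumes X: "cls C X" and i: "i \<le> m" and ab: "t \<le> a" "a \<le> b" "b \<le> T"
    and g: "grid a b n g" "mesh_le n g \<delta>" and g': "grid a b n' g'" "mesh_le n' g' \<delta>'"
  shows "mom 4 (\<lambda>\<omega>. RS i X n g \<omega> - RS i X n' g' \<omega>) (\<kappa> * (C * (max \<delta> \<delta>')\<^sup>2) * (b - a)\<^sup>2)"
proof -
  define R :: "(nat + nat) set" where "R = {..<n} <+> {..<n'}"
  define s where "s = case_sum g g'"
  define u where "u = case_sum (\<lambda>k. g (Suc k)) (\<lambda>k. g' (Suc k))"
  define Y where "Y = case_sum (\<lambda>k. X (g k)) (\<lambda>k \<omega>. - X (g' k) \<omega>)"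
  have "mom 4 (\<lambda>\<omega>. \<Sum>r\<in>R. Y r \<omega> * inc i (s r) (u r) \<omega>) (\<kappa> * (C * (max \<delta> \<delta>')\<^sup>2) * (b - a)\<^sup>2)"
  proof (rule mom4_family[OF i _ ab(2,3)])
    show "0 \<le> a" using ab t by auto
    show "finite R" by (simp add: R_def)
    show "0 \<le> C * (max \<delta> \<delta>')\<^sup>2" using clsD(1)[OF X] by simp
  next
    fix r assume "r \<in> R"
    then consider k where "r = Inl k" "k < n" | k where "r = Inr k" "k < n'" by (auto simp: R_def)
    thus "a \<le> s r \<and> s r \<le> u r \<and> u r \<le> b"
    proof cases
      case 1
      thus ?thesis using grid_bounds[OF g(1), of k] grid_bounds[OF g(1), of "Suc k"] grid_mono[OF g(1), of k "Suc k"]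
        by (simp add: s_def u_def)
    next
      case 2
      thus ?thesis using grid_bounds[OF g'(1), of k] grid_bounds[OF g'(1), of "Suc k"] grid_mono[OF g'(1), of k "Suc k"]
        by (simp add: s_def u_def)
    qed
  next
    fix r assume "r \<in> R"
    then consider k where "r = Inl k" "k < n" | k where "r = Inr k" "k < n'" by (auto simp: R_def)
    thus "Y r \<in> borel_measurable (F (s r))"
    proof cases
      case 1
      thus ?thesis using grid_bounds[OF g(1), of k] clsD(2)[OF X, of "g k"] ab by (simp add: s_def Y_def)
    next
      case 2
      thus ?thesis using grid_bounds[OF g'(1), of k] clsD(2)[OF X, of "g' k"] ab by (simp add: s_def Y_def)
    qed
  next
    fix x assume x: "a \<le> x" "x < b"
    obtain q where q: "q < n" "g q \<le> x" "x < g (Suc q)" "{k\<in>{..<n}. g k \<le> x \<and> x < g (Suc k)} = {q}"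
      using grid_cell[OF g(1) x] by blast
    obtain q' where q': "q' < n'" "g' q' \<le> x" "x < g' (Suc q')" "{k\<in>{..<n'}. g' k \<le> x \<and> x < g' (Suc k)} = {q'}"
      using grid_cell[OF g'(1) x] by blast
    have "{r \<in> R. s r \<le> x \<and> x < u r} =
       {k\<in>{..<n}. g k \<le> x \<and> x < g (Suc k)} <+> {k\<in>{..<n'}. g' k \<le> x \<and> x < g' (Suc k)}"
      by (auto simp: R_def s_def u_def)
    hence "(\<Sum>r\<in>{r \<in> R. s r \<le> x \<and> x < u r}. Y r \<omega>) = X (g q) \<omega> - X (g' q') \<omega>" for \<omega>
      by (simp only: q(4) q'(4) sum.Plus finite.intros) (simp add: Y_def)
    moreover have "mom 4 (\<lambda>\<omega>. X (g q) \<omega> - X (g' q') \<omega>) (C * (max \<delta> \<delta>')\<^sup>2)"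
    proof (rule mom_mono)
      show "mom 4 (\<lambda>\<omega>. X (g q) \<omega> - X (g' q') \<omega>) (C * (g q - g' q')\<^sup>2)"
        using grid_bounds[OF g(1), of q] grid_bounds[OF g'(1), of q'] q q' ab by (intro clsD(5)[OF X]) auto
      have "g (Suc q) - g q \<le> \<delta>" "g' (Suc q') - g' q' \<le> \<delta>'" using g(2) g'(2) q(1) q'(1) by (auto simp: mesh_le_def)
      hence "\<bar>g q - g' q'\<bar> \<le> max \<delta> \<delta>'" using q q' by auto
      hence "(g q - g' q')\<^sup>2 \<le> (max \<delta> \<delta>')\<^sup>2" by (metis abs_le_square_iff abs_ge_self order.trans)
      thus "C * (g q - g' q')\<^sup>2 \<le> C * (max \<delta> \<delta>')\<^sup>2" using clsD(1)[OF X] by (intro mult_left_mono) auto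
    qed
    ultimately show "mom 4 (\<lambda>\<omega>. \<Sum>r\<in>{r \<in> R. s r \<le> x \<and> x < u r}. Y r \<omega>) (C * (max \<delta> \<delta>')\<^sup>2)" by (simp only:)
  qed
  moreover have "(\<Sum>r\<in>R. Y r \<omega> * inc i (s r) (u r) \<omega>) = RS i X n g \<omega> - RS i X n' g' \<omega>" for \<omega>
    unfolding R_def RS_def
    by (simp add: sum.Plus Y_def s_def u_def sum_negf)
  ultimately show ?thesis by (simp only:)
qed

definition ug :: "real \<Rightarrow> real \<Rightarrow> nat \<Rightarrow> nat \<Rightarrow> real" where
  "ug a b n k = a + (b - a) * (real k / real (Suc n))"

lemma ug_diff: "ug a b n (Suc k) - ug a b n k = (b - a) / real (Suc n)"
proof -
  have "ug a b n (Suc k) - ug a b n k = (b - a) * ((real (Suc k) - real k) / real (Suc n))"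
    unfolding ug_def diff_divide_distrib right_diff_distrib by simp
  thus ?thesis by simp
qed

lemma ug_grid:
  assumes "a \<le> b"
  shows "grid a b (Suc n) (ug a b n)"
  unfolding grid_def
proof (intro conjI allI impI)
  show "ug a b n 0 = a" by (simp add: ug_def)
  show "ug a b n (Suc n) = b" by (simp add: ug_def del: of_nat_Suc)
  fix k
  have "0 \<le> (b - a) / real (Suc n)" using assms by simp
  thus "ug a b n k \<le> ug a b n (Suc k)" unfolding ug_diff[of a b n k, symmetric] by simp
qed

lemma ug_mesh: "mesh_le (Suc n) (ug a b n) ((b - a) / real (Suc n))"
  by (simp add: mesh_le_def ug_diff del: of_nat_Suc)

lemma tendsto_ug_mesh: "(\<lambda>n. c / real (Suc n)) \<longlonglongrightarrow> 0"
  using LIMSEQ_Suc[OF lim_const_over_n[of c]] by simp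

lemma mom4_RS:
  assumes X: "cls C X" and i: "i \<le> m" and ab: "t \<le> a" "a \<le> b" "b \<le> T" and g: "grid a b n g"
  shows "RS i X n g \<in> borel_measurable (F b)" "mom 4 (RS i X n g) (\<kappa> * C * (b - a)\<^sup>2)"
proof -
  have gk: "t \<le> g k" "g k \<le> T" if "k < n" for k using grid_bounds[OF g, of k] ab that by auto
  have a: "0 \<le> a" using ab t by auto
  show "mom 4 (RS i X n g) (\<kappa> * C * (b - a)\<^sup>2)"
    unfolding RS_def[abs_def]
    by (rule mom4_grid[OF i g a ab(3)]) (use gk clsD[OF X] in auto)
  show "RS i X n g \<in> borel_measurable (F b)"
    unfolding RS_def[abs_def]
    by (rule measurable_grid_sum[OF i g a ab(3)]) (use gk clsD(2)[OF X] in auto)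
qed

text \<open>The estimate ranges over every admissible C and every grid, so that the property depends
  on i, X and s alone and provides an explicit rate.\<close>

definition is_ito :: "nat \<Rightarrow> (real \<Rightarrow> 'a \<Rightarrow> real) \<Rightarrow> real \<Rightarrow> ('a \<Rightarrow> real) \<Rightarrow> bool" where
  "is_ito i X s Y \<longleftrightarrow> Y \<in> borel_measurable (F s) \<and> (\<forall>C n g \<delta>. cls C X \<longrightarrow> grid t s n g \<longrightarrow> mesh_le n g \<delta> \<longrightarrow> 0 \<le> \<delta> \<longrightarrow>
     mom 4 (\<lambda>\<omega>. RS i X n g \<omega> - Y \<omega>) (\<kappa> * C * T\<^sup>2 * \<delta>\<^sup>2))"

text \<open>Riemann sums on uniform grids are Cauchy by \<open>RS_compare\<close>, and an almost
  everywhere convergent subsequence gives Y. An arbitrary grid is then compared with that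
  subsequence: Fatou's lemma preserves the estimate while the mesh of the subsequence drops out of
  the maximum.\<close>

lemma ito_exists:
  assumes X: "cls C X" and i: "i \<le> m" and s: "t \<le> s" "s \<le> T"
  shows "\<exists>Y. is_ito i X s Y"
proof -
  define Z where "Z n = RS i X (Suc n) (ug t s n)" for n
  define d where "d n = (s - t) / real (Suc n)" for n
  have d: "d \<longlonglongrightarrow> 0" unfolding d_def by (rule tendsto_ug_mesh)
  have d0: "d n \<ge> 0" for n using s by (simp add: d_def)
  have dm: "d k \<le> d n" if "n \<le> k" for n k using that s by (simp add: d_def frac_le)
  note gr = ug_grid[OF s(1)] ug_mesh[of _ t s, folded d_def]
  have cmp: "mom 4 (\<lambda>\<omega>. Z n \<omega> - Z k \<omega>) (\<kappa> * (C * (d n)\<^sup>2) * (s - t)\<^sup>2)" if "n \<le> k" for n k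
    using RS_compare[OF X i order.refl s gr gr, of n k] dm[OF that] by (simp add: Z_def max_absorb1)
  have "(\<lambda>n. \<kappa> * (C * (d n)\<^sup>2) * (s - t)\<^sup>2) \<longlonglongrightarrow> \<kappa> * (C * 0\<^sup>2) * (s - t)\<^sup>2"
    by (intro tendsto_intros d)
  hence lim: "(\<lambda>n. \<kappa> * (C * (d n)\<^sup>2) * (s - t)\<^sup>2) \<longlonglongrightarrow> 0" by simp
  have sub: "space (F s) = space M" "sets (F s) \<subseteq> sets M"
    using subalgebra_F[of s] s t by (auto simp: subalgebra_def)
  note RSs = mom4_RS[OF X i order.refl s gr(1), folded Z_def]
  obtain Y r where Y: "Y \<in> borel_measurable (F s)" and r: "strict_mono r" "AE \<omega> in M. (\<lambda>n. Z (r n) \<omega>) \<longlonglongrightarrow> Y \<omega>"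
    using mom4_complete[OF cmp lim RSs(2) RSs(1) sub] by blast
  have YM: "Y \<in> borel_measurable M" using measurable_F[OF Y] s t by auto
  have "mom 4 (\<lambda>\<omega>. RS i X n g \<omega> - Y \<omega>) (\<kappa> * C' * T\<^sup>2 * \<delta>\<^sup>2)"
    if X': "cls C' X" and g: "grid t s n g" "mesh_le n g \<delta>" and \<delta>: "0 \<le> \<delta>" for C' n g \<delta>
  proof (rule mom_mono)
    note RSg = mom4_RS[OF X' i order.refl s g(1)]
    show "mom 4 (\<lambda>\<omega>. RS i X n g \<omega> - Y \<omega>) (\<kappa> * (C' * \<delta>\<^sup>2) * (s - t)\<^sup>2)"
    proof (rule mom_AE_limit)
      show "mom 4 (\<lambda>\<omega>. RS i X n g \<omega> - Z (r k) \<omega>) (\<kappa> * (C' * (max \<delta> (d (r k)))\<^sup>2) * (s - t)\<^sup>2)" for k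
        unfolding Z_def by (rule RS_compare[OF X' i order.refl s g gr])
      show "AE \<omega> in M. (\<lambda>k. RS i X n g \<omega> - Z (r k) \<omega>) \<longlonglongrightarrow> RS i X n g \<omega> - Y \<omega>"
        using r(2) by eventually_elim (intro tendsto_intros)
      have "(\<lambda>k. d (r k)) \<longlonglongrightarrow> 0" using LIMSEQ_subseq_LIMSEQ[OF d r(1)] by (simp add: o_def)
      hence "(\<lambda>k. \<kappa> * (C' * (max \<delta> (d (r k)))\<^sup>2) * (s - t)\<^sup>2) \<longlonglongrightarrow> \<kappa> * (C' * (max \<delta> 0)\<^sup>2) * (s - t)\<^sup>2"
        by (intro tendsto_intros)
      thus "(\<lambda>k. \<kappa> * (C' * (max \<delta> (d (r k)))\<^sup>2) * (s - t)\<^sup>2) \<longlonglongrightarrow> \<kappa> * (C' * \<delta>\<^sup>2) * (s - t)\<^sup>2"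
        using \<delta> by (simp add: max_absorb1)
      show "(\<lambda>\<omega>. RS i X n g \<omega> - Y \<omega>) \<in> borel_measurable M"
        using momD(1)[OF RSg(2)] YM by (intro borel_measurable_diff)
    qed simp
    have "(s - t)\<^sup>2 \<le> T\<^sup>2" using s t by (intro power_mono) auto
    hence "\<kappa> * (C' * \<delta>\<^sup>2) * (s - t)\<^sup>2 \<le> \<kappa> * (C' * \<delta>\<^sup>2) * T\<^sup>2"
      using clsD(1)[OF X'] kappa_pos by (intro mult_left_mono) auto
    thus "\<kappa> * (C' * \<delta>\<^sup>2) * (s - t)\<^sup>2 \<le> \<kappa> * C' * T\<^sup>2 * \<delta>\<^sup>2" by (simp add: mult_ac)
  qed
  thus ?thesis using Y by (auto simp: is_ito_def)
qed

text \<open>Chosen separately for each time s, hence determined only almost surely at fixed times;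
  no path regularity is asserted.\<close>

definition II :: "nat \<Rightarrow> (real \<Rightarrow> 'a \<Rightarrow> real) \<Rightarrow> real \<Rightarrow> 'a \<Rightarrow> real" where
  "II i X s = (SOME Y. is_ito i X s Y)"

context
  fixes C X i
  assumes X: "cls C X" and i: "i \<le> m"
begin

lemma is_ito_II: "t \<le> s \<Longrightarrow> s \<le> T \<Longrightarrow> is_ito i X s (II i X s)"
  unfolding II_def by (rule someI_ex[OF ito_exists[OF X i]])

lemma II_measurable:
  assumes "t \<le> s" "s \<le> T"
  shows "II i X s \<in> borel_measurable (F s)" "II i X s \<in> borel_measurable M"
proof -
  show "II i X s \<in> borel_measurable (F s)" using is_ito_II[OF assms] by (simp add: is_ito_def)
  thus "II i X s \<in> borel_measurable M" using assms t by (intro measurable_F[of _ s]) auto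
qed

lemma II_approx:
  assumes "t \<le> s" "s \<le> T" "grid t s n g" "mesh_le n g \<delta>" "0 \<le> \<delta>"
  shows "mom 4 (\<lambda>\<omega>. RS i X n g \<omega> - II i X s \<omega>) (\<kappa> * C * T\<^sup>2 * \<delta>\<^sup>2)"
  using is_ito_II[OF assms(1,2)] X assms unfolding is_ito_def by blast

lemma II_approx_ug:
  assumes "t \<le> s" "s \<le> T"
  shows "mom 4 (\<lambda>\<omega>. RS i X (Suc n) (ug t s n) \<omega> - II i X s \<omega>) (\<kappa> * C * T\<^sup>2 * ((s - t) / real (Suc n))\<^sup>2)"
  using assms by (intro II_approx ug_grid ug_mesh) auto

lemma II_unique:
  assumes s: "t \<le> s" "s \<le> T"
    and Y: "\<And>n. mom 2 (\<lambda>\<omega>. RS i X (Suc n) (ug t s n) \<omega> - Y \<omega>) (e n)" "e \<longlonglongrightarrow> 0"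
  shows "AE \<omega> in M. II i X s \<omega> = Y \<omega>"
proof -
  define f where "f n = sqrt (\<kappa> * C * T\<^sup>2 * ((s - t) / real (Suc n))\<^sup>2)" for n
  have "mom 2 (\<lambda>\<omega>. II i X s \<omega> - Y \<omega>) 0"
  proof (rule mom_limit_bound)
    fix n
    have "mom 2 (\<lambda>\<omega>. (RS i X (Suc n) (ug t s n) \<omega> - Y \<omega>) - (RS i X (Suc n) (ug t s n) \<omega> - II i X s \<omega>)) (2 * (e n + f n))"
      unfolding f_def by (intro mom2_diff Y mom4_imp_mom2_sqrt II_approx_ug s)
    thus "mom 2 (\<lambda>\<omega>. II i X s \<omega> - Y \<omega>) (2 * (e n + f n))" by simp
  next
    have "(\<lambda>n. 2 * (e n + f n)) \<longlonglongrightarrow> 2 * (0 + sqrt (\<kappa> * C * T\<^sup>2 * 0\<^sup>2))"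
      unfolding f_def by (intro tendsto_intros Y tendsto_ug_mesh)
    thus "(\<lambda>n. 2 * (e n + f n)) \<longlonglongrightarrow> 0" by simp
  qed
  from mom_zero_imp_AE[OF this] show ?thesis by auto
qed

lemma II_start: "AE \<omega> in M. II i X t \<omega> = 0"
proof (rule II_unique)
  have z: "RS i X (Suc n) (ug t t n) \<omega> - 0 = 0" for n \<omega> by (simp add: RS_def ug_def)
  show "mom 2 (\<lambda>\<omega>. RS i X (Suc n) (ug t t n) \<omega> - 0) 0" for n unfolding z by (rule mom_0) simp
qed (use t in auto)

lemma RS_concat:
  assumes "grid a b n g" "grid b c n' g'" "mesh_le n g \<delta>" "mesh_le n' g' \<delta>"
  defines "h \<equiv> \<lambda>k. if k \<le> n then g k else g' (k - n)"
  shows "grid a c (n + n') h" "mesh_le (n + n') h \<delta>"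
    "RS i X (n + n') h \<omega> = RS i X n g \<omega> + RS i X n' g' \<omega>"
proof -
  have h1: "h k = g k" if "k \<le> n" for k using that by (simp add: h_def)
  have h2: "h (n + k) = g' k" for k using assms(1,2) by (simp add: h_def grid_def)
  have c: "k < n \<or> (\<exists>j<n'. k = n + j)" if "k < n + n'" for k
    using that by (cases "k < n") (auto intro!: exI[of _ "k - n"])
  show "mesh_le (n + n') h \<delta>" unfolding mesh_le_def
  proof (intro allI impI)
    fix k assume "k < n + n'"
    from c[OF this] show "h (Suc k) - h k \<le> \<delta>"
      using assms(3,4) h1 h2 by (auto simp: mesh_le_def simp flip: add_Suc_right)
  qed
  show "grid a c (n + n') h" unfolding grid_def
  proof (intro conjI allI impI)
    fix k assume "k < n + n'"
    from c[OF this] show "h k \<le> h (Suc k)"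
      using assms(1,2) h1 h2 by (auto simp: grid_def simp flip: add_Suc_right)
  qed (use assms(1,2) h1[of 0] h2[of n'] in \<open>auto simp: grid_def\<close>)
  have "(\<Sum>k<n + n'. f k) = (\<Sum>k<n. f k) + (\<Sum>k<n'. f (n + k))" for f :: "nat \<Rightarrow> real"
    by (induction n') (simp_all add: add.assoc)
  thus "RS i X (n + n') h \<omega> = RS i X n g \<omega> + RS i X n' g' \<omega>"
    unfolding RS_def using h1 h2 by (simp flip: add_Suc_right)
qed

text \<open>The uniform grid on [a, b] is compared with its single-cell grid. A mesh of size b - a
  and an interval of length b - a each contribute a square, so the error is of order (b-a)^4,
  against (b-a)^2 for the main term. The approximation errors of the integrals vanish as n
  grows.\<close>

lemma II_increment:
  assumes ab: "t \<le> a" "a \<le> b" "b \<le> T"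
  shows "mom 4 (\<lambda>\<omega>. II i X b \<omega> - II i X a \<omega> - X a \<omega> * inc i a b \<omega>) (8 * (\<kappa> * C) * (b - a) ^ 4)"
proof (rule mom_limit_bound)
  fix n
  \<comment> \<open>T/(n+1) bounds the meshes on [t, a] and on [a, b] at the same time;
    \<open>h\<close> joins the two grids, and \<open>g'\<close> is the single cell, whose Riemann
    sum is the leading term \<open>X a * inc i a b\<close>.\<close>
  define \<delta> where "\<delta> = T / real (Suc n)"
  define h where "h k = (if k \<le> Suc n then ug t a n k else ug a b n (k - Suc n))" for k
  define g' where "g' k = (if k = 0 then a else b)" for k :: nat
  have \<delta>: "\<delta> \<ge> 0" using t by (simp add: \<delta>_def)
  have ms: "mesh_le (Suc n) (ug x y n) \<delta>" if "t \<le> x" "y \<le> T" for x y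
    unfolding mesh_le_def ug_diff \<delta>_def using that t by (auto intro!: divide_right_mono)
  note cc = RS_concat[OF ug_grid[OF ab(1)] ug_grid[OF ab(2)] ms ms, folded h_def]
  have 1: "mom 4 (\<lambda>\<omega>. RS i X (Suc n + Suc n) h \<omega> - II i X b \<omega>) (\<kappa> * C * T\<^sup>2 * \<delta>\<^sup>2)"
    using cc(1,2) \<delta> ab by (intro II_approx) auto
  have 2: "mom 4 (\<lambda>\<omega>. RS i X (Suc n) (ug t a n) \<omega> - II i X a \<omega>) (\<kappa> * C * T\<^sup>2 * \<delta>\<^sup>2)"
    using ug_grid[OF ab(1)] ms[of t a] \<delta> ab by (intro II_approx) auto
  have 3: "mom 4 (\<lambda>\<omega>. RS i X (Suc n) (ug a b n) \<omega> - RS i X 1 g' \<omega>) (\<kappa> * (C * (max ((b - a) / real (Suc n)) (b - a))\<^sup>2) * (b - a)\<^sup>2)"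
    using ab by (intro RS_compare[OF X i ab ug_grid[OF ab(2)] ug_mesh]) (auto simp: grid_def mesh_le_def g'_def)
  have mx: "max ((b - a) / real (Suc n)) (b - a) = b - a"
    using ab divide_left_mono[of 1 "real (Suc n)" "b - a"] by (simp add: max_def)
  have 3: "mom 4 (\<lambda>\<omega>. RS i X (Suc n) (ug a b n) \<omega> - X a \<omega> * inc i a b \<omega>) (\<kappa> * C * (b - a) ^ 4)"
    using 3 unfolding mx by (simp add: RS_def g'_def mult_ac power4_eq_xxxx power2_eq_square)
  have "mom 4 (\<lambda>\<omega>. (RS i X (Suc n) (ug a b n) \<omega> - X a \<omega> * inc i a b \<omega>) +
      ((RS i X (Suc n) (ug t a n) \<omega> - II i X a \<omega>) - (RS i X (Suc n + Suc n) h \<omega> - II i X b \<omega>)))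
      (8 * (\<kappa> * C * (b - a) ^ 4 + 8 * (\<kappa> * C * T\<^sup>2 * \<delta>\<^sup>2 + \<kappa> * C * T\<^sup>2 * \<delta>\<^sup>2)))"
    by (intro mom4_add mom4_diff 1 2 3)
  moreover have "RS i X (Suc n + Suc n) h \<omega> = RS i X (Suc n) (ug t a n) \<omega> + RS i X (Suc n) (ug a b n) \<omega>" for \<omega>
    using ab by (intro cc(3)) auto
  ultimately show "mom 4 (\<lambda>\<omega>. II i X b \<omega> - II i X a \<omega> - X a \<omega> * inc i a b \<omega>)
     (8 * (\<kappa> * C * (b - a) ^ 4 + 8 * (\<kappa> * C * T\<^sup>2 * (T / real (Suc n))\<^sup>2 + \<kappa> * C * T\<^sup>2 * (T / real (Suc n))\<^sup>2)))"
    by (simp add: \<delta>_def algebra_simps)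
next
  have "(\<lambda>n. 8 * (\<kappa> * C * (b - a) ^ 4 + 8 * (\<kappa> * C * T\<^sup>2 * (T / real (Suc n))\<^sup>2 + \<kappa> * C * T\<^sup>2 * (T / real (Suc n))\<^sup>2)))
     \<longlonglongrightarrow> 8 * (\<kappa> * C * (b - a) ^ 4 + 8 * (\<kappa> * C * T\<^sup>2 * 0\<^sup>2 + \<kappa> * C * T\<^sup>2 * 0\<^sup>2))"
    by (intro tendsto_intros tendsto_ug_mesh)
  thus "(\<lambda>n. 8 * (\<kappa> * C * (b - a) ^ 4 + 8 * (\<kappa> * C * T\<^sup>2 * (T / real (Suc n))\<^sup>2 + \<kappa> * C * T\<^sup>2 * (T / real (Suc n))\<^sup>2)))
     \<longlonglongrightarrow> 8 * (\<kappa> * C) * (b - a) ^ 4" by (simp add: mult_ac)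
qed

lemma mom4_mult_inc:
  assumes ab: "t \<le> a" "a \<le> b" "b \<le> T"
  shows "mom 4 (\<lambda>\<omega>. X a \<omega> * inc i a b \<omega>) (\<kappa> * C * (b - a)\<^sup>2)"
  using mom4_RS(2)[OF X i ab, of 1 "\<lambda>k. if k = 0 then a else b"] ab by (simp add: grid_def RS_def[abs_def])

lemma II_diff_mom4:
  assumes ab: "t \<le> a" "a \<le> b" "b \<le> T"
  shows "mom 4 (\<lambda>\<omega>. II i X b \<omega> - II i X a \<omega>) (8 * \<kappa> * C * (8 * T\<^sup>2 + 1) * (b - a)\<^sup>2)"
proof (rule mom_mono)
  have "mom 4 (\<lambda>\<omega>. (II i X b \<omega> - II i X a \<omega> - X a \<omega> * inc i a b \<omega>) + X a \<omega> * inc i a b \<omega>)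
     (8 * (8 * (\<kappa> * C) * (b - a) ^ 4 + \<kappa> * C * (b - a)\<^sup>2))"
    by (intro mom4_add II_increment mom4_mult_inc ab)
  thus "mom 4 (\<lambda>\<omega>. II i X b \<omega> - II i X a \<omega>) (8 * (8 * (\<kappa> * C) * (b - a) ^ 4 + \<kappa> * C * (b - a)\<^sup>2))" by simp
  have "(b - a)\<^sup>2 \<le> T\<^sup>2" using ab t by (intro power_mono) auto
  hence "(b - a)\<^sup>2 * (b - a)\<^sup>2 \<le> T\<^sup>2 * (b - a)\<^sup>2" by (intro mult_right_mono) auto
  hence "\<kappa> * C * (b - a) ^ 4 \<le> \<kappa> * C * (T\<^sup>2 * (b - a)\<^sup>2)"
    using clsD(1)[OF X] kappa_pos by (intro mult_left_mono) (auto simp: power4_eq_xxxx power2_eq_square)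
  thus "8 * (8 * (\<kappa> * C) * (b - a) ^ 4 + \<kappa> * C * (b - a)\<^sup>2) \<le> 8 * \<kappa> * C * (8 * T\<^sup>2 + 1) * (b - a)\<^sup>2"
    by (simp add: algebra_simps)
qed

text \<open>The class is stable under integration, so integrals can be iterated. The factor 1 + T^2
  makes one constant serve for sizes and increments.\<close>

lemma cls_II: "cls (8 * \<kappa> * C * (8 * T\<^sup>2 + 1) * (1 + T\<^sup>2)) (II i X)"
proof -
  define K where "K = 8 * \<kappa> * C * (8 * T\<^sup>2 + 1)"
  have K: "K \<ge> 0" using clsD(1)[OF X] kappa_pos by (simp add: K_def)
  have d: "mom 4 (\<lambda>\<omega>. II i X s \<omega> - II i X u \<omega>) (K * (s - u)\<^sup>2)" if "s \<in> {t..T}" "u \<in> {t..T}" for s u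
  proof (cases "s \<le> u")
    case True
    have "mom 4 (\<lambda>\<omega>. II i X u \<omega> - II i X s \<omega>) (K * (u - s)\<^sup>2)"
      unfolding K_def using that True by (intro II_diff_mom4) auto
    thus ?thesis by (subst power2_commute) (rule mom_minus, auto)
  next
    case False
    thus ?thesis unfolding K_def using that by (intro II_diff_mom4) auto
  qed
  \<comment> \<open>The integral over [t, t] vanishes almost surely, so sizes are increments from
    t.\<close>
  have v: "mom 4 (II i X s) (K * T\<^sup>2)" if "s \<in> {t..T}" for s
  proof (rule mom_AE_cong)
    have "(s - t)\<^sup>2 \<le> T\<^sup>2" using that t by (intro power_mono) auto
    thus "mom 4 (\<lambda>\<omega>. II i X s \<omega> - II i X t \<omega>) (K * T\<^sup>2)"
      using d[of s t] that t K by (intro mom_mono[OF d]) (auto intro: mult_left_mono)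
    show "AE \<omega> in M. II i X s \<omega> - II i X t \<omega> = II i X s \<omega>" using II_start by eventually_elim simp
    show "II i X s \<in> borel_measurable M" using II_measurable(2)[of s] that by auto
  qed
  have le: "K * r \<le> K * (1 + T\<^sup>2) * r" if "r \<ge> 0" for r
    using K that mult_right_mono[of K "K * (1 + T\<^sup>2)" r] by (simp add: algebra_simps)
  show ?thesis unfolding cls_def K_def[symmetric]
  proof (intro conjI ballI)
    show "0 \<le> K * (1 + T\<^sup>2)" using K by simp
    fix s assume s: "s \<in> {t..T}"
    show "II i X s \<in> borel_measurable (F s)" using II_measurable(1)[of s] s by auto
    show "mom 4 (II i X s) (K * (1 + T\<^sup>2))" using K by (intro mom_mono[OF v[OF s]]) (simp add: algebra_simps)
    fix u assume "u \<in> {t..T}"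
    with s show "mom 4 (\<lambda>\<omega>. II i X s \<omega> - II i X u \<omega>) (K * (1 + T\<^sup>2) * (s - u)\<^sup>2)"
      by (intro mom_mono[OF d] le) auto
  qed
qed

end

end

section \<open>Riemann sums and mean-square null sequences\<close>

lemma riemann_grid:
  fixes h :: "real \<Rightarrow> real"
  assumes g: "\<And>k. k < n \<Longrightarrow> g k \<le> g (Suc k)" and h: "continuous_on {g 0..g n} h"
    and e: "\<And>k x. k < n \<Longrightarrow> g k \<le> x \<Longrightarrow> x \<le> g (Suc k) \<Longrightarrow> \<bar>h x - h (g k)\<bar> \<le> e"
  shows "\<bar>(\<Sum>k<n. h (g k) * (g (Suc k) - g k)) - integral {g 0..g n} h\<bar> \<le> e * (g n - g 0)"
  using assms
proof (induction n)
  case (Suc n)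
  note g = Suc.prems(1)
  have mono: "g 0 \<le> g j" if "j \<le> Suc n" for j
    using that
  proof (induction j)
    case (Suc j)
    thus ?case using g[of j] by simp
  qed simp
  have le: "g n \<le> g (Suc n)" using Suc.prems(1) by auto
  have cn: "continuous_on {g 0..g n} h" "continuous_on {g n..g (Suc n)} h"
    using Suc.prems(2) le mono[of n] by (auto intro: continuous_on_subset)
  have IH: "\<bar>(\<Sum>k<n. h (g k) * (g (Suc k) - g k)) - integral {g 0..g n} h\<bar> \<le> e * (g n - g 0)"
    using Suc.prems cn(1) by (intro Suc.IH) auto
  have "integral {g 0..g n} h + integral {g n..g (Suc n)} h = integral {g 0..g (Suc n)} h"
    using mono[of n] le Suc.prems(2) by (intro Henstock_Kurzweil_Integration.integral_combine integrable_continuous_real) auto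
  moreover have "\<bar>h (g n) * (g (Suc n) - g n) - integral {g n..g (Suc n)} h\<bar> \<le> e * (g (Suc n) - g n)"
  proof -
    have "h (g n) * (g (Suc n) - g n) - integral {g n..g (Suc n)} h = integral {g n..g (Suc n)} (\<lambda>x. h (g n) - h x)"
      using le cn(2) by (subst Henstock_Kurzweil_Integration.integral_diff) (auto intro: integrable_continuous_real)
    also have "norm (integral {g n..g (Suc n)} (\<lambda>x. h (g n) - h x)) \<le> e * (g (Suc n) - g n)"
      using le cn(2) Suc.prems(3)[of n] by (intro integral_bound) (auto intro!: continuous_intros simp: abs_minus_commute)
    finally show ?thesis by simp
  qed
  ultimately show ?case using IH by (simp add: algebra_simps abs_le_iff)
qed simp

context prob_space
begin

definition ms0 :: "(nat \<Rightarrow> 'a \<Rightarrow> real) \<Rightarrow> bool" where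
  "ms0 A \<longleftrightarrow> (\<exists>e. e \<longlonglongrightarrow> 0 \<and> (\<forall>n. mom 2 (A n) (e n)))"

lemma ms0I: "(\<And>n. mom 2 (A n) (e n)) \<Longrightarrow> e \<longlonglongrightarrow> 0 \<Longrightarrow> ms0 A"
  by (auto simp: ms0_def)

lemma ms0_add: "ms0 A \<Longrightarrow> ms0 B \<Longrightarrow> ms0 (\<lambda>n \<omega>. A n \<omega> + B n \<omega>)"
proof -
  assume "ms0 A" "ms0 B"
  then obtain e f where "e \<longlonglongrightarrow> 0" "f \<longlonglongrightarrow> 0" "\<And>n. mom 2 (A n) (e n)" "\<And>n. mom 2 (B n) (f n)"
    by (auto simp: ms0_def)
  moreover from this have "(\<lambda>n. 2 * (e n + f n)) \<longlonglongrightarrow> 2 * (0 + 0)" by (intro tendsto_intros)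
  ultimately show ?thesis by (intro ms0I[of _ "\<lambda>n. 2 * (e n + f n)"] mom2_add) auto
qed

lemma ms0_cmult: "ms0 A \<Longrightarrow> ms0 (\<lambda>n \<omega>. c * A n \<omega>)"
proof -
  assume "ms0 A"
  then obtain e where "e \<longlonglongrightarrow> 0" "\<And>n. mom 2 (A n) (e n)" by (auto simp: ms0_def)
  moreover from this have "(\<lambda>n. c\<^sup>2 * e n) \<longlonglongrightarrow> c\<^sup>2 * 0" by (intro tendsto_intros)
  ultimately show ?thesis by (intro ms0I[of _ "\<lambda>n. c\<^sup>2 * e n"] mom_cmult) auto
qed

lemma ms0_diff: "ms0 A \<Longrightarrow> ms0 B \<Longrightarrow> ms0 (\<lambda>n \<omega>. A n \<omega> - B n \<omega>)"
  using ms0_add[of A "\<lambda>n \<omega>. (-1) * B n \<omega>"] ms0_cmult[of B "-1"] by simp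

lemma ms0_zero: "ms0 (\<lambda>n \<omega>. 0)"
  by (rule ms0I[where e = "\<lambda>_. 0"]) (auto intro: mom_0)

lemma ms0_AE_cong:
  assumes "ms0 A" "\<And>n. AE \<omega> in M. A n \<omega> = B n \<omega>" "\<And>n. B n \<in> borel_measurable M"
  shows "ms0 B"
  using assms(1) mom_AE_cong[OF _ assms(2,3)] by (auto simp: ms0_def)

text \<open>The device behind all almost sure identities below: the difference of the two sides is
  written as a null sequence that happens not to depend on n.\<close>

lemma ms0_const: "ms0 (\<lambda>n. X) \<Longrightarrow> AE \<omega> in M. X \<omega> = 0"
  using mom_zero_imp_AE[of 2 X] mom_limit_bound[of 2 X] by (auto simp: ms0_def)

lemma ms0_mom4:
  assumes "\<And>n. mom 4 (A n) (e n)" "e \<longlonglongrightarrow> 0"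
  shows "ms0 A"
proof (rule ms0I)
  show "mom 2 (A n) (sqrt (e n))" for n by (rule mom4_imp_mom2_sqrt[OF assms(1)])
  show "(\<lambda>n. sqrt (e n)) \<longlonglongrightarrow> 0" using tendsto_real_sqrt[OF assms(2)] by simp
qed

lemma ms0_mult:
  assumes "\<And>n. mom 4 (A n) (e n)" "e \<longlonglongrightarrow> 0" "\<And>n. mom 4 (B n) c"
  shows "ms0 (\<lambda>n \<omega>. A n \<omega> * B n \<omega>)"
proof (rule ms0I)
  have c: "c \<ge> 0" using mom_nonneg[OF assms(3)] by simp
  have e: "e n \<ge> 0" for n using mom_nonneg[OF assms(1)] by simp
  show "mom 2 (\<lambda>\<omega>. A n \<omega> * B n \<omega>) (sqrt (e n) * sqrt c)" for n
    using assms c e by (intro mom4_mult) auto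
  have "(\<lambda>n. sqrt (e n) * sqrt c) \<longlonglongrightarrow> sqrt 0 * sqrt c" by (intro tendsto_intros assms)
  thus "(\<lambda>n. sqrt (e n) * sqrt c) \<longlonglongrightarrow> 0" by simp
qed

lemma mom2_Cauchy_Schwarz:
  assumes "mom 2 X a" "mom 2 Y b"
  shows "\<bar>expectation (\<lambda>\<omega>. X \<omega> * Y \<omega>)\<bar> \<le> sqrt a * sqrt b"
proof (rule LIMSEQ_le_const)
  have "(\<lambda>n. (sqrt a + 1 / real (Suc n)) * (sqrt b + 1 / real (Suc n))) \<longlonglongrightarrow> (sqrt a + 0) * (sqrt b + 0)"
    by (intro tendsto_intros LIMSEQ_Suc[OF lim_1_over_n])
  thus "(\<lambda>n. (sqrt a + 1 / real (Suc n)) * (sqrt b + 1 / real (Suc n))) \<longlonglongrightarrow> sqrt a * sqrt b" by simp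
  have "\<bar>expectation (\<lambda>\<omega>. X \<omega> * Y \<omega>)\<bar> \<le> (sqrt a + 1 / real (Suc n)) * (sqrt b + 1 / real (Suc n))" for n
  proof -
    define u v where "u = sqrt a + 1 / real (Suc n)" and "v = sqrt b + 1 / real (Suc n)"
    have ab: "a \<ge> 0" "b \<ge> 0" using mom_nonneg[OF assms(1)] mom_nonneg[OF assms(2)] by auto
    have uv: "u > 0" "v > 0" unfolding u_def v_def using ab by (auto intro!: add_nonneg_pos)
    have "(sqrt a)\<^sup>2 \<le> u\<^sup>2" "(sqrt b)\<^sup>2 \<le> v\<^sup>2" unfolding u_def v_def using ab by (intro power_mono; simp)+
    hence "a \<le> u\<^sup>2" "b \<le> v\<^sup>2" using ab by auto
    hence "\<bar>expectation (\<lambda>\<omega>. X \<omega> * Y \<omega>)\<bar> \<le> (v / u * u\<^sup>2 + v\<^sup>2 / (v / u)) / 2"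
      using assms uv by (intro mom2_expectation_abs_le) (auto intro: mom_mono)
    also have "\<dots> = u * v" using uv by (simp add: power2_eq_square)
    finally show ?thesis by (simp add: u_def v_def)
  qed
  thus "\<exists>N. \<forall>n\<ge>N. \<bar>expectation (\<lambda>\<omega>. X \<omega> * Y \<omega>)\<bar> \<le> (sqrt a + 1 / real (Suc n)) * (sqrt b + 1 / real (Suc n))" by blast
qed

lemma ms0_expectation:
  assumes "ms0 A" "\<And>n. mom 2 (B n) c"
  shows "(\<lambda>n. expectation (\<lambda>\<omega>. A n \<omega> * B n \<omega>)) \<longlonglongrightarrow> 0"
proof -
  obtain e where e: "e \<longlonglongrightarrow> 0" "\<And>n. mom 2 (A n) (e n)" using assms(1) by (auto simp: ms0_def)
  have "(\<lambda>n. sqrt (e n) * sqrt c) \<longlonglongrightarrow> sqrt 0 * sqrt c" by (intro tendsto_intros e)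
  hence *: "(\<lambda>n. sqrt (e n) * sqrt c) \<longlonglongrightarrow> 0" by simp
  show ?thesis
    by (rule Lim_null_comparison[OF _ *]) (use mom2_Cauchy_Schwarz[OF e(2) assms(2)] in auto)
qed

end

section \<open>Admissible integrands and properties of the integral\<close>

context ito
begin

text \<open>Deterministic weights of this kind preserve the class: their increments obey K^4 (s-u)^4
  \<le> K^4 T^2 (s-u)^2, which is the required order.\<close>

definition lipf :: "(real \<Rightarrow> real) \<Rightarrow> bool" where
  "lipf f \<longleftrightarrow> (\<exists>K\<ge>0. \<forall>s\<in>{t..T}. \<forall>u\<in>{t..T}. \<bar>f s - f u\<bar> \<le> K * \<bar>s - u\<bar>)"

lemma lipfE:
  assumes "lipf f"
  obtains B K where "B \<ge> 0" "K \<ge> 0" "\<And>s. s \<in> {t..T} \<Longrightarrow> \<bar>f s\<bar> \<le> B"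
    "\<And>s u. s \<in> {t..T} \<Longrightarrow> u \<in> {t..T} \<Longrightarrow> \<bar>f s - f u\<bar> \<le> K * \<bar>s - u\<bar>"
proof -
  obtain K where K: "K \<ge> 0" "\<And>s u. s \<in> {t..T} \<Longrightarrow> u \<in> {t..T} \<Longrightarrow> \<bar>f s - f u\<bar> \<le> K * \<bar>s - u\<bar>"
    using assms by (auto simp: lipf_def)
  have "\<bar>f s\<bar> \<le> \<bar>f t\<bar> + K * T" if s: "s \<in> {t..T}" for s
  proof -
    have "\<bar>f s - f t\<bar> \<le> K * \<bar>s - t\<bar>" using K(2)[of s t] s t by auto
    also have "\<dots> \<le> K * T" using K(1) s t by (intro mult_left_mono) auto
    finally show ?thesis by linarith
  qed
  moreover have "\<bar>f t\<bar> + K * T \<ge> 0" using K t by auto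
  ultimately show ?thesis using K that by blast
qed

lemma lipfD:
  assumes "lipf f"
  shows "\<exists>B K. B \<ge> 0 \<and> K \<ge> 0 \<and> (\<forall>s\<in>{t..T}. \<bar>f s\<bar> \<le> B) \<and>
    (\<forall>s\<in>{t..T}. \<forall>u\<in>{t..T}. \<bar>f s - f u\<bar> \<le> K * \<bar>s - u\<bar>)"
  by (rule lipfE[OF assms]) blast

lemma lipf_continuous_on: "lipf f \<Longrightarrow> continuous_on {t..T} f"
proof -
  assume "lipf f"
  then obtain K where "K \<ge> 0" "\<forall>s\<in>{t..T}. \<forall>u\<in>{t..T}. \<bar>f s - f u\<bar> \<le> K * \<bar>s - u\<bar>" by (auto simp: lipf_def)
  hence "K-lipschitz_on {t..T} f" by (intro lipschitz_onI) (auto simp: dist_real_def)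
  thus ?thesis by (rule lipschitz_on_continuous_on)
qed

lemma lipf_const: "lipf (\<lambda>_. c)"
  by (auto simp: lipf_def intro!: exI[of _ 0])

lemma lipf_id: "lipf (\<lambda>s. s)"
  by (auto simp: lipf_def intro!: exI[of _ 1])

lemma lipf_add:
  assumes "lipf f" "lipf g"
  shows "lipf (\<lambda>s. f s + g s)"
proof -
  obtain B K where f: "K \<ge> 0" "\<And>s u. s \<in> {t..T} \<Longrightarrow> u \<in> {t..T} \<Longrightarrow> \<bar>f s - f u\<bar> \<le> K * \<bar>s - u\<bar>" using lipfD[OF assms(1)] by blast
  obtain B' K' where g: "K' \<ge> 0" "\<And>s u. s \<in> {t..T} \<Longrightarrow> u \<in> {t..T} \<Longrightarrow> \<bar>g s - g u\<bar> \<le> K' * \<bar>s - u\<bar>" using lipfD[OF assms(2)] by blast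
  have "\<bar>f s + g s - (f u + g u)\<bar> \<le> (K + K') * \<bar>s - u\<bar>" if "s \<in> {t..T}" "u \<in> {t..T}" for s u
  proof -
    have "\<bar>f s + g s - (f u + g u)\<bar> \<le> \<bar>f s - f u\<bar> + \<bar>g s - g u\<bar>" by linarith
    also have "\<dots> \<le> K * \<bar>s - u\<bar> + K' * \<bar>s - u\<bar>" by (intro add_mono f g that)
    finally show ?thesis by (simp add: algebra_simps)
  qed
  thus ?thesis using f g unfolding lipf_def by (intro exI[of _ "K + K'"]) auto
qed

lemma lipf_mult:
  assumes "lipf f" "lipf g"
  shows "lipf (\<lambda>s. f s * g s)"
proof -
  obtain B K where f: "B \<ge> 0" "K \<ge> 0" "\<And>s. s \<in> {t..T} \<Longrightarrow> \<bar>f s\<bar> \<le> B"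
    "\<And>s u. s \<in> {t..T} \<Longrightarrow> u \<in> {t..T} \<Longrightarrow> \<bar>f s - f u\<bar> \<le> K * \<bar>s - u\<bar>" using lipfD[OF assms(1)] by blast
  obtain B' K' where g: "B' \<ge> 0" "K' \<ge> 0" "\<And>s. s \<in> {t..T} \<Longrightarrow> \<bar>g s\<bar> \<le> B'"
    "\<And>s u. s \<in> {t..T} \<Longrightarrow> u \<in> {t..T} \<Longrightarrow> \<bar>g s - g u\<bar> \<le> K' * \<bar>s - u\<bar>" using lipfD[OF assms(2)] by blast
  have "\<bar>f s * g s - f u * g u\<bar> \<le> (B * K' + B' * K) * \<bar>s - u\<bar>" if "s \<in> {t..T}" "u \<in> {t..T}" for s u
  proof -
    have "f s * g s - f u * g u = f s * (g s - g u) + g u * (f s - f u)" by (simp add: algebra_simps)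
    hence "\<bar>f s * g s - f u * g u\<bar> \<le> \<bar>f s\<bar> * \<bar>g s - g u\<bar> + \<bar>g u\<bar> * \<bar>f s - f u\<bar>"
      by (metis abs_mult abs_triangle_ineq)
    also have "\<dots> \<le> B * (K' * \<bar>s - u\<bar>) + B' * (K * \<bar>s - u\<bar>)" by (intro add_mono mult_mono f g that) auto
    finally show ?thesis by (simp add: algebra_simps)
  qed
  thus ?thesis using f g unfolding lipf_def by (intro exI[of _ "B * K' + B' * K"]) auto
qed

lemma lipf_power: "lipf f \<Longrightarrow> lipf (\<lambda>s. f s ^ n)"
  by (induction n) (auto intro: lipf_const lipf_mult)

lemma lipf_diff: "lipf f \<Longrightarrow> lipf g \<Longrightarrow> lipf (\<lambda>s. f s - g s)"
  using lipf_add[of f "\<lambda>s. (-1) * g s"] lipf_mult[OF lipf_const, of g "-1"] by simp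

lemma lipf_integral:
  assumes "continuous_on {t..T} f"
  shows "lipf (\<lambda>s. integral {t..s} f)"
proof -
  obtain B where B: "\<And>x. x \<in> {t..T} \<Longrightarrow> \<bar>f x\<bar> \<le> B" "B \<ge> 0"
  proof -
    obtain B where "\<forall>x\<in>{t..T}. \<bar>f x\<bar> \<le> B"
      using compact_imp_bounded[OF compact_continuous_image[OF assms compact_Icc]] by (auto simp: bounded_iff)
    moreover from this have "B \<ge> 0" using t by (auto intro: order.trans[of _ "\<bar>f t\<bar>"])
    ultimately show ?thesis using that by blast
  qed
  have *: "\<bar>integral {t..u} f - integral {t..s} f\<bar> \<le> B * (u - s)" if "t \<le> s" "s \<le> u" "u \<le> T" for s u
  proof -
    have cu: "continuous_on {t..u} f" "continuous_on {s..u} f" using assms that by (auto intro: continuous_on_subset)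
    have "integral {t..s} f + integral {s..u} f = integral {t..u} f"
      using that cu by (intro Henstock_Kurzweil_Integration.integral_combine integrable_continuous_real) auto
    moreover have "norm (integral {s..u} f) \<le> B * (u - s)"
      using that B cu by (intro integral_bound) auto
    ultimately show ?thesis by (auto simp: abs_le_iff)
  qed
  have "\<bar>integral {t..s} f - integral {t..u} f\<bar> \<le> B * \<bar>s - u\<bar>" if "s \<in> {t..T}" "u \<in> {t..T}" for s u
    using *[of s u] *[of u s] that by (cases "s \<le> u") (auto simp: abs_minus_commute)
  thus ?thesis using B unfolding lipf_def by blast
qed

definition adm :: "(real \<Rightarrow> 'a \<Rightarrow> real) \<Rightarrow> bool" where "adm X \<longleftrightarrow> (\<exists>C. cls C X)"

lemma adm_II: "adm X \<Longrightarrow> i \<le> m \<Longrightarrow> adm (II i X)"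
  using cls_II by (auto simp: adm_def)

lemma adm_const: "adm (\<lambda>_ _. c)"
  unfolding adm_def cls_def using mom_const[of 4 c] mom_0[of 4]
  by (intro exI[of _ "c ^ 4"]) (auto intro: mom_mono)

lemma adm_mult:
  assumes f: "lipf f" and X: "adm X"
  shows "adm (\<lambda>s \<omega>. f s * X s \<omega>)"
proof -
  obtain C where X: "cls C X" using X by (auto simp: adm_def)
  have C: "C \<ge> 0" using clsD(1)[OF X] .
  obtain B K where f: "B \<ge> 0" "K \<ge> 0" "\<And>s. s \<in> {t..T} \<Longrightarrow> \<bar>f s\<bar> \<le> B"
    "\<And>s u. s \<in> {t..T} \<Longrightarrow> u \<in> {t..T} \<Longrightarrow> \<bar>f s - f u\<bar> \<le> K * \<bar>s - u\<bar>" using lipfD[OF f] by blast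
  define D where "D = B ^ 4 * C + 8 * (B ^ 4 * C + K ^ 4 * T\<^sup>2 * C)"
  have f4: "f s ^ 4 \<le> B ^ 4" if "s \<in> {t..T}" for s
    using power_mono[OF f(3)[OF that], of 4] by (simp add: power_even_abs)
  have v: "mom 4 (\<lambda>\<omega>. f s * X s \<omega>) (B ^ 4 * C)" if "s \<in> {t..T}" for s
    using that by (intro mom_mono[OF mom_cmult[OF clsD(4)[OF X]]] mult_right_mono f4 C) auto
  have d: "mom 4 (\<lambda>\<omega>. f s * X s \<omega> - f u * X u \<omega>) (8 * (B ^ 4 * C + K ^ 4 * T\<^sup>2 * C) * (s - u)\<^sup>2)"
    if su: "s \<in> {t..T}" "u \<in> {t..T}" for s u
  proof -
    have "mom 4 (\<lambda>\<omega>. f s * (X s \<omega> - X u \<omega>) + (f s - f u) * X u \<omega>) (8 * (f s ^ 4 * (C * (s - u)\<^sup>2) + (f s - f u) ^ 4 * C))"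
      using su by (intro mom4_add mom_cmult clsD[OF X]) auto
    moreover have "8 * (f s ^ 4 * (C * (s - u)\<^sup>2) + (f s - f u) ^ 4 * C) \<le> 8 * (B ^ 4 * C + K ^ 4 * T\<^sup>2 * C) * (s - u)\<^sup>2"
    proof -
      have "(f s - f u) ^ 4 \<le> (K * \<bar>s - u\<bar>) ^ 4"
        using power_mono[OF f(4)[OF su], of 4] by (simp add: power_even_abs)
      also have "\<dots> = K ^ 4 * ((s - u)\<^sup>2 * (s - u)\<^sup>2)"
        by (simp add: power_mult_distrib power_even_abs)
      also have "\<dots> \<le> K ^ 4 * (T\<^sup>2 * (s - u)\<^sup>2)"
      proof (intro mult_left_mono mult_right_mono)
        have "\<bar>s - u\<bar>\<^sup>2 \<le> T\<^sup>2" using su t by (intro power_mono) auto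
        thus "(s - u)\<^sup>2 \<le> T\<^sup>2" by simp
      qed auto
      finally have "(f s - f u) ^ 4 * C \<le> K ^ 4 * (T\<^sup>2 * (s - u)\<^sup>2) * C" using C by (intro mult_right_mono)
      moreover have "f s ^ 4 * (C * (s - u)\<^sup>2) \<le> B ^ 4 * (C * (s - u)\<^sup>2)" using C f4[OF su(1)] by (intro mult_right_mono) auto
      ultimately show ?thesis by (simp add: algebra_simps)
    qed
    ultimately have "mom 4 (\<lambda>\<omega>. f s * (X s \<omega> - X u \<omega>) + (f s - f u) * X u \<omega>) (8 * (B ^ 4 * C + K ^ 4 * T\<^sup>2 * C) * (s - u)\<^sup>2)"
      by (rule mom_mono)
    thus ?thesis by (simp add: algebra_simps)
  qed
  have nn: "0 \<le> B ^ 4 * C" "0 \<le> 8 * (B ^ 4 * C + K ^ 4 * T\<^sup>2 * C)" using C f by auto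
  have "cls D (\<lambda>s \<omega>. f s * X s \<omega>)"
    unfolding cls_def D_def
  proof (intro conjI ballI)
    fix s assume s: "s \<in> {t..T}"
    show "(\<lambda>\<omega>. f s * X s \<omega>) \<in> borel_measurable (F s)" using clsD(2)[OF X, of s] s by auto
    show "mom 4 (\<lambda>\<omega>. f s * X s \<omega>) (B ^ 4 * C + 8 * (B ^ 4 * C + K ^ 4 * T\<^sup>2 * C))"
      using nn by (intro mom_mono[OF v[OF s]]) linarith
    fix u assume u: "u \<in> {t..T}"
    show "mom 4 (\<lambda>\<omega>. f s * X s \<omega> - f u * X u \<omega>) ((B ^ 4 * C + 8 * (B ^ 4 * C + K ^ 4 * T\<^sup>2 * C)) * (s - u)\<^sup>2)"
      using nn(1) by (intro mom_mono[OF d[OF s u]] mult_right_mono) (simp_all add: mult.commute)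
  qed (use nn in linarith)
  thus ?thesis by (auto simp: adm_def)
qed

lemma adm_det: "lipf f \<Longrightarrow> adm (\<lambda>s _. f s)"
  using adm_mult[OF _ adm_const[of 1], of f] by simp

lemma adm_add:
  assumes "adm X" "adm Y"
  shows "adm (\<lambda>s \<omega>. X s \<omega> + Y s \<omega>)"
proof -
  obtain C D where X: "cls C X" and Y: "cls D Y" using assms by (auto simp: adm_def)
  have "cls (8 * (C + D)) (\<lambda>s \<omega>. X s \<omega> + Y s \<omega>)"
    unfolding cls_def
  proof (intro conjI ballI)
    show "0 \<le> 8 * (C + D)" using clsD(1)[OF X] clsD(1)[OF Y] by simp
    fix s assume s: "s \<in> {t..T}"
    show "(\<lambda>\<omega>. X s \<omega> + Y s \<omega>) \<in> borel_measurable (F s)" using clsD(2)[OF X, of s] clsD(2)[OF Y, of s] s by auto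
    show "mom 4 (\<lambda>\<omega>. X s \<omega> + Y s \<omega>) (8 * (C + D))" using s by (intro mom4_add clsD[OF X] clsD[OF Y]) auto
    fix u assume u: "u \<in> {t..T}"
    have "mom 4 (\<lambda>\<omega>. (X s \<omega> - X u \<omega>) + (Y s \<omega> - Y u \<omega>)) (8 * (C * (s - u)\<^sup>2 + D * (s - u)\<^sup>2))"
      using s u by (intro mom4_add clsD[OF X] clsD[OF Y]) auto
    thus "mom 4 (\<lambda>\<omega>. X s \<omega> + Y s \<omega> - (X u \<omega> + Y u \<omega>)) (8 * (C + D) * (s - u)\<^sup>2)" by (simp add: algebra_simps)
  qed
  thus ?thesis by (auto simp: adm_def)
qed

lemma adm_AE:
  assumes "adm X" "\<And>s. s \<in> {t..T} \<Longrightarrow> Y s \<in> borel_measurable (F s)"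
    and ae: "\<And>s. s \<in> {t..T} \<Longrightarrow> AE \<omega> in M. X s \<omega> = Y s \<omega>"
  shows "adm Y"
proof -
  obtain C where X: "cls C X" using assms by (auto simp: adm_def)
  have YM: "Y s \<in> borel_measurable M" if "s \<in> {t..T}" for s
    using assms(2)[OF that] that t by (intro measurable_F[of _ s]) auto
  have "cls C Y"
    unfolding cls_def
  proof (intro conjI ballI)
    show "0 \<le> C" by (rule clsD(1)[OF X])
    fix s assume s: "s \<in> {t..T}"
    show "Y s \<in> borel_measurable (F s)" by (rule assms(2)[OF s])
    show "mom 4 (Y s) C" using s by (intro mom_AE_cong[OF clsD(4)[OF X] ae YM]) auto
    fix u assume u: "u \<in> {t..T}"
    show "mom 4 (\<lambda>\<omega>. Y s \<omega> - Y u \<omega>) (C * (s - u)\<^sup>2)"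
    proof (rule mom_AE_cong[OF clsD(5)[OF X, of s u]])
      show "AE \<omega> in M. X s \<omega> - X u \<omega> = Y s \<omega> - Y u \<omega>" using ae[OF s] ae[OF u] by eventually_elim simp
      show "(\<lambda>\<omega>. Y s \<omega> - Y u \<omega>) \<in> borel_measurable M" using YM[OF s] YM[OF u] by (intro borel_measurable_diff)
    qed (use s u in auto)
  qed
  thus ?thesis by (auto simp: adm_def)
qed

lemma adm_measurable:
  assumes "adm X" "t \<le> s" "s \<le> T"
  shows "X s \<in> borel_measurable (F s)" "X s \<in> borel_measurable M"
  using assms clsD(2,3) by (auto simp: adm_def)

lemma adm_mom4: "adm X \<Longrightarrow> \<exists>C\<ge>0. \<forall>s\<in>{t..T}. mom 4 (X s) C"
  unfolding adm_def using clsD(1,4) by fastforce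

lemma II_measurable':
  assumes "adm X" "i \<le> m" "t \<le> s" "s \<le> T"
  shows "II i X s \<in> borel_measurable (F s)" "II i X s \<in> borel_measurable M"
  using assms II_measurable by (auto simp: adm_def)

lemma RS_ms0:
  assumes X: "adm X" and i: "i \<le> m" and s: "t \<le> s" "s \<le> T"
    and g: "\<And>n. grid t s (N n) (g n)" "\<And>n. mesh_le (N n) (g n) (\<delta> n)" "\<And>n. 0 \<le> \<delta> n" "\<delta> \<longlonglongrightarrow> 0"
  shows "ms0 (\<lambda>n \<omega>. RS i X (N n) (g n) \<omega> - II i X s \<omega>)"
proof -
  obtain C where X: "cls C X" using X by (auto simp: adm_def)
  show ?thesis
  proof (rule ms0_mom4)
    show "mom 4 (\<lambda>\<omega>. RS i X (N n) (g n) \<omega> - II i X s \<omega>) (\<kappa> * C * T\<^sup>2 * (\<delta> n)\<^sup>2)" for n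
      by (rule II_approx[OF X i s g(1-3)])
    have "(\<lambda>n. \<kappa> * C * T\<^sup>2 * (\<delta> n)\<^sup>2) \<longlonglongrightarrow> \<kappa> * C * T\<^sup>2 * 0\<^sup>2" by (intro tendsto_intros g)
    thus "(\<lambda>n. \<kappa> * C * T\<^sup>2 * (\<delta> n)\<^sup>2) \<longlonglongrightarrow> 0" by simp
  qed
qed

lemma RS_ug_ms0:
  assumes X: "adm X" and i: "i \<le> m" and s: "t \<le> s" "s \<le> T"
  shows "ms0 (\<lambda>n \<omega>. RS i X (Suc n) (ug t s n) \<omega> - II i X s \<omega>)"
  by (rule RS_ms0[OF assms ug_grid ug_mesh _ tendsto_ug_mesh]) (use s in auto)

text \<open>To evaluate an integral it suffices to know the mean-square limit of the uniform Riemann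
  sums.\<close>

lemma II_eqI:
  assumes X: "adm X" and i: "i \<le> m" and s: "t \<le> s" "s \<le> T"
    and Y: "ms0 (\<lambda>n \<omega>. RS i X (Suc n) (ug t s n) \<omega> - Y \<omega>)"
  shows "AE \<omega> in M. II i X s \<omega> = Y \<omega>"
proof -
  have "ms0 (\<lambda>n \<omega>. (RS i X (Suc n) (ug t s n) \<omega> - Y \<omega>) - (RS i X (Suc n) (ug t s n) \<omega> - II i X s \<omega>))"
    by (intro ms0_diff Y RS_ug_ms0 assms)
  hence "ms0 (\<lambda>n \<omega>. II i X s \<omega> - Y \<omega>)" by simp
  from ms0_const[OF this] show ?thesis by auto
qed

lemma RS_measurable: "adm X \<Longrightarrow> i \<le> m \<Longrightarrow> t \<le> s \<Longrightarrow> s \<le> T \<Longrightarrow> grid t s n g \<Longrightarrow> RS i X n g \<in> borel_measurable M"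
  unfolding adm_def using mom4_RS(2) momD(1) by blast

text \<open>The exceptional set may vary with time, but each Riemann sum involves only finitely many
  times.\<close>

lemma II_AE_cong:
  assumes X: "adm X" "adm Y" and i: "i \<le> m" and s: "t \<le> s" "s \<le> T"
    and ae: "\<And>u. u \<in> {t..T} \<Longrightarrow> AE \<omega> in M. X u \<omega> = Y u \<omega>"
  shows "AE \<omega> in M. II i X s \<omega> = II i Y s \<omega>"
proof (rule II_eqI[OF X(1) i s], rule ms0_AE_cong[OF RS_ug_ms0[OF X(2) i s]])
  fix n
  have "AE \<omega> in M. \<forall>k\<in>{..<Suc n}. X (ug t s n k) \<omega> = Y (ug t s n k) \<omega>"
  proof (intro AE_finite_allI ae)
    fix k assume "k \<in> {..<Suc n}"
    thus "ug t s n k \<in> {t..T}" using grid_bounds[OF ug_grid[OF s(1)], of k n] s by auto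
  qed simp
  thus "AE \<omega> in M. RS i Y (Suc n) (ug t s n) \<omega> - II i Y s \<omega> = RS i X (Suc n) (ug t s n) \<omega> - II i Y s \<omega>"
    by eventually_elim (simp add: RS_def)
  show "(\<lambda>\<omega>. RS i X (Suc n) (ug t s n) \<omega> - II i Y s \<omega>) \<in> borel_measurable M"
    by (intro borel_measurable_diff II_measurable' RS_measurable[where s = s] ug_grid assms)
qed

lemma II_add:
  assumes X: "adm X" "adm Y" and i: "i \<le> m" and s: "t \<le> s" "s \<le> T"
  shows "AE \<omega> in M. II i (\<lambda>s \<omega>. X s \<omega> + Y s \<omega>) s \<omega> = II i X s \<omega> + II i Y s \<omega>"
proof (rule II_eqI[OF adm_add[OF X] i s])
  have "RS i (\<lambda>s \<omega>. X s \<omega> + Y s \<omega>) n g \<omega> = RS i X n g \<omega> + RS i Y n g \<omega>" for n g \<omega>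
    by (simp add: RS_def distrib_right sum.distrib)
  hence eq: "(RS i (\<lambda>s \<omega>. X s \<omega> + Y s \<omega>) n g \<omega> - (II i X s \<omega> + II i Y s \<omega>))
     = (RS i X n g \<omega> - II i X s \<omega>) + (RS i Y n g \<omega> - II i Y s \<omega>)" for n g \<omega> by simp
  show "ms0 (\<lambda>n \<omega>. RS i (\<lambda>s \<omega>. X s \<omega> + Y s \<omega>) (Suc n) (ug t s n) \<omega> - (II i X s \<omega> + II i Y s \<omega>))"
    unfolding eq by (intro ms0_add RS_ug_ms0 assms)
qed

lemma riemann_ug:
  assumes h: "continuous_on {a..b} h" and ab: "a \<le> b"
  shows "(\<lambda>n. \<Sum>k<Suc n. h (ug a b n k) * (ug a b n (Suc k) - ug a b n k)) \<longlonglongrightarrow> integral {a..b} h"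
proof (rule LIMSEQ_I)
  fix r :: real assume r: "r > 0"
  define e where "e = r / (b - a + 1)"
  have e: "e > 0" using r ab by (simp add: e_def)
  have "uniformly_continuous_on {a..b} h" using h by (intro compact_uniformly_continuous) auto
  then obtain d where d: "d > 0" "\<And>x y. x \<in> {a..b} \<Longrightarrow> y \<in> {a..b} \<Longrightarrow> dist y x < d \<Longrightarrow> dist (h y) (h x) < e"
    using e unfolding uniformly_continuous_on_def by blast
  from order_tendstoD(2)[OF tendsto_ug_mesh d(1)] obtain n0 where n0: "\<And>n. n \<ge> n0 \<Longrightarrow> (b - a) / real (Suc n) < d"
    by (auto simp: eventually_sequentially)
  have "norm ((\<Sum>k<Suc n. h (ug a b n k) * (ug a b n (Suc k) - ug a b n k)) - integral {a..b} h) < r" if n: "n \<ge> n0" for n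
  proof -
    let ?g = "ug a b n"
    have G: "grid a b (Suc n) ?g" by (rule ug_grid[OF ab])
    have g0: "?g 0 = a" "?g (Suc n) = b" using G by (auto simp: grid_def)
    have "\<bar>(\<Sum>k<Suc n. h (?g k) * (?g (Suc k) - ?g k)) - integral {?g 0..?g (Suc n)} h\<bar> \<le> e * (?g (Suc n) - ?g 0)"
    proof (rule riemann_grid)
      fix k assume k: "k < Suc n"
      show "?g k \<le> ?g (Suc k)" using G k by (auto simp: grid_def)
      fix x assume x: "?g k \<le> x" "x \<le> ?g (Suc k)"
      have "dist x (?g k) \<le> (b - a) / real (Suc n)" using x ug_diff[of a b n k] by (simp add: dist_real_def)
      also have "\<dots> < d" by (rule n0[OF n])
      finally have "dist (h x) (h (?g k)) < e"
        using grid_bounds[OF G, of k] grid_bounds[OF G, of "Suc k"] k x by (intro d(2)) auto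
      thus "\<bar>h x - h (?g k)\<bar> \<le> e" by (simp add: dist_real_def)
    qed (simp add: g0 h)
    also have "\<dots> < r" using r ab by (simp add: g0 e_def field_simps)
    finally show ?thesis by (simp add: g0)
  qed
  thus "\<exists>no. \<forall>n\<ge>no. norm ((\<Sum>k<Suc n. h (ug a b n k) * (ug a b n (Suc k) - ug a b n k)) - integral {a..b} h) < r" by blast
qed

lemma II_time_det:
  assumes f: "lipf f" and s: "t \<le> s" "s \<le> T"
  shows "AE \<omega> in M. II 0 (\<lambda>s _. f s) s \<omega> = integral {t..s} f"
proof (rule II_eqI[OF adm_det[OF f] _ s])
  define e where "e n = (\<Sum>k<Suc n. f (ug t s n k) * (ug t s n (Suc k) - ug t s n k)) - integral {t..s} f" for n
  have "continuous_on {t..s} f" using lipf_continuous_on[OF f] s by (auto intro: continuous_on_subset)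
  from riemann_ug[OF this s(1)] have e: "e \<longlonglongrightarrow> 0" unfolding e_def by (simp add: LIM_zero_iff)
  show "ms0 (\<lambda>n \<omega>. RS 0 (\<lambda>s _. f s) (Suc n) (ug t s n) \<omega> - integral {t..s} f)"
  proof (rule ms0I)
    show "mom 2 (\<lambda>\<omega>. RS 0 (\<lambda>s _. f s) (Suc n) (ug t s n) \<omega> - integral {t..s} f) ((e n)\<^sup>2)" for n
      unfolding RS_def inc_0 e_def by (rule mom_const)
    show "(\<lambda>n. (e n)\<^sup>2) \<longlonglongrightarrow> 0" using tendsto_power[OF e, of 2] by simp
  qed
qed simp

text \<open>The expectation of the product of the integrands is supplied as a continuous function h,
  so that the discrete isometry becomes a convergent Riemann sum.\<close>

lemma II_isometry:
  assumes X: "adm X" "adm Y" and i: "i \<in> {1..m}" and s: "t \<le> s" "s \<le> T"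
    and h: "continuous_on {t..T} h" "\<And>u. u \<in> {t..T} \<Longrightarrow> expectation (\<lambda>\<omega>. X u \<omega> * Y u \<omega>) = h u"
  shows "expectation (\<lambda>\<omega>. II i X s \<omega> * II i Y s \<omega>) = integral {t..s} h"
proof -
  let ?A = "\<lambda>n. RS i X (Suc n) (ug t s n)" and ?B = "\<lambda>n. RS i Y (Suc n) (ug t s n)"
  have i': "i \<le> m" using i by auto
  obtain C D where C: "cls C X" and D: "cls D Y" using X by (auto simp: adm_def)
  note gr = ug_grid[OF s(1)]
  have gb: "ug t s n k \<in> {t..T}" if "k < Suc n" for n k
    using grid_bounds[OF gr, of k n] s that by auto
  have mA: "mom 2 (?A n) (sqrt (\<kappa> * C * (s - t)\<^sup>2))" for n
    by (intro mom4_imp_mom2_sqrt mom4_RS[OF C i'] s gr order.refl)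
  have mB: "mom 2 (?B n) (sqrt (\<kappa> * D * (s - t)\<^sup>2))" for n
    by (intro mom4_imp_mom2_sqrt mom4_RS[OF D i'] s gr order.refl)
  have mX: "mom 2 (X (ug t s n k)) (sqrt C)" "mom 2 (Y (ug t s n k)) (sqrt D)" if "k < Suc n" for n k
    using gb[OF that] clsD(4)[OF C] clsD(4)[OF D] by (auto intro!: mom4_imp_mom2_sqrt)
  have iso: "expectation (\<lambda>\<omega>. ?A n \<omega> * ?B n \<omega>) = (\<Sum>k<Suc n. h (ug t s n k) * (ug t s n (Suc k) - ug t s n k))" for n
  proof -
    have "expectation (\<lambda>\<omega>. ?A n \<omega> * ?B n \<omega>) =
       (\<Sum>k<Suc n. expectation (\<lambda>\<omega>. X (ug t s n k) \<omega> * Y (ug t s n k) \<omega>) * (ug t s n (Suc k) - ug t s n k))"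
      unfolding RS_def using gb mX t s clsD(2)[OF C] clsD(2)[OF D]
      by (intro wiener_grid_isometry[OF i gr]) auto
    also have "\<dots> = (\<Sum>k<Suc n. h (ug t s n k) * (ug t s n (Suc k) - ug t s n k))"
      using gb by (intro sum.cong refl) (auto simp: h(2))
    finally show ?thesis .
  qed
  obtain E where E: "mom 4 (II i X s) E" "mom 4 (II i Y s) E"
  proof -
    obtain E1 E2 where "mom 4 (II i X s) E1" "mom 4 (II i Y s) E2"
      using cls_II[OF C i'] cls_II[OF D i'] s clsD(4) by blast
    from mom_mono[OF this(1), of "max E1 E2"] mom_mono[OF this(2), of "max E1 E2"] that show ?thesis by auto
  qed
  note E' = mom4_imp_mom2_sqrt[OF E(1)] mom4_imp_mom2_sqrt[OF E(2)]
  \<comment> \<open>With A, B the Riemann sums and I, J their limits, A B - I J = (A - I) B + (B -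
    J) I; each product has one null factor and one factor bounded in mean square.\<close>
  have "(\<lambda>n. expectation (\<lambda>\<omega>. (?A n \<omega> - II i X s \<omega>) * ?B n \<omega>) + expectation (\<lambda>\<omega>. (?B n \<omega> - II i Y s \<omega>) * II i X s \<omega>)) \<longlonglongrightarrow> 0 + 0"
    by (intro tendsto_add ms0_expectation[OF RS_ug_ms0 mB] ms0_expectation[OF RS_ug_ms0 E'(1)] X i' s)
  moreover have "expectation (\<lambda>\<omega>. (?A n \<omega> - II i X s \<omega>) * ?B n \<omega>) + expectation (\<lambda>\<omega>. (?B n \<omega> - II i Y s \<omega>) * II i X s \<omega>)
     = (\<Sum>k<Suc n. h (ug t s n k) * (ug t s n (Suc k) - ug t s n k)) - expectation (\<lambda>\<omega>. II i X s \<omega> * II i Y s \<omega>)" for n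
    unfolding iso[symmetric] left_diff_distrib
    using mom2_integrable_mult[OF mA[of n] mB[of n]] mom2_integrable_mult[OF E'(1) mB[of n]]
      mom2_integrable_mult[OF E'] mom2_integrable_mult[OF mB[of n] E'(1)] mom2_integrable_mult[OF E'(2) E'(1)]
    by (simp add: mult.commute)
  ultimately have "(\<lambda>n. (\<Sum>k<Suc n. h (ug t s n k) * (ug t s n (Suc k) - ug t s n k)) - expectation (\<lambda>\<omega>. II i X s \<omega> * II i Y s \<omega>)) \<longlonglongrightarrow> 0"
    by simp
  hence "(\<lambda>n. \<Sum>k<Suc n. h (ug t s n k) * (ug t s n (Suc k) - ug t s n k)) \<longlonglongrightarrow> expectation (\<lambda>\<omega>. II i X s \<omega> * II i Y s \<omega>)"
    by (simp only: LIM_zero_iff)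
  moreover have "continuous_on {t..s} h" using h(1) s by (auto intro: continuous_on_subset)
  note riemann_ug[OF this s(1)]
  ultimately show ?thesis by (rule LIMSEQ_unique)
qed

end

section \<open>The product rule and the Stratonovich correction\<close>

text \<open>Discrete product rule: the double sum is split into the two triangles and the
  diagonal.\<close>

lemma sum_mult_sum_split:
  fixes a b :: "nat \<Rightarrow> real"
  shows "(\<Sum>k<n. a k) * (\<Sum>k<n. b k) =
    (\<Sum>k<n. (\<Sum>r<k. a r) * b k) + (\<Sum>k<n. (\<Sum>r<k. b r) * a k) + (\<Sum>k<n. a k * b k)"
  by (induction n) (simp_all add: algebra_simps)

context ito
begin

text \<open>Inside an outer Riemann sum, inner partial sums may be replaced by integrals. The first
  k cells form a grid of [t, g k] with the same mesh bound, so the inner error is uniform in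
  k.\<close>

lemma RS_error_ms0:
  assumes X: "adm X" "adm Y" and ij: "i \<le> m" "j \<le> m" and s: "t \<le> s" "s \<le> T"
  shows "ms0 (\<lambda>n \<omega>. \<Sum>k<Suc n. ((RS i X k (ug t s n) \<omega> - II i X (ug t s n k) \<omega>) * Y (ug t s n k) \<omega>)
     * inc j (ug t s n k) (ug t s n (Suc k)) \<omega>)"
proof -
  obtain C D where C: "cls C X" and D: "cls D Y" using X by (auto simp: adm_def)
  have nn: "C \<ge> 0" "D \<ge> 0" "\<kappa> \<ge> 0" using clsD(1)[OF C] clsD(1)[OF D] kappa_pos by auto
  define d where "d n = (s - t) / real (Suc n)" for n
  have d0: "d n \<ge> 0" for n using s by (simp add: d_def)
  define c where "c n = sqrt (\<kappa> * C * T\<^sup>2 * (d n)\<^sup>2) * sqrt D" for n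
  have c0: "c n \<ge> 0" for n unfolding c_def using nn by simp
  note gr = ug_grid[OF s(1)]
  show ?thesis
  proof (rule ms0I)
    fix n
    let ?g = "ug t s n"
    show "mom 2 (\<lambda>\<omega>. \<Sum>k<Suc n. ((RS i X k ?g \<omega> - II i X (?g k) \<omega>) * Y (?g k) \<omega>) * inc j (?g k) (?g (Suc k)) \<omega>)
       ((1 + T) * c n * (s - t))"
    proof (rule mom2_grid[OF ij(2) gr t(1) s(2,1)])
      fix k assume k: "k < Suc n"
      have gk: "t \<le> ?g k" "?g k \<le> T" using grid_bounds[OF gr, of k n] k s by auto
      have gk': "grid t (?g k) k ?g" by (rule grid_restrict[OF gr]) (use k in simp)
      have mk: "mesh_le k ?g (d n)" using ug_mesh[of n t s] k by (auto simp: mesh_le_def d_def)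
      show "(\<lambda>\<omega>. (RS i X k ?g \<omega> - II i X (?g k) \<omega>) * Y (?g k) \<omega>) \<in> borel_measurable (F (?g k))"
        using mom4_RS(1)[OF C ij(1) order.refl gk gk'] II_measurable(1)[OF C ij(1) gk] clsD(2)[OF D gk]
        by (intro borel_measurable_times borel_measurable_diff)
      show "mom 2 (\<lambda>\<omega>. (RS i X k ?g \<omega> - II i X (?g k) \<omega>) * Y (?g k) \<omega>) (c n)"
        unfolding c_def using II_approx[OF C ij(1) gk gk' mk d0] clsD(4)[OF D gk] nn
        by (intro mom4_mult) auto
    qed (rule c0)
  next
    have "(\<lambda>n. (1 + T) * c n * (s - t)) \<longlonglongrightarrow> (1 + T) * (sqrt (\<kappa> * C * T\<^sup>2 * 0\<^sup>2) * sqrt D) * (s - t)"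
      unfolding c_def d_def by (intro tendsto_intros tendsto_ug_mesh)
    thus "(\<lambda>n. (1 + T) * c n * (s - t)) \<longlonglongrightarrow> 0" by simp
  qed
qed

text \<open>Convergence of the quadratic covariation. By orthogonality the second moment is of order
  sum d^2, at most the mesh times the length of the interval.\<close>

lemma brack_ms0:
  assumes P: "adm P" and ij: "i \<le> m" "j \<le> m" "i \<noteq> 0 \<or> j \<noteq> 0" and s: "t \<le> s" "s \<le> T"
    and g: "\<And>n. grid t s (N n) (g n)" "\<And>n. mesh_le (N n) (g n) (\<delta> n)" "\<delta> \<longlonglongrightarrow> 0"
  shows "ms0 (\<lambda>n \<omega>. \<Sum>k<N n. P (g n k) \<omega> * brack i j (g n k) (g n (Suc k)) \<omega>)"
proof -
  obtain C where C: "cls C P" using P by (auto simp: adm_def)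
  have nn: "sqrt C \<ge> 0" "T \<ge> 0" using clsD(1)[OF C] t by auto
  show ?thesis
  proof (rule ms0I)
    fix n
    have gk: "t \<le> g n k" "g n k \<le> g n (Suc k)" "g n (Suc k) \<le> T" "g n k \<le> T" if "k < N n" for k
      using grid_bounds[OF g(1), of k n] grid_bounds[OF g(1), of "Suc k" n] g(1)[of n] s that by (auto simp: grid_def)
    have "mom 2 (\<lambda>\<omega>. \<Sum>k<N n. P (g n k) \<omega> * brack i j (g n k) (g n (Suc k)) \<omega>)
       (\<Sum>k<N n. sqrt C * ((2 + T) * (g n (Suc k) - g n k)\<^sup>2))"
      by (rule mom2_orth_grid[OF g(1) t(1) s(2)])
         (use gk t nn ij in \<open>auto intro!: orth_incr_brack mom4_imp_mom2_sqrt clsD[OF C] intro: order.trans\<close>)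
    moreover have "(\<Sum>k<N n. sqrt C * ((2 + T) * (g n (Suc k) - g n k)\<^sup>2)) \<le> sqrt C * (2 + T) * \<delta> n * (s - t)"
    proof -
      have "(\<Sum>k<N n. sqrt C * ((2 + T) * (g n (Suc k) - g n k)\<^sup>2)) \<le> (\<Sum>k<N n. sqrt C * ((2 + T) * (\<delta> n * (g n (Suc k) - g n k))))"
        using nn gk g(2)[of n] unfolding power2_eq_square
        by (intro sum_mono mult_left_mono mult_right_mono) (auto simp: mesh_le_def)
      also have "\<dots> = sqrt C * (2 + T) * \<delta> n * (s - t)"
        unfolding sum_grid_diff[OF g(1)[of n], symmetric] sum_distrib_left by (simp add: mult.assoc)
      finally show ?thesis .
    qed
    ultimately show "mom 2 (\<lambda>\<omega>. \<Sum>k<N n. P (g n k) \<omega> * brack i j (g n k) (g n (Suc k)) \<omega>) (sqrt C * (2 + T) * \<delta> n * (s - t))"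
      by (rule mom_mono)
  next
    have "(\<lambda>n. sqrt C * (2 + T) * \<delta> n * (s - t)) \<longlonglongrightarrow> sqrt C * (2 + T) * 0 * (s - t)" by (intro tendsto_intros g)
    thus "(\<lambda>n. sqrt C * (2 + T) * \<delta> n * (s - t)) \<longlonglongrightarrow> 0" by simp
  qed
qed

lemma product_ms0:
  assumes X: "adm X" "adm Y" and ij: "i \<le> m" "j \<le> m" and s: "t \<le> s" "s \<le> T"
  shows "ms0 (\<lambda>n \<omega>. RS i X (Suc n) (ug t s n) \<omega> * RS j Y (Suc n) (ug t s n) \<omega> - II i X s \<omega> * II j Y s \<omega>)"
proof -
  obtain C D where C: "cls C X" and D: "cls D Y" using X by (auto simp: adm_def)
  obtain E where E: "mom 4 (II i X s) E" using cls_II[OF C ij(1)] s clsD(4) by blast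
  let ?A = "\<lambda>n. RS i X (Suc n) (ug t s n)" and ?B = "\<lambda>n. RS j Y (Suc n) (ug t s n)"
  have lim: "(\<lambda>n. \<kappa> * c * T\<^sup>2 * ((s - t) / real (Suc n))\<^sup>2) \<longlonglongrightarrow> 0" for c
  proof -
    have "(\<lambda>n. \<kappa> * c * T\<^sup>2 * ((s - t) / real (Suc n))\<^sup>2) \<longlonglongrightarrow> \<kappa> * c * T\<^sup>2 * 0\<^sup>2" by (intro tendsto_intros tendsto_ug_mesh)
    thus ?thesis by simp
  qed
  have "ms0 (\<lambda>n \<omega>. (?A n \<omega> - II i X s \<omega>) * ?B n \<omega> + (?B n \<omega> - II j Y s \<omega>) * II i X s \<omega>)"
    by (intro ms0_add ms0_mult[OF II_approx_ug[OF C ij(1) s] lim mom4_RS(2)[OF D ij(2) order.refl s ug_grid[OF s(1)]]]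
       ms0_mult[OF II_approx_ug[OF D ij(2) s] lim E])
  thus ?thesis by (simp add: algebra_simps)
qed

text \<open>The triangles of \<open>sum_mult_sum_split\<close> become stochastic integrals up to
  \<open>RS_error_ms0\<close>, and the diagonal becomes a time integral up to
  \<open>brack_ms0\<close>. Since the class of integrands has no general closure under products,
  admissibility of the three products is assumed.\<close>

lemma product_rule:
  assumes X: "adm X" "adm Y" and ij: "i \<le> m" "j \<le> m" "i \<noteq> 0 \<or> j \<noteq> 0" and s: "t \<le> s" "s \<le> T"
    and ZY: "adm (\<lambda>u \<omega>. II i X u \<omega> * Y u \<omega>)" and ZX: "adm (\<lambda>u \<omega>. II j Y u \<omega> * X u \<omega>)"
    and XY: "adm (\<lambda>u \<omega>. X u \<omega> * Y u \<omega>)"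
  shows "AE \<omega> in M. II i X s \<omega> * II j Y s \<omega> = II j (\<lambda>u \<omega>. II i X u \<omega> * Y u \<omega>) s \<omega> +
     II i (\<lambda>u \<omega>. II j Y u \<omega> * X u \<omega>) s \<omega> + (if i = j then II 0 (\<lambda>u \<omega>. X u \<omega> * Y u \<omega>) s \<omega> else 0)"
proof -
  define P1 where "P1 = (\<lambda>u \<omega>. II i X u \<omega> * Y u \<omega>)"
  define P2 where "P2 = (\<lambda>u \<omega>. II j Y u \<omega> * X u \<omega>)"
  define P3 where "P3 = (\<lambda>u \<omega>. X u \<omega> * Y u \<omega>)"
  define E1 where "E1 n \<omega> = (\<Sum>k<Suc n. ((RS i X k (ug t s n) \<omega> - II i X (ug t s n k) \<omega>) * Y (ug t s n k) \<omega>)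
     * inc j (ug t s n k) (ug t s n (Suc k)) \<omega>)" for n \<omega>
  define E2 where "E2 n \<omega> = (\<Sum>k<Suc n. ((RS j Y k (ug t s n) \<omega> - II j Y (ug t s n k) \<omega>) * X (ug t s n k) \<omega>)
     * inc i (ug t s n k) (ug t s n (Suc k)) \<omega>)" for n \<omega>
  define E3 where "E3 n \<omega> = (\<Sum>k<Suc n. P3 (ug t s n k) \<omega> * brack i j (ug t s n k) (ug t s n (Suc k)) \<omega>)" for n \<omega>
  let ?A = "\<lambda>n. RS i X (Suc n) (ug t s n)" and ?B = "\<lambda>n. RS j Y (Suc n) (ug t s n)"
  have e: "ms0 E1" "ms0 E2" "ms0 E3"
    unfolding E1_def E2_def E3_def
    using RS_error_ms0[OF X ij(1,2) s] RS_error_ms0[OF X(2,1) ij(2,1) s]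
      brack_ms0[OF XY ij s ug_grid[OF s(1)] ug_mesh tendsto_ug_mesh] by (simp_all add: P3_def)
  have id: "?A n \<omega> * ?B n \<omega> = E1 n \<omega> + RS j P1 (Suc n) (ug t s n) \<omega> + (E2 n \<omega> + RS i P2 (Suc n) (ug t s n) \<omega>) +
     (E3 n \<omega> + (if i = j then RS 0 P3 (Suc n) (ug t s n) \<omega> else 0))" for n \<omega>
  proof -
    let ?g = "ug t s n"
    define a where "a k = X (?g k) \<omega> * inc i (?g k) (?g (Suc k)) \<omega>" for k
    define b where "b k = Y (?g k) \<omega> * inc j (?g k) (?g (Suc k)) \<omega>" for k
    have "?A n \<omega> * ?B n \<omega> = (\<Sum>k<Suc n. (\<Sum>r<k. a r) * b k) + (\<Sum>k<Suc n. (\<Sum>r<k. b r) * a k) + (\<Sum>k<Suc n. a k * b k)"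
      unfolding RS_def a_def[symmetric] b_def[symmetric] by (rule sum_mult_sum_split)
    moreover have "(\<Sum>k<Suc n. (\<Sum>r<k. a r) * b k) = E1 n \<omega> + RS j P1 (Suc n) ?g \<omega>"
      unfolding E1_def RS_def a_def b_def P1_def sum.distrib[symmetric]
      by (intro sum.cong refl) (simp add: algebra_simps)
    moreover have "(\<Sum>k<Suc n. (\<Sum>r<k. b r) * a k) = E2 n \<omega> + RS i P2 (Suc n) ?g \<omega>"
      unfolding E2_def RS_def a_def b_def P2_def sum.distrib[symmetric]
      by (intro sum.cong refl) (simp add: algebra_simps)
    moreover have "(\<Sum>k<Suc n. a k * b k) = E3 n \<omega> + (if i = j then RS 0 P3 (Suc n) ?g \<omega> else 0)"
    proof (cases "i = j")
      case True
      thus ?thesis unfolding E3_def RS_def a_def b_def P3_def brack_def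
        by (simp add: sum.distrib[symmetric] del: sum.lessThan_Suc) (intro sum.cong refl, simp add: algebra_simps)
    next
      case False
      thus ?thesis unfolding E3_def RS_def a_def b_def P3_def brack_def
        by (simp add: mult_ac)
    qed
    ultimately show ?thesis by simp
  qed
  have z3: "ms0 (\<lambda>n \<omega>. if i = j then RS 0 P3 (Suc n) (ug t s n) \<omega> - II 0 P3 s \<omega> else 0)"
    using RS_ug_ms0[OF XY _ s, of 0] by (cases "i = j") (simp_all add: ms0_zero P3_def)
  have eq: "E1 n \<omega> + (RS j P1 (Suc n) (ug t s n) \<omega> - II j P1 s \<omega>) + (E2 n \<omega> + (RS i P2 (Suc n) (ug t s n) \<omega> - II i P2 s \<omega>)) +
     (E3 n \<omega> + (if i = j then RS 0 P3 (Suc n) (ug t s n) \<omega> - II 0 P3 s \<omega> else 0))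
     - (?A n \<omega> * ?B n \<omega> - II i X s \<omega> * II j Y s \<omega>)
     = II i X s \<omega> * II j Y s \<omega> - (II j P1 s \<omega> + II i P2 s \<omega> + (if i = j then II 0 P3 s \<omega> else 0))" for n \<omega>
    unfolding id by (cases "i = j") simp_all
  have "ms0 (\<lambda>n \<omega>. E1 n \<omega> + (RS j P1 (Suc n) (ug t s n) \<omega> - II j P1 s \<omega>) + (E2 n \<omega> + (RS i P2 (Suc n) (ug t s n) \<omega> - II i P2 s \<omega>)) +
     (E3 n \<omega> + (if i = j then RS 0 P3 (Suc n) (ug t s n) \<omega> - II 0 P3 s \<omega> else 0))
     - (?A n \<omega> * ?B n \<omega> - II i X s \<omega> * II j Y s \<omega>))"
    by (intro ms0_diff ms0_add e z3 product_ms0 X ij s RS_ug_ms0 ZY[folded P1_def] ZX[folded P2_def])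
  hence "ms0 (\<lambda>n \<omega>. II i X s \<omega> * II j Y s \<omega> - (II j P1 s \<omega> + II i P2 s \<omega> + (if i = j then II 0 P3 s \<omega> else 0)))"
    unfolding eq .
  from ms0_const[OF this] show ?thesis
    unfolding P1_def[symmetric] P2_def[symmetric] P3_def[symmetric] by (simp only: right_minus_eq)
qed

text \<open>The process X has the dynamics dX = Y dV_j up to terms of order dt; its bracket with W_j is then
  the time integral of Y.\<close>
definition lead :: "nat \<Rightarrow> (real \<Rightarrow> 'a \<Rightarrow> real) \<Rightarrow> (real \<Rightarrow> 'a \<Rightarrow> real) \<Rightarrow> bool" where
  "lead j Y X \<longleftrightarrow> (\<exists>K\<ge>0. \<forall>a b. t \<le> a \<longrightarrow> a \<le> b \<longrightarrow> b \<le> T \<longrightarrow>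
     mom 4 (\<lambda>\<omega>. X b \<omega> - X a \<omega> - Y a \<omega> * inc j a b \<omega>) (K * (b - a) ^ 4))"

lemma lead_II: "adm X \<Longrightarrow> i \<le> m \<Longrightarrow> lead i X (II i X)"
proof -
  assume "adm X" and i: "i \<le> m"
  then obtain C where C: "cls C X" by (auto simp: adm_def)
  have "8 * (\<kappa> * C) \<ge> 0" using clsD(1)[OF C] kappa_pos by simp
  thus ?thesis unfolding lead_def using II_increment[OF C i] by blast
qed

lemma lipf_diff_power4:
  assumes "lipf f"
  shows "\<exists>K\<ge>0. \<forall>a b. t \<le> a \<longrightarrow> a \<le> b \<longrightarrow> b \<le> T \<longrightarrow> (f b - f a) ^ 4 \<le> K * (b - a) ^ 4"
proof -
  obtain K where K: "K \<ge> 0" "\<And>s u. s \<in> {t..T} \<Longrightarrow> u \<in> {t..T} \<Longrightarrow> \<bar>f s - f u\<bar> \<le> K * \<bar>s - u\<bar>"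
    using lipfD[OF assms] by blast
  have "(f b - f a) ^ 4 \<le> K ^ 4 * (b - a) ^ 4" if "t \<le> a" "a \<le> b" "b \<le> T" for a b
    using power_mono[OF K(2)[of b a], of 4] that by (simp add: power_even_abs power_mult_distrib)
  thus ?thesis using K(1) by (intro exI[of _ "K ^ 4"]) auto
qed

text \<open>A Lipschitz function has no leading Wiener part: the density is 0, and the integrator is
  formally time.\<close>

lemma lead_det:
  assumes "lipf f"
  shows "lead 0 (\<lambda>_ _. 0) (\<lambda>s _. f s)"
  using lipf_diff_power4[OF assms] unfolding lead_def by (auto intro: mom_mono[OF mom_const])

lemma lead_add_det:
  assumes "lead j Y X" "lipf f"
  shows "lead j Y (\<lambda>s \<omega>. X s \<omega> + f s)"
proof -
  obtain K where K: "K \<ge> 0" "\<And>a b. t \<le> a \<Longrightarrow> a \<le> b \<Longrightarrow> b \<le> T \<Longrightarrow>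
     mom 4 (\<lambda>\<omega>. X b \<omega> - X a \<omega> - Y a \<omega> * inc j a b \<omega>) (K * (b - a) ^ 4)"
    using assms(1) unfolding lead_def by blast
  obtain L where L: "L \<ge> 0" "\<And>a b. t \<le> a \<Longrightarrow> a \<le> b \<Longrightarrow> b \<le> T \<Longrightarrow> (f b - f a) ^ 4 \<le> L * (b - a) ^ 4"
    using lipf_diff_power4[OF assms(2)] by blast
  have "mom 4 (\<lambda>\<omega>. X b \<omega> + f b - (X a \<omega> + f a) - Y a \<omega> * inc j a b \<omega>) (8 * (K + L) * (b - a) ^ 4)"
    if "t \<le> a" "a \<le> b" "b \<le> T" for a b
  proof -
    have "mom 4 (\<lambda>\<omega>. (X b \<omega> - X a \<omega> - Y a \<omega> * inc j a b \<omega>) + (f b - f a)) (8 * (K * (b - a) ^ 4 + L * (b - a) ^ 4))"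
      by (intro mom4_add K that mom_mono[OF mom_const] L)
    thus ?thesis by (simp add: algebra_simps)
  qed
  moreover have "8 * (K + L) \<ge> 0" using K L by simp
  ultimately show ?thesis unfolding lead_def by blast
qed

text \<open>The weight is frozen at the left endpoint; the change of the weight times
  \<open>X b\<close> is of order b - a and goes into the remainder.\<close>

lemma lead_mult:
  assumes "lead j Y X" "lipf f" "adm X"
  shows "lead j (\<lambda>s \<omega>. f s * Y s \<omega>) (\<lambda>s \<omega>. f s * X s \<omega>)"
proof -
  obtain K where K: "K \<ge> 0" "\<And>a b. t \<le> a \<Longrightarrow> a \<le> b \<Longrightarrow> b \<le> T \<Longrightarrow>
     mom 4 (\<lambda>\<omega>. X b \<omega> - X a \<omega> - Y a \<omega> * inc j a b \<omega>) (K * (b - a) ^ 4)"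
    using assms(1) unfolding lead_def by blast
  obtain L where L: "L \<ge> 0" "\<And>a b. t \<le> a \<Longrightarrow> a \<le> b \<Longrightarrow> b \<le> T \<Longrightarrow> (f b - f a) ^ 4 \<le> L * (b - a) ^ 4"
    using lipf_diff_power4[OF assms(2)] by blast
  obtain B where B: "B \<ge> 0" "\<And>s. s \<in> {t..T} \<Longrightarrow> \<bar>f s\<bar> \<le> B" using lipfD[OF assms(2)] by blast
  obtain C where C: "C \<ge> 0" "\<And>s. s \<in> {t..T} \<Longrightarrow> mom 4 (X s) C" using adm_mom4[OF assms(3)] by blast
  have "mom 4 (\<lambda>\<omega>. f b * X b \<omega> - f a * X a \<omega> - f a * Y a \<omega> * inc j a b \<omega>) (8 * (B ^ 4 * K + L * C) * (b - a) ^ 4)"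
    if ab: "t \<le> a" "a \<le> b" "b \<le> T" for a b
  proof -
    have "mom 4 (\<lambda>\<omega>. f a * (X b \<omega> - X a \<omega> - Y a \<omega> * inc j a b \<omega>) + (f b - f a) * X b \<omega>)
        (8 * (f a ^ 4 * (K * (b - a) ^ 4) + (f b - f a) ^ 4 * C))"
      using ab by (intro mom4_add mom_cmult K C) auto
    moreover have "8 * (f a ^ 4 * (K * (b - a) ^ 4) + (f b - f a) ^ 4 * C) \<le> 8 * (B ^ 4 * (K * (b - a) ^ 4) + L * (b - a) ^ 4 * C)"
    proof (intro mult_left_mono add_mono mult_right_mono)
      show "f a ^ 4 \<le> B ^ 4" using power_mono[OF B(2)[of a], of 4] ab by (simp add: power_even_abs)
    qed (use ab K C L in auto)
    ultimately have "mom 4 (\<lambda>\<omega>. f a * (X b \<omega> - X a \<omega> - Y a \<omega> * inc j a b \<omega>) + (f b - f a) * X b \<omega>)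
       (8 * (B ^ 4 * (K * (b - a) ^ 4) + L * (b - a) ^ 4 * C))" by (rule mom_mono)
    thus ?thesis by (simp add: algebra_simps)
  qed
  moreover have "8 * (B ^ 4 * K + L * C) \<ge> 0" using B K L C by simp
  ultimately show ?thesis unfolding lead_def by blast
qed

text \<open>The terms are not orthogonal, but each is of order d^(3/2) in mean square, so Cauchy-Schwarz with
  the weights d suffices.\<close>
lemma remainder_ms0:
  assumes i: "i \<le> m" and s: "t \<le> s" "s \<le> T" and K: "K \<ge> 0"
    and R: "\<And>a b. t \<le> a \<Longrightarrow> a \<le> b \<Longrightarrow> b \<le> T \<Longrightarrow> mom 4 (R a b) (K * (b - a) ^ 4)"
    and g: "\<And>n. grid t s (N n) (g n)" "\<And>n k. k < N n \<Longrightarrow> g n k < g n (Suc k)" "\<And>n. mesh_le (N n) (g n) (\<delta> n)" "\<delta> \<longlonglongrightarrow> 0"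
  shows "ms0 (\<lambda>n \<omega>. \<Sum>k<N n. R (g n k) (g n (Suc k)) \<omega> * inc i (g n k) (g n (Suc k)) \<omega>)"
proof (rule ms0I)
  define c where "c = sqrt K * sqrt \<kappa>"
  have c: "c \<ge> 0" using K kappa_pos by (simp add: c_def)
  have C: "cls 1 (\<lambda>_ _. 1)"
    unfolding cls_def using mom_const[of 4 1] by (auto intro: mom_mono[OF mom_0])
  have Ri: "mom 2 (\<lambda>\<omega>. R a b \<omega> * inc i a b \<omega>) (c * (b - a) ^ 3)" if ab: "t \<le> a" "a \<le> b" "b \<le> T" for a b
  proof -
    have "mom 2 (\<lambda>\<omega>. R a b \<omega> * inc i a b \<omega>) ((sqrt K * (b - a)\<^sup>2) * (sqrt \<kappa> * (b - a)))"
    proof (rule mom4_mult)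
      show "mom 4 (R a b) ((sqrt K * (b - a)\<^sup>2)\<^sup>2)" using R[OF ab] K by (simp add: power_mult_distrib)
      show "mom 4 (inc i a b) ((sqrt \<kappa> * (b - a))\<^sup>2)"
        using mom4_mult_inc[OF C i ab] kappa_pos by (simp add: power_mult_distrib)
    qed (use ab K kappa_pos in auto)
    thus ?thesis by (simp add: c_def power2_eq_square power3_eq_cube mult_ac)
  qed
  fix n
  define d where "d k = g n (Suc k) - g n k" for k
  define A where "A k \<omega> = R (g n k) (g n (Suc k)) \<omega> * inc i (g n k) (g n (Suc k)) \<omega>" for k \<omega>
  have dpos: "d k > 0" if "k < N n" for k using g(2)[OF that] by (simp add: d_def)
  have sd: "(\<Sum>k<N n. d k) = s - t" unfolding d_def by (rule sum_grid_diff[OF g(1)])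
  have mA: "mom 2 (A k) (c * d k ^ 3)" if "k < N n" for k
    unfolding A_def d_def using grid_bounds[OF g(1), of k n] grid_bounds[OF g(1), of "Suc k" n] g(2)[OF that] s that
    by (intro Ri) auto
  have "mom 2 (\<lambda>\<omega>. \<Sum>k<N n. A k \<omega>) ((s - t) * (c * \<delta> n * (s - t)))"
  proof (rule mom_dominated)
    show "integrable M (\<lambda>\<omega>. (s - t) * (\<Sum>k<N n. (A k \<omega>)\<^sup>2 / d k))"
      by (intro integrable_mult_right Bochner_Integration.integrable_sum integrable_divide momD(2)[OF mA]) auto
    show "(\<lambda>\<omega>. \<Sum>k<N n. A k \<omega>) \<in> borel_measurable M"
      by (intro borel_measurable_sum momD(1)[OF mA]) auto
    fix \<omega>
    have "(\<Sum>k<N n. A k \<omega>)\<^sup>2 = (\<Sum>k<N n. d k * (A k \<omega> / d k))\<^sup>2"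
      by (intro arg_cong[where f = "\<lambda>x. x\<^sup>2"] sum.cong refl) (use dpos in force)
    also have "\<dots> \<le> (\<Sum>k<N n. d k) * (\<Sum>k<N n. d k * (A k \<omega> / d k)\<^sup>2)"
      by (rule weighted_Cauchy_Schwarz_sum) (use dpos in force)
    also have "\<dots> = (s - t) * (\<Sum>k<N n. (A k \<omega>)\<^sup>2 / d k)"
      unfolding sd by (intro arg_cong[where f = "\<lambda>x. (s - t) * x"] sum.cong refl)
        (use dpos in \<open>force simp: power_divide power2_eq_square\<close>)
    finally show "(\<Sum>k<N n. A k \<omega>)\<^sup>2 \<le> (s - t) * (\<Sum>k<N n. (A k \<omega>)\<^sup>2 / d k)" .
  next
    have "expectation (\<lambda>\<omega>. (s - t) * (\<Sum>k<N n. (A k \<omega>)\<^sup>2 / d k)) = (s - t) * (\<Sum>k<N n. expectation (\<lambda>\<omega>. (A k \<omega>)\<^sup>2) / d k)"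
      using momD(2)[OF mA] by (simp add: Bochner_Integration.integral_sum)
    also have "\<dots> \<le> (s - t) * (\<Sum>k<N n. c * \<delta> n * d k)"
    proof (intro mult_left_mono sum_mono)
      fix k assume k: "k \<in> {..<N n}"
      have "expectation (\<lambda>\<omega>. (A k \<omega>)\<^sup>2) / d k \<le> c * d k ^ 3 / d k"
        using momD(3)[OF mA[of k]] dpos[of k] k by (intro divide_right_mono) auto
      also have "\<dots> = c * d k * d k" using dpos[of k] k by (simp add: power3_eq_cube)
      also have "\<dots> \<le> c * \<delta> n * d k"
        using c dpos[of k] k g(3)[of n] by (intro mult_right_mono mult_left_mono) (auto simp: mesh_le_def d_def)
      finally show "expectation (\<lambda>\<omega>. (A k \<omega>)\<^sup>2) / d k \<le> c * \<delta> n * d k" .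
    qed (use s in auto)
    also have "\<dots> = (s - t) * (c * \<delta> n * (s - t))" by (simp add: sd flip: sum_distrib_left)
    finally show "expectation (\<lambda>\<omega>. (s - t) * (\<Sum>k<N n. (A k \<omega>)\<^sup>2 / d k)) \<le> (s - t) * (c * \<delta> n * (s - t))" .
  qed simp
  thus "mom 2 (\<lambda>\<omega>. \<Sum>k<N n. R (g n k) (g n (Suc k)) \<omega> * inc i (g n k) (g n (Suc k)) \<omega>) ((s - t) * (c * \<delta> n * (s - t)))"
    by (simp add: A_def)
next
  have "(\<lambda>n. (s - t) * (sqrt K * sqrt \<kappa> * \<delta> n * (s - t))) \<longlonglongrightarrow> (s - t) * (sqrt K * sqrt \<kappa> * 0 * (s - t))"
    by (intro tendsto_intros g)
  thus "(\<lambda>n. (s - t) * (sqrt K * sqrt \<kappa> * \<delta> n * (s - t))) \<longlonglongrightarrow> 0" by simp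
qed

text \<open>The mean of the endpoint values is the left value plus half the increment of X. That
  increment is Y times the j-th Wiener or time increment plus a remainder; multiplied by the i-th
  increment it gives a bracket, which is negligible, and for i = j the time increment. So half the
  time integral of Y is the correction, and the limit holds along every sequence of
  partitions.\<close>

lemma strat_ms0:
  assumes X: "adm X" "adm Y" "lead j Y X" and ij: "i \<in> {1..m}" "j \<le> m" and s: "t \<le> s" "s \<le> T"
    and g: "\<And>n. grid t s (N n) (g n)" "\<And>n k. k < N n \<Longrightarrow> g n k < g n (Suc k)" "\<And>n. mesh_le (N n) (g n) (\<delta> n)" "\<delta> \<longlonglongrightarrow> 0" "\<And>n. 0 \<le> \<delta> n"
  shows "ms0 (\<lambda>n \<omega>. (\<Sum>k<N n. (X (g n k) \<omega> + X (g n (Suc k)) \<omega>) / 2 * inc i (g n k) (g n (Suc k)) \<omega>)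
      - (II i X s \<omega> + (if i = j then II 0 Y s \<omega> / 2 else 0)))"
proof -
  obtain K where K: "K \<ge> 0" "\<And>a b. t \<le> a \<Longrightarrow> a \<le> b \<Longrightarrow> b \<le> T \<Longrightarrow>
     mom 4 (\<lambda>\<omega>. X b \<omega> - X a \<omega> - Y a \<omega> * inc j a b \<omega>) (K * (b - a) ^ 4)"
    using X(3) unfolding lead_def by blast
  have i: "i \<le> m" "i \<noteq> 0" using ij by auto
  define R where "R a b \<omega> = X b \<omega> - X a \<omega> - Y a \<omega> * inc j a b \<omega>" for a b \<omega>
  have R: "mom 4 (R a b) (K * (b - a) ^ 4)" if "t \<le> a" "a \<le> b" "b \<le> T" for a b
    using K(2)[OF that] unfolding R_def[abs_def] .
  define B where "B n \<omega> = (\<Sum>k<N n. Y (g n k) \<omega> * brack j i (g n k) (g n (Suc k)) \<omega>)" for n \<omega>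
  define E where "E n \<omega> = (\<Sum>k<N n. R (g n k) (g n (Suc k)) \<omega> * inc i (g n k) (g n (Suc k)) \<omega>)" for n \<omega>
  have mB: "ms0 B" unfolding B_def by (rule brack_ms0[OF X(2) ij(2) i(1) _ s g(1,3,4)]) (use i in simp)
  have mE: "ms0 E" unfolding E_def by (rule remainder_ms0[OF i(1) s K(1) R g(1-4)])
  have m0: "ms0 (\<lambda>n \<omega>. if i = j then RS 0 Y (N n) (g n) \<omega> - II 0 Y s \<omega> else 0)"
    using RS_ms0[OF X(2) _ s g(1,3,5,4), of 0] by (cases "i = j") (simp_all add: ms0_zero)
  have "ms0 (\<lambda>n \<omega>. (RS i X (N n) (g n) \<omega> - II i X s \<omega>) + (1 / 2) * (E n \<omega> + B n \<omega> + (if i = j then RS 0 Y (N n) (g n) \<omega> - II 0 Y s \<omega> else 0)))"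
    by (intro ms0_add ms0_cmult mB mE m0 RS_ms0[OF X(1) i(1) s g(1,3,5,4)])
  moreover have "(\<Sum>k<N n. (X (g n k) \<omega> + X (g n (Suc k)) \<omega>) / 2 * inc i (g n k) (g n (Suc k)) \<omega>)
     = RS i X (N n) (g n) \<omega> + (1 / 2) * (E n \<omega> + B n \<omega> + (if i = j then RS 0 Y (N n) (g n) \<omega> else 0))" for n \<omega>
  proof -
    have "(X a \<omega> + X b \<omega>) / 2 * inc i a b \<omega> = X a \<omega> * inc i a b \<omega> + (1 / 2) * (R a b \<omega> * inc i a b \<omega> + Y a \<omega> * brack j i a b \<omega> +
        (if i = j then Y a \<omega> * inc 0 a b \<omega> else 0))" for a b
      by (auto simp: R_def brack_def field_simps)
    hence "(\<Sum>k<N n. (X (g n k) \<omega> + X (g n (Suc k)) \<omega>) / 2 * inc i (g n k) (g n (Suc k)) \<omega>) =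
      (\<Sum>k<N n. X (g n k) \<omega> * inc i (g n k) (g n (Suc k)) \<omega> + (1 / 2) * (R (g n k) (g n (Suc k)) \<omega> * inc i (g n k) (g n (Suc k)) \<omega>
        + Y (g n k) \<omega> * brack j i (g n k) (g n (Suc k)) \<omega> + (if i = j then Y (g n k) \<omega> * inc 0 (g n k) (g n (Suc k)) \<omega> else 0)))"
      by (intro sum.cong refl)
    also have "\<dots> = RS i X (N n) (g n) \<omega> + (1 / 2) * (E n \<omega> + B n \<omega> + (if i = j then RS 0 Y (N n) (g n) \<omega> else 0))"
      unfolding RS_def E_def B_def sum.distrib sum_distrib_left[symmetric] by (cases "i = j") simp_all
    finally show ?thesis .
  qed
  ultimately show ?thesis by (cases "i = j") (simp_all add: algebra_simps add_divide_distrib diff_divide_distrib)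
qed

end

section \<open>From the constructed integrals to those of the statement\<close>

context prob_space
begin

lemma ms0_imp_ms_tendsto:
  assumes "ms0 (\<lambda>n \<omega>. S n \<omega> - Y \<omega>)" "mom 2 Y c"
  shows "ms_tendsto M S Y sequentially"
proof -
  obtain e where e: "e \<longlonglongrightarrow> 0" "\<And>n. mom 2 (\<lambda>\<omega>. S n \<omega> - Y \<omega>) (e n)" using assms(1) by (auto simp: ms0_def)
  have "mom 2 (\<lambda>\<omega>. (S n \<omega> - Y \<omega>) + Y \<omega>) (2 * (e n + c))" for n by (intro mom2_add e assms)
  hence S: "mom 2 (S n) (2 * (e n + c))" for n by simp
  have "(\<lambda>n. expectation (\<lambda>\<omega>. (S n \<omega> - Y \<omega>)\<^sup>2)) \<longlonglongrightarrow> 0"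
    by (rule Lim_null_comparison[OF _ e(1)]) (use momD(3)[OF e(2)] in \<open>auto simp: abs_of_nonneg\<close>)
  thus ?thesis unfolding ms_tendsto_def using momD[OF S] momD[OF assms(2)] by auto
qed

lemma ms_tendsto_mom2: "ms_tendsto M S Y F \<Longrightarrow> \<exists>c. mom 2 Y c"
  by (auto simp: ms_tendsto_def mom_def)

lemma ms_tendsto_unique:
  assumes "ms_tendsto M S Y sequentially" "ms_tendsto M S Y' sequentially"
  shows "AE \<omega> in M. Y \<omega> = Y' \<omega>"
proof -
  define e where "e n = expectation (\<lambda>\<omega>. (S n \<omega> - Y \<omega>)\<^sup>2)" for n
  define e' where "e' n = expectation (\<lambda>\<omega>. (S n \<omega> - Y' \<omega>)\<^sup>2)" for n
  have lim: "e \<longlonglongrightarrow> 0" "e' \<longlonglongrightarrow> 0" using assms by (auto simp: ms_tendsto_def e_def[abs_def] e'_def[abs_def])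
  obtain n0 where n0: "\<And>n. n \<ge> n0 \<Longrightarrow> S n \<in> borel_measurable M \<and> integrable M (\<lambda>\<omega>. (S n \<omega>)\<^sup>2)"
    using assms(1) by (auto simp: ms_tendsto_def eventually_sequentially)
  have m: "mom 2 (\<lambda>\<omega>. S n \<omega> - Z \<omega>) (expectation (\<lambda>\<omega>. (S n \<omega> - Z \<omega>)\<^sup>2))"
    if n: "n \<ge> n0" and Z: "ms_tendsto M S Z sequentially" for n Z
  proof -
    have "mom 2 (S n) (expectation (\<lambda>\<omega>. (S n \<omega>)\<^sup>2))" using n0[OF n] by (auto simp: mom_def)
    moreover obtain c where "mom 2 Z c" using ms_tendsto_mom2[OF Z] by blast
    ultimately have "mom 2 (\<lambda>\<omega>. S n \<omega> - Z \<omega>) (2 * (expectation (\<lambda>\<omega>. (S n \<omega>)\<^sup>2) + c))" by (rule mom2_diff)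
    thus ?thesis by (simp add: mom_def)
  qed
  have "mom 2 (\<lambda>\<omega>. Y \<omega> - Y' \<omega>) 0"
  proof (rule mom_limit_bound)
    fix n
    \<comment> \<open>Shifted by \<open>n0\<close>, because mean-square convergence asserts square
      integrability of the approximations only eventually.\<close>
    have "mom 2 (\<lambda>\<omega>. (S (n + n0) \<omega> - Y' \<omega>) - (S (n + n0) \<omega> - Y \<omega>)) (2 * (e' (n + n0) + e (n + n0)))"
      unfolding e_def e'_def by (intro mom2_diff m assms) auto
    thus "mom 2 (\<lambda>\<omega>. Y \<omega> - Y' \<omega>) (2 * (e' (n + n0) + e (n + n0)))" by simp
  next
    have "(\<lambda>n. 2 * (e' (n + n0) + e (n + n0))) \<longlonglongrightarrow> 2 * (0 + 0)"
      by (intro tendsto_intros LIMSEQ_ignore_initial_segment lim)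
    thus "(\<lambda>n. 2 * (e' (n + n0) + e (n + n0))) \<longlonglongrightarrow> 0" by simp
  qed
  from mom_zero_imp_AE[OF this] show ?thesis by auto
qed

end

sublocale ito \<subseteq> legendre_interval t T
  using t by unfold_locales

context ito
begin

lemma adm_mom2: "adm X \<Longrightarrow> t \<le> s \<Longrightarrow> s \<le> T \<Longrightarrow> \<exists>c. mom 2 (X s) c"
  unfolding adm_def using clsD(4) mom4_imp_mom2_sqrt by blast

lemma partition_grid:
  assumes "is_partition t s N \<tau>"
  shows "grid t s N \<tau>" "\<And>k. k < N \<Longrightarrow> \<tau> k < \<tau> (Suc k)" "mesh_le N \<tau> (mesh N \<tau>)" "0 \<le> mesh N \<tau>"
  using assms unfolding is_partition_def grid_def mesh_le_def mesh_def by (auto intro: less_imp_le)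

text \<open>The defining relations quantify over partition sequences; a concrete one is needed to
  extract convergence and uniqueness. For s = t the strict ordering forces the partition without
  cells.\<close>

lemma partitions_exist:
  assumes "t \<le> s"
  shows "\<exists>N \<tau>. (\<forall>k. is_partition t s (N k) (\<tau> k)) \<and> (\<lambda>k. mesh (N k) (\<tau> k)) \<longlonglongrightarrow> 0"
proof (cases "s = t")
  case True
  thus ?thesis by (intro exI[of _ "\<lambda>_. 0"] exI[of _ "\<lambda>_ _. t"]) (simp add: is_partition_def mesh_def)
next
  case False
  hence st: "t < s" using assms by simp
  have pos: "ug t s n k < ug t s n (Suc k)" for n k
  proof -
    have "0 < (s - t) / real (Suc n)" using st by simp
    thus ?thesis unfolding ug_diff[of t s n k, symmetric] by simp
  qed
  have part: "is_partition t s (Suc n) (ug t s n)" for n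
    using ug_grid[OF assms, of n] pos by (auto simp: is_partition_def grid_def)
  have me: "mesh (Suc n) (ug t s n) = (s - t) / real (Suc n)" for n
  proof -
    have "(\<lambda>q. c) ` {..<Suc n} = {c}" for c :: real by auto
    thus ?thesis unfolding mesh_def ug_diff using st by (simp add: max_def)
  qed
  show ?thesis
    using part tendsto_ug_mesh[of "s - t"] by (intro exI[of _ Suc] exI[of _ "ug t s"]) (simp add: me)
qed

lemma inc_W: "i \<in> {1..m} \<Longrightarrow> inc i a b \<omega> = W i b \<omega> - W i a \<omega>"
  by (simp add: inc_def V_def)

text \<open>X' is the integrand actually written, built from \<open>SOME\<close>-chosen inner
  integrals; X is an admissible process that agrees with it almost surely at each time. A
  Stratonovich sum sees finitely many times, so both have the same limits.\<close>

lemma strat_int_characterization: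
  assumes X: "adm X" "adm Y" "lead j Y X" and ij: "i \<in> {1..m}" "j \<le> m" and s: "t \<le> s" "s \<le> T"
    and X': "\<And>u. u \<in> {t..T} \<Longrightarrow> X' u \<in> borel_measurable M" "\<And>u. u \<in> {t..T} \<Longrightarrow> AE \<omega> in M. X' u \<omega> = X u \<omega>"
  defines "I \<equiv> strat_int M (W i) X' t s"
  shows "strat_int_rel M (W i) X' t s I" "I \<in> borel_measurable M"
    "AE \<omega> in M. I \<omega> = II i X s \<omega> + (if i = j then II 0 Y s \<omega> / 2 else 0)"
proof -
  have i: "i \<le> m" using ij by simp
  define L where "L \<omega> = II i X s \<omega> + (if i = j then II 0 Y s \<omega> / 2 else 0)" for \<omega>
  obtain c where c: "mom 2 L c"
  proof -
    obtain C D where C: "mom 2 (II i X s) C" and D: "mom 2 (II 0 Y s) D"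
      using adm_mom2[OF adm_II[OF X(1) i] s] adm_mom2[OF adm_II[OF X(2), of 0] s] by auto
    have "\<exists>D. mom 2 (\<lambda>\<omega>. if i = j then II 0 Y s \<omega> / 2 else 0) D"
      using mom_cmult[OF D, of "1/2"] mom_0[of 2] by (cases "i = j") auto
    then obtain E where "mom 2 (\<lambda>\<omega>. if i = j then II 0 Y s \<omega> / 2 else 0) E" by blast
    from mom2_add[OF C this] show ?thesis using that unfolding L_def by blast
  qed
  have main: "ms_tendsto M (\<lambda>k \<omega>. \<Sum>q<N k. (X' (\<tau> k q) \<omega> + X' (\<tau> k (Suc q)) \<omega>) / 2 * (W i (\<tau> k (Suc q)) \<omega> - W i (\<tau> k q) \<omega>)) L sequentially"
    if part: "\<And>k. is_partition t s (N k) (\<tau> k)" and me: "(\<lambda>k. mesh (N k) (\<tau> k)) \<longlonglongrightarrow> 0" for N \<tau>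
  proof (rule ms0_imp_ms_tendsto[OF _ c], rule ms0_AE_cong)
    note P = partition_grid[OF part]
    show "ms0 (\<lambda>k \<omega>. (\<Sum>q<N k. (X (\<tau> k q) \<omega> + X (\<tau> k (Suc q)) \<omega>) / 2 * inc i (\<tau> k q) (\<tau> k (Suc q)) \<omega>) - L \<omega>)"
      unfolding L_def by (rule strat_ms0[OF X ij s P(1,2,3) me P(4)])
    fix k
    have b: "\<tau> k q \<in> {t..T}" if "q \<le> N k" for q using grid_bounds[OF P(1)[of k] that] s by auto
    have "AE \<omega> in M. \<forall>q\<in>{..N k}. X' (\<tau> k q) \<omega> = X (\<tau> k q) \<omega>"
      by (intro AE_finite_allI X') (use b in auto)
    thus "AE \<omega> in M. (\<Sum>q<N k. (X (\<tau> k q) \<omega> + X (\<tau> k (Suc q)) \<omega>) / 2 * inc i (\<tau> k q) (\<tau> k (Suc q)) \<omega>) - L \<omega> =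
      (\<Sum>q<N k. (X' (\<tau> k q) \<omega> + X' (\<tau> k (Suc q)) \<omega>) / 2 * (W i (\<tau> k (Suc q)) \<omega> - W i (\<tau> k q) \<omega>)) - L \<omega>"
      by eventually_elim (simp add: inc_W[OF ij(1)])
    have "W i u \<in> borel_measurable M" if "u \<in> {t..T}" for u
      using measurable_V[OF i, of u] measurable_F[of "V i u" u] that t ij by (simp add: V_def[abs_def])
    thus "(\<lambda>\<omega>. (\<Sum>q<N k. (X' (\<tau> k q) \<omega> + X' (\<tau> k (Suc q)) \<omega>) / 2 * (W i (\<tau> k (Suc q)) \<omega> - W i (\<tau> k q) \<omega>)) - L \<omega>) \<in> borel_measurable M"
      using momD(1)[OF c] X'(1) b
      by (intro borel_measurable_diff borel_measurable_sum borel_measurable_times borel_measurable_divide borel_measurable_add) auto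
  qed
  \<comment> \<open>The constructed limit \<open>L\<close> shows that the relation is satisfiable,
    so the chosen value satisfies it; uniqueness of mean-square limits then identifies the
    two.\<close>
  hence "strat_int_rel M (W i) X' t s L" unfolding strat_int_rel_def by blast
  thus rel: "strat_int_rel M (W i) X' t s I" unfolding I_def strat_int_def
    by (rule someI[of "strat_int_rel M (W i) X' t s"])
  obtain N \<tau> where part: "\<And>k. is_partition t s (N k) (\<tau> k)" "(\<lambda>k. mesh (N k) (\<tau> k)) \<longlonglongrightarrow> 0"
    using partitions_exist[OF s(1)] by blast
  have I: "ms_tendsto M (\<lambda>k \<omega>. \<Sum>q<N k. (X' (\<tau> k q) \<omega> + X' (\<tau> k (Suc q)) \<omega>) / 2 * (W i (\<tau> k (Suc q)) \<omega> - W i (\<tau> k q) \<omega>)) I sequentially"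
    using rel part unfolding strat_int_rel_def by blast
  thus "I \<in> borel_measurable M" by (simp add: ms_tendsto_def)
  show "AE \<omega> in M. I \<omega> = II i X s \<omega> + (if i = j then II 0 Y s \<omega> / 2 else 0)"
    using ms_tendsto_unique[OF I main[OF part]] by (simp add: L_def)
qed

lemma ito_int_characterization:
  assumes f: "lipf f" and i: "i \<in> {1..m}" and s: "t \<le> s" "s \<le> T"
  defines "I \<equiv> ito_int M (W i) (\<lambda>u _. f u) t s"
  shows "ito_int_rel M (W i) (\<lambda>u _. f u) t s I" "I \<in> borel_measurable M"
    "AE \<omega> in M. I \<omega> = II i (\<lambda>u _. f u) s \<omega>"
proof -
  have i': "i \<le> m" using i by simp
  let ?L = "II i (\<lambda>u _. f u) s"
  obtain c where c: "mom 2 ?L c"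
    using adm_mom2[OF adm_II[OF adm_det[OF f] i'] s] by blast
  have main: "ms_tendsto M (\<lambda>k \<omega>. \<Sum>q<N k. f (\<tau> k q) * (W i (\<tau> k (Suc q)) \<omega> - W i (\<tau> k q) \<omega>)) ?L sequentially"
    if part: "\<And>k. is_partition t s (N k) (\<tau> k)" and me: "(\<lambda>k. mesh (N k) (\<tau> k)) \<longlonglongrightarrow> 0" for N \<tau>
  proof (rule ms0_imp_ms_tendsto[OF _ c])
    note P = partition_grid[OF part]
    show "ms0 (\<lambda>k \<omega>. (\<Sum>q<N k. f (\<tau> k q) * (W i (\<tau> k (Suc q)) \<omega> - W i (\<tau> k q) \<omega>)) - ?L \<omega>)"
      using RS_ms0[OF adm_det[OF f] i' s P(1,3,4) me] by (simp add: RS_def inc_W[OF i])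
  qed
  hence "ito_int_rel M (W i) (\<lambda>u _. f u) t s ?L" unfolding ito_int_rel_def by blast
  thus rel: "ito_int_rel M (W i) (\<lambda>u _. f u) t s I" unfolding I_def ito_int_def
    by (rule someI[of "ito_int_rel M (W i) (\<lambda>u _. f u) t s"])
  obtain N \<tau> where part: "\<And>k. is_partition t s (N k) (\<tau> k)" "(\<lambda>k. mesh (N k) (\<tau> k)) \<longlonglongrightarrow> 0"
    using partitions_exist[OF s(1)] by blast
  have I: "ms_tendsto M (\<lambda>k \<omega>. \<Sum>q<N k. f (\<tau> k q) * (W i (\<tau> k (Suc q)) \<omega> - W i (\<tau> k q) \<omega>)) I sequentially"
    using rel part unfolding ito_int_rel_def by blast
  thus "I \<in> borel_measurable M" by (simp add: ms_tendsto_def)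
  show "AE \<omega> in M. I \<omega> = ?L \<omega>" using ms_tendsto_unique[OF I main[OF part]] .
qed

subsection \<open>Iterated integrals\<close>

definition J1 :: "nat \<Rightarrow> (real \<Rightarrow> real) \<Rightarrow> real \<Rightarrow> 'a \<Rightarrow> real" where
  "J1 i f = II i (\<lambda>s _. f s)"

definition J2 :: "nat \<Rightarrow> (real \<Rightarrow> real) \<Rightarrow> nat \<Rightarrow> (real \<Rightarrow> real) \<Rightarrow> real \<Rightarrow> 'a \<Rightarrow> real" where
  "J2 i f j g = II j (\<lambda>s \<omega>. g s * J1 i f s \<omega>)"

text \<open>Innermost component and weight come first, as in \<open>D3\<close>.\<close>

definition J3 :: "nat \<Rightarrow> (real \<Rightarrow> real) \<Rightarrow> nat \<Rightarrow> (real \<Rightarrow> real) \<Rightarrow> nat \<Rightarrow> (real \<Rightarrow> real) \<Rightarrow> real \<Rightarrow> 'a \<Rightarrow> real" where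
  "J3 i f j g k h = II k (\<lambda>s \<omega>. h s * J2 i f j g s \<omega>)"

lemma adm_J1: "lipf f \<Longrightarrow> i \<le> m \<Longrightarrow> adm (J1 i f)"
  unfolding J1_def by (intro adm_II adm_det)

lemma adm_J2: "lipf f \<Longrightarrow> lipf g \<Longrightarrow> i \<le> m \<Longrightarrow> j \<le> m \<Longrightarrow> adm (J2 i f j g)"
  unfolding J2_def by (intro adm_II adm_mult adm_J1)

lemma adm_J3: "lipf f \<Longrightarrow> lipf g \<Longrightarrow> lipf h \<Longrightarrow> i \<le> m \<Longrightarrow> j \<le> m \<Longrightarrow> k \<le> m \<Longrightarrow> adm (J3 i f j g k h)"
  unfolding J3_def by (intro adm_II adm_mult adm_J2)

lemma lipf_D1: "lipf f \<Longrightarrow> lipf (D1 f)"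
  unfolding D1_def[abs_def] by (intro lipf_integral lipf_continuous_on)

lemma isometry_J1:
  assumes "lipf f" "lipf f'" "i \<in> {1..m}" "s \<in> {t..T}"
  shows "expectation (\<lambda>\<omega>. J1 i f s \<omega> * J1 i f' s \<omega>) = D1 (\<lambda>u. f u * f' u) s"
  unfolding J1_def D1_def using assms
  by (intro II_isometry adm_det lipf_continuous_on lipf_mult) (auto simp: prob_space)

text \<open>The second moment at one level is a deterministic Lipschitz function of time, which is
  the h that \<open>II_isometry\<close> requires at the next level.\<close>

lemma isometry_J2:
  assumes "lipf f" "lipf f'" "lipf g" "lipf g'" "i \<in> {1..m}" "j \<in> {1..m}" "s \<in> {t..T}"
  shows "expectation (\<lambda>\<omega>. J2 i f j g s \<omega> * J2 i f' j g' s \<omega>) = D2 (\<lambda>u. f u * f' u) (\<lambda>u. g u * g' u) s"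
  unfolding J2_def D2_def D1_def[of "\<lambda>u. _ u * D1 _ u"]
proof (rule II_isometry)
  fix u assume u: "u \<in> {t..T}"
  have "expectation (\<lambda>\<omega>. g u * J1 i f u \<omega> * (g' u * J1 i f' u \<omega>)) = expectation (\<lambda>\<omega>. (g u * g' u) * (J1 i f u \<omega> * J1 i f' u \<omega>))"
    by (simp add: mult_ac)
  also have "\<dots> = g u * g' u * expectation (\<lambda>\<omega>. J1 i f u \<omega> * J1 i f' u \<omega>)" by simp
  also have "\<dots> = g u * g' u * D1 (\<lambda>u. f u * f' u) u"
    by (simp only: isometry_J1[OF assms(1,2,5) u])
  finally show "expectation (\<lambda>\<omega>. g u * J1 i f u \<omega> * (g' u * J1 i f' u \<omega>)) = g u * g' u * D1 (\<lambda>u. f u * f' u) u" .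
qed (use assms in \<open>auto intro!: adm_mult adm_J1 lipf_continuous_on lipf_mult lipf_D1\<close>)

lemma isometry_J3:
  assumes "lipf f" "lipf f'" "lipf g" "lipf g'" "lipf h" "lipf h'" "i \<in> {1..m}" "j \<in> {1..m}" "k \<in> {1..m}" "s \<in> {t..T}"
  shows "expectation (\<lambda>\<omega>. J3 i f j g k h s \<omega> * J3 i f' j g' k h' s \<omega>) =
    D3 (\<lambda>u. f u * f' u) (\<lambda>u. g u * g' u) (\<lambda>u. h u * h' u) s"
  unfolding J3_def D3_def D1_def[of "\<lambda>u. _ u * D2 _ _ u"]
proof (rule II_isometry)
  fix u assume u: "u \<in> {t..T}"
  have "expectation (\<lambda>\<omega>. h u * J2 i f j g u \<omega> * (h' u * J2 i f' j g' u \<omega>)) = expectation (\<lambda>\<omega>. (h u * h' u) * (J2 i f j g u \<omega> * J2 i f' j g' u \<omega>))"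
    by (simp add: mult_ac)
  also have "\<dots> = h u * h' u * expectation (\<lambda>\<omega>. J2 i f j g u \<omega> * J2 i f' j g' u \<omega>)" by simp
  also have "\<dots> = h u * h' u * D2 (\<lambda>u. f u * f' u) (\<lambda>u. g u * g' u) u"
    by (simp only: isometry_J2[OF assms(1-4,7,8) u])
  finally show "expectation (\<lambda>\<omega>. h u * J2 i f j g u \<omega> * (h' u * J2 i f' j g' u \<omega>)) = h u * h' u * D2 (\<lambda>u. f u * f' u) (\<lambda>u. g u * g' u) u" .
next
  have "lipf (D2 (\<lambda>u. f u * f' u) (\<lambda>u. g u * g' u))" unfolding D2_def using assms by (intro lipf_D1 lipf_mult)
  thus "cont (\<lambda>u. h u * h' u * D2 (\<lambda>u. f u * f' u) (\<lambda>u. g u * g' u) u)"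
    using assms by (intro lipf_continuous_on lipf_mult)
qed (use assms in \<open>auto intro!: adm_mult adm_J2\<close>)

lemma J1_product:
  assumes f: "lipf f" "lipf g" and ij: "i \<in> {1..m}" "j \<in> {1..m}" and s: "s \<in> {t..T}"
  shows "AE \<omega> in M. J1 i f s \<omega> * J1 j g s \<omega> = J2 i f j g s \<omega> + J2 j g i f s \<omega> + (if i = j then D1 (\<lambda>u. f u * g u) s else 0)"
proof -
  have s': "t \<le> s" "s \<le> T" using s by auto
  have "AE \<omega> in M. II i (\<lambda>s _. f s) s \<omega> * II j (\<lambda>s _. g s) s \<omega> = II j (\<lambda>u \<omega>. II i (\<lambda>s _. f s) u \<omega> * g u) s \<omega> +
     II i (\<lambda>u \<omega>. II j (\<lambda>s _. g s) u \<omega> * f u) s \<omega> + (if i = j then II 0 (\<lambda>u \<omega>. f u * g u) s \<omega> else 0)"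
  proof (rule product_rule)
    show "adm (\<lambda>u \<omega>. II i (\<lambda>s _. f s) u \<omega> * g u)" "adm (\<lambda>u \<omega>. II j (\<lambda>s _. g s) u \<omega> * f u)"
      using adm_mult[OF f(2) adm_J1[OF f(1), of i]] adm_mult[OF f(1) adm_J1[OF f(2), of j]] ij by (simp_all add: J1_def mult.commute)
  qed (use f ij s' in \<open>auto intro!: adm_det lipf_mult\<close>)
  moreover have "AE \<omega> in M. II 0 (\<lambda>u \<omega>. f u * g u) s \<omega> = D1 (\<lambda>u. f u * g u) s"
    unfolding D1_def using f s' by (intro II_time_det lipf_mult)
  ultimately show ?thesis
    by eventually_elim (simp add: J1_def J2_def mult.commute)
qed

text \<open>The product rule with time as one of the integrators. It exchanges the order of a time
  and a Wiener integration, and so turns time integrals of Wiener integrals into Wiener integrals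
  with modified weight.\<close>

lemma J1_parts:
  assumes q: "lipf q" "lipf f" and i: "i \<in> {1..m}" and s: "s \<in> {t..T}"
  shows "AE \<omega> in M. D1 q s * J1 i f s \<omega> = J1 i (\<lambda>u. f u * D1 q u) s \<omega> + II 0 (\<lambda>u \<omega>. q u * J1 i f u \<omega>) s \<omega>"
proof -
  have s': "t \<le> s" "s \<le> T" using s by auto
  have a: "adm (\<lambda>u \<omega>. f u * II 0 (\<lambda>s _. q s) u \<omega>)" using q by (intro adm_mult adm_II adm_det) auto
  have "AE \<omega> in M. II 0 (\<lambda>s _. q s) s \<omega> * II i (\<lambda>s _. f s) s \<omega> = II i (\<lambda>u \<omega>. II 0 (\<lambda>s _. q s) u \<omega> * f u) s \<omega> +
     II 0 (\<lambda>u \<omega>. II i (\<lambda>s _. f s) u \<omega> * q u) s \<omega> + (if 0 = i then II 0 (\<lambda>u \<omega>. q u * f u) s \<omega> else 0)"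
  proof (rule product_rule)
    show "adm (\<lambda>u \<omega>. II 0 (\<lambda>s _. q s) u \<omega> * f u)" using a by (simp add: mult.commute)
    show "adm (\<lambda>u \<omega>. II i (\<lambda>s _. f s) u \<omega> * q u)"
      using adm_mult[OF q(1) adm_J1[OF q(2), of i]] i by (simp add: J1_def mult.commute)
  qed (use q i s' in \<open>auto intro!: adm_det lipf_mult\<close>)
  moreover have "AE \<omega> in M. II 0 (\<lambda>s _. q s) s \<omega> = D1 q s"
    unfolding D1_def using q s' by (intro II_time_det)
  moreover have "AE \<omega> in M. II i (\<lambda>u \<omega>. f u * II 0 (\<lambda>s _. q s) u \<omega>) s \<omega> = II i (\<lambda>u \<omega>. f u * D1 q u) s \<omega>"
  proof (rule II_AE_cong[OF a])
    fix u assume "u \<in> {t..T}"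
    hence "AE \<omega> in M. II 0 (\<lambda>s _. q s) u \<omega> = D1 q u" unfolding D1_def using q by (intro II_time_det) auto
    thus "AE \<omega> in M. f u * II 0 (\<lambda>s _. q s) u \<omega> = f u * D1 q u" by eventually_elim simp
  qed (use q i s' in \<open>auto intro!: adm_det lipf_mult lipf_D1\<close>)
  ultimately show ?thesis
    by eventually_elim (use i in \<open>auto simp: J1_def mult.commute\<close>)
qed

end

context ito
begin

lemma II_cmult:
  assumes X: "adm X" and i: "i \<le> m" and s: "t \<le> s" "s \<le> T"
  shows "AE \<omega> in M. II i (\<lambda>s \<omega>. c * X s \<omega>) s \<omega> = c * II i X s \<omega>"
proof (rule II_eqI[OF adm_mult[OF lipf_const X] i s])
  have eq: "RS i (\<lambda>s \<omega>. c * X s \<omega>) n g \<omega> - c * II i X s \<omega> = c * (RS i X n g \<omega> - II i X s \<omega>)" for n g \<omega>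
    by (simp add: RS_def right_diff_distrib sum_distrib_left mult.assoc)
  show "ms0 (\<lambda>n \<omega>. RS i (\<lambda>s \<omega>. c * X s \<omega>) (Suc n) (ug t s n) \<omega> - c * II i X s \<omega>)"
    unfolding eq by (intro ms0_cmult RS_ug_ms0 assms)
qed

lemma J1_linear:
  assumes f: "lipf f" "lipf g" and i: "i \<le> m" and s: "s \<in> {t..T}"
  shows "AE \<omega> in M. J1 i (\<lambda>u. a * f u + b * g u) s \<omega> = a * J1 i f s \<omega> + b * J1 i g s \<omega>"
proof -
  have s': "t \<le> s" "s \<le> T" using s by auto
  have "AE \<omega> in M. II i (\<lambda>s _. a * f s + b * g s) s \<omega> = II i (\<lambda>s _. a * f s) s \<omega> + II i (\<lambda>s _. b * g s) s \<omega>"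
    using f i s' by (intro II_add adm_det lipf_mult lipf_const)
  moreover have "AE \<omega> in M. II i (\<lambda>s _. a * f s) s \<omega> = a * II i (\<lambda>s _. f s) s \<omega>"
    using f i s' by (intro II_cmult adm_det)
  moreover have "AE \<omega> in M. II i (\<lambda>s _. b * g s) s \<omega> = b * II i (\<lambda>s _. g s) s \<omega>"
    using f i s' by (intro II_cmult adm_det)
  ultimately show ?thesis unfolding J1_def by eventually_elim simp
qed

text \<open>The shuffle identity with trace terms: the product rule applied to the outer integral of
  \<open>J2\<close> and to \<open>J1 k h\<close>, followed by \<open>J1_product\<close> inside the
  integrand.\<close>

lemma J2_J1_product:
  assumes f: "lipf f" "lipf g" "lipf h" and i: "i \<in> {1..m}" "j \<in> {1..m}" "k \<in> {1..m}" and s: "s \<in> {t..T}"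
  shows "AE \<omega> in M. J2 i f j g s \<omega> * J1 k h s \<omega> = J3 i f j g k h s \<omega> + J3 i f k h j g s \<omega> + J3 k h i f j g s \<omega>
     + (if i = k then J1 j (\<lambda>u. g u * D1 (\<lambda>y. f y * h y) u) s \<omega> else 0)
     + (if j = k then II 0 (\<lambda>u \<omega>. g u * h u * J1 i f u \<omega>) s \<omega> else 0)"
proof -
  have s': "t \<le> s" "s \<le> T" using s by auto
  have i': "i \<le> m" "j \<le> m" "k \<le> m" using i by auto
  define d where "d u = (if i = k then g u * D1 (\<lambda>y. f y * h y) u else 0)" for u
  have d: "lipf d" unfolding d_def using f by (cases "i = k") (auto intro!: lipf_mult lipf_D1 lipf_const)
  \<comment> \<open>The sum of admissible processes that \<open>J1_product\<close> equates almost
    surely with the product of integrals below; it certifies that this product is an admissible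
    integrand.\<close>
  define P where "P u \<omega> = g u * J2 i f k h u \<omega> + (g u * J2 k h i f u \<omega> + d u)" for u \<omega>
  have a1: "adm (\<lambda>u \<omega>. g u * J2 i f k h u \<omega>)" "adm (\<lambda>u \<omega>. g u * J2 k h i f u \<omega> + d u)" "adm (\<lambda>u \<omega>. g u * J2 k h i f u \<omega>)"
    using f i' d by (auto intro!: adm_add adm_mult adm_J2 adm_det)
  have aP: "adm P" unfolding P_def[abs_def] by (intro adm_add a1)
  have PP: "AE \<omega> in M. P u \<omega> = J1 k h u \<omega> * (g u * J1 i f u \<omega>)" if "u \<in> {t..T}" for u
    using J1_product[OF f(1,3) i(1,3) that] by eventually_elim (auto simp: P_def d_def algebra_simps)
  have aM: "adm (\<lambda>u \<omega>. J1 k h u \<omega> * (g u * J1 i f u \<omega>))"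
  proof (rule adm_AE[OF aP _ PP])
    fix u assume "u \<in> {t..T}"
    thus "(\<lambda>\<omega>. J1 k h u \<omega> * (g u * J1 i f u \<omega>)) \<in> borel_measurable (F u)"
      using adm_measurable(1)[OF adm_J1[OF f(3) i'(3)], of u] adm_measurable(1)[OF adm_J1[OF f(1) i'(1)], of u] by auto
  qed
  have "AE \<omega> in M. II j (\<lambda>s \<omega>. g s * J1 i f s \<omega>) s \<omega> * II k (\<lambda>s _. h s) s \<omega> =
     II k (\<lambda>u \<omega>. II j (\<lambda>s \<omega>. g s * J1 i f s \<omega>) u \<omega> * h u) s \<omega> + II j (\<lambda>u \<omega>. II k (\<lambda>s _. h s) u \<omega> * (g u * J1 i f u \<omega>)) s \<omega>
     + (if j = k then II 0 (\<lambda>u \<omega>. g u * J1 i f u \<omega> * h u) s \<omega> else 0)"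
  proof (rule product_rule)
    show "adm (\<lambda>u \<omega>. II j (\<lambda>s \<omega>. g s * J1 i f s \<omega>) u \<omega> * h u)"
      using adm_mult[OF f(3) adm_J2[OF f(1,2) i'(1,2)]] by (simp add: J2_def mult.commute)
    show "adm (\<lambda>u \<omega>. II k (\<lambda>s _. h s) u \<omega> * (g u * J1 i f u \<omega>))" using aM by (simp add: J1_def[of k h])
    show "adm (\<lambda>u \<omega>. g u * J1 i f u \<omega> * h u)"
      using adm_mult[OF lipf_mult[OF f(2,3)] adm_J1[OF f(1) i'(1)]] by (simp add: mult_ac)
  qed (use f i i' s' in \<open>auto intro!: adm_det adm_mult adm_J1\<close>)
  moreover have "(\<lambda>u \<omega>. g u * J1 i f u \<omega> * h u) = (\<lambda>u \<omega>. g u * h u * J1 i f u \<omega>)"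
    "(\<lambda>u \<omega>. J2 i f j g u \<omega> * h u) = (\<lambda>u \<omega>. h u * J2 i f j g u \<omega>)"
    by (simp_all add: fun_eq_iff mult_ac)
  ultimately have "AE \<omega> in M. J2 i f j g s \<omega> * J1 k h s \<omega> = J3 i f j g k h s \<omega> + II j (\<lambda>u \<omega>. J1 k h u \<omega> * (g u * J1 i f u \<omega>)) s \<omega>
     + (if j = k then II 0 (\<lambda>u \<omega>. g u * h u * J1 i f u \<omega>) s \<omega> else 0)"
    unfolding J2_def[of i f j g, symmetric] J1_def[of k h, symmetric] J3_def by (simp only:)
  moreover have "AE \<omega> in M. II j P s \<omega> = II j (\<lambda>u \<omega>. J1 k h u \<omega> * (g u * J1 i f u \<omega>)) s \<omega>"
    by (rule II_AE_cong[OF aP aM i'(2) s' PP])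
  moreover have "AE \<omega> in M. II j P s \<omega> = II j (\<lambda>u \<omega>. g u * J2 i f k h u \<omega>) s \<omega> + II j (\<lambda>u \<omega>. g u * J2 k h i f u \<omega> + d u) s \<omega>"
    unfolding P_def[abs_def] by (rule II_add[OF a1(1,2) i'(2) s'])
  moreover have "AE \<omega> in M. II j (\<lambda>u \<omega>. g u * J2 k h i f u \<omega> + d u) s \<omega> = II j (\<lambda>u \<omega>. g u * J2 k h i f u \<omega>) s \<omega> + II j (\<lambda>u _. d u) s \<omega>"
    by (rule II_add[OF a1(3) adm_det[OF d] i'(2) s'])
  moreover have "AE \<omega> in M. II j (\<lambda>u _. d u) s \<omega> = (if i = k then J1 j (\<lambda>u. g u * D1 (\<lambda>y. f y * h y) u) s \<omega> else 0)"
  proof (cases "i = k")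
    case True
    thus ?thesis by (simp add: d_def[abs_def] J1_def)
  next
    case False
    \<comment> \<open>The zero integrand is written as 0 times 1 so that linearity applies: its
      integral is a chosen random variable that vanishes only almost surely.\<close>
    have "AE \<omega> in M. II j (\<lambda>u _. 0 * 1) s \<omega> = 0 * II j (\<lambda>u _. 1) s \<omega>"
      using i' s' by (intro II_cmult adm_const)
    thus ?thesis using False by (simp add: d_def[abs_def])
  qed
  ultimately show ?thesis
    unfolding J3_def by eventually_elim simp
qed

text \<open>The six orderings come from two shuffles. For i = k and for j = k, one shuffle leaves a
  Wiener integral with an integrated weight and the other a time integral; by
  \<open>J1_parts\<close> these two add up to the trace times a single Wiener integral.\<close>

lemma J1_triple_product:
  assumes f: "lipf f" "lipf g" "lipf h" and i: "i \<in> {1..m}" "j \<in> {1..m}" "k \<in> {1..m}" and s: "s \<in> {t..T}"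
  shows "AE \<omega> in M. J1 i f s \<omega> * J1 j g s \<omega> * J1 k h s \<omega> =
     J3 i f j g k h s \<omega> + J3 i f k h j g s \<omega> + J3 j g i f k h s \<omega> + J3 j g k h i f s \<omega> + J3 k h i f j g s \<omega> + J3 k h j g i f s \<omega>
     + (if i = j then D1 (\<lambda>u. f u * g u) s * J1 k h s \<omega> else 0)
     + (if i = k then D1 (\<lambda>u. f u * h u) s * J1 j g s \<omega> else 0)
     + (if j = k then D1 (\<lambda>u. g u * h u) s * J1 i f s \<omega> else 0)"
  using J1_product[OF f(1,2) i(1,2) s] J2_J1_product[OF f i s] J2_J1_product[OF f(2,1,3) i(2,1,3) s]
    J1_parts[OF lipf_mult[OF f(1,3)] f(2) i(2) s] J1_parts[OF lipf_mult[OF f(2,3)] f(1) i(1) s]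
proof eventually_elim
  case (elim \<omega>)
  have "J1 i f s \<omega> * J1 j g s \<omega> * J1 k h s \<omega> = J2 i f j g s \<omega> * J1 k h s \<omega> + J2 j g i f s \<omega> * J1 k h s \<omega>
     + (if i = j then D1 (\<lambda>u. f u * g u) s * J1 k h s \<omega> else 0)"
    unfolding elim(1) by (simp add: distrib_right)
  thus ?case unfolding elim(2,3,4,5) by simp
qed

text \<open>\<open>strat_int_characterization\<close> is applied level by level, each time with the
  leading density of the current integrand. The coincidence of the first two components produces a
  deterministic correction inside the outer integral; that of the last two produces a time integral
  outside.\<close>

lemma iterated_strat:
  assumes f: "lipf f" "lipf g" "lipf h" and i: "i1 \<in> {1..m}" "i2 \<in> {1..m}" "i3 \<in> {1..m}"
  defines "S1 \<equiv> \<lambda>s. strat_int M (W i1) (\<lambda>u _. f u) t s"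
  defines "S2 \<equiv> \<lambda>s. strat_int M (W i2) (\<lambda>u \<omega>. g u * S1 u \<omega>) t s"
  defines "S3 \<equiv> strat_int M (W i3) (\<lambda>u \<omega>. h u * S2 u \<omega>) t T"
  shows "\<forall>s\<in>{t..T}. strat_int_rel M (W i1) (\<lambda>u _. f u) t s (S1 s)"
    "\<forall>s\<in>{t..T}. strat_int_rel M (W i2) (\<lambda>u \<omega>. g u * S1 u \<omega>) t s (S2 s)"
    "strat_int_rel M (W i3) (\<lambda>u \<omega>. h u * S2 u \<omega>) t T S3"
    "S3 \<in> borel_measurable M"
    "AE \<omega> in M. S3 \<omega> = J3 i1 f i2 g i3 h T \<omega>
       + (if i1 = i2 then J1 i3 (\<lambda>u. h u * (D1 (\<lambda>y. f y * g y) u / 2)) T \<omega> else 0)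
       + (if i2 = i3 then J1 i1 (\<lambda>u. f u * ((D1 (\<lambda>y. g y * h y) T - D1 (\<lambda>y. g y * h y) u) / 2)) T \<omega> else 0)"
proof -
  have i': "i1 \<le> m" "i2 \<le> m" "i3 \<le> m" using i by auto
  have T: "t \<le> T" "T \<in> {t..T}" using t by auto
  note c1 = strat_int_characterization[OF adm_det[OF f(1)] adm_const lead_det[OF f(1)] i(1), of _ "\<lambda>u _. f u", folded S1_def]
  show "\<forall>s\<in>{t..T}. strat_int_rel M (W i1) (\<lambda>u _. f u) t s (S1 s)"
    by (intro ballI c1) auto
  have S1m: "S1 u \<in> borel_measurable M" if "u \<in> {t..T}" for u using that by (intro c1(2)) auto
  have S1: "AE \<omega> in M. S1 u \<omega> = J1 i1 f u \<omega>" if "u \<in> {t..T}" for u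
  proof -
    have "AE \<omega> in M. S1 u \<omega> = II i1 (\<lambda>s _. f s) u \<omega> + (if i1 = 0 then II 0 (\<lambda>_ _. 0) u \<omega> / 2 else 0)"
      using that by (intro c1(3)) auto
    thus ?thesis using i by (auto simp: J1_def)
  qed
  define X2 where "X2 u \<omega> = g u * J1 i1 f u \<omega>" for u \<omega>
  define d where "d u = (if i1 = i2 then D1 (\<lambda>y. f y * g y) u / 2 else 0)" for u
  have l12: "lipf (\<lambda>y. f y * g y)" "lipf (\<lambda>y. g y * h y)" using f by (auto intro: lipf_mult)
  have d: "lipf d"
    unfolding d_def using lipf_mult[OF lipf_const[of "1/2"] lipf_D1[OF l12(1)]] lipf_const[of 0]
    by (cases "i1 = i2") simp_all
  have aX2: "adm X2" unfolding X2_def[abs_def] using f i' by (intro adm_mult adm_J1)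
  have lX2: "lead i1 (\<lambda>u \<omega>. g u * f u) X2"
    unfolding X2_def[abs_def] J1_def using f i' by (intro lead_mult lead_II adm_det adm_II)
  have aY2: "adm (\<lambda>u \<omega>. g u * f u)" using f by (intro adm_det lipf_mult)
  have c2: "strat_int_rel M (W i2) (\<lambda>u \<omega>. g u * S1 u \<omega>) t s (S2 s)" "S2 s \<in> borel_measurable M"
    "AE \<omega> in M. S2 s \<omega> = II i2 X2 s \<omega> + (if i2 = i1 then II 0 (\<lambda>u \<omega>. g u * f u) s \<omega> / 2 else 0)" if s: "s \<in> {t..T}" for s
  proof -
    have m: "(\<lambda>\<omega>. g u * S1 u \<omega>) \<in> borel_measurable M" if "u \<in> {t..T}" for u using S1m[OF that] by simp
    have ae: "AE \<omega> in M. g u * S1 u \<omega> = X2 u \<omega>" if "u \<in> {t..T}" for u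
      using S1[OF that] by eventually_elim (simp add: X2_def)
    have s': "t \<le> s" "s \<le> T" using s by auto
    note c = strat_int_characterization[OF aX2 aY2 lX2 i(2) i'(1) s' m ae, folded S2_def]
    show "strat_int_rel M (W i2) (\<lambda>u \<omega>. g u * S1 u \<omega>) t s (S2 s)" "S2 s \<in> borel_measurable M"
      "AE \<omega> in M. S2 s \<omega> = II i2 X2 s \<omega> + (if i2 = i1 then II 0 (\<lambda>u \<omega>. g u * f u) s \<omega> / 2 else 0)"
      by (rule c; assumption)+
  qed
  show "\<forall>s\<in>{t..T}. strat_int_rel M (W i2) (\<lambda>u \<omega>. g u * S1 u \<omega>) t s (S2 s)" using c2(1) by blast
  have S2: "AE \<omega> in M. S2 s \<omega> = J2 i1 f i2 g s \<omega> + d s" if s: "s \<in> {t..T}" for s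
  proof -
    have "AE \<omega> in M. II 0 (\<lambda>u _. f u * g u) s \<omega> = D1 (\<lambda>y. f y * g y) s"
      unfolding D1_def using s l12 by (intro II_time_det) auto
    with c2(3)[OF s] show ?thesis
      by eventually_elim (auto simp: d_def J2_def X2_def[abs_def] mult.commute)
  qed
  define X3 where "X3 u \<omega> = h u * (J2 i1 f i2 g u \<omega> + d u)" for u \<omega>
  define Y3 where "Y3 u \<omega> = h u * X2 u \<omega>" for u \<omega>
  have aA: "adm (\<lambda>u \<omega>. J2 i1 f i2 g u \<omega> + d u)" using f i' d by (intro adm_add adm_J2 adm_det)
  have aX3: "adm X3" unfolding X3_def[abs_def] by (intro adm_mult f aA)
  have aY3: "adm Y3" unfolding Y3_def[abs_def] by (intro adm_mult f aX2)
  \<comment> \<open>The correction \<open>d\<close> is Lipschitz in time and affects only the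
    remainder; the leading part is that of \<open>J2\<close>, driven by component
    \<open>i2\<close>.\<close>
  have lX3: "lead i2 Y3 X3"
    unfolding X3_def[abs_def] Y3_def[abs_def]
  proof (intro lead_mult lead_add_det d f aA)
    show "lead i2 X2 (J2 i1 f i2 g)" unfolding J2_def X2_def[symmetric] by (intro lead_II aX2 i')
  qed
  have m3: "(\<lambda>\<omega>. h u * S2 u \<omega>) \<in> borel_measurable M" if "u \<in> {t..T}" for u using c2(2)[OF that] by simp
  have ae3: "AE \<omega> in M. h u * S2 u \<omega> = X3 u \<omega>" if "u \<in> {t..T}" for u
    using S2[OF that] by eventually_elim (simp add: X3_def)
  have c3: "strat_int_rel M (W i3) (\<lambda>u \<omega>. h u * S2 u \<omega>) t T S3" "S3 \<in> borel_measurable M"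
     "AE \<omega> in M. S3 \<omega> = II i3 X3 T \<omega> + (if i3 = i2 then II 0 Y3 T \<omega> / 2 else 0)"
    unfolding S3_def by (rule strat_int_characterization[OF aX3 aY3 lX3 i(3) i'(2) T(1) order.refl m3 ae3]; assumption)+
  show "strat_int_rel M (W i3) (\<lambda>u \<omega>. h u * S2 u \<omega>) t T S3" "S3 \<in> borel_measurable M" by (rule c3)+
  have split: "AE \<omega> in M. II i3 X3 T \<omega> = J3 i1 f i2 g i3 h T \<omega> + J1 i3 (\<lambda>u. h u * d u) T \<omega>"
    unfolding X3_def distrib_left J3_def J1_def using f i' d T
    by (intro II_add adm_mult adm_J2 adm_det lipf_mult) auto
  have z: "AE \<omega> in M. J1 i3 (\<lambda>u. h u * d u) T \<omega> = (if i1 = i2 then J1 i3 (\<lambda>u. h u * (D1 (\<lambda>y. f y * g y) u / 2)) T \<omega> else 0)"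
  proof (cases "i1 = i2")
    case True
    thus ?thesis by (simp add: d_def)
  next
    case False
    have "AE \<omega> in M. J1 i3 (\<lambda>u. 0 * h u + 0 * h u) T \<omega> = 0 * J1 i3 h T \<omega> + 0 * J1 i3 h T \<omega>"
      by (intro J1_linear f i' T)
    thus ?thesis using False by (simp add: d_def)
  qed
  let ?q = "D1 (\<lambda>y. g y * h y)"
  have lq: "lipf (\<lambda>u. f u * ?q u)" using f l12 by (intro lipf_mult lipf_D1)
  have lin: "AE \<omega> in M. J1 i1 (\<lambda>u. ?q T / 2 * f u + - (1 / 2) * (f u * ?q u)) T \<omega> = ?q T / 2 * J1 i1 f T \<omega> + - (1 / 2) * J1 i1 (\<lambda>u. f u * ?q u) T \<omega>"
    by (intro J1_linear f i' T lq)
  have eqs: "(\<lambda>u. ?q T / 2 * f u + - (1 / 2) * (f u * ?q u)) = (\<lambda>u. f u * ((?q T - ?q u) / 2))"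
    "Y3 = (\<lambda>u \<omega>. g u * h u * J1 i1 f u \<omega>)"
    by (simp_all add: fun_eq_iff field_simps Y3_def X2_def)
  \<comment> \<open>Integration by parts turns half the time integral into a Wiener integral whose
    weight contains half the integral of g h over the tail [u, T]. This is the half-trace that
    \<open>trace23\<close> approximates.\<close>
  have "AE \<omega> in M. II 0 Y3 T \<omega> / 2 = J1 i1 (\<lambda>u. f u * ((?q T - ?q u) / 2)) T \<omega>"
    using lin J1_parts[OF l12(2) f(1) i(1) T(2)]
  proof eventually_elim
    case (elim \<omega>)
    have "J1 i1 (\<lambda>u. f u * ((?q T - ?q u) / 2)) T \<omega> = (?q T * J1 i1 f T \<omega> - J1 i1 (\<lambda>u. f u * ?q u) T \<omega>) / 2"
      using elim(1) unfolding eqs(1) by (simp add: field_simps)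
    thus ?case unfolding elim(2) eqs(2) by simp
  qed
  with c3(3) split z show "AE \<omega> in M. S3 \<omega> = J3 i1 f i2 g i3 h T \<omega>
       + (if i1 = i2 then J1 i3 (\<lambda>u. h u * (D1 (\<lambda>y. f y * g y) u / 2)) T \<omega> else 0)
       + (if i2 = i3 then J1 i1 (\<lambda>u. f u * ((?q T - ?q u) / 2)) T \<omega> else 0)"
    by eventually_elim auto
qed

end

section \<open>Mean-square error of the expansion\<close>

text \<open>The bound is the exact second moment, written through the Gram matrix, so that the
  isometries can be substituted. With Y = 0 it covers sums without a target.\<close>

lemma (in prob_space) mom2_gram:
  assumes A: "finite A" and X: "\<And>a. a \<in> A \<Longrightarrow> mom 2 (X a) (c a)" and Y: "mom 2 Y d"
  shows "mom 2 (\<lambda>\<omega>. (\<Sum>a\<in>A. C a * X a \<omega>) - Y \<omega>)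
    ((\<Sum>a\<in>A. \<Sum>b\<in>A. C a * C b * expectation (\<lambda>\<omega>. X a \<omega> * X b \<omega>))
      - 2 * (\<Sum>a\<in>A. C a * expectation (\<lambda>\<omega>. X a \<omega> * Y \<omega>)) + expectation (\<lambda>\<omega>. Y \<omega> * Y \<omega>))"
proof -
  have i1: "integrable M (\<lambda>\<omega>. X a \<omega> * X b \<omega>)" if "a \<in> A" "b \<in> A" for a b
    using mom2_integrable_mult[OF X[OF that(1)] X[OF that(2)]] .
  have i2: "integrable M (\<lambda>\<omega>. X a \<omega> * Y \<omega>)" if "a \<in> A" for a using mom2_integrable_mult[OF X[OF that] Y] .
  have i3: "integrable M (\<lambda>\<omega>. Y \<omega> * Y \<omega>)" using mom2_integrable_mult[OF Y Y] .
  have eq: "((\<Sum>a\<in>A. C a * X a \<omega>) - Y \<omega>)\<^sup>2 = (\<Sum>a\<in>A. \<Sum>b\<in>A. C a * C b * (X a \<omega> * X b \<omega>))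
      - 2 * (\<Sum>a\<in>A. C a * (X a \<omega> * Y \<omega>)) + Y \<omega> * Y \<omega>" for \<omega>
    unfolding power2_diff power2_eq_square[of "\<Sum>a\<in>A. C a * X a \<omega>"] sum_product
    by (simp add: sum_distrib_left sum_distrib_right power2_eq_square mult_ac)
  have m: "(\<lambda>\<omega>. (\<Sum>a\<in>A. C a * X a \<omega>) - Y \<omega>) \<in> borel_measurable M"
    using momD(1)[OF X] momD(1)[OF Y] by (intro borel_measurable_diff borel_measurable_sum borel_measurable_times) auto
  have I: "integrable M (\<lambda>\<omega>. \<Sum>a\<in>A. \<Sum>b\<in>A. C a * C b * (X a \<omega> * X b \<omega>))" "integrable M (\<lambda>\<omega>. \<Sum>a\<in>A. C a * (X a \<omega> * Y \<omega>))"
    using i1 i2 by (auto intro!: Bochner_Integration.integrable_sum)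
  have "integrable M (\<lambda>\<omega>. ((\<Sum>a\<in>A. C a * X a \<omega>) - Y \<omega>)\<^sup>2)"
    unfolding eq using I i3 by (intro Bochner_Integration.integrable_add Bochner_Integration.integrable_diff integrable_mult_right)
  moreover have "expectation (\<lambda>\<omega>. ((\<Sum>a\<in>A. C a * X a \<omega>) - Y \<omega>)\<^sup>2) =
    (\<Sum>a\<in>A. \<Sum>b\<in>A. C a * C b * expectation (\<lambda>\<omega>. X a \<omega> * X b \<omega>))
      - 2 * (\<Sum>a\<in>A. C a * expectation (\<lambda>\<omega>. X a \<omega> * Y \<omega>)) + expectation (\<lambda>\<omega>. Y \<omega> * Y \<omega>)"
  proof -
    have "expectation (\<lambda>\<omega>. ((\<Sum>a\<in>A. C a * X a \<omega>) - Y \<omega>)\<^sup>2) = expectation (\<lambda>\<omega>. \<Sum>a\<in>A. \<Sum>b\<in>A. C a * C b * (X a \<omega> * X b \<omega>))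
       - 2 * expectation (\<lambda>\<omega>. \<Sum>a\<in>A. C a * (X a \<omega> * Y \<omega>)) + expectation (\<lambda>\<omega>. Y \<omega> * Y \<omega>)"
      unfolding eq using I i3 by simp
    also have "expectation (\<lambda>\<omega>. \<Sum>a\<in>A. \<Sum>b\<in>A. C a * C b * (X a \<omega> * X b \<omega>)) = (\<Sum>a\<in>A. \<Sum>b\<in>A. C a * C b * expectation (\<lambda>\<omega>. X a \<omega> * X b \<omega>))"
      using i1 by (subst Bochner_Integration.integral_sum) (auto intro!: Bochner_Integration.integrable_sum sum.cong simp: Bochner_Integration.integral_sum)
    also have "expectation (\<lambda>\<omega>. \<Sum>a\<in>A. C a * (X a \<omega> * Y \<omega>)) = (\<Sum>a\<in>A. C a * expectation (\<lambda>\<omega>. X a \<omega> * Y \<omega>))"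
      using i2 by (subst Bochner_Integration.integral_sum) auto
    finally show ?thesis .
  qed
  ultimately show ?thesis using m by (simp add: mom_def)
qed

lemma sum_diagonal_atMost:
  fixes f :: "nat \<Rightarrow> nat \<Rightarrow> real"
  shows "(\<Sum>i\<le>p. \<Sum>j\<le>q. if i = j then f i j else 0) = (\<Sum>i\<le>min p q. f i i)"
proof -
  have "(\<Sum>i\<le>p. \<Sum>j\<le>q. if i = j then f i j else 0) = (\<Sum>i\<le>p. if i \<le> q then f i i else 0)"
    by (intro sum.cong refl) (simp add: sum.delta)
  also have "\<dots> = (\<Sum>i\<in>{i\<in>{..p}. i \<le> q}. f i i)" by (rule sum.inter_filter[symmetric]) simp
  also have "{i\<in>{..p}. i \<le> q} = {..min p q}" by auto
  finally show ?thesis .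
qed

lemma tendsto_zero_triple:
  fixes h :: "nat \<times> nat \<times> nat \<Rightarrow> real"
  assumes "\<And>e. e > 0 \<Longrightarrow> \<exists>P. \<forall>p1\<ge>P. \<forall>p2\<ge>P. \<forall>p3\<ge>P. \<bar>h (p1, p2, p3)\<bar> < e"
  shows "(h \<longlongrightarrow> 0) (sequentially \<times>\<^sub>F sequentially \<times>\<^sub>F sequentially)"
proof (rule tendstoI)
  fix e :: real assume "e > 0"
  from assms[OF this] obtain P where P: "\<forall>p1\<ge>P. \<forall>p2\<ge>P. \<forall>p3\<ge>P. \<bar>h (p1, p2, p3)\<bar> < e" by blast
  have "eventually (\<lambda>p. fst p \<ge> P \<and> (fst (snd p) \<ge> P \<and> snd (snd p) \<ge> P)) (sequentially \<times>\<^sub>F sequentially \<times>\<^sub>F sequentially)"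
    by (intro eventually_prodI eventually_ge_at_top)
  thus "eventually (\<lambda>p. dist (h p) 0 < e) (sequentially \<times>\<^sub>F sequentially \<times>\<^sub>F sequentially)"
    by eventually_elim (use P in \<open>auto simp: dist_real_def\<close>)
qed

definition triples :: "nat \<Rightarrow> nat \<Rightarrow> nat \<Rightarrow> (nat \<times> nat \<times> nat) set" where
  "triples p1 p2 p3 = {..p1} \<times> {..p2} \<times> {..p3}"

lemma finite_triples: "finite (triples p1 p2 p3)"
  by (simp add: triples_def)

lemma sum_triples:
  fixes w :: "nat \<times> nat \<times> nat \<Rightarrow> real"
  shows "(\<Sum>a\<in>triples p1 p2 p3. w a) = (\<Sum>j1\<le>p1. \<Sum>j2\<le>p2. \<Sum>j3\<le>p3. w (j1, j2, j3))"
  by (simp add: triples_def sum.cartesian_product)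

text \<open>A Kronecker symbol in two indices restricts their common value to the smaller
  truncation. This is the origin of the minima in the trace bounds.\<close>

lemma sum_triples_diagonal:
  fixes w :: "nat \<Rightarrow> nat \<Rightarrow> nat \<Rightarrow> real" and x :: "nat \<Rightarrow> real"
  shows "(\<Sum>j1\<le>p1. \<Sum>j2\<le>p2. \<Sum>j3\<le>p3. w j1 j2 j3 * (if j1 = j2 then x j3 else 0)) = (\<Sum>j\<le>p3. (\<Sum>i\<le>min p1 p2. w i i j) * x j)"
    and "(\<Sum>j1\<le>p1. \<Sum>j2\<le>p2. \<Sum>j3\<le>p3. w j1 j2 j3 * (if j1 = j3 then x j2 else 0)) = (\<Sum>j\<le>p2. (\<Sum>i\<le>min p1 p3. w i j i) * x j)"
    and "(\<Sum>j1\<le>p1. \<Sum>j2\<le>p2. \<Sum>j3\<le>p3. w j1 j2 j3 * (if j2 = j3 then x j1 else 0)) = (\<Sum>j\<le>p1. (\<Sum>i\<le>min p2 p3. w j i i) * x j)"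
proof -
  have "(\<Sum>j1\<le>p1. \<Sum>j2\<le>p2. \<Sum>j3\<le>p3. w j1 j2 j3 * (if j1 = j2 then x j3 else 0))
     = (\<Sum>j1\<le>p1. \<Sum>j2\<le>p2. if j1 = j2 then (\<Sum>j3\<le>p3. w j1 j2 j3 * x j3) else 0)"
    by (intro sum.cong refl) simp
  also have "\<dots> = (\<Sum>i\<le>min p1 p2. \<Sum>j\<le>p3. w i i j * x j)" by (rule sum_diagonal_atMost)
  also have "\<dots> = (\<Sum>j\<le>p3. (\<Sum>i\<le>min p1 p2. w i i j) * x j)"
    by (subst sum.swap) (simp add: sum_distrib_right)
  finally show "(\<Sum>j1\<le>p1. \<Sum>j2\<le>p2. \<Sum>j3\<le>p3. w j1 j2 j3 * (if j1 = j2 then x j3 else 0)) = (\<Sum>j\<le>p3. (\<Sum>i\<le>min p1 p2. w i i j) * x j)" .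
  have "(\<Sum>j1\<le>p1. \<Sum>j2\<le>p2. \<Sum>j3\<le>p3. w j1 j2 j3 * (if j1 = j3 then x j2 else 0))
     = (\<Sum>j2\<le>p2. \<Sum>j1\<le>p1. \<Sum>j3\<le>p3. if j1 = j3 then w j1 j2 j3 * x j2 else 0)"
    by (subst sum.swap) (intro sum.cong refl, simp)
  also have "\<dots> = (\<Sum>j\<le>p2. (\<Sum>i\<le>min p1 p3. w i j i) * x j)"
    by (simp only: sum_diagonal_atMost sum_distrib_right)
  finally show "(\<Sum>j1\<le>p1. \<Sum>j2\<le>p2. \<Sum>j3\<le>p3. w j1 j2 j3 * (if j1 = j3 then x j2 else 0)) = (\<Sum>j\<le>p2. (\<Sum>i\<le>min p1 p3. w i j i) * x j)" .
  have "(\<Sum>j1\<le>p1. \<Sum>j2\<le>p2. \<Sum>j3\<le>p3. w j1 j2 j3 * (if j2 = j3 then x j1 else 0))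
     = (\<Sum>j1\<le>p1. \<Sum>j2\<le>p2. \<Sum>j3\<le>p3. if j2 = j3 then w j1 j2 j3 * x j1 else 0)"
    by (intro sum.cong refl) simp
  also have "\<dots> = (\<Sum>j\<le>p1. (\<Sum>i\<le>min p2 p3. w j i i) * x j)"
    by (simp only: sum_diagonal_atMost sum_distrib_right)
  finally show "(\<Sum>j1\<le>p1. \<Sum>j2\<le>p2. \<Sum>j3\<le>p3. w j1 j2 j3 * (if j2 = j3 then x j1 else 0)) = (\<Sum>j\<le>p1. (\<Sum>i\<le>min p2 p3. w j i i) * x j)" .
qed

lemma small_min_add:
  fixes a b :: "nat \<Rightarrow> real"
  assumes "a \<longlonglongrightarrow> 0" "b \<longlonglongrightarrow> 0" "e > 0"
  shows "\<exists>P. \<forall>x\<ge>P. \<forall>y\<ge>P. \<forall>z\<ge>P. \<bar>a (min x y) + b z\<bar> < e"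
proof -
  obtain N where N: "\<And>n. n \<ge> N \<Longrightarrow> \<bar>a n\<bar> < e / 2"
    using LIMSEQ_D[OF assms(1), of "e / 2"] assms(3) by auto
  obtain N' where N': "\<And>n. n \<ge> N' \<Longrightarrow> \<bar>b n\<bar> < e / 2"
    using LIMSEQ_D[OF assms(2), of "e / 2"] assms(3) by auto
  have "\<bar>a (min x y) + b z\<bar> < e" if "x \<ge> max N N'" "y \<ge> max N N'" "z \<ge> max N N'" for x y z
  proof -
    have "\<bar>a (min x y)\<bar> < e / 2" "\<bar>b z\<bar> < e / 2" using that N[of "min x y"] N'[of z] by simp_all
    thus ?thesis by linarith
  qed
  thus ?thesis by blast
qed

context ito
begin

lemma lipf_poly: "lipf (poly p)"
proof (induction p)
  case 0
  show ?case by (simp add: poly_0[abs_def] lipf_const)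
next
  case (pCons a p)
  have "lipf (\<lambda>x. a + x * poly p x)" by (intro lipf_add lipf_const lipf_mult lipf_id pCons)
  thus ?case by (simp add: poly_pCons[abs_def])
qed

lemma lipf_phi: "lipf (\<phi> j)"
  using lipf_poly[of "phi_poly t T j"] by (simp add: poly_phi_poly[OF tT])

context
  fixes i1 i2 i3 :: nat and f g h :: "real \<Rightarrow> real"
  assumes i: "i1 \<in> {1..m}" "i2 \<in> {1..m}" "i3 \<in> {1..m}" and f: "lipf f" "lipf g" "lipf h"
begin

private lemma T: "T \<in> {t..T}" "t \<le> T" using t by auto

private lemma cf: "cont f" "cont g" "cont h" using f by (auto intro: lipf_continuous_on)

private definition C :: "nat \<times> nat \<times> nat \<Rightarrow> real" where "C a = C3 f g h (fst a) (fst (snd a)) (snd (snd a))"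

text \<open>\<open>K0\<close> keeps the original order; \<open>K1\<close> to \<open>K5\<close>
  permute it, each basis function moving together with its component.\<close>

private definition K0 where "K0 a = J3 i1 (\<phi> (fst a)) i2 (\<phi> (fst (snd a))) i3 (\<phi> (snd (snd a))) T"
private definition K1 where "K1 a = J3 i1 (\<phi> (fst a)) i3 (\<phi> (snd (snd a))) i2 (\<phi> (fst (snd a))) T"
private definition K2 where "K2 a = J3 i2 (\<phi> (fst (snd a))) i1 (\<phi> (fst a)) i3 (\<phi> (snd (snd a))) T"
private definition K3 where "K3 a = J3 i2 (\<phi> (fst (snd a))) i3 (\<phi> (snd (snd a))) i1 (\<phi> (fst a)) T"
private definition K4 where "K4 a = J3 i3 (\<phi> (snd (snd a))) i1 (\<phi> (fst a)) i2 (\<phi> (fst (snd a))) T"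
private definition K5 where "K5 a = J3 i3 (\<phi> (snd (snd a))) i2 (\<phi> (fst (snd a))) i1 (\<phi> (fst a)) T"

private lemma mom2_J3: "lipf p \<Longrightarrow> lipf q \<Longrightarrow> lipf r \<Longrightarrow> i \<in> {1..m} \<Longrightarrow> j \<in> {1..m} \<Longrightarrow> k \<in> {1..m} \<Longrightarrow> \<exists>c. mom 2 (J3 i p j q k r T) c"
  using adm_mom2[OF adm_J3, of p q r i j k T] T by auto

text \<open>The six quantities are even moments, hence nonnegative, and their sum is E; so each of
  them is at most E. Every isometry used compares an ordering with itself, so coincidences among the
  components do no harm.\<close>

lemma chaos_error:
  assumes A: "finite A"
  defines "E \<equiv> D3 (\<lambda>s. (f s)\<^sup>2) (\<lambda>s. (g s)\<^sup>2) (\<lambda>s. (h s)\<^sup>2) T - (\<Sum>a\<in>A. (C a)\<^sup>2)"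
  shows "mom 2 (\<lambda>\<omega>. (\<Sum>a\<in>A. C a * K0 a \<omega>) - J3 i1 f i2 g i3 h T \<omega>) E"
    "mom 2 (\<lambda>\<omega>. \<Sum>a\<in>A. C a * K1 a \<omega>) E" "mom 2 (\<lambda>\<omega>. \<Sum>a\<in>A. C a * K2 a \<omega>) E"
    "mom 2 (\<lambda>\<omega>. \<Sum>a\<in>A. C a * K3 a \<omega>) E" "mom 2 (\<lambda>\<omega>. \<Sum>a\<in>A. C a * K4 a \<omega>) E"
    "mom 2 (\<lambda>\<omega>. \<Sum>a\<in>A. C a * K5 a \<omega>) E"
proof -
  note L = lipf_phi
  define G where "G K = (\<Sum>a\<in>A. \<Sum>b\<in>A. C a * C b * expectation (\<lambda>\<omega>. K a \<omega> * K b \<omega>))" for K :: "_ \<Rightarrow> 'a \<Rightarrow> real"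
  have gram: "mom 2 (\<lambda>\<omega>. \<Sum>a\<in>A. C a * K a \<omega>) (G K)" if "\<And>a. \<exists>c. mom 2 (K a) c" for K
  proof -
    obtain c where "\<And>a. mom 2 (K a) (c a)" using \<open>\<And>a. \<exists>c. mom 2 (K a) c\<close> by metis
    from mom2_gram[OF A this mom_0[of 2], of C] show ?thesis by (simp add: G_def)
  qed
  define e0 where "e0 = G K0 - 2 * (\<Sum>a\<in>A. C a * C a) + D3 (\<lambda>s. (f s)\<^sup>2) (\<lambda>s. (g s)\<^sup>2) (\<lambda>s. (h s)\<^sup>2) T"
  have m0: "mom 2 (\<lambda>\<omega>. (\<Sum>a\<in>A. C a * K0 a \<omega>) - J3 i1 f i2 g i3 h T \<omega>) e0"
  proof -
    have "\<And>a. \<exists>c. mom 2 (K0 a) c" unfolding K0_def by (intro mom2_J3 L i)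
    then obtain c where c: "\<And>a. mom 2 (K0 a) (c a)" by metis
    obtain d where d: "mom 2 (J3 i1 f i2 g i3 h T) d" using mom2_J3[OF f i] by blast
    have "expectation (\<lambda>\<omega>. K0 a \<omega> * J3 i1 f i2 g i3 h T \<omega>) = C a" for a
      unfolding K0_def C_def C3_def isometry_J3[OF L f(1) L f(2) L f(3) i T(1)] by (simp add: mult.commute)
    moreover have "expectation (\<lambda>\<omega>. J3 i1 f i2 g i3 h T \<omega> * J3 i1 f i2 g i3 h T \<omega>) = D3 (\<lambda>s. (f s)\<^sup>2) (\<lambda>s. (g s)\<^sup>2) (\<lambda>s. (h s)\<^sup>2) T"
      unfolding isometry_J3[OF f(1) f(1) f(2) f(2) f(3) f(3) i T(1)] by (simp add: power2_eq_square)
    ultimately show ?thesis using mom2_gram[OF A c d, of C] by (simp add: e0_def G_def)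
  qed
  have mK: "mom 2 (\<lambda>\<omega>. \<Sum>a\<in>A. C a * K1 a \<omega>) (G K1)" "mom 2 (\<lambda>\<omega>. \<Sum>a\<in>A. C a * K2 a \<omega>) (G K2)"
    "mom 2 (\<lambda>\<omega>. \<Sum>a\<in>A. C a * K3 a \<omega>) (G K3)" "mom 2 (\<lambda>\<omega>. \<Sum>a\<in>A. C a * K4 a \<omega>) (G K4)"
    "mom 2 (\<lambda>\<omega>. \<Sum>a\<in>A. C a * K5 a \<omega>) (G K5)"
    unfolding K1_def K2_def K3_def K4_def K5_def by (intro gram mom2_J3 L i)+
  \<comment> \<open>The six Gram matrices add up to the identity: entrywise this is
    \<open>sum_permutations_D3\<close> for products of basis functions, followed by
    orthonormality.\<close>
  have "G K0 + G K1 + G K2 + G K3 + G K4 + G K5 = (\<Sum>a\<in>A. \<Sum>b\<in>A. C a * C b * (if a = b then 1 else 0))"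
    unfolding G_def sum.distrib[symmetric] distrib_left[symmetric]
  proof (intro sum.cong refl arg_cong2[where f = "(*)"])
    fix a b :: "nat \<times> nat \<times> nat"
    let ?p = "\<lambda>u. \<phi> (fst a) u * \<phi> (fst b) u" and ?q = "\<lambda>u. \<phi> (fst (snd a)) u * \<phi> (fst (snd b)) u"
      and ?r = "\<lambda>u. \<phi> (snd (snd a)) u * \<phi> (snd (snd b)) u"
    have "cont ?p" "cont ?q" "cont ?r" by (intro continuous_intros)+
    from sum_permutations_D3[OF this T(1)]
    show "expectation (\<lambda>\<omega>. K0 a \<omega> * K0 b \<omega>) + expectation (\<lambda>\<omega>. K1 a \<omega> * K1 b \<omega>) + expectation (\<lambda>\<omega>. K2 a \<omega> * K2 b \<omega>) +
      expectation (\<lambda>\<omega>. K3 a \<omega> * K3 b \<omega>) + expectation (\<lambda>\<omega>. K4 a \<omega> * K4 b \<omega>) + expectation (\<lambda>\<omega>. K5 a \<omega> * K5 b \<omega>) = (if a = b then 1 else 0)"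
      unfolding K0_def K1_def K2_def K3_def K4_def K5_def
        isometry_J3[OF L L L L L L i(1,2,3) T(1)] isometry_J3[OF L L L L L L i(1,3,2) T(1)]
        isometry_J3[OF L L L L L L i(2,1,3) T(1)] isometry_J3[OF L L L L L L i(2,3,1) T(1)]
        isometry_J3[OF L L L L L L i(3,1,2) T(1)] isometry_J3[OF L L L L L L i(3,2,1) T(1)]
      by (auto simp: D1_phi prod_eq_iff)
  qed
  also have "\<dots> = (\<Sum>a\<in>A. C a * C a)"
    using A by (intro sum.cong refl) (simp add: if_distrib cong: if_cong)
  finally have "e0 + G K1 + G K2 + G K3 + G K4 + G K5 = E"
    by (simp add: e0_def E_def power2_eq_square)
  moreover have "e0 \<ge> 0" "G K1 \<ge> 0" "G K2 \<ge> 0" "G K3 \<ge> 0" "G K4 \<ge> 0" "G K5 \<ge> 0"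
    using mom_nonneg[OF m0] mK[THEN mom_nonneg] by auto
  ultimately show "mom 2 (\<lambda>\<omega>. (\<Sum>a\<in>A. C a * K0 a \<omega>) - J3 i1 f i2 g i3 h T \<omega>) E"
    "mom 2 (\<lambda>\<omega>. \<Sum>a\<in>A. C a * K1 a \<omega>) E" "mom 2 (\<lambda>\<omega>. \<Sum>a\<in>A. C a * K2 a \<omega>) E"
    "mom 2 (\<lambda>\<omega>. \<Sum>a\<in>A. C a * K3 a \<omega>) E" "mom 2 (\<lambda>\<omega>. \<Sum>a\<in>A. C a * K4 a \<omega>) E"
    "mom 2 (\<lambda>\<omega>. \<Sum>a\<in>A. C a * K5 a \<omega>) E"
    using m0 mK by (auto intro: mom_mono)
qed

private lemma mom2_J1: "lipf q \<Longrightarrow> j \<in> {1..m} \<Longrightarrow> \<exists>c. mom 2 (J1 j q T) c"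
  using adm_mom2[OF adm_J1, of q j T] T by auto

text \<open>By orthonormality the Gram matrix is the identity, and the result is precisely the
  expression bounded in \<open>trace12\<close> and \<open>trace23\<close>; with G = 0 it is the one
  of \<open>trace13\<close>.\<close>

lemma trace_error:
  assumes G: "lipf G" and j: "k \<in> {1..m}"
  shows "mom 2 (\<lambda>\<omega>. (\<Sum>j\<le>n. \<alpha> j * J1 k (\<phi> j) T \<omega>) - J1 k G T \<omega>)
    ((\<Sum>j\<le>n. (\<alpha> j)\<^sup>2) - 2 * (\<Sum>j\<le>n. \<alpha> j * D1 (\<lambda>x. G x * \<phi> j x) T) + D1 (\<lambda>x. (G x)\<^sup>2) T)"
proof -
  note L = lipf_phi
  obtain c where c: "\<And>j. mom 2 (J1 k (\<phi> j) T) (c j)" using mom2_J1[OF L j] by metis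
  obtain d where d: "mom 2 (J1 k G T) d" using mom2_J1[OF G j] by blast
  have "(\<Sum>a\<le>n. \<Sum>b\<le>n. \<alpha> a * \<alpha> b * expectation (\<lambda>\<omega>. J1 k (\<phi> a) T \<omega> * J1 k (\<phi> b) T \<omega>)) = (\<Sum>a\<le>n. (\<alpha> a)\<^sup>2)"
    by (intro sum.cong refl) (simp add: isometry_J1[OF L L j T(1)] D1_phi if_distrib power2_eq_square cong: if_cong)
  moreover have "expectation (\<lambda>\<omega>. J1 k (\<phi> a) T \<omega> * J1 k G T \<omega>) = D1 (\<lambda>x. G x * \<phi> a x) T" for a
    unfolding isometry_J1[OF L G j T(1)] by (simp add: mult.commute)
  moreover have "expectation (\<lambda>\<omega>. J1 k G T \<omega> * J1 k G T \<omega>) = D1 (\<lambda>x. (G x)\<^sup>2) T"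
    unfolding isometry_J1[OF G G j T(1)] by (simp add: power2_eq_square)
  ultimately show ?thesis using mom2_gram[where X = "\<lambda>j. J1 k (\<phi> j) T" and C = \<alpha>, OF finite_atMost[of n] c d] by simp
qed

text \<open>Convergence along all large triples follows from one good triple, since enlarging the
  box of indices can only increase the sum of squares.\<close>

lemma chaos_error_small:
  assumes "e > 0"
  shows "\<exists>P. \<forall>p1\<ge>P. \<forall>p2\<ge>P. \<forall>p3\<ge>P.
    D3 (\<lambda>s. (f s)\<^sup>2) (\<lambda>s. (g s)\<^sup>2) (\<lambda>s. (h s)\<^sup>2) T - (\<Sum>a\<in>triples p1 p2 p3. (C a)\<^sup>2) < e"
proof -
  obtain q1 q2 q3 where q: "(\<Sum>j1\<le>q1. \<Sum>j2\<le>q2. \<Sum>j3\<le>q3. (C3 f g h j1 j2 j3)\<^sup>2) >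
     D3 (\<lambda>s. (f s)\<^sup>2) (\<lambda>s. (g s)\<^sup>2) (\<lambda>s. (h s)\<^sup>2) T - e"
    using parseval_C3[OF cf assms] by blast
  have "D3 (\<lambda>s. (f s)\<^sup>2) (\<lambda>s. (g s)\<^sup>2) (\<lambda>s. (h s)\<^sup>2) T - (\<Sum>a\<in>triples p1 p2 p3. (C a)\<^sup>2) < e"
    if "p1 \<ge> q1 + q2 + q3" "p2 \<ge> q1 + q2 + q3" "p3 \<ge> q1 + q2 + q3" for p1 p2 p3
  proof -
    have "(\<Sum>a\<in>triples q1 q2 q3. (C a)\<^sup>2) \<le> (\<Sum>a\<in>triples p1 p2 p3. (C a)\<^sup>2)"
      using that by (intro sum_mono2) (auto simp: triples_def)
    thus ?thesis using q unfolding sum_triples[of _ q1] C_def by simp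
  qed
  thus ?thesis by blast
qed

text \<open>Expanding each product of three Wiener integrals by \<open>J1_triple_product\<close>
  groups the partial sum into six orderings and three traces; the target has matching terms for the
  original ordering and for the traces (1,2) and (2,3), while the trace (1,3) must vanish in the
  limit.\<close>

lemma expansion_limit:
  assumes eq: "i1 = i2 \<Longrightarrow> f = g" "i2 = i3 \<Longrightarrow> g = h" "i1 = i3 \<Longrightarrow> f = h"
  shows "\<exists>B. (B \<longlongrightarrow> 0) (sequentially \<times>\<^sub>F sequentially \<times>\<^sub>F sequentially) \<and> (\<forall>p1 p2 p3. mom 2 (\<lambda>\<omega>.
     (\<Sum>j1\<le>p1. \<Sum>j2\<le>p2. \<Sum>j3\<le>p3. C3 f g h j1 j2 j3 * J1 i1 (\<phi> j1) T \<omega> * J1 i2 (\<phi> j2) T \<omega> * J1 i3 (\<phi> j3) T \<omega>)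
     - (J3 i1 f i2 g i3 h T \<omega>
       + (if i1 = i2 then J1 i3 (\<lambda>u. h u * (D1 (\<lambda>y. f y * g y) u / 2)) T \<omega> else 0)
       + (if i2 = i3 then J1 i1 (\<lambda>u. f u * ((D1 (\<lambda>y. g y * h y) T - D1 (\<lambda>y. g y * h y) u) / 2)) T \<omega> else 0)))
     (B (p1, p2, p3)))"
proof -
  define G12 where "G12 = (\<lambda>u. h u * (D1 (\<lambda>y. f y * g y) u / 2))"
  define G23 where "G23 = (\<lambda>u. f u * ((D1 (\<lambda>y. g y * h y) T - D1 (\<lambda>y. g y * h y) u) / 2))"
  have lG: "lipf G12" "lipf G23"
  proof -
    have "lipf (\<lambda>u. h u * ((1 / 2) * D1 (\<lambda>y. f y * g y) u))"
      "lipf (\<lambda>u. f u * ((1 / 2) * (D1 (\<lambda>y. g y * h y) T - D1 (\<lambda>y. g y * h y) u)))"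
      by (intro lipf_mult lipf_const lipf_diff lipf_D1 f)+
    thus "lipf G12" "lipf G23" by (simp_all add: G12_def G23_def)
  qed
  define t12 where "t12 p1 p2 p3 \<omega> = (\<Sum>j\<le>p3. (\<Sum>i\<le>min p1 p2. C3 f g h i i j) * J1 i3 (\<phi> j) T \<omega>) - J1 i3 G12 T \<omega>" for p1 p2 p3 \<omega>
  define t13 where "t13 p1 p2 p3 \<omega> = (\<Sum>j\<le>p2. (\<Sum>i\<le>min p1 p3. C3 f g h i j i) * J1 i2 (\<phi> j) T \<omega>)" for p1 p2 p3 \<omega>
  define t23 where "t23 p1 p2 p3 \<omega> = (\<Sum>j\<le>p1. (\<Sum>i\<le>min p2 p3. C3 f g h j i i) * J1 i1 (\<phi> j) T \<omega>) - J1 i1 G23 T \<omega>" for p1 p2 p3 \<omega>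
  have "\<exists>a b. a \<longlonglongrightarrow> 0 \<and> b \<longlonglongrightarrow> 0 \<and> (\<forall>p1 p2 p3. mom 2 (\<lambda>\<omega>. if i1 = i2 then t12 p1 p2 p3 \<omega> else 0) (a (min p1 p2) + b p3))"
  proof (cases "i1 = i2")
    case True
    obtain a b where ab: "a \<longlonglongrightarrow> 0" "b \<longlonglongrightarrow> 0" "\<And>q n.
      (\<Sum>j\<le>n. (\<Sum>i\<le>q. C3 f f h i i j)\<^sup>2) - 2 * (\<Sum>j\<le>n. (\<Sum>i\<le>q. C3 f f h i i j) * D1 (\<lambda>x. h x * (D1 (\<lambda>y. f y * f y) x / 2) * \<phi> j x) T)
      + D1 (\<lambda>x. (h x * (D1 (\<lambda>y. f y * f y) x / 2))\<^sup>2) T \<le> a q + b n"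
      using trace12[OF cf(1,3)] by blast
    have "mom 2 (t12 p1 p2 p3) (a (min p1 p2) + b p3)" for p1 p2 p3
      unfolding t12_def
      by (rule mom_mono[OF trace_error[OF lG(1) i(3)]]) (use ab(3)[of "min p1 p2" p3] eq(1)[OF True] in \<open>simp add: G12_def\<close>)
    thus ?thesis using ab(1,2) True by auto
  next
    case False
    thus ?thesis using mom_0[of 2] by (intro exI[of _ "\<lambda>_. 0"]) simp
  qed
  then obtain a12 b12 where r12: "a12 \<longlonglongrightarrow> 0" "b12 \<longlonglongrightarrow> 0" "\<And>p1 p2 p3. mom 2 (\<lambda>\<omega>. if i1 = i2 then t12 p1 p2 p3 \<omega> else 0) (a12 (min p1 p2) + b12 p3)"
    by blast
  have "\<exists>a b. a \<longlonglongrightarrow> 0 \<and> b \<longlonglongrightarrow> 0 \<and> (\<forall>p1 p2 p3. mom 2 (\<lambda>\<omega>. if i1 = i3 then t13 p1 p2 p3 \<omega> else 0) (a (min p1 p3) + b p2))"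
  proof (cases "i1 = i3")
    case True
    obtain a b where ab: "a \<longlonglongrightarrow> 0" "b \<longlonglongrightarrow> 0" "\<And>q n. (\<Sum>j\<le>n. (\<Sum>i\<le>q. C3 f g f i j i)\<^sup>2) \<le> a q + b n"
      using trace13[OF cf(1,2)] by blast
    have "mom 2 (t13 p1 p2 p3) (a (min p1 p3) + b p2)" for p1 p2 p3
    proof -
      \<comment> \<open>The trace (1,3) is compared with the integral of the zero function, which is
        0 almost surely by linearity.\<close>
      have z: "AE \<omega> in M. J1 i2 (\<lambda>u. 0 * f u + 0 * f u) T \<omega> = 0 * J1 i2 f T \<omega> + 0 * J1 i2 f T \<omega>"
        using i by (intro J1_linear f T) auto
      have "mom 2 (\<lambda>\<omega>. (\<Sum>j\<le>p2. (\<Sum>i\<le>min p1 p3. C3 f g h i j i) * J1 i2 (\<phi> j) T \<omega>) - J1 i2 (\<lambda>u. 0) T \<omega>) (a (min p1 p3) + b p2)"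
        by (rule mom_mono[OF trace_error[OF lipf_const i(2)]]) (use ab(3)[of "min p1 p3" p2] eq(3)[OF True] in \<open>simp add: D1_def\<close>)
      thus ?thesis
      proof (rule mom_AE_cong)
        show "AE \<omega> in M. (\<Sum>j\<le>p2. (\<Sum>i\<le>min p1 p3. C3 f g h i j i) * J1 i2 (\<phi> j) T \<omega>) - J1 i2 (\<lambda>u. 0) T \<omega> = t13 p1 p2 p3 \<omega>"
          using z by eventually_elim (simp add: t13_def)
        show "t13 p1 p2 p3 \<in> borel_measurable M" unfolding t13_def
          using adm_measurable(2)[OF adm_J1[OF lipf_phi, of i2]] i T by (intro borel_measurable_sum borel_measurable_times) auto
      qed
    qed
    thus ?thesis using ab(1,2) True by auto
  next
    case False
    thus ?thesis using mom_0[of 2] by (intro exI[of _ "\<lambda>_. 0"]) simp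
  qed
  then obtain a13 b13 where r13: "a13 \<longlonglongrightarrow> 0" "b13 \<longlonglongrightarrow> 0" "\<And>p1 p2 p3. mom 2 (\<lambda>\<omega>. if i1 = i3 then t13 p1 p2 p3 \<omega> else 0) (a13 (min p1 p3) + b13 p2)"
    by blast
  have "\<exists>a b. a \<longlonglongrightarrow> 0 \<and> b \<longlonglongrightarrow> 0 \<and> (\<forall>p1 p2 p3. mom 2 (\<lambda>\<omega>. if i2 = i3 then t23 p1 p2 p3 \<omega> else 0) (a (min p2 p3) + b p1))"
  proof (cases "i2 = i3")
    case True
    obtain a b where ab: "a \<longlonglongrightarrow> 0" "b \<longlonglongrightarrow> 0" "\<And>q n. (\<Sum>j\<le>n. (\<Sum>i\<le>q. C3 f g g j i i)\<^sup>2)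
     - 2 * (\<Sum>j\<le>n. (\<Sum>i\<le>q. C3 f g g j i i) * D1 (\<lambda>x. f x * ((D1 (\<lambda>y. g y * g y) T - D1 (\<lambda>y. g y * g y) x) / 2) * \<phi> j x) T)
      + D1 (\<lambda>x. (f x * ((D1 (\<lambda>y. g y * g y) T - D1 (\<lambda>y. g y * g y) x) / 2))\<^sup>2) T \<le> a q + b n"
      using trace23[OF cf(1,2)] by blast
    have "mom 2 (t23 p1 p2 p3) (a (min p2 p3) + b p1)" for p1 p2 p3
      unfolding t23_def
      by (rule mom_mono[OF trace_error[OF lG(2) i(1)]]) (use ab(3)[of "min p2 p3" p1] eq(2)[OF True] in \<open>simp add: G23_def\<close>)
    thus ?thesis using ab(1,2) True by auto
  next
    case False
    thus ?thesis using mom_0[of 2] by (intro exI[of _ "\<lambda>_. 0"]) simp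
  qed
  then obtain a23 b23 where r23: "a23 \<longlonglongrightarrow> 0" "b23 \<longlonglongrightarrow> 0" "\<And>p1 p2 p3. mom 2 (\<lambda>\<omega>. if i2 = i3 then t23 p1 p2 p3 \<omega> else 0) (a23 (min p2 p3) + b23 p1)"
    by blast
  define E where "E p1 p2 p3 = D3 (\<lambda>s. (f s)\<^sup>2) (\<lambda>s. (g s)\<^sup>2) (\<lambda>s. (h s)\<^sup>2) T - (\<Sum>a\<in>triples p1 p2 p3. (C a)\<^sup>2)" for p1 p2 p3
  \<comment> \<open>Nine terms are added by eight uses of \<open>mom2_add\<close>, each of which
    doubles. With a common bound r this gives 4, 10, 22, 46, 94, 190, 382 and finally 766 times
    r.\<close>
  define B where "B p1 p2 p3 = 766 * (E p1 p2 p3 + (a12 (min p1 p2) + b12 p3) + (a13 (min p1 p3) + b13 p2) + (a23 (min p2 p3) + b23 p1))" for p1 p2 p3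
  note che = chaos_error[OF finite_triples, folded E_def]
  have E0: "E p1 p2 p3 \<ge> 0" for p1 p2 p3 using mom_nonneg[OF che(2)] by simp
  have lim: "((\<lambda>(p1, p2, p3). B p1 p2 p3) \<longlongrightarrow> 0) (sequentially \<times>\<^sub>F sequentially \<times>\<^sub>F sequentially)"
  proof (rule tendsto_zero_triple)
    fix e :: real assume "e > 0"
    \<comment> \<open>Four contributions, each below e/4000, multiplied by 766 stay below e.\<close>
    hence e: "e / 4000 > 0" by simp
    obtain P1 where P1: "\<And>p1 p2 p3. p1 \<ge> P1 \<Longrightarrow> p2 \<ge> P1 \<Longrightarrow> p3 \<ge> P1 \<Longrightarrow> E p1 p2 p3 < e / 4000"
      using chaos_error_small[OF e] unfolding E_def by blast
    obtain P2 where P2: "\<And>x y z. x \<ge> P2 \<Longrightarrow> y \<ge> P2 \<Longrightarrow> z \<ge> P2 \<Longrightarrow> \<bar>a12 (min x y) + b12 z\<bar> < e / 4000"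
      using small_min_add[OF r12(1,2) e] by blast
    obtain P3 where P3: "\<And>x y z. x \<ge> P3 \<Longrightarrow> y \<ge> P3 \<Longrightarrow> z \<ge> P3 \<Longrightarrow> \<bar>a13 (min x y) + b13 z\<bar> < e / 4000"
      using small_min_add[OF r13(1,2) e] by blast
    obtain P4 where P4: "\<And>x y z. x \<ge> P4 \<Longrightarrow> y \<ge> P4 \<Longrightarrow> z \<ge> P4 \<Longrightarrow> \<bar>a23 (min x y) + b23 z\<bar> < e / 4000"
      using small_min_add[OF r23(1,2) e] by blast
    have "\<bar>B p1 p2 p3\<bar> < e" if "p1 \<ge> P1 + P2 + P3 + P4" "p2 \<ge> P1 + P2 + P3 + P4" "p3 \<ge> P1 + P2 + P3 + P4" for p1 p2 p3
    proof -
      have "E p1 p2 p3 < e / 4000" using that by (intro P1) auto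
      moreover have "\<bar>a12 (min p1 p2) + b12 p3\<bar> < e / 4000" using that by (intro P2) auto
      moreover have "\<bar>a13 (min p1 p3) + b13 p2\<bar> < e / 4000" using that by (intro P3) auto
      moreover have "\<bar>a23 (min p2 p3) + b23 p1\<bar> < e / 4000" using that by (intro P4) auto
      moreover have "\<bar>766 * (w + x + y + z)\<bar> < e"
        if "w < e / 4000" "\<bar>x\<bar> < e / 4000" "\<bar>y\<bar> < e / 4000" "\<bar>z\<bar> < e / 4000" "0 \<le> w" for w x y z :: real
        using that unfolding abs_less_iff by (intro conjI) (simp_all add: field_simps)
      ultimately show ?thesis using E0[of p1 p2 p3] unfolding B_def by blast
    qed
    thus "\<exists>P. \<forall>p1\<ge>P. \<forall>p2\<ge>P. \<forall>p3\<ge>P. \<bar>case (p1, p2, p3) of (p1, p2, p3) \<Rightarrow> B p1 p2 p3\<bar> < e"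
      by (intro exI[of _ "P1 + P2 + P3 + P4"]) simp
  qed
  have main: "mom 2 (\<lambda>\<omega>.
     (\<Sum>j1\<le>p1. \<Sum>j2\<le>p2. \<Sum>j3\<le>p3. C3 f g h j1 j2 j3 * J1 i1 (\<phi> j1) T \<omega> * J1 i2 (\<phi> j2) T \<omega> * J1 i3 (\<phi> j3) T \<omega>)
     - (J3 i1 f i2 g i3 h T \<omega> + (if i1 = i2 then J1 i3 G12 T \<omega> else 0) + (if i2 = i3 then J1 i1 G23 T \<omega> else 0)))
     (B p1 p2 p3)" (is "mom 2 ?S _") for p1 p2 p3
  proof -
    let ?A = "triples p1 p2 p3"
    define r where "r = E p1 p2 p3 + (a12 (min p1 p2) + b12 p3) + (a13 (min p1 p3) + b13 p2) + (a23 (min p2 p3) + b23 p1)"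
    have nn: "E p1 p2 p3 \<ge> 0" "a12 (min p1 p2) + b12 p3 \<ge> 0" "a13 (min p1 p3) + b13 p2 \<ge> 0" "a23 (min p2 p3) + b23 p1 \<ge> 0"
      using E0 mom_nonneg[OF r12(3)] mom_nonneg[OF r13(3)] mom_nonneg[OF r23(3)] by auto
    have le: "E p1 p2 p3 \<le> r" "a12 (min p1 p2) + b12 p3 \<le> r" "a13 (min p1 p3) + b13 p2 \<le> r" "a23 (min p2 p3) + b23 p1 \<le> r"
      using nn unfolding r_def by linarith+
    \<comment> \<open>The error regrouped by orderings and traces; only finitely many triples occur,
      so the triple product rule holds for all of them outside one null set.\<close>
    let ?R = "\<lambda>\<omega>. ((\<Sum>a\<in>?A. C a * K0 a \<omega>) - J3 i1 f i2 g i3 h T \<omega>) + (\<Sum>a\<in>?A. C a * K1 a \<omega>) + (\<Sum>a\<in>?A. C a * K2 a \<omega>)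
      + (\<Sum>a\<in>?A. C a * K3 a \<omega>) + (\<Sum>a\<in>?A. C a * K4 a \<omega>) + (\<Sum>a\<in>?A. C a * K5 a \<omega>)
      + (if i1 = i2 then t12 p1 p2 p3 \<omega> else 0) + (if i1 = i3 then t13 p1 p2 p3 \<omega> else 0) + (if i2 = i3 then t23 p1 p2 p3 \<omega> else 0)"
    have "mom 2 ?R (2 * (2 * (2 * (2 * (2 * (2 * (2 * (2 * (r + r) + r) + r) + r) + r) + r) + r) + r))"
      by (intro mom2_add mom_mono[OF che(1) le(1)] mom_mono[OF che(2) le(1)] mom_mono[OF che(3) le(1)] mom_mono[OF che(4) le(1)]
         mom_mono[OF che(5) le(1)] mom_mono[OF che(6) le(1)] mom_mono[OF r12(3) le(2)] mom_mono[OF r13(3) le(3)] mom_mono[OF r23(3) le(4)])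
    hence R: "mom 2 ?R (B p1 p2 p3)" unfolding B_def r_def[symmetric] by simp
    have "AE \<omega> in M. \<forall>a\<in>?A. J1 i1 (\<phi> (fst a)) T \<omega> * J1 i2 (\<phi> (fst (snd a))) T \<omega> * J1 i3 (\<phi> (snd (snd a))) T \<omega> =
       K0 a \<omega> + K1 a \<omega> + K2 a \<omega> + K3 a \<omega> + K4 a \<omega> + K5 a \<omega>
       + (if i1 = i2 then D1 (\<lambda>u. \<phi> (fst a) u * \<phi> (fst (snd a)) u) T * J1 i3 (\<phi> (snd (snd a))) T \<omega> else 0)
       + (if i1 = i3 then D1 (\<lambda>u. \<phi> (fst a) u * \<phi> (snd (snd a)) u) T * J1 i2 (\<phi> (fst (snd a))) T \<omega> else 0)
       + (if i2 = i3 then D1 (\<lambda>u. \<phi> (fst (snd a)) u * \<phi> (snd (snd a)) u) T * J1 i1 (\<phi> (fst a)) T \<omega> else 0)"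
      unfolding K0_def K1_def K2_def K3_def K4_def K5_def
      by (intro AE_finite_allI finite_triples J1_triple_product lipf_phi i T)
    hence ae: "AE \<omega> in M. ?R \<omega> = ?S \<omega>"
    proof eventually_elim
      case (elim \<omega>)
      have "(\<Sum>j1\<le>p1. \<Sum>j2\<le>p2. \<Sum>j3\<le>p3. C3 f g h j1 j2 j3 * J1 i1 (\<phi> j1) T \<omega> * J1 i2 (\<phi> j2) T \<omega> * J1 i3 (\<phi> j3) T \<omega>)
        = (\<Sum>a\<in>?A. C a * (J1 i1 (\<phi> (fst a)) T \<omega> * J1 i2 (\<phi> (fst (snd a))) T \<omega> * J1 i3 (\<phi> (snd (snd a))) T \<omega>))"
        unfolding sum_triples by (simp add: C_def mult.assoc)
      also have "\<dots> = (\<Sum>a\<in>?A. C a * K0 a \<omega> + C a * K1 a \<omega> + C a * K2 a \<omega> + C a * K3 a \<omega> + C a * K4 a \<omega> + C a * K5 a \<omega>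
        + (if i1 = i2 then C a * (if fst a = fst (snd a) then J1 i3 (\<phi> (snd (snd a))) T \<omega> else 0) else 0)
        + (if i1 = i3 then C a * (if fst a = snd (snd a) then J1 i2 (\<phi> (fst (snd a))) T \<omega> else 0) else 0)
        + (if i2 = i3 then C a * (if fst (snd a) = snd (snd a) then J1 i1 (\<phi> (fst a)) T \<omega> else 0) else 0))"
      proof (intro sum.cong refl)
        fix a assume "a \<in> ?A"
        from bspec[OF elim this] show "C a * (J1 i1 (\<phi> (fst a)) T \<omega> * J1 i2 (\<phi> (fst (snd a))) T \<omega> * J1 i3 (\<phi> (snd (snd a))) T \<omega>) =
          C a * K0 a \<omega> + C a * K1 a \<omega> + C a * K2 a \<omega> + C a * K3 a \<omega> + C a * K4 a \<omega> + C a * K5 a \<omega>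
        + (if i1 = i2 then C a * (if fst a = fst (snd a) then J1 i3 (\<phi> (snd (snd a))) T \<omega> else 0) else 0)
        + (if i1 = i3 then C a * (if fst a = snd (snd a) then J1 i2 (\<phi> (fst (snd a))) T \<omega> else 0) else 0)
        + (if i2 = i3 then C a * (if fst (snd a) = snd (snd a) then J1 i1 (\<phi> (fst a)) T \<omega> else 0) else 0)"
          by (simp only: D1_phi distrib_left) simp
      qed
      also have "\<dots> = (\<Sum>a\<in>?A. C a * K0 a \<omega>) + (\<Sum>a\<in>?A. C a * K1 a \<omega>) + (\<Sum>a\<in>?A. C a * K2 a \<omega>)
        + (\<Sum>a\<in>?A. C a * K3 a \<omega>) + (\<Sum>a\<in>?A. C a * K4 a \<omega>) + (\<Sum>a\<in>?A. C a * K5 a \<omega>)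
        + (if i1 = i2 then \<Sum>j\<le>p3. (\<Sum>i\<le>min p1 p2. C3 f g h i i j) * J1 i3 (\<phi> j) T \<omega> else 0)
        + (if i1 = i3 then \<Sum>j\<le>p2. (\<Sum>i\<le>min p1 p3. C3 f g h i j i) * J1 i2 (\<phi> j) T \<omega> else 0)
        + (if i2 = i3 then \<Sum>j\<le>p1. (\<Sum>i\<le>min p2 p3. C3 f g h j i i) * J1 i1 (\<phi> j) T \<omega> else 0)"
      proof -
        have "(\<Sum>a\<in>?A. C a * (if fst a = fst (snd a) then J1 i3 (\<phi> (snd (snd a))) T \<omega> else 0)) = (\<Sum>j\<le>p3. (\<Sum>i\<le>min p1 p2. C3 f g h i i j) * J1 i3 (\<phi> j) T \<omega>)"
          "(\<Sum>a\<in>?A. C a * (if fst a = snd (snd a) then J1 i2 (\<phi> (fst (snd a))) T \<omega> else 0)) = (\<Sum>j\<le>p2. (\<Sum>i\<le>min p1 p3. C3 f g h i j i) * J1 i2 (\<phi> j) T \<omega>)"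
          "(\<Sum>a\<in>?A. C a * (if fst (snd a) = snd (snd a) then J1 i1 (\<phi> (fst a)) T \<omega> else 0)) = (\<Sum>j\<le>p1. (\<Sum>i\<le>min p2 p3. C3 f g h j i i) * J1 i1 (\<phi> j) T \<omega>)"
          unfolding sum_triples C_def fst_conv snd_conv by (rule sum_triples_diagonal)+
        moreover have "(\<Sum>a\<in>?A. if c then w a else 0) = (if c then \<Sum>a\<in>?A. w a else 0)" for c and w :: "_ \<Rightarrow> real"
          by (cases c) simp_all
        ultimately show ?thesis by (simp only: sum.distrib)
      qed
      finally have "(\<Sum>j1\<le>p1. \<Sum>j2\<le>p2. \<Sum>j3\<le>p3. C3 f g h j1 j2 j3 * J1 i1 (\<phi> j1) T \<omega> * J1 i2 (\<phi> j2) T \<omega> * J1 i3 (\<phi> j3) T \<omega>) = \<dots>" .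
      thus ?case unfolding t12_def t13_def t23_def by (simp only:) simp
    qed
    have Sm: "?S \<in> borel_measurable M"
    proof -
      have mJ: "J1 j q T \<in> borel_measurable M" if "j \<in> {1..m}" "lipf q" for j q
        using adm_measurable(2)[OF adm_J1[OF that(2), of j]] that T by auto
      have m3: "J3 i1 f i2 g i3 h T \<in> borel_measurable M" using mom2_J3[OF f i] momD(1) by blast
      have mi: "(\<lambda>\<omega>. if c then w \<omega> else 0) \<in> borel_measurable M" if "w \<in> borel_measurable M" for c and w :: "'a \<Rightarrow> real"
        using that by (cases c) simp_all
      show ?thesis
        by (intro borel_measurable_diff borel_measurable_add borel_measurable_sum borel_measurable_times borel_measurable_const
          mi mJ m3 lipf_phi i lG)
    qed
    show ?thesis by (rule mom_AE_cong[OF R ae Sm])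
  qed
  show ?thesis
    using lim main unfolding G12_def G23_def by (intro exI[of _ "\<lambda>(p1, p2, p3). B p1 p2 p3"]) simp
qed

end

end

text \<open>All integrals are \<open>SOME\<close> terms, so the conclusion also asserts their
  defining relations; the limit thus speaks about genuine stochastic integrals.\<close>

theorem theorem3:
  fixes M :: "'a measure" and F :: "real \<Rightarrow> 'a measure" and T t :: real and m :: nat
    and W :: "nat \<Rightarrow> real \<Rightarrow> 'a \<Rightarrow> real"
    and l1 l2 l3 i1 i2 i3 :: nat
  assumes "prob_space M" and "complete_measure M"
    and "rc_filtration M F T"
    and "std_wiener M F T m W"
    and "0 \<le> t" and "t < T"
    and "i1 \<in> {1..m}" and "i2 \<in> {1..m}" and "i3 \<in> {1..m}"
    and "(i1 \<noteq> i2 \<and> i2 \<noteq> i3 \<and> i1 \<noteq> i3)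
         \<or> (i1 = i2 \<and> i2 \<noteq> i3 \<and> l1 = l2 \<and> l2 \<noteq> l3)
         \<or> (i1 \<noteq> i2 \<and> i2 = i3 \<and> l1 \<noteq> l2 \<and> l2 = l3)
         \<or> (l1 = l2 \<and> l2 = l3)"
  shows "let \<phi> = legendre_phi t T;
             \<zeta> = (\<lambda>i j. ito_int M (W i) (\<lambda>s _. \<phi> j s) t T);
             C = (\<lambda>j3 j2 j1. integral {t..T} (\<lambda>s. (t - s)^l3 * \<phi> j3 s *
                    integral {t..s} (\<lambda>s1. (t - s1)^l2 * \<phi> j2 s1 *
                      integral {t..s1} (\<lambda>s2. (t - s2)^l1 * \<phi> j1 s2))));
             J1 = (\<lambda>s. strat_int M (W i1) (\<lambda>u _. (t - u)^l1) t s);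
             J2 = (\<lambda>s. strat_int M (W i2) (\<lambda>u \<omega>. (t - u)^l2 * J1 u \<omega>) t s);
             I = strat_int M (W i3) (\<lambda>u \<omega>. (t - u)^l3 * J2 u \<omega>) t T
         in (\<forall>s\<in>{t..T}. strat_int_rel M (W i1) (\<lambda>u _. (t - u)^l1) t s (J1 s)) \<and>
            (\<forall>s\<in>{t..T}. strat_int_rel M (W i2) (\<lambda>u \<omega>. (t - u)^l2 * J1 u \<omega>) t s (J2 s)) \<and>
            strat_int_rel M (W i3) (\<lambda>u \<omega>. (t - u)^l3 * J2 u \<omega>) t T I \<and>
            (\<forall>i\<in>{1..m}. \<forall>j. ito_int_rel M (W i) (\<lambda>s _. \<phi> j s) t T (\<zeta> i j)) \<and>
            ms_tendsto M
              (\<lambda>(p1, p2, p3) \<omega>. \<Sum>j1\<le>p1. \<Sum>j2\<le>p2. \<Sum>j3\<le>p3.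
                  C j3 j2 j1 * \<zeta> i1 j1 \<omega> * \<zeta> i2 j2 \<omega> * \<zeta> i3 j3 \<omega>)
              I (sequentially \<times>\<^sub>F sequentially \<times>\<^sub>F sequentially)"
proof -
  interpret prob_space M by fact
  interpret ito M F T m W t
    using assms by unfold_locales
  define f g h where "f = (\<lambda>s::real. (t - s) ^ l1)" and "g = (\<lambda>s::real. (t - s) ^ l2)" and "h = (\<lambda>s::real. (t - s) ^ l3)"
  have lip: "lipf f" "lipf g" "lipf h"
    unfolding f_def g_def h_def by (intro lipf_power lipf_diff lipf_const lipf_id)+
  note i = assms(7-9)
  have T: "T \<in> {t..T}" "t \<le> T" using assms by auto
  define J1' where "J1' = (\<lambda>s. strat_int M (W i1) (\<lambda>u _. f u) t s)"
  define J2' where "J2' = (\<lambda>s. strat_int M (W i2) (\<lambda>u \<omega>. g u * J1' u \<omega>) t s)"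
  define I where "I = strat_int M (W i3) (\<lambda>u \<omega>. h u * J2' u \<omega>) t T"
  define \<zeta> where "\<zeta> = (\<lambda>i j. ito_int M (W i) (\<lambda>s _. \<phi> j s) t T)"
  note st = iterated_strat[OF lip i, folded J1'_def, folded J2'_def, folded I_def]
  have z: "ito_int_rel M (W k) (\<lambda>s _. \<phi> j s) t T (\<zeta> k j)" "\<zeta> k j \<in> borel_measurable M"
    "AE \<omega> in M. \<zeta> k j \<omega> = J1 k (\<phi> j) T \<omega>" if "k \<in> {1..m}" for k j
    using ito_int_characterization[OF lipf_phi that T(2) order.refl, of j] by (simp_all add: \<zeta>_def J1_def)
  have C: "C3 f g h j1 j2 j3 = integral {t..T} (\<lambda>s. (t - s)^l3 * \<phi> j3 s *
                    integral {t..s} (\<lambda>s1. (t - s1)^l2 * \<phi> j2 s1 *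
                      integral {t..s1} (\<lambda>s2. (t - s2)^l1 * \<phi> j1 s2)))" for j1 j2 j3
    by (simp add: C3_def D3_def D2_def D1_def f_def g_def h_def)
  \<comment> \<open>In the first case there is no coincidence, in the second and third exactly one,
    between components of equal exponent, and in the fourth all weights agree.\<close>
  have "i1 = i2 \<Longrightarrow> f = g" "i2 = i3 \<Longrightarrow> g = h" "i1 = i3 \<Longrightarrow> f = h"
    using assms(10) by (auto simp: f_def g_def h_def)
  from expansion_limit[OF i lip this] obtain B where B: "(B \<longlongrightarrow> 0) (sequentially \<times>\<^sub>F sequentially \<times>\<^sub>F sequentially)"
    "\<And>p1 p2 p3. mom 2 (\<lambda>\<omega>.
     (\<Sum>j1\<le>p1. \<Sum>j2\<le>p2. \<Sum>j3\<le>p3. C3 f g h j1 j2 j3 * J1 i1 (\<phi> j1) T \<omega> * J1 i2 (\<phi> j2) T \<omega> * J1 i3 (\<phi> j3) T \<omega>)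
     - (J3 i1 f i2 g i3 h T \<omega>
       + (if i1 = i2 then J1 i3 (\<lambda>u. h u * (D1 (\<lambda>y. f y * g y) u / 2)) T \<omega> else 0)
       + (if i2 = i3 then J1 i1 (\<lambda>u. f u * ((D1 (\<lambda>y. g y * h y) T - D1 (\<lambda>y. g y * h y) u) / 2)) T \<omega> else 0)))
     (B (p1, p2, p3))" by blast
  define S where "S = (\<lambda>(p1, p2, p3) \<omega>. \<Sum>j1\<le>p1. \<Sum>j2\<le>p2. \<Sum>j3\<le>p3.
                  C3 f g h j1 j2 j3 * \<zeta> i1 j1 \<omega> * \<zeta> i2 j2 \<omega> * \<zeta> i3 j3 \<omega>)"
  have SI: "mom 2 (\<lambda>\<omega>. S p \<omega> - I \<omega>) (B p)" for p
  proof -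
    obtain p1 p2 p3 where p: "p = (p1, p2, p3)" by (cases p)
    have "AE \<omega> in M. (\<forall>j\<in>{..p1}. \<zeta> i1 j \<omega> = J1 i1 (\<phi> j) T \<omega>) \<and> (\<forall>j\<in>{..p2}. \<zeta> i2 j \<omega> = J1 i2 (\<phi> j) T \<omega>) \<and>
       (\<forall>j\<in>{..p3}. \<zeta> i3 j \<omega> = J1 i3 (\<phi> j) T \<omega>)"
      by (intro AE_conjI AE_finite_allI finite_atMost z(3) i)
    with st(5) have "AE \<omega> in M. (\<Sum>j1\<le>p1. \<Sum>j2\<le>p2. \<Sum>j3\<le>p3. C3 f g h j1 j2 j3 * J1 i1 (\<phi> j1) T \<omega> * J1 i2 (\<phi> j2) T \<omega> * J1 i3 (\<phi> j3) T \<omega>)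
     - (J3 i1 f i2 g i3 h T \<omega>
       + (if i1 = i2 then J1 i3 (\<lambda>u. h u * (D1 (\<lambda>y. f y * g y) u / 2)) T \<omega> else 0)
       + (if i2 = i3 then J1 i1 (\<lambda>u. f u * ((D1 (\<lambda>y. g y * h y) T - D1 (\<lambda>y. g y * h y) u) / 2)) T \<omega> else 0))
       = S p \<omega> - I \<omega>"
      by eventually_elim (simp add: S_def p)
    moreover have "(\<lambda>\<omega>. S p \<omega> - I \<omega>) \<in> borel_measurable M"
      unfolding S_def p prod.case
      by (intro borel_measurable_diff borel_measurable_sum borel_measurable_times borel_measurable_const z(2) i st(4))
    ultimately show ?thesis unfolding p by (rule mom_AE_cong[OF B(2)])
  qed
  \<comment> \<open>Square integrability of the limit is part of the defining relation, used along
    one concrete sequence of partitions.\<close>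
  obtain c where c: "mom 2 I c"
  proof -
    obtain N \<tau> where "\<forall>k. is_partition t T (N k) (\<tau> k)" "(\<lambda>k. mesh (N k) (\<tau> k)) \<longlonglongrightarrow> 0"
      using partitions_exist[OF T(2)] by blast
    with st(3) show ?thesis unfolding strat_int_rel_def using ms_tendsto_mom2 that by blast
  qed
  have Sp: "mom 2 (S p) (2 * (B p + c))" for p
    using mom2_add[OF SI[of p] c] by simp
  have "((\<lambda>p. expectation (\<lambda>\<omega>. (S p \<omega> - I \<omega>)\<^sup>2)) \<longlongrightarrow> 0) (sequentially \<times>\<^sub>F sequentially \<times>\<^sub>F sequentially)"
    by (rule Lim_null_comparison[OF _ B(1)]) (use momD(3)[OF SI] in \<open>simp add: abs_of_nonneg\<close>)
  hence conv: "ms_tendsto M S I (sequentially \<times>\<^sub>F sequentially \<times>\<^sub>F sequentially)"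
    unfolding ms_tendsto_def using momD(1,2)[OF c] momD(1,2)[OF Sp] by simp
  show ?thesis
    using st(1-3) z(1) conv[unfolded S_def C]
    unfolding Let_def I_def J2'_def J1'_def \<zeta>_def f_def g_def h_def by blast
qed

end
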